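(* Consider the leader, the $n$ followers, the local disturbances and the communication graph $\mathcal G$ described in the context, and suppose that Assumptions 1, 2, 3 and 4 of the context hold. Let $\lambda>0$ be a constant, and for $i=1,\dots,n$ let $\Psi_i,F_i,G_i$ be the internal-model matrices of the context. Then there exist smooth positive functions $\rho_i:\mathbb{R}\to(0,\infty)$, $i=1,\dots,n$ (not depending on the initial conditions, on $\mu$, on the input $w$ or on its bound $l$), such that the distributed control law $$u_i=-\Psi_i\eta_i-k_i\rho_i(e_{vi})e_{vi}-\theta_i\,\mathrm{sgn}(e_{vi}),\quad \dot\eta_i=F_i\eta_i+G_iu_i,\quad \dot k_i=-\lambda k_i+\rho_i(e_{vi})e_{vi}^2,\quad \dot\theta_i=|e_{vi}|,$$ with $e_{vi}=\sum_{j=0}^n a_{ij}(y_i-y_j)$ and $k_i(0)=\theta_i(0)=0$, $i=1,\dots,n$, globally solves the distributed generalized output regulation problem. That is, for every $\mu\in\mathbb{R}^{n_\mu}$, every admissible leader input $w$ (continuous with $\|w(t)\|_\infty\le l$ for all $t\geq 0$, for some constant $l>0$), and all initial conditions $v(0)\in\mathbb{R}^{n_v}$, $z_i(0)\in\mathbb{R}^{n_{z_i}}$, $y_i(0)\in\mathbb{R}$, $\omega_i(0)\in\mathbb{R}^{n_{\omega_i}}$, $\eta_i(0)\in\mathbb{R}^{n_{p_i}}$ $(i=1,\dots,n)$, the trajectory of the closed-loop system (in the sense of Filippov) is well-defined for all $t>0$ and $$\lim_{t\to\infty}\big(y_i(t)-y_0(t)\big)=0,\qquad i=1,\dots,n.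$$
   Context: **Leader (node 0).** $\dot v=p(v)+q(v)w(t)$, $y_0=r(v,\mu)$, with state $v\in\mathbb{R}^{n_v}$, output $y_0\in\mathbb{R}$, uncertain constant parameter $\mu\in\mathbb{R}^{n_\mu}$, and unknown input $w(t)\in\mathbb{R}^{n_w}$, continuous in $t$ with $\|w(t)\|_\infty\le l$ for some constant $l>0$. **Followers** $i=1,\dots,n$: $\dot z_i=f_i(z_i,y_i,\mu)$, $\dot y_i=g_i(z_i,y_i,\mu)+u_i+d_i$, with $z_i\in\mathbb{R}^{n_{z_i}}$, $y_i,u_i,d_i\in\mathbb{R}$. The functions $f_i,g_i,p,q,r$ are smooth, with $f_i(0,0,\mu)=0$, $g_i(0,0,\mu)=0$, $p(0)=0$, $r(0,\mu)=0$. **Local disturbances.** $\dot\omega_i=S_i\omega_i$, $d_i=D_i(\mu)\omega_i$, $\omega_i\in\mathbb{R}^{n_{\omega_i}}$, where $S_i$ has no eigenvalues with negative real parts. **Graph.** $\mathcal G=(\mathcal V,\mathcal E)$ is a directed graph with $\mathcal V=\{0,1,\dots,n\}$ and weighted adjacency matrix $A=[a_{ij}]\in\mathbb{R}^{(n+1)\times(n+1)}$, $a_{ii}=0$, $a_{ij}\ge0$, and $a_{ij}>0$ if and only if $(j,i)\in\mathcal E$ (an arc leaving $j$ and entering $i$). **Assumption 1.** For every follower $i$ there is a directed walk in $\mathcal G$ from node 0 to node $i$, and the subgraph induced by $\{1,\dots,n\}$ is undirected ($a_{ij}=a_{ji}$ for $i,j=1,\dots,n$). **Assumption 2.** There are class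 $\mathcal K$ functions $\alpha_0,\gamma_0$ such that every solution of the leader satisfies $\|v(t)\|\le\alpha_0(\|v(0)\|)+\gamma_0(\sup_{s\ge0}\|w(s)\|_\infty)$ for all $t\ge0$. (Class $\mathcal K$: continuous, strictly increasing, vanishing at $0$; class $\mathcal K_\infty$: moreover defined on $[0,\infty)$ and unbounded.) **Assumption 3.** For each $i=1,\dots,n$ there is a smooth function $\mathbf z_i(v,\mu)$ with $\mathbf z_i(0,\mu)=0$ and $\frac{\partial\mathbf z_i(v,\mu)}{\partial v}p(v)=f_i(\mathbf z_i(v,\mu),r(v,\mu),\mu)$. **Error coordinates.** $\bar z_i=z_i-\mathbf z_i(v,\mu)$, $e_i=y_i-r(v,\mu)$. Then $\dot{\bar z}_i=\bar f_i(\bar z_i,e_i,v,w,\mu)$ with $$\bar f_i(\bar z_i,e_i,v,w,\mu)=f_i(\bar z_i+\mathbf z_i(v,\mu),e_i+r(v,\mu),\mu)-f_i(\mathbf z_i(v,\mu),r(v,\mu),\mu)-\tfrac{\partial\mathbf z_i(v,\mu)}{\partial v}q(v)w.$$ **Assumption 4.** For each $i=1,\dots,n$ there are known (i.e. independent of the set $\Sigma$ below) smooth positive definite functions $\gamma_{1i}:\mathbb{R}\to\mathbb{R}$, $\gamma_{2i}:\mathbb{R}^{n_w}\to\mathbb{R}$ and a known class $\mathcal K_\infty$ function $\alpha_i$ with $\limsup_{s\to0+}\alpha_i^{-1}(s^2)/s<\infty$, such that for any compact $\Sigma\subset\mathbb{R}^{n_v+n_w+n_\mu}$ there exist a smooth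 function $V_{\bar z_i}$ with $\alpha_{1i}(\|\bar z_i\|)\le V_{\bar z_i}(\bar z_i)\le\alpha_{2i}(\|\bar z_i\|)$ for some smooth $\alpha_{1i},\alpha_{2i}\in\mathcal K_\infty$, and positive constants $\delta_{1i},\delta_{2i}$ (unknown, i.e. possibly depending on $\Sigma$), such that for all $(v,w,\mu)\in\Sigma$ and all $\bar z_i,e_i$, $$\tfrac{\partial V_{\bar z_i}}{\partial\bar z_i}(\bar z_i)\,\bar f_i(\bar z_i,e_i,v,w,\mu)\le-\alpha_i(\|\bar z_i\|)+\delta_{1i}\gamma_{1i}(e_i)+\delta_{2i}\gamma_{2i}(w).$$ **Internal-model matrices.** Let $s^{n_{p_i}}+\hat p_{i,1}s^{n_{p_i}-1}+\cdots+\hat p_{i,n_{p_i}}$ be the minimal polynomial of $S_i$. $\Phi_i\in\mathbb{R}^{n_{p_i}\times n_{p_i}}$ is its companion matrix (ones on the superdiagonal, last row $[-\hat p_{i,n_{p_i}},-\hat p_{i,n_{p_i}-1},\dots,-\hat p_{i,1}]$, zeros elsewhere), $\Psi_i=[1,0,\dots,0]\in\mathbb{R}^{1\times n_{p_i}}$, and $G_i\in\mathbb{R}^{n_{p_i}\times1}$ is a constant matrix such that $F_i=\Phi_i+G_i\Psi_i$ is Hurwitz (it exists since $(\Psi_i,\Phi_i)$ is observable). **Solutions.** Since the control is discontinuous (sgn is the sign function), solutions of the closed-loop system are understood in the sense of Filippov; "well-defined for all $t>0$" means that Filippov solutions exist and are defined for all $t>0$; the limit is asserted along any such solution. *)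

theory Defs
  imports "HOL-Analysis.Analysis" "Jordan_Normal_Form.Char_Poly"
begin

text \<open>The component syntax is reserved for \<^typ>\<open>real ^ 'n\<close>; for the vectors of
  Jordan_Normal_Form the function \<^const>\<open>vec_index\<close> is written out.\<close>

no_notation Matrix.vec_index (infixl \<open>$\<close> 100)

text \<open>Derivatives are taken within \<open>S\<close>. This is meant for sets on which they are unique;
  here \<open>S\<close> is the whole space or the half-line \<open>{0..}\<close>.\<close>

primrec Ck_on :: "nat \<Rightarrow> 'a::euclidean_space set \<Rightarrow> ('a \<Rightarrow> 'b::real_normed_vector) \<Rightarrow> bool" where
  "Ck_on 0 S f \<longleftrightarrow> continuous_on S f"
| "Ck_on (Suc k) S f \<longleftrightarrow>
     f differentiable_on S \<and> (\<forall>h. Ck_on k S (\<lambda>x. frechet_derivative f (at x within S) h))"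

definition smooth_on :: "'a::euclidean_space set \<Rightarrow> ('a \<Rightarrow> 'b::real_normed_vector) \<Rightarrow> bool" where
  "smooth_on S f \<longleftrightarrow> (\<forall>k. Ck_on k S f)"

abbreviation smooth :: "('a::euclidean_space \<Rightarrow> 'b::real_normed_vector) \<Rightarrow> bool" where
  "smooth f \<equiv> smooth_on UNIV f"

definition positive_definite :: "('a::zero \<Rightarrow> real) \<Rightarrow> bool" where
  "positive_definite \<gamma> \<longleftrightarrow> \<gamma> 0 = 0 \<and> (\<forall>x. x \<noteq> 0 \<longrightarrow> 0 < \<gamma> x)"

text \<open>Comparison functions live on \<open>{0..}\<close>; their values at negative arguments are irrelevant.\<close>

definition class_K :: "(real \<Rightarrow> real) \<Rightarrow> bool" where
  "class_K \<alpha> \<longleftrightarrow> continuous_on {0..} \<alpha> \<and> strict_mono_on {0..} \<alpha> \<and> \<alpha> 0 = 0"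

definition class_K_inf :: "(real \<Rightarrow> real) \<Rightarrow> bool" where
  "class_K_inf \<alpha> \<longleftrightarrow> class_K \<alpha> \<and> filterlim \<alpha> at_top at_top"

text \<open>The dimensions of \<open>z\<^sub>i\<close>, \<open>\<omega>\<^sub>i\<close> and \<open>\<eta>\<^sub>i\<close> may differ from follower to follower. For
  \<open>m \<le> CARD('k)\<close> the space of \<open>m\<close>-vectors is identified with the span of the first \<open>m\<close>
  coordinate axes of \<^typ>\<open>real ^ 'k\<close>, with respect to the fixed numbering
  \<^term>\<open>to_nat_on (UNIV :: 'k set)\<close> of \<^typ>\<open>'k\<close> by \<open>0, \<dots>, CARD('k) - 1\<close>. As \<^typ>\<open>'k\<close> is an
  arbitrary finite type, every finite family of dimensions is covered.\<close>

definition coord_space :: "nat \<Rightarrow> (real ^ 'k) set" where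
  "coord_space m = {x. \<forall>k. m \<le> to_nat_on (UNIV :: 'k set) k \<longrightarrow> x $ k = 0}"

definition coord_proj :: "nat \<Rightarrow> real ^ 'k \<Rightarrow> real ^ 'k" where
  "coord_proj m x = (\<chi> k. if to_nat_on (UNIV :: 'k set) k < m then x $ k else 0)"

definition to_vec :: "nat \<Rightarrow> real ^ 'k \<Rightarrow> real Matrix.vec" where
  "to_vec m x = Matrix.vec m (\<lambda>j. x $ from_nat_into UNIV j)"

definition of_vec :: "real Matrix.vec \<Rightarrow> real ^ 'k" where
  "of_vec u = (\<chi> k. if to_nat_on (UNIV :: 'k set) k < dim_vec u
                     then vec_index u (to_nat_on (UNIV :: 'k set) k) else 0)"

definition mat_act :: "real mat \<Rightarrow> real ^ 'k \<Rightarrow> real ^ 'k" where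
  "mat_act M x = of_vec (M *\<^sub>v to_vec (dim_col M) x)"

definition row_act :: "real mat \<Rightarrow> real ^ 'k \<Rightarrow> real" where
  "row_act M x = vec_index (M *\<^sub>v to_vec (dim_col M) x) 0"

definition col_act :: "real mat \<Rightarrow> real \<Rightarrow> real ^ 'k" where
  "col_act M u = of_vec (u \<cdot>\<^sub>v col M 0)"

definition complex_eigenvalue :: "real mat \<Rightarrow> complex \<Rightarrow> bool" where
  "complex_eigenvalue M c \<longleftrightarrow> eigenvalue (map_mat complex_of_real M) c"

definition hurwitz :: "real mat \<Rightarrow> bool" where
  "hurwitz M \<longleftrightarrow> (\<forall>c. complex_eigenvalue M c \<longrightarrow> Re c < 0)"

definition poly_of_mat :: "real poly \<Rightarrow> real mat \<Rightarrow> real mat" where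
  "poly_of_mat p M = mat (dim_row M) (dim_row M)
     (\<lambda>ij. \<Sum>k\<le>degree p. coeff p k * (M ^\<^sub>m k) $$ ij)"

definition minimal_polynomial :: "real mat \<Rightarrow> real poly \<Rightarrow> bool" where
  "minimal_polynomial M p \<longleftrightarrow>
     lead_coeff p = 1 \<and> poly_of_mat p M = 0\<^sub>m (dim_row M) (dim_row M) \<and>
     (\<forall>s. s \<noteq> 0 \<and> poly_of_mat s M = 0\<^sub>m (dim_row M) (dim_row M) \<longrightarrow> degree p \<le> degree s)"

text \<open>With \<open>p = s\<^sup>n + a\<^sub>1 s\<^sup>n\<^sup>-\<^sup>1 + \<dots> + a\<^sub>n\<close> and columns numbered from \<open>0\<close>, the entry \<open>-a\<^sub>n\<^sub>-\<^sub>j\<close> of the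
  last row is \<open>-coeff p j\<close>.\<close>

definition Phi_mat :: "real poly \<Rightarrow> real mat" where
  "Phi_mat p = mat (degree p) (degree p)
     (\<lambda>(i, j). if Suc i = degree p then - coeff p j else if j = Suc i then 1 else 0)"

definition Psi_mat :: "nat \<Rightarrow> real mat" where
  "Psi_mat m = mat 1 m (\<lambda>(i, j). if j = 0 then 1 else 0)"

definition F_mat :: "real poly \<Rightarrow> real mat \<Rightarrow> real mat" where
  "F_mat p G = Phi_mat p + G * Psi_mat (degree p)"

definition abs_continuous :: "real \<Rightarrow> real \<Rightarrow> (real \<Rightarrow> 'a::real_normed_vector) \<Rightarrow> bool" where
  "abs_continuous a b x \<longleftrightarrow>
     (\<forall>\<epsilon>>0. \<exists>\<delta>>0. \<forall>d. d division_of \<Union>d \<and> \<Union>d \<subseteq> {a..b} \<and> (\<Sum>K\<in>d. measure lborel K) < \<delta>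
        \<longrightarrow> (\<Sum>K\<in>d. norm (x (Sup K) - x (Inf K))) < \<epsilon>)"

definition filippov_set :: "('a::euclidean_space \<Rightarrow> 'a) \<Rightarrow> 'a \<Rightarrow> 'a set" where
  "filippov_set f x = (\<Inter>\<delta>\<in>{0<..}. \<Inter>N\<in>{N. negligible N}. closure (convex hull (f ` (ball x \<delta> - N))))"

definition filippov_solution ::
    "(real \<Rightarrow> 'a::euclidean_space \<Rightarrow> 'a) \<Rightarrow> real set \<Rightarrow> (real \<Rightarrow> 'a) \<Rightarrow> bool" where
  "filippov_solution f I x \<longleftrightarrow>
     (\<forall>a b. a \<le> b \<and> {a..b} \<subseteq> I \<longrightarrow> abs_continuous a b x) \<and>
     (AE t in lebesgue. t \<in> I \<longrightarrow>
        (\<exists>x'. (x has_vector_derivative x') (at t within I) \<and> x' \<in> filippov_set (f t) (x t)))"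

text \<open>Solutions need not be unique: a solution on \<open>{0..}\<close> exists, and no solution stops in
  finite time.\<close>

definition well_defined_from :: "(real \<Rightarrow> 'a::euclidean_space \<Rightarrow> 'a) \<Rightarrow> 'a \<Rightarrow> bool" where
  "well_defined_from f x0 \<longleftrightarrow>
     (\<exists>x. filippov_solution f {0..} x \<and> x 0 = x0) \<and>
     (\<forall>T x. 0 < T \<and> filippov_solution f {0..<T} x \<and> x 0 = x0 \<longrightarrow>
        (\<exists>x'. filippov_solution f {0..} x' \<and> (\<forall>t\<in>{0..<T}. x' t = x t)))"

text \<open>Nodes are \<^typ>\<open>'n option\<close>: \<^const>\<open>None\<close> is the leader, \<^term>\<open>Some i\<close> is follower \<open>i\<close>.\<close>

definition arcs :: "real ^ 'n::finite option ^ 'n option \<Rightarrow> ('n option \<times> 'n option) set" where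
  "arcs A = {(j, i). 0 < A $ i $ j}"

definition virtual_error :: "real ^ 'n::finite option ^ 'n option \<Rightarrow> real \<Rightarrow> real ^ 'n \<Rightarrow> 'n::finite \<Rightarrow> real" where
  "virtual_error A y0 y i =
     (let Y = (\<lambda>j. case j of None \<Rightarrow> y0 | Some j' \<Rightarrow> y $ j')
      in \<Sum>j\<in>UNIV. A $ Some i $ j * (Y (Some i) - Y j))"

definition admissible_input :: "(real \<Rightarrow> real ^ 'w) \<Rightarrow> bool" where
  "admissible_input w \<longleftrightarrow> continuous_on {0..} w \<and> (\<exists>l>0. \<forall>t\<ge>0. infnorm (w t) \<le> l)"

definition leader_solution ::
    "(real ^ 'v \<Rightarrow> real ^ 'v) \<Rightarrow> (real ^ 'v \<Rightarrow> real ^ 'w ^ 'v) \<Rightarrow> (real \<Rightarrow> real ^ 'w) \<Rightarrow>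
     real \<Rightarrow> (real \<Rightarrow> real ^ 'v) \<Rightarrow> bool" where
  "leader_solution p q w T v \<longleftrightarrow>
     (\<forall>t\<in>{0..T}. (v has_vector_derivative p (v t) + q (v t) *v w t) (at t within {0..T}))"

definition f_bar ::
    "(real ^ 'k \<Rightarrow> real \<Rightarrow> real ^ 'm \<Rightarrow> real ^ 'k) \<Rightarrow> (real ^ 'v \<Rightarrow> real ^ 'm \<Rightarrow> real) \<Rightarrow>
     (real ^ 'v \<Rightarrow> real ^ 'w ^ 'v) \<Rightarrow> (real ^ 'v \<Rightarrow> real ^ 'm \<Rightarrow> real ^ 'k) \<Rightarrow>
     real ^ 'k \<Rightarrow> real \<Rightarrow> real ^ 'v \<Rightarrow> real ^ 'w \<Rightarrow> real ^ 'm \<Rightarrow> real ^ 'k" where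
  "f_bar f r q zs zb e v w \<mu> =
     f (zb + zs v \<mu>) (e + r v \<mu>) \<mu> - f (zs v \<mu>) (r v \<mu>) \<mu>
       - frechet_derivative (\<lambda>v. zs v \<mu>) (at v) (q v *v w)"

text \<open>The components are \<open>(v, z, y, \<omega>, \<eta>, k, \<theta>)\<close>.\<close>

type_synonym ('v, 'k, 'n) state =
  "(real ^ 'v) \<times> (real ^ 'k ^ 'n) \<times> (real ^ 'n) \<times> (real ^ 'k ^ 'n) \<times> (real ^ 'k ^ 'n) \<times>
   (real ^ 'n) \<times> (real ^ 'n)"

text \<open>The functions \<open>f i\<close> and \<open>g i\<close> are evaluated only on \<open>coord_space (nz i)\<close>, so that the
  coordinates outside the follower spaces have no influence and keep the value \<open>0\<close>.\<close>

definition closed_loop ::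
    "(real ^ 'v \<Rightarrow> real ^ 'v) \<Rightarrow> (real ^ 'v \<Rightarrow> real ^ 'w ^ 'v) \<Rightarrow> (real ^ 'v \<Rightarrow> real ^ 'm \<Rightarrow> real) \<Rightarrow>
     ('n \<Rightarrow> nat) \<Rightarrow> ('n \<Rightarrow> real ^ 'k \<Rightarrow> real \<Rightarrow> real ^ 'm \<Rightarrow> real ^ 'k) \<Rightarrow>
     ('n \<Rightarrow> real ^ 'k \<Rightarrow> real \<Rightarrow> real ^ 'm \<Rightarrow> real) \<Rightarrow>
     ('n \<Rightarrow> real mat) \<Rightarrow> ('n \<Rightarrow> real ^ 'm \<Rightarrow> real mat) \<Rightarrow> real ^ 'n option ^ 'n option \<Rightarrow>
     ('n \<Rightarrow> real mat) \<Rightarrow> ('n \<Rightarrow> real mat) \<Rightarrow> ('n \<Rightarrow> real mat) \<Rightarrow> real \<Rightarrow> ('n \<Rightarrow> real \<Rightarrow> real) \<Rightarrow>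
     real ^ 'm \<Rightarrow> (real \<Rightarrow> real ^ 'w) \<Rightarrow> real \<Rightarrow>
     ('v::finite, 'k::finite, 'n::finite) state \<Rightarrow> ('v, 'k, 'n) state" where
  "closed_loop p q r nz f g S D A \<Psi> F G lam \<rho> \<mu> w t = (\<lambda>(v, z, y, \<omega>, \<eta>, k, \<theta>).
     let e = (\<lambda>i. virtual_error A (r v \<mu>) y i);
         u = (\<lambda>i. - row_act (\<Psi> i) (\<eta> $ i) - k $ i * \<rho> i (e i) * e i - \<theta> $ i * sgn (e i));
         d = (\<lambda>i. row_act (D i \<mu>) (\<omega> $ i))
     in (p v + q v *v w t,
         \<chi> i. f i (coord_proj (nz i) (z $ i)) (y $ i) \<mu>,
         \<chi> i. g i (coord_proj (nz i) (z $ i)) (y $ i) \<mu> + u i + d i,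
         \<chi> i. mat_act (S i) (\<omega> $ i),
         \<chi> i. mat_act (F i) (\<eta> $ i) + col_act (G i) (u i),
         \<chi> i. - lam * k $ i + \<rho> i (e i) * (e i)\<^sup>2,
         \<chi> i. \<bar>e i\<bar>))"

definition tracking_error ::
    "(real ^ 'v \<Rightarrow> real ^ 'm \<Rightarrow> real) \<Rightarrow> real ^ 'm \<Rightarrow> 'n \<Rightarrow> ('v::finite, 'k::finite, 'n::finite) state \<Rightarrow> real" where
  "tracking_error r \<mu> i = (\<lambda>(v, z, y, \<omega>, \<eta>, k, \<theta>). y $ i - r v \<mu>)"

end

theory Submission
  imports Defs "HOL-Complex_Analysis.Great_Picard" "Jordan_Normal_Form.Spectral_Radius"
begin

text \<open>In the coordinates \<open>zb\<^sub>i\<close>, \<open>e = y - r\<close>, \<open>\<nu> = H e\<close> (the virtual errors, with \<open>H\<close> the grounded Laplacian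
  of the followers) and \<open>x\<^sub>i = \<eta>\<^sub>i - T\<^sub>i \<omega>\<^sub>i - G\<^sub>i e\<^sub>i\<close> the disturbances disappear and \<open>x\<^sub>i\<close> is driven through the
  Hurwitz matrix \<open>F\<^sub>i\<close>. As \<open>H\<close> is symmetric and positive definite, \<open>e \<bullet> H e / 2\<close> can be added to functions
  \<open>U\<^sub>i(zb\<^sub>i)\<close> with a changed supply rate, to quadratic forms in \<open>x\<^sub>i\<close> and to \<open>(k\<^sub>i - 1)\<^sup>2 / 2\<close>; its derivative couples to each
  follower only through \<open>\<nu>\<^sub>i\<close>. For a given bound on \<open>(v, w, \<mu>)\<close>, the total decreases outside a bounded set as soon as
  \<open>\<rho>(\<nu>) \<nu>\<^sup>2\<close> dominates a function of \<open>\<bar>\<nu>\<bar>\<close> for large \<open>\<bar>\<nu>\<bar>\<close>. Countably many such functions, one for each ball, are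
  dominated by a single smooth \<open>\<rho>\<close>, so no knowledge of the bounds enters \<open>\<rho>\<close>. This bounds everything but \<open>\<theta>\<close> and \<open>\<omega>\<close>.
  With \<open>M\<close> a bound for the remaining terms of \<open>e'\<close>, the function \<open>e \<bullet> H e / 2 + \<Sum> (\<theta>\<^sub>i - M)\<^sup>2 / 2\<close> is nonincreasing;
  hence \<open>\<theta>\<close> is bounded, and as \<open>\<theta>\<^sub>i' = \<bar>\<nu>\<^sub>i\<bar>\<close>, Barbalat's argument gives \<open>\<nu> \<rightarrow> 0\<close> and so \<open>e \<rightarrow> 0\<close>.

  Existence of Filippov solutions comes from Euler polygons; the a priori bounds extend them to all times.\<close>

text \<open>The Lyapunov data of the z-subsystems depend on the compact set, \<rho> may not. So the
  data come first, with bounds that are uniform in the number standing for \<rho>(\<nu>); only then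
  is \<rho> chosen. That step asks for boundedness alone, not for decay near the origin. In it the
  sign term contributes -\<theta> |\<nu>| \<le> 0 and is dropped; hence M does not depend on
  \<theta>, and the later bound for \<theta> is not circular. Centring k at 1 turns -k \<rho>
  \<nu>^2 + (k - 1) \<rho> \<nu>^2 into -\<rho> \<nu>^2, whatever k is. The supply of the
  z-subsystem i depends on e_i, while the control dominates functions of \<nu>_i only; since H is
  invertible, the follower with the largest |\<nu>_j| pays for all e_i. Filippov sets ignore null
  sets, but an Euler polygon samples the field at single points, possibly on a switching surface.
  The value sgn 0 = 0 keeps such samples in the closed convex hull of the values nearby. Solutions
  are differentiable only almost everywhere. All estimates therefore apply a mean value inequality
  for absolutely continuous functions to locally Lipschitz functions of the state.\<close>

no_notation Matrix.vec_index (infixl "$" 100)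
no_notation scalar_prod (infix "\<bullet>" 70)

subsection \<open>Absolutely continuous and Lipschitz functions of a real variable\<close>

lemma division_sum_measure_le:
  fixes d :: "real set set"
  assumes d: "d division_of \<Union>d" and sub: "\<Union>d \<subseteq> S" and S: "S \<in> lmeasurable"
  shows "(\<Sum>K\<in>d. measure lborel K) \<le> measure lebesgue S"
proof -
  have "measure lborel K = measure lebesgue K" if "K \<in> d" for K
    using division_ofD(4)[OF d that] by auto
  then have "(\<Sum>K\<in>d. measure lborel K) = (\<Sum>K\<in>d. measure lebesgue K)"
    by (rule sum.cong[OF refl])
  also have "\<dots> = measure lebesgue (\<Union>d)"
    using content_division[OF d] by simp
  also have "\<dots> \<le> measure lebesgue S"
    using sub S lmeasurable_division[OF d] by (intro measure_mono_fmeasurable) (auto dest: fmeasurableD)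
  finally show ?thesis .
qed

text \<open>Two tags can share an interval only if it is degenerate, and there both the length and
  the increment vanish. So the sums over tagged pairs equal the sums over the set of intervals, to
  which absolute continuity applies.\<close>

lemma abs_continuousD_tagged:
  fixes x :: "real \<Rightarrow> 'a::real_normed_vector"
  assumes ac: "\<And>d. d division_of \<Union>d \<and> \<Union>d \<subseteq> {a..b} \<and> (\<Sum>K\<in>d. measure lborel K) < \<delta>
        \<Longrightarrow> (\<Sum>K\<in>d. norm (x (Sup K) - x (Inf K))) < \<epsilon>"
    and p: "p tagged_partial_division_of {a..b}"
    and O: "S \<in> lmeasurable" "measure lebesgue S < \<delta>" and sub: "\<And>t K. (t, K) \<in> p \<Longrightarrow> K \<subseteq> S"
  shows "(\<Sum>(t, K)\<in>p. norm (x (Sup K) - x (Inf K))) < \<epsilon>"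
    and "(\<Sum>(t, K)\<in>p. measure lborel K) < \<delta>"
proof -
  let ?d = "snd ` p"
  have tag: "p tagged_division_of \<Union>?d"
    by (rule tagged_partial_division_of_Union_self[OF p])
  have d: "?d division_of \<Union>?d"
    by (rule division_of_tagged_division[OF tag])
  have "\<Union>?d \<subseteq> {a..b}"
    using tagged_partial_division_ofD(3)[OF p] by force
  have m: "(\<Sum>K\<in>?d. measure lborel K) < \<delta>"
    by (rule le_less_trans[OF division_sum_measure_le[OF d _ O(1)] O(2)]) (use sub in force)
  have "(\<Sum>(t, K)\<in>p. measure lborel K) = (\<Sum>K\<in>?d. measure lborel K)"
    by (rule sum.over_tagged_division_lemma[OF tag]) (simp add: content_eq_0_interior)
  with m show "(\<Sum>(t, K)\<in>p. measure lborel K) < \<delta>" by simp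
  \<comment> \<open>The conversion wants a summand that vanishes on every \<open>cbox u v\<close>
    with empty interior. This includes the empty set, where \<open>Sup\<close> and
    \<open>Inf\<close> say nothing.\<close>
  let ?g = "\<lambda>K. if K = {} then 0 else norm (x (Sup K) - x (Inf K))"
  have ne: "K \<noteq> {}" if "(t, K) \<in> p" for t K
    using tagged_partial_division_ofD(2)[OF p that] by auto
  have "(\<Sum>(t, K)\<in>p. norm (x (Sup K) - x (Inf K))) = (\<Sum>(t, K)\<in>p. ?g K)"
    using ne by (intro sum.cong) auto
  also have "\<dots> = (\<Sum>K\<in>?d. ?g K)"
    by (rule sum.over_tagged_division_lemma[OF tag]) (auto simp: box_eq_empty)
  also have "\<dots> = (\<Sum>K\<in>?d. norm (x (Sup K) - x (Inf K)))"
    using ne by (intro sum.cong) auto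
  also have "\<dots> < \<epsilon>"
    by (rule ac) (use d m \<open>\<Union>?d \<subseteq> {a..b}\<close> in auto)
  finally show "(\<Sum>(t, K)\<in>p. norm (x (Sup K) - x (Inf K))) < \<epsilon>" .
qed

text \<open>A tagged division is split according to whether the tag lies in the exceptional null set: the
  intervals of the first kind have small total length, those of the second kind are short enough to
  see the derivative at their tag.\<close>

lemma abs_continuous_increment_le:
  fixes x :: "real \<Rightarrow> real"
  assumes ac: "abs_continuous a b x" and ab: "a \<le> b"
    and deriv: "AE t in lebesgue. t \<in> {a..b} \<longrightarrow>
      (\<exists>x'. (x has_real_derivative x') (at t within {a..b}) \<and> x' \<le> M)"
  shows "x b - x a \<le> M * (b - a)"
proof (rule field_le_epsilon)
  fix e0 :: real assume "0 < e0"
  \<comment> \<open>The error e0 is spent as follows: e0/2 on the excess slope e over the whole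
    interval, e0/4 on the increments over intervals tagged in N, and e0/4 on the lengths of these
    intervals times M + e, which may be negative.\<close>
  define e where "e = e0 / (2 * (b - a + 1))"
  have "0 < e" and e: "e * (b - a) \<le> e0 / 2"
    using \<open>0 < e0\<close> ab by (auto simp: e_def field_simps)
  define N where "N = {t\<in>{a..b}. \<not> (\<exists>x'. (x has_real_derivative x') (at t within {a..b}) \<and> x' \<le> M)}"
  have "negligible N"
    using deriv unfolding N_def eventually_ae_filter_negligible
    by (auto intro: negligible_subset)
  obtain \<delta>0 where \<delta>0: "\<delta>0 > 0" "\<And>d. d division_of \<Union>d \<and> \<Union>d \<subseteq> {a..b} \<and> (\<Sum>K\<in>d. measure lborel K) < \<delta>0
        \<Longrightarrow> (\<Sum>K\<in>d. norm (x (Sup K) - x (Inf K))) < e0 / 4"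
    using ac[unfolded abs_continuous_def, rule_format, of "e0/4"] \<open>0 < e0\<close> by auto
  define \<delta> where "\<delta> = min \<delta>0 (e0 / (4 * (\<bar>M\<bar> + 1) + 4 * e))"
  have "\<delta> > 0" using \<delta>0 \<open>0 < e0\<close> \<open>0 < e\<close> by (auto simp: \<delta>_def add_pos_pos)
  have "(\<bar>M\<bar> + e) * \<delta> \<le> (\<bar>M\<bar> + 1 + e) * (e0 / (4 * (\<bar>M\<bar> + 1) + 4 * e))"
    using \<open>0 < e\<close> \<open>\<delta> > 0\<close> by (intro mult_mono) (auto simp: \<delta>_def)
  also have "\<dots> = e0 / 4" using \<open>0 < e\<close> by (simp add: field_simps add_pos_pos)
  finally have M\<delta>: "(\<bar>M\<bar> + e) * \<delta> \<le> e0 / 4" .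
  obtain U where U: "open U" "N \<subseteq> U" "U - N \<in> lmeasurable" "emeasure lebesgue (U - N) < ennreal \<delta>"
    using sets_lebesgue_outer_open[of N \<delta>] \<open>negligible N\<close> \<open>\<delta> > 0\<close> negligible_imp_sets by blast
  have Ulm: "U \<in> lmeasurable"
    using U \<open>negligible N\<close> negligible_iff_measure[of N] fmeasurable.Un[of N lebesgue "U - N"]
    by (simp add: Un_absorb1)
  have "measure lebesgue U < \<delta>"
  proof -
    have "measure lebesgue U = measure lebesgue (U - N)"
      using \<open>negligible N\<close> Ulm
      by (simp add: negligible_iff_null_sets fmeasurableD measure_Diff_null_set)
    also have "\<dots> < \<delta>" using U(3,4) \<open>\<delta> > 0\<close> by (simp add: emeasure_eq_measure2 ennreal_less_iff)
    finally show ?thesis .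
  qed
  have "\<exists>r>0. \<forall>u v. u \<le> t \<and> t \<le> v \<and> a \<le> u \<and> v \<le> b \<and> dist u t < r \<and> dist v t < r \<longrightarrow>
      x v - x u \<le> (M + e) * (v - u)" if t: "t \<in> {a..b} - N" for t
  proof -
    obtain x' where x': "(x has_real_derivative x') (at t within {a..b})" "x' \<le> M"
      using t unfolding N_def by blast
    from x'(1) have "(x has_derivative (\<lambda>h. x' * h)) (at t within {a..b})"
      by (simp add: has_field_derivative_def)
    then obtain r where r: "r > 0" "\<And>s. s \<in> {a..b} \<Longrightarrow> dist s t < r \<Longrightarrow>
        norm (x s - x t - x' * (s - t)) \<le> e * norm (s - t)"
      using \<open>0 < e\<close> unfolding has_derivative_within_alt dist_norm by blast
    show ?thesis
    proof (intro exI[of _ r] conjI allI impI, goal_cases)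
      case (2 u v)
      have "x v - x t \<le> (x' + e) * (v - t)"
        using r(2)[of v] 2 by (auto simp: abs_le_iff algebra_simps)
      moreover have "x t - x u \<le> (x' + e) * (t - u)"
        using r(2)[of u] 2 by (auto simp: abs_le_iff algebra_simps)
      ultimately have "x v - x u \<le> (x' + e) * (v - u)" by (simp add: algebra_simps)
      also have "\<dots> \<le> (M + e) * (v - u)" using x'(2) 2 by (intro mult_right_mono) auto
      finally show ?case .
    qed (use r in auto)
  qed
  then obtain r where r: "\<And>t. t \<in> {a..b} - N \<Longrightarrow> r t > 0"
    "\<And>t u v. \<lbrakk>t \<in> {a..b} - N; u \<le> t; t \<le> v; a \<le> u; v \<le> b; dist u t < r t; dist v t < r t\<rbrakk> \<Longrightarrow>
      x v - x u \<le> (M + e) * (v - u)"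
    by metis
  define \<gamma> where "\<gamma> t = (if t \<in> N then U else if t \<in> {a..b} then ball t (r t) else ball t 1)" for t
  have "gauge \<gamma>"
    using U r(1) by (auto simp: gauge_def \<gamma>_def)
  then obtain p where p: "p tagged_division_of {a..b}" "\<gamma> fine p"
    using fine_division_exists[of \<gamma> a b] by auto
  have fin: "finite p" using p(1) by blast
  define p1 where "p1 = {(t, K). (t, K) \<in> p \<and> t \<in> N}"
  define p2 where "p2 = {(t, K). (t, K) \<in> p \<and> t \<notin> N}"
  have un: "p = p1 \<union> p2" "p1 \<inter> p2 = {}" by (auto simp: p1_def p2_def)
  have p1p: "p1 tagged_partial_division_of {a..b}"
    by (rule tagged_partial_division_subset[of p]) (use p un in \<open>auto simp: tagged_division_of_def\<close>)
  have p1U: "K \<subseteq> U" if "(t, K) \<in> p1" for t K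
    using fineD[OF p(2), of t K] that by (auto simp: p1_def \<gamma>_def)
  have \<delta>': "(\<Sum>K\<in>d. norm (x (Sup K) - x (Inf K))) < e0 / 4"
    if "d division_of \<Union>d \<and> \<Union>d \<subseteq> {a..b} \<and> (\<Sum>K\<in>d. measure lborel K) < \<delta>" for d
    using that by (intro \<delta>0(2)) (auto simp: \<delta>_def)
  have B: "(\<Sum>(t, K)\<in>p1. norm (x (Sup K) - x (Inf K))) < e0 / 4" "(\<Sum>(t, K)\<in>p1. measure lborel K) < \<delta>"
    by (rule abs_continuousD_tagged[OF \<delta>' p1p Ulm \<open>measure lebesgue U < \<delta>\<close>]; use p1U in blast)+
  have split_sum: "sum F p = sum F p1 + sum F p2" for F :: "real \<times> real set \<Rightarrow> real"
    using fin un by (metis finite_Un sum.union_disjoint)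
  let ?c = "\<lambda>t :: real. \<lambda>K :: real set. (M + e) * measure lborel K"
  have "x b - x a = (\<Sum>(t, K)\<in>p. x (Sup K) - x (Inf K))"
    by (rule additive_tagged_division_1[OF ab p(1), symmetric])
  moreover have "(\<Sum>(t, K)\<in>p. x (Sup K) - x (Inf K)) =
      (\<Sum>(t, K)\<in>p1. x (Sup K) - x (Inf K)) + (\<Sum>(t, K)\<in>p2. x (Sup K) - x (Inf K))"
    by (rule split_sum)
  moreover have "(\<Sum>(t, K)\<in>p1. x (Sup K) - x (Inf K)) \<le> e0 / 4"
    by (rule order_trans[OF _ less_imp_le[OF B(1)]]) (auto intro!: sum_mono)
  moreover have "(\<Sum>(t, K)\<in>p2. x (Sup K) - x (Inf K)) \<le> (\<Sum>(t, K)\<in>p2. ?c t K)"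
  proof (rule sum_mono, clarify)
    fix t K assume tK: "(t, K) \<in> p2"
    then have "(t, K) \<in> p" and tN: "t \<notin> N" by (auto simp: p2_def)
    note td = tagged_division_ofD[OF p(1)]
    obtain u v where K: "K = {u..v}" using td(4)[OF \<open>(t, K) \<in> p\<close>] by auto
    have tK': "t \<in> K" "K \<subseteq> {a..b}" using td(2,3)[OF \<open>(t, K) \<in> p\<close>] by auto
    have uv: "u \<in> K" "v \<in> K" "u \<le> t" "t \<le> v" using tK' K by auto
    have "\<gamma> t = ball t (r t)" using tN tK' by (auto simp: \<gamma>_def)
    then have "K \<subseteq> ball t (r t)" using fineD[OF p(2) \<open>(t, K) \<in> p\<close>] by simp
    then have "dist u t < r t" "dist v t < r t" using uv by (auto simp: dist_commute)
    moreover have "a \<le> u" "v \<le> b" "t \<in> {a..b} - N" using uv(1,2) tK' tN by auto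
    ultimately have "x v - x u \<le> (M + e) * (v - u)"
      using uv by (intro r(2)[of t]) auto
    then show "x (Sup K) - x (Inf K) \<le> ?c t K"
      using K tK' by auto
  qed
  moreover have "(\<Sum>(t, K)\<in>p. ?c t K) = (\<Sum>(t, K)\<in>p1. ?c t K) + (\<Sum>(t, K)\<in>p2. ?c t K)"
    by (rule split_sum)
  moreover have "(\<Sum>(t, K)\<in>p. ?c t K) = (M + e) * (b - a)"
    using additive_content_tagged_division[of p a b] p(1) ab
    by (simp add: sum_distrib_left[symmetric] case_prod_unfold)
  moreover have "- (\<Sum>(t, K)\<in>p1. ?c t K) \<le> (\<bar>M\<bar> + e) * \<delta>"
  proof -
    have "(\<Sum>(t, K)\<in>p1. ?c t K) = (M + e) * (\<Sum>(t, K)\<in>p1. measure lborel K)"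
      by (simp add: sum_distrib_left case_prod_unfold)
    then have "- (\<Sum>(t, K)\<in>p1. ?c t K) = (- (M + e)) * (\<Sum>(t, K)\<in>p1. measure lborel K)"
      by (simp only: mult_minus_left)
    also have "\<dots> \<le> (\<bar>M\<bar> + e) * (\<Sum>(t, K)\<in>p1. measure lborel K)"
      using \<open>0 < e\<close> by (intro mult_right_mono sum_nonneg) auto
    also have "\<dots> \<le> (\<bar>M\<bar> + e) * \<delta>"
      using B(2) \<open>0 < e\<close> by (intro mult_left_mono) auto
    finally show ?thesis .
  qed
  ultimately have "x b - x a \<le> e0 / 4 + (M + e) * (b - a) + (\<bar>M\<bar> + e) * \<delta>"
    by linarith
  then show "x b - x a \<le> M * (b - a) + e0"
    using M\<delta> e \<open>0 < e0\<close> unfolding distrib_right by linarith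
qed

text \<open>The scalar case is applied to the projection onto the direction of the increment
  \<open>x b - x a\<close>, whose own increment is the full norm. The value \<open>sgn 0 = 0\<close>
  covers a vanishing increment.\<close>

lemma abs_continuous_norm_increment_le:
  fixes x :: "real \<Rightarrow> 'a::real_inner"
  assumes ac: "abs_continuous a b x" and ab: "a \<le> b"
    and deriv: "AE t in lebesgue. t \<in> {a..b} \<longrightarrow>
      (\<exists>x'. (x has_vector_derivative x') (at t within {a..b}) \<and> norm x' \<le> M)"
  shows "norm (x b - x a) \<le> M * (b - a)"
proof -
  define u where "u = sgn (x b - x a)"
  have u: "norm u \<le> 1" by (simp add: u_def norm_sgn)
  have "abs_continuous a b (\<lambda>t. x t \<bullet> u)"
    unfolding abs_continuous_def
  proof (intro allI impI, goal_cases)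
    case (1 \<epsilon>)
    then obtain \<delta> where \<delta>: "\<delta> > 0" "\<And>d. d division_of \<Union>d \<and> \<Union>d \<subseteq> {a..b} \<and> (\<Sum>K\<in>d. measure lborel K) < \<delta>
        \<Longrightarrow> (\<Sum>K\<in>d. norm (x (Sup K) - x (Inf K))) < \<epsilon>"
      using ac unfolding abs_continuous_def by blast
    have "norm (x s \<bullet> u - x t \<bullet> u) \<le> norm (x s - x t)" for s t
      using Cauchy_Schwarz_ineq2[of "x s - x t" u] u
      by (simp add: inner_diff_left[symmetric]) (meson mult_left_le norm_ge_zero order_trans)
    then have "(\<Sum>K\<in>d. norm (x (Sup K) \<bullet> u - x (Inf K) \<bullet> u)) \<le> (\<Sum>K\<in>d. norm (x (Sup K) - x (Inf K)))" for d
      by (rule sum_mono)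
    then show ?case using \<delta> by (meson le_less_trans)
  qed
  moreover have "AE t in lebesgue. t \<in> {a..b} \<longrightarrow>
      (\<exists>x'. ((\<lambda>t. x t \<bullet> u) has_real_derivative x') (at t within {a..b}) \<and> x' \<le> M)"
    using deriv
  proof eventually_elim
    case (elim t)
    show ?case
    proof
      assume "t \<in> {a..b}"
      with elim obtain x' where x': "(x has_vector_derivative x') (at t within {a..b})" "norm x' \<le> M"
        by blast
      from x'(1) have "((\<lambda>t. x t \<bullet> u) has_vector_derivative x' \<bullet> u) (at t within {a..b})"
        by (rule bounded_linear.has_vector_derivative[OF bounded_linear_inner_left])
      moreover have "x' \<bullet> u \<le> norm x' * norm u" by (rule norm_cauchy_schwarz)
      moreover have "norm x' * norm u \<le> M" using u x'(2)
        by (meson mult_left_le norm_ge_zero order_trans)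
      ultimately show "\<exists>x'. ((\<lambda>t. x t \<bullet> u) has_real_derivative x') (at t within {a..b}) \<and> x' \<le> M"
        by (auto simp: has_real_derivative_iff_has_vector_derivative intro!: exI[of _ "x' \<bullet> u"])
    qed
  qed
  ultimately have "x b \<bullet> u - x a \<bullet> u \<le> M * (b - a)"
    using ab by (intro abs_continuous_increment_le)
  moreover have "v \<bullet> sgn v = norm v" for v :: 'a
    by (cases "v = 0") (simp_all add: sgn_div_norm dot_square_norm power2_eq_square)
  from this[of "x b - x a"] have "(x b - x a) \<bullet> u = norm (x b - x a)"
    by (simp add: u_def)
  ultimately show ?thesis by (simp add: inner_diff_left)
qed

lemma lipschitz_on_imp_abs_continuous:
  fixes x :: "real \<Rightarrow> 'a::real_normed_vector"
  assumes lip: "L-lipschitz_on {a..b} x"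
  shows "abs_continuous a b x"
  unfolding abs_continuous_def
proof (intro allI impI)
  fix \<epsilon> :: real assume "0 < \<epsilon>"
  have L: "0 \<le> L" using lip by (rule lipschitz_on_nonneg)
  have "(\<Sum>K\<in>d. norm (x (Sup K) - x (Inf K))) < \<epsilon>"
    if d: "d division_of \<Union>d" "\<Union>d \<subseteq> {a..b}" "(\<Sum>K\<in>d. measure lborel K) < \<epsilon> / (L + 1)" for d
  proof -
    have "norm (x (Sup K) - x (Inf K)) \<le> L * measure lborel K" if Kd: "K \<in> d" for K
    proof -
      obtain u v where K: "K = {u..v}" "u \<le> v"
        using division_ofD(3)[OF d(1) Kd] division_ofD(4)[OF d(1) Kd] by (metis atLeastatMost_empty_iff2 cbox_interval)
      then have "u \<in> {a..b}" "v \<in> {a..b}" using d(2) Kd by fastforce+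
      then show ?thesis
        using lipschitz_onD[OF lip, of v u] K by (simp add: dist_norm)
    qed
    then have "(\<Sum>K\<in>d. norm (x (Sup K) - x (Inf K))) \<le> (\<Sum>K\<in>d. L * measure lborel K)"
      by (rule sum_mono)
    also have "\<dots> \<le> (L + 1) * (\<Sum>K\<in>d. measure lborel K)"
      by (simp add: sum_distrib_left[symmetric] mult_right_mono sum_nonneg)
    also have "\<dots> < \<epsilon>" using d(3) L by (simp add: field_simps)
    finally show ?thesis .
  qed
  then show "\<exists>\<delta>>0. \<forall>d. d division_of \<Union>d \<and> \<Union>d \<subseteq> {a..b} \<and> (\<Sum>K\<in>d. measure lborel K) < \<delta> \<longrightarrow>
      (\<Sum>K\<in>d. norm (x (Sup K) - x (Inf K))) < \<epsilon>"
    using \<open>0 < \<epsilon>\<close> L by (intro exI[of _ "\<epsilon> / (L + 1)"]) auto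
qed

section \<open>Almost everywhere differentiability of Lipschitz functions\<close>

text \<open>The function G = C t - F t is nondecreasing as well, and the Stieltjes measures of F and
  G add up to C times Lebesgue measure. It suffices to see this on half-open intervals.\<close>

lemma emeasure_interval_measure_le_lborel:
  fixes F :: "real \<Rightarrow> real"
  assumes F: "\<And>s t. s \<le> t \<Longrightarrow> F s \<le> F t" and lip: "\<And>s t. s \<le> t \<Longrightarrow> F t - F s \<le> C * (t - s)"
    and cont: "continuous_on UNIV F" and A: "A \<in> sets borel"
  shows "emeasure (interval_measure F) A \<le> ennreal C * emeasure lborel A"
proof -
  define G where "G t = C * t - F t" for t
  have C: "0 \<le> C" using F[of 0 1] lip[of 0 1] by simp
  have G: "\<And>s t. s \<le> t \<Longrightarrow> G s \<le> G t" using lip by (simp add: G_def algebra_simps)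
  have contG: "continuous_on UNIV G" unfolding G_def by (intro continuous_intros cont)
  have rF: "continuous (at_right a) F" and rG: "continuous (at_right a) G" for a
    using cont contG by (auto simp: continuous_on_eq_continuous_at intro: continuous_within_subset)
  let ?F = "interval_measure F" and ?G = "interval_measure G"
  define \<nu> where "\<nu> = measure_of UNIV (sets borel) (\<lambda>A. emeasure ?F A + emeasure ?G A)"
  have sets: "sets \<nu> = sets borel"
    unfolding \<nu>_def by (metis sets.sets_measure_of_eq space_borel)
  have em: "emeasure \<nu> A = emeasure ?F A + emeasure ?G A" if "A \<in> sets borel" for A
    unfolding \<nu>_def
  proof (rule emeasure_measure_of_sigma[OF _ _ _ that])
    show "sigma_algebra UNIV (sets borel :: real set set)"
      by (metis sets.sigma_algebra_axioms space_borel)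
    show "countably_additive (sets borel) (\<lambda>A. emeasure ?F A + emeasure ?G A)"
    proof (rule countably_additiveI)
      fix A :: "nat \<Rightarrow> real set" assume *: "range A \<subseteq> sets borel" "disjoint_family A"
      then show "(\<Sum>i. emeasure ?F (A i) + emeasure ?G (A i)) = emeasure ?F (\<Union>i. A i) + emeasure ?G (\<Union>i. A i)"
        by (simp add: suminf_add[symmetric] suminf_emeasure)
    qed
  qed (simp add: positive_def)
  have "\<nu> = density lborel (\<lambda>_. ennreal C)"
  proof (rule measure_eqI_generator_eq)
    let ?E = "range (\<lambda>(a, b). {a<..b::real})"
    show "Int_stable ?E"
      by (auto simp: Int_stable_def intro!: image_eqI[of _ _ "(max _ _, min _ _)"])
    show "sets \<nu> = sigma_sets UNIV ?E" "sets (density lborel (\<lambda>_. ennreal C)) = sigma_sets UNIV ?E"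
      by (simp_all add: sets borel_sigma_sets_Ioc)
    fix X assume "X \<in> ?E"
    then obtain a b where X: "X = {a<..b}" by auto
    show "emeasure \<nu> X = emeasure (density lborel (\<lambda>_. ennreal C)) X"
    proof (cases "a \<le> b")
      case True
      then show ?thesis
        using F[OF True] G[OF True] C
        by (simp add: X em emeasure_interval_measure_Ioc[OF True F rF] emeasure_interval_measure_Ioc[OF True G rG]
            emeasure_density_const ennreal_plus[symmetric] ennreal_mult'[symmetric] G_def algebra_simps del: ennreal_plus)
    qed (simp add: X)
  next
    show "range (\<lambda>n::nat. {- real n<..real n}) \<subseteq> range (\<lambda>(a, b). {a<..b})" by auto
    show "(\<Union>n::nat. {- real n<..real n}) = UNIV"
    proof (intro UNIV_eq_I[symmetric])
      fix x :: real
      obtain n :: nat where "\<bar>x\<bar> < n" using reals_Archimedean2 by blast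
      then show "x \<in> (\<Union>n::nat. {- real n<..real n})" by (intro UN_I[of n]) auto
    qed
    show "emeasure \<nu> {- real n<..real n} \<noteq> \<infinity>" for n
      using F[of "- real n" "real n"] G[of "- real n" "real n"]
      by (simp add: em emeasure_interval_measure_Ioc F rF G rG)
  qed simp
  then have "emeasure ?F A + emeasure ?G A = ennreal C * emeasure lborel A"
    using em[OF A] A by (simp add: emeasure_density_const)
  then show ?thesis by (metis le_iff_add)
qed

text \<open>Domination by Lebesgue measure makes the Stieltjes measure of F absolutely continuous.
  Its Radon-Nikodym density is the integrand, obtained before anything is known about derivatives of
  F.\<close>

lemma mono_lipschitz_indefinite_integral:
  fixes F :: "real \<Rightarrow> real"
  assumes F: "\<And>s t. s \<le> t \<Longrightarrow> F s \<le> F t" and lip: "\<And>s t. s \<le> t \<Longrightarrow> F t - F s \<le> C * (t - s)"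
  obtains g where "\<And>a b. a \<le> b \<Longrightarrow> (g has_integral (F b - F a)) {a..b}"
proof -
  have C: "0 \<le> C" using F[of 0 1] lip[of 0 1] by simp
  have "C-lipschitz_on UNIV F"
  proof (rule lipschitz_onI[OF _ C])
    show "dist (F x) (F y) \<le> C * dist x y" for x y
      using F[of x y] F[of y x] lip[of x y] lip[of y x] by (cases x y rule: linorder_cases) (auto simp: dist_real_def)
  qed
  then have cont: "continuous_on UNIV F" by (rule lipschitz_on_continuous_on)
  let ?F = "interval_measure F"
  have "absolutely_continuous lborel ?F"
    unfolding absolutely_continuous_def
  proof
    fix A :: "real set" assume "A \<in> null_sets lborel"
    then show "A \<in> null_sets ?F"
      using emeasure_interval_measure_le_lborel[OF F lip cont, of A] by (auto simp: null_sets_def)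
  qed
  then obtain g where g: "g \<in> borel_measurable lborel" "density lborel g = ?F"
    using sigma_finite_measure.Radon_Nikodym[OF sigma_finite_lborel, of ?F] by auto
  have rF: "continuous (at_right a) F" for a
    using cont by (auto simp: continuous_on_eq_continuous_at intro: continuous_within_subset)
  show ?thesis
  proof (rule that[of "\<lambda>x. enn2real (g x)"])
    fix a b :: real assume ab: "a \<le> b"
    have nn: "(\<integral>\<^sup>+x. g x * indicator {a<..b} x \<partial>lborel) = ennreal (F b - F a)"
      using emeasure_density[OF g(1), of "{a<..b}"] emeasure_interval_measure_Ioc[OF ab F rF] by (simp add: g(2))
    then have fin: "AE x in lborel. g x * indicator {a<..b} x \<noteq> \<infinity>"
      using g(1) by (intro nn_integral_noteq_infinite) auto
    have "(\<integral>\<^sup>+x. ennreal (enn2real (g x) * indicator {a<..b} x) \<partial>lborel) = ennreal (F b - F a)"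
      unfolding nn[symmetric]
    proof (rule nn_integral_cong_AE, use fin in eventually_elim)
      case (elim x)
      then show ?case by (auto simp: indicator_def less_top)
    qed
    then have "has_bochner_integral lborel (\<lambda>x. enn2real (g x) * indicator {a<..b} x) (F b - F a)"
      using g(1) F[OF ab] by (intro has_bochner_integral_nn_integral) auto
    then have "((\<lambda>x. enn2real (g x) * indicator {a<..b} x) has_integral (F b - F a)) UNIV"
      using has_integral_integral_lborel has_bochner_integral_iff by metis
    then have "((\<lambda>x. if x \<in> {a<..b} then enn2real (g x) else 0) has_integral (F b - F a)) UNIV"
      by (rule has_integral_eq[rotated]) (auto simp: indicator_def)
    then have "((\<lambda>x. enn2real (g x)) has_integral (F b - F a)) {a<..b}"
      by (subst (asm) has_integral_restrict_UNIV)
    then show "((\<lambda>x. enn2real (g x)) has_integral (F b - F a)) {a..b}"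
      by (rule has_integral_spike_set_eq[THEN iffD1, rotated -1])
        (auto intro: negligible_subset[of "{a}"])
  qed
qed

text \<open>The one-sided derivative of an indefinite integral exists almost everywhere; applying this to
  the reflected integrand as well gives the two-sided derivative.\<close>

lemma mono_lipschitz_AE_differentiable:
  fixes F :: "real \<Rightarrow> real"
  assumes "\<And>s t. s \<le> t \<Longrightarrow> F s \<le> F t" and "\<And>s t. s \<le> t \<Longrightarrow> F t - F s \<le> C * (t - s)"
  shows "AE t in lebesgue. \<exists>d. (F has_real_derivative d) (at t)"
proof -
  obtain g where g: "\<And>a b. a \<le> b \<Longrightarrow> (g has_integral (F b - F a)) {a..b}"
    using mono_lipschitz_indefinite_integral assms by metis
  have gr: "((\<lambda>x. g (- x)) has_integral (F (- a) - F (- b))) {a..b}" if "a \<le> b" for a b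
    using g[of "-b" "-a"] that by (subst has_integral_reflect_real[symmetric]) auto
  have int: "g integrable_on cbox a b" "(\<lambda>x. g (- x)) integrable_on cbox a b" for a b
    using g[of a b] gr[of a b] by (cases "a \<le> b"; force simp: integrable_on_def)+
  obtain N1 where N1: "negligible N1" "\<And>x e. \<lbrakk>x \<notin> N1; 0 < e\<rbrakk> \<Longrightarrow>
      \<exists>d>0. \<forall>h. 0 < h \<and> h < d \<longrightarrow> norm (integral (cbox x (x + h *\<^sub>R One)) g /\<^sub>R h ^ DIM(real) - g x) < e"
    using integrable_ccontinuous_explicit[OF int(1)] by blast
  obtain N2 where N2: "negligible N2" "\<And>x e. \<lbrakk>x \<notin> N2; 0 < e\<rbrakk> \<Longrightarrow>
      \<exists>d>0. \<forall>h. 0 < h \<and> h < d \<longrightarrow> norm (integral (cbox x (x + h *\<^sub>R One)) (\<lambda>x. g (- x)) /\<^sub>R h ^ DIM(real) - g (- x)) < e"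
    using integrable_ccontinuous_explicit[OF int(2)] by blast
  have "negligible (uminus ` N2)"
    using N2(1) by (intro negligible_differentiable_image_negligible) (auto intro!: derivative_intros simp: differentiable_on_def)
  then have neg: "negligible (N1 \<union> uminus ` N2)" using N1(1) by auto
  have "(F has_real_derivative g t) (at t)" if t: "t \<notin> N1 \<union> uminus ` N2" for t
    unfolding DERIV_def LIM_def
  proof (intro allI impI)
    fix e :: real assume e: "0 < e"
    have "- t \<notin> N2" using t by force
    obtain d1 where d1: "d1 > 0" "\<And>h. 0 < h \<Longrightarrow> h < d1 \<Longrightarrow> \<bar>(F (t + h) - F t) / h - g t\<bar> < e"
      using N1(2)[of t e] t e integral_unique[OF g] by (auto simp: divide_inverse mult.commute)
    obtain d2 where d2: "d2 > 0" "\<And>h. 0 < h \<Longrightarrow> h < d2 \<Longrightarrow> \<bar>(F t - F (t - h)) / h - g t\<bar> < e"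
      using N2(2)[OF \<open>- t \<notin> N2\<close> e] integral_unique[OF gr] by (auto simp: divide_inverse mult.commute)
    have "\<bar>(F (t + h) - F t) / h - g t\<bar> < e" if "h \<noteq> 0" "\<bar>h\<bar> < min d1 d2" for h
    proof (cases "h > 0")
      case True then show ?thesis using d1 that by auto
    next
      case False
      then have "\<bar>(F t - F (t - (- h))) / (- h) - g t\<bar> < e" using that by (intro d2) auto
      moreover have "(F t - F (t - (- h))) / (- h) = (F (t + h) - F t) / h"
        using that by (simp add: field_simps)
      ultimately show ?thesis by simp
    qed
    then show "\<exists>s>0. \<forall>x. x \<noteq> 0 \<and> dist x 0 < s \<longrightarrow> dist ((F (t + x) - F t) / x) (g t) < e"
      using d1(1) d2(1) by (intro exI[of _ "min d1 d2"]) (auto simp: dist_real_def)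
  qed
  then show ?thesis
    by (intro AE_I'[of "N1 \<union> uminus ` N2"]) (use neg in \<open>auto simp: negligible_iff_null_sets\<close>)
qed

text \<open>Adding L t to a coordinate makes it nondecreasing with slopes at most 2 L, which is the
  case already settled.\<close>

lemma lipschitz_AE_differentiable:
  fixes x :: "real \<Rightarrow> 'a::euclidean_space"
  assumes lip: "L-lipschitz_on UNIV x"
  shows "AE t in lebesgue. \<exists>d. (x has_vector_derivative d) (at t)"
proof -
  have "AE t in lebesgue. \<exists>d. ((\<lambda>t. x t \<bullet> b) has_real_derivative d) (at t)" if b: "b \<in> Basis" for b
  proof -
    have l: "\<bar>x t \<bullet> b - x s \<bullet> b\<bar> \<le> L * (t - s)" if "s \<le> t" for s t
      using lipschitz_onD[OF lip, of t s] Basis_le_norm[OF b, of "x t - x s"] that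
      by (simp add: dist_norm inner_diff_left)
    have "AE t in lebesgue. \<exists>d. ((\<lambda>t. x t \<bullet> b + L * t) has_real_derivative d) (at t)"
      by (rule mono_lipschitz_AE_differentiable[where C = "2 * L"]) (use l in \<open>force simp: abs_le_iff algebra_simps\<close>)+
    then show ?thesis
    proof eventually_elim
      case (elim t)
      then obtain d where "((\<lambda>t. x t \<bullet> b + L * t) has_real_derivative d) (at t)" by blast
      from DERIV_diff[OF this DERIV_cmult_Id[of L]]
      show ?case by auto
    qed
  qed
  then have "AE t in lebesgue. \<forall>b\<in>Basis. \<exists>d. ((\<lambda>t. x t \<bullet> b) has_real_derivative d) (at t)"
    by (simp add: AE_finite_all)
  then show ?thesis
  proof eventually_elim
    case (elim t)
    then obtain d where d: "\<And>b. b \<in> Basis \<Longrightarrow> ((\<lambda>t. x t \<bullet> b) has_real_derivative d b) (at t)" by metis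
    have "(x has_vector_derivative (\<Sum>b\<in>Basis. d b *\<^sub>R b)) (at t)"
      unfolding has_vector_derivative_def
    proof (subst has_derivative_componentwise_within, rule ballI)
      fix b :: 'a assume b: "b \<in> Basis"
      have "((\<lambda>t. x t \<bullet> b) has_derivative (\<lambda>h. d b * h)) (at t)"
        using d[OF b] by (simp add: has_field_derivative_def)
      then show "((\<lambda>t. x t \<bullet> b) has_derivative (\<lambda>h. (h *\<^sub>R (\<Sum>b\<in>Basis. d b *\<^sub>R b)) \<bullet> b)) (at t)"
        using b by (simp add: mult.commute)
    qed
    then show ?case by blast
  qed
qed

subsection \<open>Differential inclusions and Filippov solutions\<close>

text \<open>The polygon with \<open>n + 1\<close> steps is written as \<open>x0\<close> plus the velocity vectors weighted by the
  time spent in each step. An increment over \<open>[u, v]\<close> is then \<open>v - u\<close> times a convex combination of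
  the velocities of the steps that meet \<open>[u, v]\<close>.\<close>

lemma euler_polygon_step_weights:
  fixes h a :: real
  assumes "0 \<le> h"
  shows "(\<Sum>k<m. max 0 (min h (t - (a + real k * h)))) = max 0 (min (real m * h) (t - a))"
proof (induction m)
  case (Suc m)
  define z where "z = real m * h"
  have "0 \<le> z" "real (Suc m) * h = z + h" using assms by (simp_all add: z_def algebra_simps)
  then show ?case
    using assms Suc.IH unfolding sum.lessThan_Suc z_def[symmetric] by (auto simp: max_def min_def)
qed simp

text \<open>The last property replaces a derivative inclusion: if the velocities at all times s
  whose step [s, s + h] meets [u, v] lie in a half-space, so does the difference quotient. Unlike
  the inclusion itself, it survives uniform limits.\<close>

lemma euler_polygon:
  fixes f :: "real \<Rightarrow> 'a::euclidean_space \<Rightarrow> 'a"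
  assumes M: "\<And>t x. norm (f t x) \<le> M" and ab: "a < b" and h: "h = (b - a) / real (Suc n)"
  obtains X where "X a = x0" "M-lipschitz_on {a..b} X"
    "\<And>u v w B. \<lbrakk>a \<le> u; u \<le> v; v \<le> b; \<And>s. \<lbrakk>a \<le> s; s \<le> b; s < v; u < s + h\<rbrakk> \<Longrightarrow> B \<le> w \<bullet> f s (X s)\<rbrakk>
      \<Longrightarrow> B * (v - u) \<le> w \<bullet> (X v - X u)"
proof -
  have hp: "0 < h" and nh: "real (Suc n) * h = b - a" using ab h by auto
  have M0: "0 \<le> M" using M[of 0 0] norm_ge_zero order_trans by blast
  define Y where "Y = rec_nat x0 (\<lambda>k y. y + h *\<^sub>R f (a + real k * h) y)"
  have Y: "Y 0 = x0" "Y (Suc k) = Y k + h *\<^sub>R f (a + real k * h) (Y k)" for k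
    by (simp_all add: Y_def)
  define F where "F k = f (a + real k * h) (Y k)" for k
  define c where "c k t = max 0 (min h (t - (a + real k * h)))" for k t
  define X where "X t = x0 + (\<Sum>k<Suc n. c k t *\<^sub>R F k)" for t
  have c_mono: "c k u \<le> c k v" if "u \<le> v" for k u v
    using that by (auto simp: c_def)
  have c_sum: "(\<Sum>k<Suc n. c k t) = t - a" if "t \<in> {a..b}" for t
    using euler_polygon_step_weights[of h t a "Suc n"] hp nh that by (auto simp: c_def)
  have Ysum: "Y k = x0 + (\<Sum>j<k. h *\<^sub>R F j)" for k
    by (induction k) (auto simp: Y F_def)
  have XY: "X (a + real k * h) = Y k" if k: "k \<le> n" for k
  proof -
    have c: "c j (a + real k * h) = (if j < k then h else 0)" for j
    proof (cases "j < k")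
      case True
      then have "real (Suc j) * h \<le> real k * h" using hp by (intro mult_right_mono) auto
      then show ?thesis using True hp by (auto simp: c_def algebra_simps)
    next
      case False
      then have "real k * h \<le> real j * h" using hp by (intro mult_right_mono) auto
      then have "a + real k * h - (a + real j * h) \<le> 0" by simp
      then show ?thesis using False hp by (simp add: c_def max_absorb1 min.coboundedI2)
    qed
    have "(\<Sum>j<Suc n. c j (a + real k * h) *\<^sub>R F j) = (\<Sum>j<k. h *\<^sub>R F j)"
      by (rule sum.mono_neutral_cong_right) (use k in \<open>auto simp: c\<close>)
    then show ?thesis by (simp add: X_def Ysum)
  qed
  have Xdiff: "X v - X u = (\<Sum>k<Suc n. (c k v - c k u) *\<^sub>R F k)" for u v
    by (simp only: X_def add_diff_cancel_left sum_subtractf[symmetric] scaleR_left_diff_distrib)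
  have csum: "(\<Sum>k<Suc n. c k v - c k u) = v - u" if "u \<in> {a..b}" "v \<in> {a..b}" for u v
    using c_sum[OF that(1)] c_sum[OF that(2)] by (simp only: sum_subtractf)
  show ?thesis
  proof
    have "c k a = 0" for k using hp by (simp add: c_def max_absorb1 min.coboundedI2)
    then show "X a = x0" by (simp add: X_def)
    have *: "norm (X v - X u) \<le> M * (v - u)" if uv: "u \<in> {a..b}" "v \<in> {a..b}" "u \<le> v" for u v
    proof -
      have "norm (X v - X u) \<le> (\<Sum>k<Suc n. (c k v - c k u) * M)"
        unfolding Xdiff
      proof (rule sum_norm_le)
        fix k
        show "norm ((c k v - c k u) *\<^sub>R F k) \<le> (c k v - c k u) * M"
          using c_mono[OF uv(3), of k] M by (simp add: F_def mult_left_mono)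
      qed
      also have "\<dots> = M * (v - u)"
        unfolding sum_distrib_right[symmetric] csum[OF uv(1,2)] by simp
      finally show ?thesis .
    qed
    show "M-lipschitz_on {a..b} X"
    proof (rule lipschitz_on_leI[OF _ M0])
      show "dist (X x) (X y) \<le> M * dist x y" if "x \<in> {a..b}" "y \<in> {a..b}" "x \<le> y" for x y
        using *[OF that] that by (simp add: dist_norm norm_minus_commute abs_minus_commute)
    qed
    show "B * (v - u) \<le> w \<bullet> (X v - X u)"
      if uv: "a \<le> u" "u \<le> v" "v \<le> b" and
        B: "\<And>s. \<lbrakk>a \<le> s; s \<le> b; s < v; u < s + h\<rbrakk> \<Longrightarrow> B \<le> w \<bullet> f s (X s)" for u v w B
    proof -
      have "B * (v - u) = (\<Sum>k<Suc n. (c k v - c k u) * B)"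
        using csum[of u v] uv unfolding sum_distrib_right[symmetric] by simp
      also have "\<dots> \<le> (\<Sum>k<Suc n. (c k v - c k u) * (w \<bullet> F k))"
      proof (rule sum_mono)
        fix k assume k: "k \<in> {..<Suc n}"
        show "(c k v - c k u) * B \<le> (c k v - c k u) * (w \<bullet> F k)"
        proof (cases "c k v = c k u")
          case False
          let ?s = "a + real k * h"
          have "real (Suc k) * h \<le> real (Suc n) * h" using k hp by (intro mult_right_mono) auto
          then have "?s + h \<le> b" using nh by (simp add: algebra_simps)
          moreover have "?s < v" "u < ?s + h"
            using False c_mono[OF uv(2), of k] hp uv by (auto simp: c_def max_def min_def split: if_splits)
          ultimately have "B \<le> w \<bullet> f ?s (X ?s)" using hp by (intro B) auto
          then have "B \<le> w \<bullet> F k" using XY[of k] k by (simp add: F_def)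
          then show ?thesis using c_mono[OF uv(2), of k] by (intro mult_left_mono) auto
        qed simp
      qed
      also have "\<dots> = w \<bullet> (X v - X u)"
        unfolding Xdiff by (simp only: inner_sum_right inner_scaleR_right)
      finally show ?thesis .
    qed
  qed
qed

text \<open>Polygons with finer steps are equi-Lipschitz, so a subsequence converges uniformly. A
  derivative of the limit outside the closed convex hull would be cut off by a hyperplane; but the
  half-space property of the polygons passes to increments of the limit and contradicts
  this.\<close>

lemma euler_limit:
  fixes f :: "real \<Rightarrow> 'a::euclidean_space \<Rightarrow> 'a"
  assumes M: "\<And>t x. norm (f t x) \<le> M" and ab: "a < b"
  obtains x where "x a = x0" "M-lipschitz_on {a..b} x"
    "\<And>t d \<delta>. \<lbrakk>t \<in> {a<..<b}; (x has_vector_derivative d) (at t); 0 < \<delta>\<rbrakk> \<Longrightarrow>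
       d \<in> closure (convex hull {f s y |s y. s \<in> {a..b} \<and> \<bar>s - t\<bar> < \<delta> \<and> norm (y - x t) < \<delta>})"
proof -
  define h where "h n = (b - a) / real (Suc n)" for n
  have M0: "0 \<le> M" using M[of 0 0] norm_ge_zero order_trans by blast
  have "\<exists>X. X a = x0 \<and> M-lipschitz_on {a..b} X \<and>
    (\<forall>u v w B. a \<le> u \<longrightarrow> u \<le> v \<longrightarrow> v \<le> b \<longrightarrow> (\<forall>s. a \<le> s \<longrightarrow> s \<le> b \<longrightarrow> s < v \<longrightarrow> u < s + h n \<longrightarrow> B \<le> w \<bullet> f s (X s))
      \<longrightarrow> B * (v - u) \<le> w \<bullet> (X v - X u))" for n
    by (rule euler_polygon[of f M a b "h n" n x0, OF M ab h_def]) blast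
  then obtain X where X: "\<And>n. X n a = x0" "\<And>n. M-lipschitz_on {a..b} (X n)"
    "\<And>n u v w B. \<lbrakk>a \<le> u; u \<le> v; v \<le> b; \<And>s. \<lbrakk>a \<le> s; s \<le> b; s < v; u < s + h n\<rbrakk> \<Longrightarrow> B \<le> w \<bullet> f s (X n s)\<rbrakk>
      \<Longrightarrow> B * (v - u) \<le> w \<bullet> (X n v - X n u)"
    by metis
  have Xlip: "norm (X n u - X n v) \<le> M * \<bar>u - v\<bar>" if "u \<in> {a..b}" "v \<in> {a..b}" for n u v
    using lipschitz_onD[OF X(2) that] by (simp add: dist_norm)
  have bdd: "norm (X n t) \<le> norm x0 + M * (b - a)" if t: "t \<in> {a..b}" for n t
  proof -
    have "norm (X n t) \<le> norm (X n a) + norm (X n t - X n a)" by (rule norm_triangle_sub)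
    also have "norm (X n t - X n a) \<le> M * \<bar>t - a\<bar>" using t ab by (intro Xlip) auto
    also have "\<dots> \<le> M * (b - a)" using t M0 by (intro mult_left_mono) auto
    finally show ?thesis by (simp add: X(1))
  qed
  obtain x k where x: "continuous_on {a..b} x" "strict_mono (k :: nat \<Rightarrow> nat)"
    "\<And>e. 0 < e \<Longrightarrow> \<exists>N. \<forall>n t. N \<le> n \<and> t \<in> {a..b} \<longrightarrow> norm (X (k n) t - x t) < e"
  proof (rule Arzela_Ascoli[of "{a..b}" X "norm x0 + M * (b - a)"])
    show "\<exists>d>0. \<forall>n y. y \<in> {a..b} \<and> norm (s - y) < d \<longrightarrow> norm (X n s - X n y) < e"
      if "s \<in> {a..b}" "0 < e" for s e
    proof (intro exI[of _ "e / (M + 1)"] conjI allI impI)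
      fix n y assume y: "y \<in> {a..b} \<and> norm (s - y) < e / (M + 1)"
      have "norm (X n s - X n y) \<le> M * \<bar>s - y\<bar>" using that y by (intro Xlip) auto
      also have "\<dots> \<le> (M + 1) * \<bar>s - y\<bar>" by (intro mult_right_mono) auto
      also have "\<dots> < e" using y M0 by (simp add: field_simps)
      finally show "norm (X n s - X n y) < e" .
    qed (use that M0 in auto)
  qed (use bdd in auto)
  have lim: "(\<lambda>n. X (k n) t) \<longlonglongrightarrow> x t" if "t \<in> {a..b}" for t
    using x(3) that by (force intro!: LIMSEQ_I)
  have hlim: "(\<lambda>n. h (k n)) \<longlonglongrightarrow> 0"
  proof -
    have "h \<longlonglongrightarrow> 0" unfolding h_def
      by (intro real_tendsto_divide_at_top[OF tendsto_const] filterlim_compose[OF filterlim_real_sequentially] filterlim_Suc)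
    then show ?thesis using LIMSEQ_subseq_LIMSEQ[OF _ x(2)] by (auto simp: o_def)
  qed
  have xlip: "norm (x u - x v) \<le> M * \<bar>u - v\<bar>" if "u \<in> {a..b}" "v \<in> {a..b}" for u v
    by (rule tendsto_upperbound[OF tendsto_norm[OF tendsto_diff[OF lim[OF that(1)] lim[OF that(2)]]]])
      (use Xlip[OF that] in auto)
  show ?thesis
  proof
    show "x a = x0" using lim[of a] ab by (simp add: X(1) LIMSEQ_const_iff)
    show "M-lipschitz_on {a..b} x" by (rule lipschitz_onI) (use xlip M0 in \<open>auto simp: dist_norm\<close>)
    fix t d \<delta> assume t: "t \<in> {a<..<b}" and d: "(x has_vector_derivative d) (at t)" and \<delta>: "(0::real) < \<delta>"
    define S where "S = {f s y |s y. s \<in> {a..b} \<and> \<bar>s - t\<bar> < \<delta> \<and> norm (y - x t) < \<delta>}"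
    have "d \<in> closure (convex hull S)"
    proof (rule ccontr)
      assume "d \<notin> closure (convex hull S)"
      then obtain w B where w: "w \<bullet> d < B" "\<And>y. y \<in> closure (convex hull S) \<Longrightarrow> B < w \<bullet> y"
        using separating_hyperplane_closed_point[of "closure (convex hull S)" d] by (auto intro: convex_closure)
      \<comment> \<open>Within time \<eta> a polygon moves at most \<delta>/2, and it is eventually
        within \<delta>/2 of the limit at t. The relevant samples are thus taken within \<delta> of
        \<open>x t\<close>.\<close>
      define \<eta> where "\<eta> = min (\<delta> / 2) (\<delta> / (2 * (M + 1)))"
      have \<eta>: "\<eta> > 0" "\<eta> < \<delta>" "M * \<eta> \<le> \<delta> / 2"
      proof -
        have "\<eta> \<le> \<delta> / (2 * (M + 1))" by (simp add: \<eta>_def)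
        then have "\<eta> * (2 * (M + 1)) \<le> \<delta>" using M0 by (simp add: pos_le_divide_eq)
        moreover have "0 \<le> \<eta>" using M0 \<delta> by (simp add: \<eta>_def)
        ultimately show "M * \<eta> \<le> \<delta> / 2" by (simp add: algebra_simps)
      qed (use \<delta> M0 in \<open>auto simp: \<eta>_def\<close>)
      have inc: "B * (v - t) \<le> w \<bullet> (x v - x t)" if v: "t < v" "v < t + \<eta>" "v \<le> b" for v
      proof -
        have ev: "\<forall>\<^sub>F n in sequentially. B * (v - t) \<le> w \<bullet> (X (k n) v - X (k n) t)"
        proof -
          have "\<forall>\<^sub>F n in sequentially. norm (X (k n) t - x t) < \<delta> / 2"
            using tendstoD[OF lim[of t], of "\<delta>/2"] t \<delta> by (simp add: dist_norm)
          moreover have "\<forall>\<^sub>F n in sequentially. h (k n) < \<eta>"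
            using order_tendstoD(2)[OF hlim \<eta>(1)] .
          ultimately show ?thesis
          proof eventually_elim
            case (elim n)
            show ?case
            proof (rule X(3))
              fix s assume s: "a \<le> s" "s \<le> b" "s < v" "t < s + h (k n)"
              then have st: "\<bar>s - t\<bar> \<le> \<eta>" "\<bar>s - t\<bar> < \<delta>" using elim(2) v \<eta> by auto
              have "norm (X (k n) s - x t) \<le> norm (X (k n) s - X (k n) t) + norm (X (k n) t - x t)"
                using norm_triangle_ineq[of "X (k n) s - X (k n) t" "X (k n) t - x t"] by simp
              also have "norm (X (k n) s - X (k n) t) \<le> M * \<bar>s - t\<bar>" using s t by (intro Xlip) auto
              also have "\<dots> \<le> M * \<eta>" using M0 st by (intro mult_left_mono) auto
              finally have "norm (X (k n) s - x t) < \<delta>" using elim(1) \<eta> by linarith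
              then have "f s (X (k n) s) \<in> S" unfolding S_def using s st by auto
              then have "f s (X (k n) s) \<in> closure (convex hull S)"
                using closure_subset hull_subset by fastforce
              then show "B \<le> w \<bullet> f s (X (k n) s)" using w(2) by fastforce
            qed (use t v in auto)
          qed
        qed
        show ?thesis
          by (rule tendsto_lowerbound[OF tendsto_inner[OF tendsto_const tendsto_diff[OF lim lim]] ev])
            (use t v in auto)
      qed
      have "((\<lambda>s. w \<bullet> x s) has_real_derivative w \<bullet> d) (at t)"
        using bounded_linear.has_vector_derivative[OF bounded_linear_inner_right d]
        by (simp add: has_real_derivative_iff_has_vector_derivative)
      from DERIV_diff[OF this DERIV_cmult_Id[of B]]
      have "((\<lambda>s. w \<bullet> x s - B * s) has_real_derivative (w \<bullet> d - B)) (at t)" .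
      from DERIV_neg_dec_right[OF this] w(1)
      obtain e where e: "e > 0" "\<And>h. h > 0 \<Longrightarrow> h < e \<Longrightarrow> w \<bullet> x (t + h) - B * (t + h) < w \<bullet> x t - B * t"
        by auto
      define h where "h = min (e / 2) (min (\<eta> / 2) (b - t))"
      have "h > 0" "h < e" "h < \<eta>" "t + h \<le> b" using e \<eta> t by (auto simp: h_def)
      then show False using e(2)[of h] inc[of "t + h"] by (simp add: inner_diff_right algebra_simps)
    qed
    then show "d \<in> closure (convex hull {f s y |s y. s \<in> {a..b} \<and> \<bar>s - t\<bar> < \<delta> \<and> norm (y - x t) < \<delta>})"
      by (simp add: S_def)
  qed
qed

section \<open>Filippov sets and Filippov solutions\<close>

lemma abs_continuous_imp_continuous_on:
  fixes x :: "real \<Rightarrow> 'a::real_normed_vector"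
  assumes "abs_continuous a b x"
  shows "continuous_on {a..b} x"
  unfolding continuous_on_iff
proof (intro ballI allI impI)
  fix t and e :: real assume t: "t \<in> {a..b}" and "0 < e"
  then obtain \<delta> where \<delta>: "\<delta> > 0" "\<And>d. d division_of \<Union>d \<and> \<Union>d \<subseteq> {a..b} \<and> (\<Sum>K\<in>d. measure lborel K) < \<delta>
        \<Longrightarrow> (\<Sum>K\<in>d. norm (x (Sup K) - x (Inf K))) < e"
    using assms unfolding abs_continuous_def by blast
  have *: "norm (x v - x u) < e" if "u \<in> {a..b}" "v \<in> {a..b}" "u \<le> v" "v - u < \<delta>" for u v
  proof -
    have "{{u..v}} division_of \<Union>{{u..v}}"
      using division_of_self[of u v] that by simp
    then show ?thesis using \<delta>(2)[of "{{u..v}}"] that by auto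
  qed
  show "\<exists>d>0. \<forall>s\<in>{a..b}. dist s t < d \<longrightarrow> dist (x s) (x t) < e"
  proof (intro exI[of _ \<delta>] conjI ballI impI \<delta>(1))
    fix s assume "s \<in> {a..b}" "dist s t < \<delta>"
    then show "dist (x s) (x t) < e"
      using *[of s t] *[of t s] t by (cases "s \<le> t") (auto simp: dist_norm norm_minus_commute)
  qed
qed

lemma filippov_set_subset_closure:
  assumes "0 < \<delta>"
  shows "filippov_set f x \<subseteq> closure (convex hull (f ` ball x \<delta>))"
proof
  fix d assume "d \<in> filippov_set f x"
  then have "d \<in> closure (convex hull (f ` (ball x \<delta> - {})))"
    using assms negligible_empty unfolding filippov_set_def by blast
  then show "d \<in> closure (convex hull (f ` ball x \<delta>))" by simp
qed

lemma norm_filippov_set_le: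
  assumes "0 < \<delta>" "\<And>y. y \<in> ball x \<delta> \<Longrightarrow> norm (f y) \<le> M" "d \<in> filippov_set f x"
  shows "norm d \<le> M"
proof -
  have "convex hull (f ` ball x \<delta>) \<subseteq> cball 0 M"
    using assms(2) by (intro hull_minimal) auto
  then have "closure (convex hull (f ` ball x \<delta>)) \<subseteq> cball 0 M"
    by (rule closure_minimal) simp
  then show ?thesis using filippov_set_subset_closure[OF assms(1), of f x] assms(3) by auto
qed

lemma filippov_solution_subset:
  assumes "filippov_solution f I x" "J \<subseteq> I"
  shows "filippov_solution f J x"
proof -
  have "AE t in lebesgue. t \<in> I \<longrightarrow>
      (\<exists>x'. (x has_vector_derivative x') (at t within I) \<and> x' \<in> filippov_set (f t) (x t))"
    using assms(1) by (simp add: filippov_solution_def)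
  then have "AE t in lebesgue. t \<in> J \<longrightarrow>
      (\<exists>x'. (x has_vector_derivative x') (at t within J) \<and> x' \<in> filippov_set (f t) (x t))"
    by eventually_elim (use assms(2) has_vector_derivative_within_subset in blast)
  then show ?thesis using assms unfolding filippov_solution_def by blast
qed

lemma filippov_solution_lipschitz_on:
  fixes x :: "real \<Rightarrow> 'a::euclidean_space"
  assumes x: "filippov_solution f I x" and I: "{a..b} \<subseteq> I" and "0 \<le> M"
    and M: "\<And>t d. t \<in> {a..b} \<Longrightarrow> d \<in> filippov_set (f t) (x t) \<Longrightarrow> norm d \<le> M"
  shows "M-lipschitz_on {a..b} x"
proof (rule lipschitz_on_leI[OF _ \<open>0 \<le> M\<close>])
  fix s t assume st: "s \<in> {a..b}" "t \<in> {a..b}" "s \<le> t"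
  have "norm (x t - x s) \<le> M * (t - s)"
  proof (rule abs_continuous_norm_increment_le[OF _ st(3)])
    show "abs_continuous s t x" using x I st unfolding filippov_solution_def by force
    have "AE u in lebesgue. u \<in> I \<longrightarrow>
      (\<exists>x'. (x has_vector_derivative x') (at u within I) \<and> x' \<in> filippov_set (f u) (x u))"
      using x by (simp add: filippov_solution_def)
    then show "AE u in lebesgue. u \<in> {s..t} \<longrightarrow>
      (\<exists>x'. (x has_vector_derivative x') (at u within {s..t}) \<and> norm x' \<le> M)"
    proof eventually_elim
      case (elim u)
      show ?case
      proof
        assume u: "u \<in> {s..t}"
        then have "u \<in> {a..b}" using st by auto
        then obtain x' where "(x has_vector_derivative x') (at u within I)" "x' \<in> filippov_set (f u) (x u)"
          using elim I by blast
        moreover have "{s..t} \<subseteq> I" using I st by auto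
        ultimately show "\<exists>x'. (x has_vector_derivative x') (at u within {s..t}) \<and> norm x' \<le> M"
          using M[OF \<open>u \<in> {a..b}\<close>] has_vector_derivative_within_subset by blast
      qed
    qed
  qed
  then show "dist (x s) (x t) \<le> M * dist s t"
    using st by (simp add: dist_norm norm_minus_commute)
qed

text \<open>This links the Euler limit, which knows field values at nearby times and states, with
  the Filippov set, which uses time t only and discards null sets. \<open>tc\<close> moves a value
  \<open>f s y\<close> to time t with error \<epsilon>, \<open>sel\<close> places
  \<open>f t y\<close> in the required hull, and \<epsilon> is arbitrary.\<close>

lemma mem_filippov_setI:
  fixes f :: "real \<Rightarrow> 'a::euclidean_space \<Rightarrow> 'a"
  assumes sel: "\<And>y \<delta> N. 0 < \<delta> \<Longrightarrow> negligible N \<Longrightarrow> f t y \<in> closure (convex hull (f t ` (ball y \<delta> - N)))"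
    and tc: "\<And>\<epsilon>. 0 < \<epsilon> \<Longrightarrow> \<exists>\<delta>>0. \<forall>s y. 0 \<le> s \<and> \<bar>s - t\<bar> < \<delta> \<and> norm (y - x) < \<delta> \<longrightarrow> norm (f s y - f t y) \<le> \<epsilon>"
    and d: "\<And>\<delta>. 0 < \<delta> \<Longrightarrow> d \<in> closure (convex hull {f s y |s y. 0 \<le> s \<and> \<bar>s - t\<bar> < \<delta> \<and> norm (y - x) < \<delta>})"
  shows "d \<in> filippov_set (f t) x"
  unfolding filippov_set_def
proof (intro INT_I)
  fix \<delta>0 :: real and N :: "'a set" assume "\<delta>0 \<in> {0<..}" "N \<in> {N. negligible N}"
  then have \<delta>0: "0 < \<delta>0" and N: "negligible N" by auto
  define K where "K = closure (convex hull (f t ` (ball x \<delta>0 - N)))"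
  have K: "convex K" "closed K" by (auto simp: K_def convex_closure)
  have "\<exists>k\<in>K. dist k d \<le> \<epsilon>" if "0 < \<epsilon>" for \<epsilon>
  proof -
    obtain \<delta>1 where \<delta>1: "\<delta>1 > 0" "\<And>s y. 0 \<le> s \<Longrightarrow> \<bar>s - t\<bar> < \<delta>1 \<Longrightarrow> norm (y - x) < \<delta>1 \<Longrightarrow> norm (f s y - f t y) \<le> \<epsilon>"
      using tc[OF \<open>0 < \<epsilon>\<close>] by blast
    define \<delta> where "\<delta> = min \<delta>1 (\<delta>0 / 2)"
    have "\<delta> > 0" using \<delta>1 \<delta>0 by (auto simp: \<delta>_def)
    \<comment> \<open>The closed \<epsilon>-neighbourhood of K is convex, so it contains the whole
      closed hull as soon as it contains the samples.\<close>
    define E where "E = (\<Union>k\<in>K. \<Union>z\<in>cball 0 \<epsilon>. {k + z})"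
    have E: "closed E" "convex E"
      unfolding E_def by (intro closed_compact_sums K compact_cball convex_sums convex_cball)+
    have "f s y \<in> E" if "0 \<le> s" "\<bar>s - t\<bar> < \<delta>" "norm (y - x) < \<delta>" for s y
    proof -
      have "ball y (\<delta>0 / 2) \<subseteq> ball x \<delta>0"
        using that by (intro ball_subset_ball_iff[THEN iffD2]) (auto simp: \<delta>_def dist_norm)
      then have "closure (convex hull (f t ` (ball y (\<delta>0 / 2) - N))) \<subseteq> K"
        unfolding K_def by (intro closure_mono hull_mono) auto
      moreover have "f t y \<in> closure (convex hull (f t ` (ball y (\<delta>0 / 2) - N)))"
        using \<delta>0 N by (intro sel) auto
      moreover have "f s y = f t y + (f s y - f t y)" by simp
      moreover have "norm (f s y - f t y) \<le> \<epsilon>" using that by (intro \<delta>1) (auto simp: \<delta>_def)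
      ultimately show ?thesis
        unfolding E_def by (intro UN_I[of "f t y"] UN_I[of "f s y - f t y"]) auto
    qed
    then have "closure (convex hull {f s y |s y. 0 \<le> s \<and> \<bar>s - t\<bar> < \<delta> \<and> norm (y - x) < \<delta>}) \<subseteq> E"
      using E by (intro closure_minimal hull_minimal) auto
    then have "d \<in> E" using d[OF \<open>\<delta> > 0\<close>] by auto
    then obtain k z where "k \<in> K" "norm z \<le> \<epsilon>" "d = k + z" by (auto simp: E_def)
    then show ?thesis by (intro bexI[of _ k]) (auto simp: dist_norm)
  qed
  then have "d \<in> closure K"
    unfolding closure_approachable_le by simp
  then show "d \<in> closure (convex hull (f t ` (ball x \<delta>0 - N)))" using K(2) by (simp add: K_def)
qed

text \<open>These are the properties under which Euler limits are Filippov solutions.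
  \<open>time_cont\<close> compares two times at the same state y, uniformly for y near x, and so
  tolerates discontinuity in the state. \<open>selection\<close> forbids special field values on
  null sets, which a polygon might sample.\<close>

locale filippov_field =
  fixes f :: "real \<Rightarrow> 'a::euclidean_space \<Rightarrow> 'a"
  assumes locally_bounded: "\<And>T R. \<exists>M. \<forall>t\<in>{0..T}. \<forall>x. norm x \<le> R \<longrightarrow> norm (f t x) \<le> M"
    and time_cont: "\<And>t x \<epsilon>. 0 \<le> t \<Longrightarrow> 0 < \<epsilon> \<Longrightarrow>
      \<exists>\<delta>>0. \<forall>s y. 0 \<le> s \<and> \<bar>s - t\<bar> < \<delta> \<and> norm (y - x) < \<delta> \<longrightarrow> norm (f s y - f t y) \<le> \<epsilon>"
    and selection: "\<And>t y \<delta> N. 0 \<le> t \<Longrightarrow> 0 < \<delta> \<Longrightarrow> negligible N \<Longrightarrow>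
      f t y \<in> closure (convex hull (f t ` (ball y \<delta> - N)))"
begin

lemma bounded_solution_lipschitz_on:
  assumes x: "filippov_solution f I x" and I: "I \<subseteq> {0..T}" and R: "\<And>t. t \<in> I \<Longrightarrow> norm (x t) \<le> R"
  obtains M where "0 \<le> M" "\<And>a b. {a..b} \<subseteq> I \<Longrightarrow> M-lipschitz_on {a..b} x"
proof -
  obtain M where M: "\<And>t x. t \<in> {0..T} \<Longrightarrow> norm x \<le> R + 1 \<Longrightarrow> norm (f t x) \<le> M"
    using locally_bounded[of T "R + 1"] by blast
  have "norm d \<le> max M 0" if "t \<in> I" "d \<in> filippov_set (f t) (x t)" for t d
  proof (rule norm_filippov_set_le[where \<delta> = 1 and f = "f t" and x = "x t"])
    fix y assume "y \<in> ball (x t) 1"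
    then have "norm y \<le> R + 1"
      using R[OF that(1)] norm_triangle_sub[of y "x t"] by (simp add: dist_norm norm_minus_commute)
    then show "norm (f t y) \<le> max M 0" using M[of t y] that(1) I by auto
  qed (use that in auto)
  then have "\<And>a b. {a..b} \<subseteq> I \<Longrightarrow> (max M 0)-lipschitz_on {a..b} x"
    by (intro filippov_solution_lipschitz_on[OF x]) auto
  then show ?thesis using that[of "max M 0"] by simp
qed

lemma closed_solution_lipschitz_on:
  assumes x: "filippov_solution f {0..T} x"
  obtains M where "M-lipschitz_on {0..T} x"
proof -
  have "continuous_on {0..T} x"
  proof (cases "0 \<le> T")
    case True
    then show ?thesis using x unfolding filippov_solution_def
      by (blast intro: abs_continuous_imp_continuous_on)
  qed simp
  then have "bounded (x ` {0..T})" by (intro compact_imp_bounded compact_continuous_image) auto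
  then obtain R where "\<And>t. t \<in> {0..T} \<Longrightarrow> norm (x t) \<le> R"
    unfolding bounded_iff by blast
  then show ?thesis using bounded_solution_lipschitz_on[OF x order_refl] that by blast
qed

lemma filippov_solutionI:
  assumes lip: "\<And>a b. {a..b} \<subseteq> I \<Longrightarrow> \<exists>M. M-lipschitz_on {a..b} x"
    and ae: "AE t in lebesgue. t \<in> I \<longrightarrow> (\<exists>d. (x has_vector_derivative d) (at t) \<and> d \<in> filippov_set (f t) (x t))"
  shows "filippov_solution f I x"
  unfolding filippov_solution_def
proof (intro conjI allI impI)
  show "abs_continuous a b x" if "a \<le> b \<and> {a..b} \<subseteq> I" for a b
    using lip[of a b] that lipschitz_on_imp_abs_continuous by blast
  show "AE t in lebesgue. t \<in> I \<longrightarrow>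
      (\<exists>x'. (x has_vector_derivative x') (at t within I) \<and> x' \<in> filippov_set (f t) (x t))"
    using ae by eventually_elim (use has_vector_derivative_at_within in blast)
qed

lemma AE_neq: "AE t in lebesgue. t \<noteq> (c::real)"
  by (rule AE_I'[of "{c}"]) (auto simp: negligible_iff_null_sets[symmetric])

lemma filippov_solution_AE_at:
  assumes x: "filippov_solution f {0..T} x"
  shows "AE t in lebesgue. t \<in> {0..T} \<longrightarrow> t \<in> {0<..<T} \<and>
    (\<exists>d. (x has_vector_derivative d) (at t) \<and> d \<in> filippov_set (f t) (x t))"
proof -
  have "AE t in lebesgue. t \<in> {0..T} \<longrightarrow>
      (\<exists>x'. (x has_vector_derivative x') (at t within {0..T}) \<and> x' \<in> filippov_set (f t) (x t))"
    using x by (simp add: filippov_solution_def)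
  then show ?thesis
    using AE_neq[of 0] AE_neq[of T]
  proof eventually_elim
    case (elim t)
    show ?case
    proof
      assume t: "t \<in> {0..T}"
      then have "t \<in> {0<..<T}" using elim by auto
      moreover from this have "at t within {0..T} = at t"
        by (intro at_within_interior) (simp add: interior_atLeastAtMost_real)
      ultimately show "t \<in> {0<..<T} \<and> (\<exists>d. (x has_vector_derivative d) (at t) \<and> d \<in> filippov_set (f t) (x t))"
        using elim(1) t by auto
    qed
  qed
qed

end

section \<open>Prolongation of solutions under a priori bounds\<close>

text \<open>A uniform a priori bound on a time interval lets the bounded field of the Euler method agree with
  \<open>f\<close> along the constructed solution.\<close>

locale apriori_bounded_field = filippov_field f for f :: "real \<Rightarrow> 'a::euclidean_space \<Rightarrow> 'a" +
  fixes X0 :: 'a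
  assumes apriori: "\<And>T. \<exists>R. \<forall>\<tau> x. 0 < \<tau> \<and> \<tau> \<le> T \<and> filippov_solution f {0..<\<tau>} x \<and> x 0 = X0 \<longrightarrow>
      (\<forall>t\<in>{0..<\<tau>}. norm (x t) \<le> R)"
begin

text \<open>The a priori bound confines the solution to a ball where the field is bounded. This
  gives one Lipschitz constant on the half-open interval, hence a limit at T.\<close>

lemma closed_extension:
  assumes x: "filippov_solution f {0..<T} x" "x 0 = X0" and T: "0 < T"
  obtains x' where "filippov_solution f {0..T} x'" "\<And>t. t \<in> {0..<T} \<Longrightarrow> x' t = x t"
proof -
  obtain R where R: "\<And>t. t \<in> {0..<T} \<Longrightarrow> norm (x t) \<le> R" using apriori[of T] x T by blast
  obtain M where M: "0 \<le> M" "\<And>a b. {a..b} \<subseteq> {0..<T} \<Longrightarrow> M-lipschitz_on {a..b} x"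
    using bounded_solution_lipschitz_on[OF x(1) _ R, of T] by (metis atLeastLessThan_subseteq_atLeastAtMost_iff order_refl)
  have "M-lipschitz_on {0..<T} x"
  proof (rule lipschitz_on_leI[OF _ M(1)])
    fix s t assume "s \<in> {0..<T}" "t \<in> {0..<T}" "s \<le> t"
    then show "dist (x s) (x t) \<le> M * dist s t"
      using lipschitz_onD[OF M(2)[of s t], of s t] by (auto simp: subset_iff)
  qed
  from lipschitz_extend_closure[OF this] T obtain x' where
    x': "M-lipschitz_on {0..T} x'" "\<And>t. t \<in> {0..<T} \<Longrightarrow> x' t = x t" by auto
  have "AE t in lebesgue. t \<in> {0..<T} \<longrightarrow>
      (\<exists>x'. (x has_vector_derivative x') (at t within {0..<T}) \<and> x' \<in> filippov_set (f t) (x t))"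
    using x by (simp add: filippov_solution_def)
  then have "AE t in lebesgue. t \<in> {0..T} \<longrightarrow>
      (\<exists>d. (x' has_vector_derivative d) (at t) \<and> d \<in> filippov_set (f t) (x' t))"
    using AE_neq[of 0] AE_neq[of T]
  proof eventually_elim
    case (elim t)
    show ?case
    proof
      assume t: "t \<in> {0..T}"
      then have t': "t \<in> {0<..<T}" using elim by auto
      then have "at t within {0..<T} = at t"
        by (intro at_within_interior) (simp add: interior_atLeastLessThan)
      then obtain d where d: "(x has_vector_derivative d) (at t)" "d \<in> filippov_set (f t) (x t)"
        using elim(1) t' by auto
      have "(x' has_vector_derivative d) (at t)"
        by (rule has_vector_derivative_transform_within_open[OF d(1), of "{0<..<T}"]) (use t' x' in auto)
      then show "\<exists>d. (x' has_vector_derivative d) (at t) \<and> d \<in> filippov_set (f t) (x' t)"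
        using d(2) x'(2) t' by auto
    qed
  qed
  then have "filippov_solution f {0..T} x'"
    by (rule filippov_solutionI[rotated]) (use x'(1) lipschitz_on_subset in blast)
  then show ?thesis using that x'(2) by blast
qed

text \<open>The field is cut off to 0 outside the ball of radius R + 1, so that the Euler method
  applies on a unit interval. The result solves the original equation as long as it stays inside
  that ball, and it never leaves: up to a first exit it would be a genuine solution, hence bounded
  by R.\<close>

lemma step_extension:
  assumes x: "filippov_solution f {0..T} x" "x 0 = X0" and T: "0 \<le> T"
  obtains x' where "filippov_solution f {0..T + 1} x'" "\<And>t. t \<in> {0..T} \<Longrightarrow> x' t = x t"
proof -
  obtain R0 where R0: "\<And>\<tau> x t. 0 < \<tau> \<Longrightarrow> \<tau> \<le> T + 1 \<Longrightarrow> filippov_solution f {0..<\<tau>} x \<Longrightarrow> x 0 = X0 \<Longrightarrow>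
      t \<in> {0..<\<tau>} \<Longrightarrow> norm (x t) \<le> R0" using apriori[of "T + 1"] by blast
  \<comment> \<open>At T = 0 no solution on a nondegenerate half-open interval is available yet, so
    R0 alone would not bound the initial state.\<close>
  define R where "R = max R0 (norm X0)"
  obtain M0 where M0: "\<And>t x. t \<in> {0..T + 1} \<Longrightarrow> norm x \<le> R + 1 \<Longrightarrow> norm (f t x) \<le> M0"
    using locally_bounded[of "T + 1" "R + 1"] by blast
  define F where "F s y = (if s \<in> {0..T + 1} \<and> norm y < R + 1 then f s y else 0)" for s y
  have "norm (F s y) \<le> max M0 0" for s y using M0[of s y] by (auto simp: F_def)
  then obtain g where g: "g T = x T" "(max M0 0)-lipschitz_on {T..T + 1} g"
    "\<And>t d \<delta>. \<lbrakk>t \<in> {T<..<T + 1}; (g has_vector_derivative d) (at t); 0 < \<delta>\<rbrakk> \<Longrightarrow>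
       d \<in> closure (convex hull {F s y |s y. s \<in> {T..T + 1} \<and> \<bar>s - t\<bar> < \<delta> \<and> norm (y - g t) < \<delta>})"
    by (rule euler_limit[where f = F and a = T and b = "T + 1" and ?x0.0 = "x T"]) auto
  define x' where "x' t = (if t \<le> T then x t else g t)" for t
  have x'g: "x' t = g t" if "T \<le> t" for t using that g(1) by (auto simp: x'_def)
  obtain M1 where M1: "M1-lipschitz_on {0..T} x" using closed_solution_lipschitz_on[OF x(1)] .
  define M where "M = max M1 (max M0 0)"
  have lip: "M-lipschitz_on {0..T + 1} x'"
    unfolding x'_def
    by (rule lipschitz_on_concat) (use M1 g in \<open>auto simp: M_def intro: lipschitz_on_mono\<close>)
  \<comment> \<open>Clamping the time argument gives a function that is Lipschitz on the whole line,
    as almost everywhere differentiability requires.\<close>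
  define G where "G t = g (max T (min (T + 1) t))" for t
  have "(max M0 0)-lipschitz_on UNIV G"
  proof (rule lipschitz_onI)
    fix s t
    have "dist (G s) (G t) \<le> max M0 0 * dist (max T (min (T + 1) s)) (max T (min (T + 1) t))"
      unfolding G_def by (intro lipschitz_onD[OF g(2)]) auto
    also have "\<dots> \<le> max M0 0 * dist s t"
      by (intro mult_left_mono) (auto simp: dist_real_def max_def min_def)
    finally show "dist (G s) (G t) \<le> max M0 0 * dist s t" .
  qed simp
  from lipschitz_AE_differentiable[OF this]
  have ae: "AE t in lebesgue. t \<in> {0..T + 1} \<longrightarrow> t \<noteq> T + 1 \<and> (t < T \<or> norm (x' t) < R + 1 \<longrightarrow>
     (\<exists>d. (x' has_vector_derivative d) (at t) \<and> d \<in> filippov_set (f t) (x' t)))"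
    using AE_neq[of T] AE_neq[of "T + 1"] filippov_solution_AE_at[OF x(1)]
  proof eventually_elim
    case (elim t)
    show ?case
    proof (intro impI conjI elim)
      assume t: "t \<in> {0..T + 1}" and R: "t < T \<or> norm (x' t) < R + 1"
      show "\<exists>d. (x' has_vector_derivative d) (at t) \<and> d \<in> filippov_set (f t) (x' t)"
      proof (cases "t < T")
        case True
        then obtain d where d: "(x has_vector_derivative d) (at t)" "d \<in> filippov_set (f t) (x t)"
          using elim t by auto
        have "(x' has_vector_derivative d) (at t)"
          by (rule has_vector_derivative_transform_within_open[OF d(1), of "{..<T}"]) (use True in \<open>auto simp: x'_def\<close>)
        then show ?thesis using d(2) True by (auto simp: x'_def)
      next
        case False
        then have tT: "t \<in> {T<..<T + 1}" using elim t by auto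
        obtain d where d: "(G has_vector_derivative d) (at t)" using elim by blast
        have dg: "(g has_vector_derivative d) (at t)" and dx: "(x' has_vector_derivative d) (at t)"
          by (rule has_vector_derivative_transform_within_open[OF d, of "{T<..<T + 1}"],
              use tT in \<open>auto simp: G_def x'_def\<close>)+
        have "norm (x' t) < R + 1" using R False by auto
        have "d \<in> filippov_set (f t) (x' t)"
        proof (rule mem_filippov_setI)
          have "0 \<le> t" using t by simp
          then show "f t y \<in> closure (convex hull (f t ` (ball y \<delta> - N)))" if "0 < \<delta>" "negligible N" for y \<delta> N
            using selection that by blast
          show "\<exists>\<delta>>0. \<forall>s y. 0 \<le> s \<and> \<bar>s - t\<bar> < \<delta> \<and> norm (y - x' t) < \<delta> \<longrightarrow> norm (f s y - f t y) \<le> \<epsilon>"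
            if "0 < \<epsilon>" for \<epsilon> by (rule time_cont[OF \<open>0 \<le> t\<close> that])
          fix \<delta> :: real assume "0 < \<delta>"
          \<comment> \<open>On this smaller neighbourhood the cut-off field coincides with
            f.\<close>
          define \<delta>' where "\<delta>' = min \<delta> (R + 1 - norm (x' t))"
          have "0 < \<delta>'" using \<open>0 < \<delta>\<close> \<open>norm (x' t) < R + 1\<close> by (simp add: \<delta>'_def)
          have "{F s y |s y. s \<in> {T..T + 1} \<and> \<bar>s - t\<bar> < \<delta>' \<and> norm (y - g t) < \<delta>'} \<subseteq>
              {f s y |s y. 0 \<le> s \<and> \<bar>s - t\<bar> < \<delta> \<and> norm (y - x' t) < \<delta>}"
          proof clarify
            fix s y assume sy: "s \<in> {T..T + 1}" "\<bar>s - t\<bar> < \<delta>'" "norm (y - g t) < \<delta>'"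
            have "norm y \<le> norm (x' t) + norm (y - x' t)" by (rule norm_triangle_sub)
            then have "norm y < R + 1" using sy(3) tT by (simp add: x'g \<delta>'_def)
            then have "F s y = f s y" using sy(1) T by (simp add: F_def)
            then show "\<exists>s' y'. F s y = f s' y' \<and> 0 \<le> s' \<and> \<bar>s' - t\<bar> < \<delta> \<and> norm (y' - x' t) < \<delta>"
              using sy tT T by (intro exI[of _ s] exI[of _ y]) (auto simp: x'g \<delta>'_def)
          qed
          then show "d \<in> closure (convex hull {f s y |s y. 0 \<le> s \<and> \<bar>s - t\<bar> < \<delta> \<and> norm (y - x' t) < \<delta>})"
            by (rule subsetD[OF closure_mono[OF hull_mono] g(3)[OF tT dg \<open>0 < \<delta>'\<close>]])
        qed
        then show ?thesis using dx by blast
      qed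
    qed
  qed
  have cont: "continuous_on {0..T + 1} x'" using lip by (rule lipschitz_on_continuous_on)
  have sol: "filippov_solution f {0..<\<tau>} x'"
    if "\<tau> \<le> T + 1" "\<And>t. T \<le> t \<Longrightarrow> t < \<tau> \<Longrightarrow> norm (x' t) < R + 1" for \<tau>
  proof (rule filippov_solutionI)
    show "\<exists>M. M-lipschitz_on {a..b} x'" if "{a..b} \<subseteq> {0..<\<tau>}" for a b
    proof -
      have "{a..b} \<subseteq> {0..T + 1}" using that \<open>\<tau> \<le> T + 1\<close> by force
      then show ?thesis using lip lipschitz_on_subset by blast
    qed
    show "AE t in lebesgue. t \<in> {0..<\<tau>} \<longrightarrow>
        (\<exists>d. (x' has_vector_derivative d) (at t) \<and> d \<in> filippov_set (f t) (x' t))"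
      using ae
    proof eventually_elim
      case (elim t)
      then show ?case using that(1) that(2)[of t] by (cases "t < T") auto
    qed
  qed
  have x'0: "x' 0 = X0" using T x(2) by (simp add: x'_def)
  have xT: "norm (x' T) \<le> R"
  proof (cases "T = 0")
    case False
    then have "0 < T" using T by simp
    have "norm (x t) \<le> R" if "t \<in> {0..<T}" for t
      using R0[of T x t] x that \<open>0 < T\<close> filippov_solution_subset[OF x(1), of "{0..<T}"] by (force simp: R_def)
    moreover have "continuous_on (closure {0..<T}) (\<lambda>t. norm (x t))"
      using \<open>0 < T\<close> lipschitz_on_continuous_on[OF M1] by (simp add: continuous_on_norm)
    ultimately have "norm (x T) \<le> R"
      using continuous_le_on_closure[of "{0..<T}" "\<lambda>t. norm (x t)" T R] \<open>0 < T\<close> by simp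
    then show ?thesis by (simp add: x'_def)
  qed (use x'0 in \<open>simp add: R_def\<close>)
  \<comment> \<open>Let \<tau> be the first time with norm at least R + 1. Before \<tau> the curve
    solves the original equation, so its norm is at most R there, and by continuity also at
    \<tau>.\<close>
  have bound: "norm (x' t) < R + 1" if "t \<in> {T..T + 1}" for t
  proof (rule ccontr)
    assume nt: "\<not> norm (x' t) < R + 1"
    define Z where "Z = {s \<in> {T..T + 1}. R + 1 \<le> norm (x' s)}"
    have "continuous_on {T..T + 1} (\<lambda>s. norm (x' s))"
      using T by (auto intro!: continuous_intros continuous_on_subset[OF cont])
    then have "closed ({T..T + 1} \<inter> (\<lambda>s. norm (x' s)) -` {R + 1..})"
      by (intro continuous_closed_preimage) auto
    moreover have "Z = {T..T + 1} \<inter> (\<lambda>s. norm (x' s)) -` {R + 1..}" by (auto simp: Z_def)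
    moreover have "bounded Z" by (rule bounded_subset[of "{T..T + 1}"]) (auto simp: Z_def)
    ultimately have "compact Z" by (simp add: compact_eq_bounded_closed)
    have "t \<in> Z" using nt that by (simp add: Z_def)
    then obtain \<tau> where \<tau>: "\<tau> \<in> Z" "\<And>s. s \<in> Z \<Longrightarrow> \<tau> \<le> s"
      using compact_attains_inf[OF \<open>compact Z\<close>] by blast
    have "\<tau> \<noteq> T" using \<tau>(1) xT by (auto simp: Z_def)
    then have "T < \<tau>" "\<tau> \<le> T + 1" using \<tau>(1) by (auto simp: Z_def)
    have "norm (x' s) < R + 1" if "T \<le> s" "s < \<tau>" for s
      using \<tau>(2)[of s] that \<open>\<tau> \<le> T + 1\<close> by (force simp: Z_def)
    then have "norm (x' s) \<le> R" if "s \<in> {0..<\<tau>}" for s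
      using R0[OF _ \<open>\<tau> \<le> T + 1\<close> sol[OF \<open>\<tau> \<le> T + 1\<close>] x'0 that] \<open>T < \<tau>\<close> T by (force simp: R_def)
    moreover have "continuous_on (closure {0..<\<tau>}) (\<lambda>t. norm (x' t))"
      using \<open>T < \<tau>\<close> \<open>\<tau> \<le> T + 1\<close> T by (auto intro!: continuous_intros continuous_on_subset[OF cont])
    ultimately have "norm (x' \<tau>) \<le> R"
      using continuous_le_on_closure[of "{0..<\<tau>}" "\<lambda>t. norm (x' t)" \<tau> R] \<open>T < \<tau>\<close> T by simp
    then show False using \<tau>(1) by (simp add: Z_def)
  qed
  have "filippov_solution f {0..T + 1} x'"
  proof (rule filippov_solutionI)
    show "\<exists>M. M-lipschitz_on {a..b} x'" if "{a..b} \<subseteq> {0..T + 1}" for a b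
      using that lip lipschitz_on_subset by blast
    show "AE t in lebesgue. t \<in> {0..T + 1} \<longrightarrow>
        (\<exists>d. (x' has_vector_derivative d) (at t) \<and> d \<in> filippov_set (f t) (x' t))"
      using ae
    proof eventually_elim
      case (elim t)
      then show ?case using bound[of t] by (cases "t < T") auto
    qed
  qed
  then show ?thesis using that[of x'] by (simp add: x'_def)
qed

text \<open>Unit steps are iterated by dependent choice, because extensions are not unique and each
  must continue the one chosen before. The limit reads off the value at t from the member numbered
  by the ceiling of t.\<close>

lemma global_extension:
  assumes x: "filippov_solution f {0..T} x" "x 0 = X0" and T: "0 \<le> T"
  obtains x' where "filippov_solution f {0..} x'" "\<And>t. t \<in> {0..T} \<Longrightarrow> x' t = x t"
proof -
  have "\<exists>X. \<forall>n. (filippov_solution f {0..T + real n} (X n) \<and> (X n) 0 = X0 \<and> (n = 0 \<longrightarrow> X n = x)) \<and>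
      (\<forall>t\<in>{0..T + real n}. X (Suc n) t = X n t)"
  proof (rule dependent_nat_choice)
    show "\<exists>y. filippov_solution f {0..T + real 0} y \<and> y 0 = X0 \<and> (0 = (0::nat) \<longrightarrow> y = x)"
      using x by simp
    fix y n assume y: "filippov_solution f {0..T + real n} y \<and> y 0 = X0 \<and> (n = 0 \<longrightarrow> y = x)"
    obtain y' where y': "filippov_solution f {0..T + real n + 1} y'" "\<And>t. t \<in> {0..T + real n} \<Longrightarrow> y' t = y t"
      using step_extension[of "T + real n" y] y T by auto
    moreover have "y' 0 = X0" using y'(2)[of 0] y T by auto
    moreover have "T + real n + 1 = T + real (Suc n)" by simp
    ultimately show "\<exists>y'. (filippov_solution f {0..T + real (Suc n)} y' \<and> y' 0 = X0 \<and> (Suc n = 0 \<longrightarrow> y' = x)) \<and>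
        (\<forall>t\<in>{0..T + real n}. y' t = y t)"
      by (intro exI[of _ y']) (simp del: of_nat_Suc)
  qed
  then obtain X where X: "\<And>n. filippov_solution f {0..T + real n} (X n)" "X 0 = x"
    "\<And>n t. t \<in> {0..T + real n} \<Longrightarrow> X (Suc n) t = X n t" by metis
  have agree: "X (n + m) t = X n t" if "t \<in> {0..T + real n}" for n m t
    by (induction m) (use that X(3) in auto)
  define x' where "x' t = X (nat \<lceil>t\<rceil>) t" for t
  have x'X: "x' t = X n t" if t: "t \<in> {0..T + real n}" for n t
  proof (cases "nat \<lceil>t\<rceil> \<le> n")
    case True
    have "t \<in> {0..T + real (nat \<lceil>t\<rceil>)}" using t T by (auto intro: add_increasing real_nat_ceiling_ge)
    from agree[OF this, of "n - nat \<lceil>t\<rceil>"] True show ?thesis by (simp add: x'_def)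
  next
    case False
    then have "n + (nat \<lceil>t\<rceil> - n) = nat \<lceil>t\<rceil>" by linarith
    then show ?thesis using agree[OF t, of "nat \<lceil>t\<rceil> - n"] unfolding x'_def by metis
  qed
  have "filippov_solution f {0..} x'"
  proof (rule filippov_solutionI)
    fix a b :: real assume ab: "{a..b} \<subseteq> {0..}"
    define n where "n = nat \<lceil>b\<rceil>"
    have n: "{a..b} \<subseteq> {0..T + real n}"
    proof
      fix u assume u: "u \<in> {a..b}"
      then have "u \<in> {0..}" using ab by blast
      moreover have "b \<le> real n" using real_nat_ceiling_ge[of b] by (simp only: n_def)
      ultimately show "u \<in> {0..T + real n}" using u T by simp
    qed
    obtain M where "M-lipschitz_on {0..T + real n} (X n)" using closed_solution_lipschitz_on[OF X(1)] .
    then have "M-lipschitz_on {a..b} (X n)" using n by (rule lipschitz_on_subset)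
    then have "M-lipschitz_on {a..b} x'"
      by (rule lipschitz_on_transform) (use n x'X in auto)
    then show "\<exists>M. M-lipschitz_on {a..b} x'" ..
  next
    have "AE t in lebesgue. \<forall>n. t \<in> {0..T + real n} \<longrightarrow> t \<in> {0<..<T + real n} \<and>
      (\<exists>d. (X n has_vector_derivative d) (at t) \<and> d \<in> filippov_set (f t) (X n t))"
      using filippov_solution_AE_at[OF X(1)] by (subst AE_all_countable) auto
    then show "AE t in lebesgue. t \<in> {0..} \<longrightarrow>
        (\<exists>d. (x' has_vector_derivative d) (at t) \<and> d \<in> filippov_set (f t) (x' t))"
    proof eventually_elim
      case (elim t)
      show ?case
      proof
        assume t: "t \<in> {0..}"
        define n where "n = nat \<lceil>t\<rceil>"
        have tn: "t \<in> {0..T + real n}" using t T real_nat_ceiling_ge[of t] by (simp add: n_def add_increasing)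
        then obtain d where d: "t \<in> {0<..<T + real n}" "(X n has_vector_derivative d) (at t)" "d \<in> filippov_set (f t) (X n t)"
          using elim by blast
        have "(x' has_vector_derivative d) (at t)"
          by (rule has_vector_derivative_transform_within_open[OF d(2), of "{0<..<T + real n}"])
            (use d(1) in \<open>auto intro!: x'X[symmetric]\<close>)
        then show "\<exists>d. (x' has_vector_derivative d) (at t) \<and> d \<in> filippov_set (f t) (x' t)"
          using d(3) x'X[OF tn] by auto
      qed
    qed
  qed
  moreover have "x' t = x t" if "t \<in> {0..T}" for t using x'X[of t 0] that X(2) by simp
  ultimately show ?thesis using that by blast
qed

lemma well_defined: "well_defined_from f X0"
  unfolding well_defined_from_def
proof (intro conjI allI impI)
  \<comment> \<open>A single point is a null set, so the degenerate interval carries a solution for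
    free; it starts the prolongation.\<close>
  have "filippov_solution f {0..0} (\<lambda>_. X0)"
  proof (rule filippov_solutionI)
    show "AE t in lebesgue. t \<in> {0..0} \<longrightarrow> (\<exists>d. ((\<lambda>_. X0) has_vector_derivative d) (at t) \<and> d \<in> filippov_set (f t) X0)"
      using AE_neq[of 0] by eventually_elim auto
  qed (auto intro: lipschitz_on_constant)
  then show "\<exists>x. filippov_solution f {0..} x \<and> x 0 = X0"
    by (rule global_extension[of 0 "\<lambda>_. X0"]) auto
  fix T x assume x: "0 < T \<and> filippov_solution f {0..<T} x \<and> x 0 = X0"
  then obtain y where y: "filippov_solution f {0..T} y" "\<And>t. t \<in> {0..<T} \<Longrightarrow> y t = x t"
    using closed_extension[of T x] by blast
  then obtain x' where "filippov_solution f {0..} x'" "\<And>t. t \<in> {0..T} \<Longrightarrow> x' t = y t"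
    using global_extension[of T y] x by (metis atLeastLessThan_iff less_imp_le order_refl)
  then show "\<exists>x'. filippov_solution f {0..} x' \<and> (\<forall>t\<in>{0..<T}. x' t = x t)"
    using y(2) by (intro exI[of _ x']) auto
qed

end

subsection \<open>Fields with sign discontinuities\<close>

text \<open>The candidates \<open>F x s\<close> form a compact convex set, as F is affine in s. Near
  x the sign of a nonzero component of E is constant, while for a vanishing component any value in
  [-1, 1] is allowed, so nearby sign vectors are candidates at x itself. By uniform continuity no
  hyperplane can then separate d from the candidates.\<close>

lemma filippov_set_sgn:
  fixes F :: "'a::euclidean_space \<Rightarrow> real ^ 'n \<Rightarrow> 'a" and E :: "'a \<Rightarrow> real ^ 'n"
  assumes cont: "continuous_on UNIV (\<lambda>(x, s). F x s)"
    and affine: "\<And>x s s' u v. 0 \<le> u \<Longrightarrow> 0 \<le> v \<Longrightarrow> u + v = 1 \<Longrightarrow>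
      F x (u *\<^sub>R s + v *\<^sub>R s') = u *\<^sub>R F x s + v *\<^sub>R F x s'"
    and contE: "continuous_on UNIV E" and f: "\<And>x. f x = F x (\<chi> i. sgn (E x $ i))"
    and d: "d \<in> filippov_set f x"
  obtains s where "\<And>i. \<bar>s $ i\<bar> \<le> 1" "\<And>i. s $ i * E x $ i = \<bar>E x $ i\<bar>" "d = F x s"
proof -
  define K where "K = {s :: real ^ 'n. \<forall>i. \<bar>s $ i\<bar> \<le> 1 \<and> s $ i * E x $ i = \<bar>E x $ i\<bar>}"
  have contF: "continuous_on UNIV (F y)" for y
    using continuous_on_compose2[OF cont, of UNIV "\<lambda>s. (y, s)"] by (simp add: continuous_intros)
  have "closed K"
    unfolding K_def by (intro closed_Collect_all closed_Collect_conj closed_Collect_le closed_Collect_eq continuous_intros)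
  moreover have "K \<subseteq> cbox (\<chi> i. - 1) (\<chi> i. 1)"
    by (auto simp: K_def mem_box_cart abs_le_iff minus_le_iff)
  ultimately have K: "compact K"
    using bounded_subset[OF bounded_cbox] compact_eq_bounded_closed by blast
  have "convex K"
  proof (rule convexI)
    fix s s' :: "real ^ 'n" and u v :: real assume *: "s \<in> K" "s' \<in> K" "0 \<le> u" "0 \<le> v" "u + v = 1"
    have "\<bar>u * s $ i + v * s' $ i\<bar> \<le> u * 1 + v * 1" for i
      by (rule order_trans[OF abs_triangle_ineq], unfold abs_mult, intro add_mono mult_mono)
        (use * in \<open>auto simp: K_def\<close>)
    moreover have "(u * s $ i + v * s' $ i) * E x $ i = (u + v) * \<bar>E x $ i\<bar>" for i
    proof -
      have "(u * s $ i + v * s' $ i) * E x $ i = u * (s $ i * E x $ i) + v * (s' $ i * E x $ i)"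
        by (simp add: algebra_simps)
      then show ?thesis using * by (simp add: K_def distrib_right[symmetric])
    qed
    ultimately show "u *\<^sub>R s + v *\<^sub>R s' \<in> K" using * by (simp add: K_def)
  qed
  define C where "C = F x ` K"
  have "compact C" unfolding C_def using K contF continuous_on_subset
    by (blast intro: compact_continuous_image)
  have "convex C"
  proof (rule convexI)
    fix c c' and u v :: real assume *: "c \<in> C" "c' \<in> C" "0 \<le> u" "0 \<le> v" "u + v = 1"
    then obtain s s' where "s \<in> K" "s' \<in> K" "c = F x s" "c' = F x s'" by (auto simp: C_def)
    then show "u *\<^sub>R c + v *\<^sub>R c' \<in> C"
      unfolding C_def using affine[of u v x s s'] * convexD[OF \<open>convex K\<close>, of s s' u v]
      by (auto intro!: image_eqI[of _ _ "u *\<^sub>R s + v *\<^sub>R s'"])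
  qed
  have "d \<in> C"
  proof (rule ccontr)
    assume "d \<notin> C"
    then obtain w B where w: "w \<bullet> d < B" "\<And>c. c \<in> C \<Longrightarrow> B < w \<bullet> c"
      using separating_hyperplane_closed_point[of C d] \<open>convex C\<close> \<open>compact C\<close> compact_imp_closed by blast
    \<comment> \<open>Passing from \<open>F x s\<close> to \<open>F y s\<close> then costs at most
      half of the gap between d and the separating hyperplane; the other half yields the
      contradiction.\<close>
    define \<epsilon> where "\<epsilon> = (B - w \<bullet> d) / (2 * (norm w + 1))"
    have \<epsilon>: "\<epsilon> > 0" using w(1) by (simp add: \<epsilon>_def add_nonneg_pos)
    have w\<epsilon>: "norm w * \<epsilon> \<le> (B - w \<bullet> d) / 2"
    proof -
      have "norm w * \<epsilon> \<le> (norm w + 1) * \<epsilon>" using \<epsilon> by simp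
      also have "\<dots> = (B - w \<bullet> d) / 2" by (simp add: \<epsilon>_def field_simps add_nonneg_eq_0_iff)
      finally show ?thesis .
    qed
    have "uniformly_continuous_on (cball x 1 \<times> K) (\<lambda>(x, s). F x s)"
      by (rule compact_uniformly_continuous[OF continuous_on_subset[OF cont]])
        (auto intro: compact_Times K)
    then obtain \<delta>1 where \<delta>1: "\<delta>1 > 0" "\<And>p q. p \<in> cball x 1 \<times> K \<Longrightarrow> q \<in> cball x 1 \<times> K \<Longrightarrow> dist q p < \<delta>1 \<Longrightarrow>
        dist (case q of (x, s) \<Rightarrow> F x s) (case p of (x, s) \<Rightarrow> F x s) < \<epsilon>"
      unfolding uniformly_continuous_on_def using \<epsilon> by metis
    have "\<forall>\<^sub>F y in nhds x. \<forall>i. sgn (E y $ i) * E x $ i = \<bar>E x $ i\<bar>"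
    proof (rule eventually_all_finite)
      fix i
      have lim: "((\<lambda>y. E y $ i) \<longlongrightarrow> E x $ i) (nhds x)"
      proof -
        have "isCont E x" using contE by (simp add: continuous_on_eq_continuous_at)
        then show ?thesis by (intro tendsto_vec_nth) (simp add: continuous_at tendsto_at_iff_tendsto_nhds)
      qed
      show "\<forall>\<^sub>F y in nhds x. sgn (E y $ i) * E x $ i = \<bar>E x $ i\<bar>"
      proof (cases "E x $ i" "0 :: real" rule: linorder_cases)
        case less
        from order_tendstoD(2)[OF lim less] show ?thesis by eventually_elim (use less in auto)
      next
        case greater
        from order_tendstoD(1)[OF lim greater] show ?thesis by eventually_elim (use greater in auto)
      qed auto
    qed
    then obtain \<delta>2 where \<delta>2: "\<delta>2 > 0" "\<And>y i. dist y x < \<delta>2 \<Longrightarrow> sgn (E y $ i) * E x $ i = \<bar>E x $ i\<bar>"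
      unfolding eventually_nhds_metric by blast
    define \<delta> where "\<delta> = min (min \<delta>1 \<delta>2) 1"
    have "\<delta> > 0" using \<delta>1 \<delta>2 by (simp add: \<delta>_def)
    define b where "b = w \<bullet> d + (B - w \<bullet> d) / 2"
    have "f ` ball x \<delta> \<subseteq> {c. b \<le> w \<bullet> c}"
    proof clarify
      fix y assume y: "y \<in> ball x \<delta>"
      define s where "s = (\<chi> i. sgn (E y $ i))"
      have s: "s \<in> K" using \<delta>2(2)[of y] y by (auto simp: K_def s_def \<delta>_def dist_commute abs_sgn_eq)
      have "dist (F y s) (F x s) < \<epsilon>"
        using \<delta>1(2)[of "(x, s)" "(y, s)"] s y by (simp add: \<delta>_def dist_commute dist_Pair_Pair)
      then have "\<bar>w \<bullet> (F y s - F x s)\<bar> \<le> norm w * \<epsilon>"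
        by (intro order_trans[OF Cauchy_Schwarz_ineq2] mult_left_mono) (auto simp: dist_norm)
      moreover have "B < w \<bullet> F x s" using w(2) s by (auto simp: C_def)
      ultimately show "b \<le> w \<bullet> f y"
        using w\<epsilon> by (simp add: f s_def[symmetric] b_def inner_diff_right abs_le_iff field_simps)
    qed
    then have "closure (convex hull (f ` ball x \<delta>)) \<subseteq> {c. b \<le> w \<bullet> c}"
      using convex_halfspace_ge[of b w] by (intro closure_minimal hull_minimal closed_halfspace_ge) (auto simp: inner_commute)
    moreover have "d \<in> closure (convex hull (f ` (ball x \<delta> - {})))"
      using d \<open>\<delta> > 0\<close> negligible_empty unfolding filippov_set_def by blast
    ultimately have "b \<le> w \<bullet> d" by auto
    then show False using w(1) by (simp add: b_def)
  qed
  then show ?thesis using that by (auto simp: C_def K_def)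
qed

text \<open>A state on several switching surfaces is approached from the two opposite sides along \<open>c\<close>; the
  midpoint of the two limiting field values is the value of the field at that state, as \<open>sgn 0 = 0\<close>.\<close>

lemma sgn_field_selection:
  fixes F :: "'a::euclidean_space \<Rightarrow> real ^ 'n \<Rightarrow> 'a" and E :: "'a \<Rightarrow> real ^ 'n"
  assumes cont: "continuous_on UNIV (\<lambda>(x, s). F x s)"
    and affine: "\<And>x s s' u v. 0 \<le> u \<Longrightarrow> 0 \<le> v \<Longrightarrow> u + v = 1 \<Longrightarrow>
      F x (u *\<^sub>R s + v *\<^sub>R s') = u *\<^sub>R F x s + v *\<^sub>R F x s'"
    and contE: "continuous_on UNIV E" and f: "\<And>x. f x = F x (\<chi> i. sgn (E x $ i))"
    and c: "\<And>x h. E (x + h *\<^sub>R c) = E x + h *\<^sub>R b" and b: "\<And>i. 0 < b $ i"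
    and \<delta>: "0 < \<delta>" and N: "negligible N"
  shows "f x \<in> closure (convex hull (f ` (ball x \<delta> - N)))"
proof -
  define K where "K = closure (convex hull (f ` (ball x \<delta> - N)))"
  have K: "closed K" "convex K" by (auto simp: K_def convex_closure)
  have contF: "continuous_on UNIV (\<lambda>y. F y s)" for s
    using continuous_on_compose2[OF cont, of UNIV "\<lambda>y. (y, s)"] by (simp add: continuous_intros)
  \<comment> \<open>Off the switching surfaces all signs are locally constant, so f is continuous at
    p. A null set contains no ball, so points outside N approximate the value.\<close>
  have reg: "f p \<in> K" if p: "p \<in> ball x \<delta>" and nz: "\<And>i. E p $ i \<noteq> 0" for p
  proof -
    have "f p \<in> closure (f ` (ball x \<delta> - N))"
      unfolding closure_approachable
    proof (intro allI impI)
      fix e :: real assume "0 < e"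
      define s where "s = (\<chi> i. sgn (E p $ i))"
      have "\<forall>\<^sub>F y in nhds p. dist (F y s) (F p s) < e"
      proof (rule tendstoD[OF _ \<open>0 < e\<close>])
        have "isCont (\<lambda>y. F y s) p" using contF[of s] by (simp add: continuous_on_eq_continuous_at)
        then show "((\<lambda>y. F y s) \<longlongrightarrow> F p s) (nhds p)"
          using tendsto_at_iff_tendsto_nhds[of "\<lambda>y. F y s" p] by (simp add: continuous_at)
      qed
      moreover have "\<forall>\<^sub>F y in nhds p. \<forall>i. sgn (E y $ i) = sgn (E p $ i)"
      proof (rule eventually_all_finite)
        fix i
        have lim: "((\<lambda>y. E y $ i) \<longlongrightarrow> E p $ i) (nhds p)"
        proof -
          have "isCont E p" using contE by (simp add: continuous_on_eq_continuous_at)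
          then show ?thesis by (intro tendsto_vec_nth) (simp add: continuous_at tendsto_at_iff_tendsto_nhds)
        qed
        show "\<forall>\<^sub>F y in nhds p. sgn (E y $ i) = sgn (E p $ i)"
        proof (cases "E p $ i" "0 :: real" rule: linorder_cases)
          case less
          from order_tendstoD(2)[OF lim less] show ?thesis by eventually_elim (use less in auto)
        next
          case greater
          from order_tendstoD(1)[OF lim greater] show ?thesis by eventually_elim (use greater in auto)
        qed (use nz[of i] in auto)
      qed
      ultimately have "\<forall>\<^sub>F y in nhds p. dist (f y) (f p) < e"
        by eventually_elim (simp add: f s_def)
      then obtain r where r: "r > 0" "\<And>y. dist y p < r \<Longrightarrow> dist (f y) (f p) < e"
        unfolding eventually_nhds_metric by blast
      have "\<not> ball p r \<inter> ball x \<delta> \<subseteq> N"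
      proof
        assume "ball p r \<inter> ball x \<delta> \<subseteq> N"
        then have "negligible (ball p r \<inter> ball x \<delta>)" using N negligible_subset by blast
        then have "ball p r \<inter> ball x \<delta> = {}" using open_not_negligible[of "ball p r \<inter> ball x \<delta>"] by (auto simp: open_Int)
        moreover have "p \<in> ball p r \<inter> ball x \<delta>" using p r(1) by simp
        ultimately show False by blast
      qed
      then obtain q where "q \<in> ball p r" "q \<in> ball x \<delta> - N" by blast
      then show "\<exists>y\<in>f ` (ball x \<delta> - N). dist y (f p) < e"
        using r(2)[of q] by (auto simp: dist_commute)
    qed
    then show ?thesis unfolding K_def by (rule subsetD[OF closure_mono[OF hull_subset]])
  qed
  define sp where "sp = (\<chi> i. if E x $ i = 0 then 1 else sgn (E x $ i))"
  define sm where "sm = (\<chi> i. if E x $ i = 0 then - 1 else sgn (E x $ i))"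
  have small: "\<forall>\<^sub>F h in at_right 0. \<forall>i. E x $ i \<noteq> 0 \<longrightarrow> h * b $ i < \<bar>E x $ i\<bar>"
  proof (rule eventually_all_finite)
    fix i
    have "((\<lambda>h. h * b $ i) \<longlongrightarrow> 0 * b $ i) (at_right 0)" by (intro tendsto_intros)
    from order_tendstoD(2)[OF this, of "\<bar>E x $ i\<bar>"]
    show "\<forall>\<^sub>F h in at_right 0. E x $ i \<noteq> 0 \<longrightarrow> h * b $ i < \<bar>E x $ i\<bar>"
      by (cases "E x $ i = 0") (auto elim: eventually_mono)
  qed
  have "((\<lambda>h. dist x (x + h *\<^sub>R c)) \<longlongrightarrow> dist x (x + 0 *\<^sub>R c)) (at_right 0)" by (intro tendsto_intros)
  from order_tendstoD(2)[OF this, of \<delta>] \<delta>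
  have near: "\<forall>\<^sub>F h in at_right 0. dist x (x + h *\<^sub>R c) < \<delta>" by simp
  have ev: "\<forall>\<^sub>F h in at_right 0. (1/2) *\<^sub>R F (x + h *\<^sub>R c) sp + (1/2) *\<^sub>R F (x + (- h) *\<^sub>R c) sm \<in> K"
    using small near eventually_at_right_less[of 0]
  proof eventually_elim
    case (elim h)
    have hb: "0 < h * b $ i" for i using elim b by simp
    have s: "sgn (E (x + h *\<^sub>R c) $ i) = sp $ i" "sgn (E (x + (- h) *\<^sub>R c) $ i) = sm $ i"
      "E (x + h *\<^sub>R c) $ i \<noteq> 0" "E (x + (- h) *\<^sub>R c) $ i \<noteq> 0" for i
    proof -
      have e: "E (x + h *\<^sub>R c) $ i = E x $ i + h * b $ i" "E (x + (- h) *\<^sub>R c) $ i = E x $ i - h * b $ i"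
        by (simp_all only: c) simp_all
      have "E x $ i = 0 \<or> h * b $ i < \<bar>E x $ i\<bar>" using elim(1) by blast
      then show "sgn (E (x + h *\<^sub>R c) $ i) = sp $ i" "sgn (E (x + (- h) *\<^sub>R c) $ i) = sm $ i"
        "E (x + h *\<^sub>R c) $ i \<noteq> 0" "E (x + (- h) *\<^sub>R c) $ i \<noteq> 0"
        unfolding e using hb[of i] by (auto simp: sp_def sm_def sgn_if)
    qed
    have "f (x + h *\<^sub>R c) \<in> K" "f (x + (- h) *\<^sub>R c) \<in> K"
      using elim(2) by (intro reg s; simp add: dist_norm)+
    moreover have "f (x + h *\<^sub>R c) = F (x + h *\<^sub>R c) sp" "f (x + (- h) *\<^sub>R c) = F (x + (- h) *\<^sub>R c) sm"
      unfolding f s(1,2) by (simp_all only: vec_lambda_eta)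
    ultimately show ?case using convexD[OF K(2), of _ _ "1/2" "1/2"] by simp
  qed
  have "((\<lambda>h. (1/2) *\<^sub>R F (x + h *\<^sub>R c) sp + (1/2) *\<^sub>R F (x + (- h) *\<^sub>R c) sm) \<longlongrightarrow>
      (1/2) *\<^sub>R F (x + 0 *\<^sub>R c) sp + (1/2) *\<^sub>R F (x + (- 0) *\<^sub>R c) sm) (at_right 0)"
    by (intro tendsto_intros isCont_tendsto_compose[where g = "\<lambda>y. F y s" for s])
      (use contF in \<open>auto simp: continuous_on_eq_continuous_at\<close>)
  then have "(1/2) *\<^sub>R F (x + 0 *\<^sub>R c) sp + (1/2) *\<^sub>R F (x + (- 0) *\<^sub>R c) sm \<in> K"
    using Lim_in_closed_set[OF K(1) ev] by simp
  moreover have "(1/2) *\<^sub>R F x sp + (1/2) *\<^sub>R F x sm = F x ((1/2) *\<^sub>R sp + (1/2) *\<^sub>R sm)"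
    by (rule affine[symmetric]) auto
  moreover have "(1/2) *\<^sub>R sp + (1/2) *\<^sub>R sm = (\<chi> i. sgn (E x $ i))"
    by (auto simp: Finite_Cartesian_Product.vec_eq_iff sp_def sm_def)
  ultimately show ?thesis by (simp add: f K_def)
qed

subsection \<open>Smooth functions of arbitrarily fast growth\<close>

text \<open>The derivative in a fixed direction h is again an everywhere convergent power series,
  with coefficients \<open>h * diffs a n\<close>. The induction therefore runs over all coefficient
  sequences at once.\<close>

lemma Ck_on_power_series:
  fixes a :: "nat \<Rightarrow> real"
  assumes "\<And>x. summable (\<lambda>n. a n * x ^ n)"
  shows "Ck_on k UNIV (\<lambda>x. \<Sum>n. a n * x ^ n)"
  using assms
proof (induction k arbitrary: a)
  case 0
  have "isCont (\<lambda>x. \<Sum>n. a n * x ^ n) x" for x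
    using termdiffs_strong_converges_everywhere[OF 0] DERIV_isCont by blast
  then show ?case by (simp add: continuous_on_eq_continuous_at)
next
  case (Suc k)
  have D: "((\<lambda>x. \<Sum>n. a n * x ^ n) has_real_derivative (\<Sum>n. diffs a n * x ^ n)) (at x)" for x
    by (rule termdiffs_strong_converges_everywhere[OF Suc.prems])
  have S: "summable (\<lambda>n. diffs a n * x ^ n)" for x
    by (rule termdiff_converges_all[OF Suc.prems])
  have "frechet_derivative (\<lambda>x. \<Sum>n. a n * x ^ n) (at x) h = (\<Sum>n. (h * diffs a n) * x ^ n)" for x h
  proof -
    have "((\<lambda>x. \<Sum>n. a n * x ^ n) has_derivative (\<lambda>h. (\<Sum>n. diffs a n * x ^ n) * h)) (at x)"
      using D by (simp add: has_field_derivative_def)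
    then have "frechet_derivative (\<lambda>x. \<Sum>n. a n * x ^ n) (at x) h = (\<Sum>n. diffs a n * x ^ n) * h"
      using frechet_derivative_at by metis
    also have "\<dots> = (\<Sum>n. (h * diffs a n) * x ^ n)"
      using suminf_mult[OF S, of h x] by (simp add: mult_ac)
    finally show ?thesis .
  qed
  moreover have "summable (\<lambda>n. (h * diffs a n) * x ^ n)" for h x
    using summable_mult[OF S, of h x] by (simp add: mult_ac)
  ultimately have "Ck_on k UNIV (\<lambda>x. frechet_derivative (\<lambda>x. \<Sum>n. a n * x ^ n) (at x) h)" for h
    using Suc.IH[of "\<lambda>n. h * diffs a n"] by simp
  moreover have "(\<lambda>x. \<Sum>n. a n * x ^ n) differentiable_on UNIV"
    using D by (auto simp: differentiable_on_def has_field_derivative_def intro: differentiableI)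
  ultimately show ?case by simp
qed

text \<open>An even entire power series \<open>\<Sum> (s / \<kappa> n)\<^sup>n\<close>, where \<open>\<kappa> n\<close> tends to infinity so slowly that for each
  \<open>k\<close> the value \<open>k\<close> is still taken at an exponent \<open>n\<close> with \<open>B (k + 1) \<le> ((k + 1) / k)\<^sup>n\<close>.\<close>

lemma smooth_dominating:
  fixes B :: "nat \<Rightarrow> real"
  obtains \<rho> :: "real \<Rightarrow> real" where "smooth \<rho>" "\<And>s. 1 \<le> \<rho> s" "\<And>s. B (nat \<lfloor>\<bar>s\<bar>\<rfloor>) \<le> \<rho> s"
proof -
  have "\<exists>M. \<forall>n\<ge>M. B (k + 1) \<le> ((real k + 1) / real k) ^ n" if "1 \<le> k" for k
  proof -
    have "1 < (real k + 1) / real k" using that by (simp add: field_simps)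
    then obtain M where "B (k + 1) < ((real k + 1) / real k) ^ M" using real_arch_pow by blast
    then show ?thesis
      using \<open>1 < (real k + 1) / real k\<close> by (meson less_imp_le order_trans power_increasing)
  qed
  then obtain M where M: "\<And>k n. 1 \<le> k \<Longrightarrow> M k \<le> n \<Longrightarrow> B (k + 1) \<le> ((real k + 1) / real k) ^ n"
    by metis
  \<comment> \<open>The exponents are even, so that negative arguments do no harm, and strictly
    increasing, so that each k gets its own; they exceed \<open>M k\<close>, where domination at
    level k begins.\<close>
  define m where "m k = 2 * (\<Sum>j\<le>k. M j + 1)" for k
  have m_even: "even (m k)" and m_ge: "M k \<le> m k" "k \<le> m k" for k
  proof -
    show "even (m k)" by (simp add: m_def)
    have "M k + 1 \<le> (\<Sum>j\<le>k. M j + 1)" by (rule member_le_sum) auto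
    then show "M k \<le> m k" by (simp add: m_def)
    have "(\<Sum>j\<le>k. 1) \<le> (\<Sum>j\<le>k. M j + 1)" by (rule sum_mono) simp
    then show "k \<le> m k" by (simp add: m_def)
  qed
  have "strict_mono m" by (rule strict_monoI_Suc) (simp add: m_def)
  \<comment> \<open>This counts the exponents m 1, m 2, ... up to n. The restriction to {1..n} loses
    nothing, since k \<le> m k; it only keeps the set visibly finite.\<close>
  define \<kappa> where "\<kappa> n = card {k\<in>{1..n}. m k \<le> n}" for n
  have \<kappa>_ge: "K \<le> \<kappa> n" if "m K \<le> n" for K n
  proof -
    have "{1..K} \<subseteq> {k\<in>{1..n}. m k \<le> n}"
    proof
      fix k assume k: "k \<in> {1..K}"
      then have "m k \<le> m K" using strict_mono_less_eq[OF \<open>strict_mono m\<close>] by simp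
      then show "k \<in> {k\<in>{1..n}. m k \<le> n}" using k m_ge(2)[of k] that by simp
    qed
    then have "card {1..K} \<le> \<kappa> n" unfolding \<kappa>_def by (intro card_mono) auto
    then show ?thesis by simp
  qed
  have \<kappa>_m: "\<kappa> (m K) = K" for K
  proof (rule antisym)
    have "{k\<in>{1..m K}. m k \<le> m K} \<subseteq> {1..K}" using strict_mono_less_eq[OF \<open>strict_mono m\<close>] by auto
    then have "\<kappa> (m K) \<le> card {1..K}" unfolding \<kappa>_def by (intro card_mono) auto
    then show "\<kappa> (m K) \<le> K" by simp
  qed (rule \<kappa>_ge, simp)
  \<comment> \<open>The exponential comparison works with (k + 1) / k for k \<ge> 1 and so reaches
    \<open>B 2\<close>, \<open>B 3\<close>, ...; the constant term takes care of the first two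
    values and of the lower bound 1.\<close>
  define c0 where "c0 = 1 + \<bar>B 0\<bar> + \<bar>B 1\<bar>"
  define c where "c n = (if n = 0 then c0 else if even n then (1 / real (\<kappa> n)) ^ n else 0)" for n
  have c_nonneg: "0 \<le> c n * x ^ n" for n x
    by (cases "even n") (auto simp: c_def c0_def zero_le_even_power)
  have summ: "summable (\<lambda>n. c n * x ^ n)" for x :: real
  proof (rule summable_comparison_test_ev)
    define K where "K = nat \<lceil>2 * \<bar>x\<bar>\<rceil> + 1"
    show "\<forall>\<^sub>F n in sequentially. norm (c n * x ^ n) \<le> (1 / 2) ^ n"
      using eventually_ge_at_top[of "m K"] eventually_gt_at_top[of 0]
    proof eventually_elim
      case (elim n)
      have \<kappa>: "2 * \<bar>x\<bar> \<le> real (\<kappa> n)" "0 < real (\<kappa> n)"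
        using \<kappa>_ge[OF elim(1)] real_nat_ceiling_ge[of "2 * \<bar>x\<bar>"] unfolding K_def by linarith+
      have "norm (c n * x ^ n) \<le> (1 / real (\<kappa> n) * \<bar>x\<bar>) ^ n"
        using elim(2) by (auto simp: c_def abs_mult power_abs power_mult_distrib power_divide)
      also have "\<dots> \<le> (1 / 2) ^ n" using \<kappa> by (intro power_mono) (auto simp: field_simps)
      finally show ?case .
    qed
  qed (simp add: summable_geometric)
  define \<rho> where "\<rho> s = (\<Sum>n. c n * s ^ n)" for s :: real
  have term_le: "c n * s ^ n \<le> \<rho> s" for n s
    using sum_le_suminf[OF summ[of s], of "{n}"] c_nonneg by (simp add: \<rho>_def)
  show ?thesis
  proof
    show "smooth \<rho>"
      unfolding smooth_on_def \<rho>_def using Ck_on_power_series[OF summ] by blast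
    have c0: "c0 \<le> \<rho> s" for s using term_le[of 0 s] by (simp add: c_def)
    then show "1 \<le> \<rho> s" for s using order_trans[OF _ c0, of 1] by (simp add: c0_def)
    show "B (nat \<lfloor>\<bar>s\<bar>\<rfloor>) \<le> \<rho> s" for s
    proof (cases "nat \<lfloor>\<bar>s\<bar>\<rfloor> \<le> 1")
      case True
      then have "nat \<lfloor>\<bar>s\<bar>\<rfloor> = 0 \<or> nat \<lfloor>\<bar>s\<bar>\<rfloor> = 1" by linarith
      then have "B (nat \<lfloor>\<bar>s\<bar>\<rfloor>) \<le> c0" by (auto simp: c0_def)
      then show ?thesis using c0 order_trans by blast
    next
      case False
      define k where "k = nat \<lfloor>\<bar>s\<bar>\<rfloor> - 1"
      have k: "1 \<le> k" "nat \<lfloor>\<bar>s\<bar>\<rfloor> = k + 1" "real k + 1 \<le> \<bar>s\<bar>"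
        using False unfolding k_def by linarith+
      have "m k \<noteq> 0" using m_ge(2)[of k] k by simp
      have "B (k + 1) \<le> ((real k + 1) / real k) ^ m k" using M[OF k(1) m_ge(1)] .
      also have "\<dots> \<le> (\<bar>s\<bar> / real k) ^ m k" using k by (intro power_mono divide_right_mono) auto
      also have "\<dots> = c (m k) * s ^ m k"
        using \<open>m k \<noteq> 0\<close> m_even[of k] by (simp add: c_def \<kappa>_m power_divide power_even_abs)
      also have "\<dots> \<le> \<rho> s" by (rule term_le)
      finally show ?thesis by (simp add: k(2))
    qed
  qed
qed

subsection \<open>Locally Lipschitz functions\<close>

text \<open>One constant for each centred ball, rather than one for each small neighbourhood: the
  composition with a bounded Lipschitz curve is then Lipschitz on its whole interval, hence
  absolutely continuous.\<close>

definition locally_lipschitz :: "('a::real_normed_vector \<Rightarrow> 'b::real_normed_vector) \<Rightarrow> bool" where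
  "locally_lipschitz f \<longleftrightarrow> (\<forall>R. \<exists>L. L-lipschitz_on (cball 0 R) f)"

lemma locally_lipschitz_bounded:
  assumes "locally_lipschitz f"
  obtains M where "\<And>x. norm x \<le> R \<Longrightarrow> norm (f x) \<le> M"
proof -
  obtain L where L: "L-lipschitz_on (cball 0 R) f" using assms by (auto simp: locally_lipschitz_def)
  have "norm (f x) \<le> norm (f 0) + L * R" if "norm x \<le> R" for x
  proof -
    have "0 \<le> R" using that norm_ge_zero order_trans by blast
    then have "norm (f x - f 0) \<le> L * norm (x - 0)" using that by (intro lipschitz_on_normD[OF L]) auto
    also have "\<dots> \<le> L * R" using that lipschitz_on_nonneg[OF L] by (simp add: mult_left_mono)
    finally show ?thesis using norm_triangle_sub[of "f x" "f 0"] by simp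
  qed
  then show ?thesis using that by blast
qed

lemma locally_lipschitz_const: "locally_lipschitz (\<lambda>x. c)"
  unfolding locally_lipschitz_def using lipschitz_on_constant by blast

lemma locally_lipschitz_add:
  assumes "locally_lipschitz f" "locally_lipschitz g"
  shows "locally_lipschitz (\<lambda>x. f x + g x)"
  unfolding locally_lipschitz_def
proof
  fix R
  obtain L M where "L-lipschitz_on (cball 0 R) f" "M-lipschitz_on (cball 0 R) g"
    using assms unfolding locally_lipschitz_def by blast
  from lipschitz_on_add[OF this] show "\<exists>L. L-lipschitz_on (cball 0 R) (\<lambda>x. f x + g x)" ..
qed

lemma locally_lipschitz_diff:
  assumes "locally_lipschitz f" "locally_lipschitz g"
  shows "locally_lipschitz (\<lambda>x. f x - g x)"
  unfolding locally_lipschitz_def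
proof
  fix R
  obtain L M where "L-lipschitz_on (cball 0 R) f" "M-lipschitz_on (cball 0 R) g"
    using assms unfolding locally_lipschitz_def by blast
  from lipschitz_on_diff[OF this] show "\<exists>L. L-lipschitz_on (cball 0 R) (\<lambda>x. f x - g x)" ..
qed

lemma locally_lipschitz_sum:
  assumes "\<And>i. i \<in> I \<Longrightarrow> locally_lipschitz (f i)"
  shows "locally_lipschitz (\<lambda>x. \<Sum>i\<in>I. f i x)"
  using assms
  by (induction I rule: infinite_finite_induct) (auto intro: locally_lipschitz_const locally_lipschitz_add)

lemma locally_lipschitz_bounded_linear:
  assumes "bounded_linear f"
  shows "locally_lipschitz f"
proof -
  obtain K where K: "\<And>x. norm (f x) \<le> norm x * K" "0 \<le> K"
    using bounded_linear.nonneg_bounded[OF assms] by auto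
  have "K-lipschitz_on (cball 0 R) f" for R
    by (rule lipschitz_onI)
      (use K in \<open>auto simp: dist_norm linear_diff[OF bounded_linear.linear[OF assms], symmetric] mult.commute\<close>)
  then show ?thesis unfolding locally_lipschitz_def by blast
qed

lemma locally_lipschitz_compose:
  assumes f: "locally_lipschitz f" and g: "locally_lipschitz g"
  shows "locally_lipschitz (\<lambda>x. f (g x))"
  unfolding locally_lipschitz_def
proof
  fix R
  obtain M where M: "\<And>x. norm x \<le> R \<Longrightarrow> norm (g x) \<le> M"
    by (rule locally_lipschitz_bounded[OF g, where R = R]) blast
  obtain L where L: "L-lipschitz_on (cball 0 R) g" using g by (auto simp: locally_lipschitz_def)
  obtain K where K: "K-lipschitz_on (cball 0 M) f" using f by (auto simp: locally_lipschitz_def)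
  have "(K * L)-lipschitz_on (cball 0 R) (\<lambda>x. f (g x))"
    by (rule lipschitz_on_compose2[OF L lipschitz_on_subset[OF K]]) (use M in auto)
  then show "\<exists>L. L-lipschitz_on (cball 0 R) (\<lambda>x. f (g x))" ..
qed

lemma locally_lipschitz_bilinear:
  fixes f :: "'d::real_normed_vector \<Rightarrow> 'a::real_normed_vector" and g :: "'d \<Rightarrow> 'b::real_normed_vector"
    and B :: "'a \<Rightarrow> 'b \<Rightarrow> 'c::real_normed_vector"
  assumes B: "bounded_bilinear B" and f: "locally_lipschitz f" and g: "locally_lipschitz g"
  shows "locally_lipschitz (\<lambda>x. B (f x) (g x))"
  unfolding locally_lipschitz_def
proof
  fix R
  obtain Mf where Mf: "\<And>x. norm x \<le> R \<Longrightarrow> norm (f x) \<le> Mf"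
    by (rule locally_lipschitz_bounded[OF f, where R = R]) blast
  obtain Mg where Mg: "\<And>x. norm x \<le> R \<Longrightarrow> norm (g x) \<le> Mg"
    by (rule locally_lipschitz_bounded[OF g, where R = R]) blast
  obtain Lf where Lf: "Lf-lipschitz_on (cball 0 R) f" using f by (auto simp: locally_lipschitz_def)
  obtain Lg where Lg: "Lg-lipschitz_on (cball 0 R) g" using g by (auto simp: locally_lipschitz_def)
  obtain K where K: "\<And>a b. norm (B a b) \<le> norm a * norm b * K" "0 \<le> K"
    using bounded_bilinear.nonneg_bounded[OF B] by auto
  define L where "L = (Lf * \<bar>Mg\<bar> + \<bar>Mf\<bar> * Lg) * K"
  have Lnn: "0 \<le> Lf" "0 \<le> Lg" using Lf Lg lipschitz_on_nonneg by blast+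
  have "L-lipschitz_on (cball 0 R) (\<lambda>x. B (f x) (g x))"
  proof (rule lipschitz_onI)
    fix x y :: 'd assume xy: "x \<in> cball 0 R" "y \<in> cball 0 R"
    have "B (f x) (g x) - B (f y) (g y) = B (f x - f y) (g x) + B (f y) (g x - g y)"
      by (simp add: bounded_bilinear.diff_left[OF B] bounded_bilinear.diff_right[OF B])
    then have "norm (B (f x) (g x) - B (f y) (g y)) \<le> norm (B (f x - f y) (g x)) + norm (B (f y) (g x - g y))"
      using norm_triangle_ineq by simp
    also have "\<dots> \<le> norm (f x - f y) * norm (g x) * K + norm (f y) * norm (g x - g y) * K"
      by (intro add_mono K)
    also have "\<dots> \<le> (Lf * norm (x - y)) * \<bar>Mg\<bar> * K + \<bar>Mf\<bar> * (Lg * norm (x - y)) * K"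
      using xy Mf[of y] Mg[of x] K(2) Lnn lipschitz_on_normD[OF Lf xy] lipschitz_on_normD[OF Lg xy]
      by (intro add_mono mult_mono mult_nonneg_nonneg) auto
    finally show "dist (B (f x) (g x)) (B (f y) (g y)) \<le> L * dist x y"
      by (simp add: dist_norm L_def algebra_simps)
  qed (use Lnn K in \<open>simp add: L_def\<close>)
  then show "\<exists>L. L-lipschitz_on (cball 0 R) (\<lambda>x. B (f x) (g x))" ..
qed

lemma smooth_has_derivative:
  "smooth f \<Longrightarrow> (f has_derivative frechet_derivative f (at x)) (at x)"
proof -
  assume "smooth f"
  then have "Ck_on (Suc 0) UNIV f" unfolding smooth_on_def by blast
  then have "f differentiable at x" by (simp add: differentiable_on_def)
  then show ?thesis using frechet_derivative_works by blast
qed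

lemma smooth_continuous_on: "smooth f \<Longrightarrow> continuous_on UNIV f"
  unfolding smooth_on_def using Ck_on.simps(1) by blast

text \<open>\<open>Ck_on\<close> provides continuity in x for each fixed direction only. Expanding h
  in the basis turns this into joint continuity.\<close>

lemma smooth_derivative_continuous:
  fixes f :: "'a::euclidean_space \<Rightarrow> 'b::real_normed_vector"
  assumes f: "smooth f"
  shows "continuous_on UNIV (\<lambda>(x, h). frechet_derivative f (at x) h)"
proof -
  have c: "continuous_on UNIV (\<lambda>x. frechet_derivative f (at x) h)" for h
  proof -
    have "Ck_on (Suc 0) UNIV f" using f unfolding smooth_on_def by blast
    then show ?thesis by simp
  qed
  have *: "frechet_derivative f (at x) h = (\<Sum>b\<in>Basis. (h \<bullet> b) *\<^sub>R frechet_derivative f (at x) b)" for x h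
  proof -
    have l: "linear (frechet_derivative f (at x))"
      using smooth_has_derivative[OF f] has_derivative_linear by blast
    have "frechet_derivative f (at x) h = frechet_derivative f (at x) (\<Sum>b\<in>Basis. (h \<bullet> b) *\<^sub>R b)"
      by (simp only: euclidean_representation)
    also have "\<dots> = (\<Sum>b\<in>Basis. (h \<bullet> b) *\<^sub>R frechet_derivative f (at x) b)"
      by (simp only: linear_sum[OF l] linear_cmul[OF l])
    finally show ?thesis .
  qed
  have "(\<lambda>(x, h). frechet_derivative f (at x) h) =
      (\<lambda>p. \<Sum>b\<in>Basis. (snd p \<bullet> b) *\<^sub>R frechet_derivative f (at (fst p)) b)"
    unfolding split_beta by (intro ext *)
  moreover have "continuous_on UNIV (\<lambda>p. \<Sum>b\<in>Basis. (snd p \<bullet> b) *\<^sub>R frechet_derivative f (at (fst p)) b)"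
    by (intro continuous_on_sum continuous_on_scaleR continuous_on_inner continuous_on_snd continuous_on_id
        continuous_on_const continuous_on_compose2[OF c continuous_on_fst[OF continuous_on_id]]) auto
  ultimately show ?thesis by simp
qed

text \<open>By compactness the derivative is bounded on a ball times the unit ball of directions,
  and balls are convex, so the mean value inequality applies.\<close>

lemma locally_lipschitz_C1:
  fixes f :: "'a::euclidean_space \<Rightarrow> 'b::real_normed_vector"
  assumes d: "\<And>x. (f has_derivative f' x) (at x)" and c: "continuous_on UNIV (\<lambda>(x, h). f' x h)"
  shows "locally_lipschitz f"
  unfolding locally_lipschitz_def
proof
  fix R :: real
  have "compact ((\<lambda>(x, h). f' x h) ` (cball 0 R \<times> cball 0 1))"
    by (intro compact_continuous_image continuous_on_subset[OF c] compact_Times) auto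
  then have "bounded ((\<lambda>(x, h). f' x h) ` (cball 0 R \<times> cball 0 1))" by (rule compact_imp_bounded)
  then obtain M where M: "\<And>y. y \<in> (\<lambda>(x, h). f' x h) ` (cball 0 R \<times> cball 0 1) \<Longrightarrow> norm y \<le> M"
    unfolding bounded_iff by blast
  have "\<bar>M\<bar>-lipschitz_on (cball 0 R) f"
  proof (rule bounded_derivative_imp_lipschitz)
    fix x :: 'a assume x: "x \<in> cball 0 R"
    show "(f has_derivative f' x) (at x within cball 0 R)" using d has_derivative_at_withinI by blast
    have l: "linear (f' x)" using d has_derivative_linear by blast
    show "onorm (f' x) \<le> \<bar>M\<bar>"
    proof (rule onorm_bound)
      fix h :: 'a
      have "norm (f' x (sgn h)) \<le> M" using x by (intro M) (auto simp: norm_sgn)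
      then have "norm h * norm (f' x (sgn h)) \<le> norm h * \<bar>M\<bar>" by (intro mult_left_mono) auto
      then show "norm (f' x h) \<le> \<bar>M\<bar> * norm h"
        by (cases "h = 0") (auto simp: sgn_div_norm linear_cmul[OF l] linear_0[OF l] field_simps)
    qed simp
  qed auto
  then show "\<exists>L. L-lipschitz_on (cball 0 R) f" ..
qed

lemma locally_lipschitz_smooth:
  fixes f :: "'a::euclidean_space \<Rightarrow> 'b::real_normed_vector"
  shows "smooth f \<Longrightarrow> locally_lipschitz f"
  by (rule locally_lipschitz_C1[OF smooth_has_derivative smooth_derivative_continuous])

lemma lipschitz_on_interval_compose:
  fixes X :: "real \<Rightarrow> 'a::real_normed_vector"
  assumes X: "L-lipschitz_on {a..b} X" and f: "locally_lipschitz f"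
  obtains M where "M-lipschitz_on {a..b} (\<lambda>t. f (X t))"
proof -
  have "bounded (X ` {a..b})"
    using lipschitz_on_continuous_on[OF X] by (intro compact_imp_bounded compact_continuous_image) auto
  then obtain R where R: "\<And>y. y \<in> X ` {a..b} \<Longrightarrow> norm y \<le> R" unfolding bounded_iff by blast
  obtain K where K: "K-lipschitz_on (cball 0 R) f" using f by (auto simp: locally_lipschitz_def)
  have "(K * L)-lipschitz_on {a..b} (\<lambda>t. f (X t))"
    by (rule lipschitz_on_compose2[OF X lipschitz_on_subset[OF K]]) (use R in auto)
  then show ?thesis using that by blast
qed

subsection \<open>Differential inequalities\<close>

lemma lipschitz_increment_le:
  fixes \<phi> :: "real \<Rightarrow> real"
  assumes "L-lipschitz_on {a..b} \<phi>" "a \<le> b"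
    and "AE t in lebesgue. t \<in> {a<..<b} \<longrightarrow> (\<exists>d. (\<phi> has_real_derivative d) (at t) \<and> d \<le> M)"
  shows "\<phi> b - \<phi> a \<le> M * (b - a)"
proof (rule abs_continuous_increment_le[OF lipschitz_on_imp_abs_continuous[OF assms(1)] assms(2)])
  have "AE t in lebesgue. t \<noteq> c" for c :: real
    by (rule AE_I'[of "{c}"]) (auto simp: negligible_iff_null_sets[symmetric])
  from this[of a] this[of b] assms(3)
  show "AE t in lebesgue. t \<in> {a..b} \<longrightarrow> (\<exists>x'. (\<phi> has_real_derivative x') (at t within {a..b}) \<and> x' \<le> M)"
    by eventually_elim (auto intro: has_field_derivative_at_within simp: less_le)
qed

text \<open>After the last time at which \<phi> is at most max (\<phi> 0) W, the function stays
  above W and therefore cannot increase.\<close>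

lemma lipschitz_sublevel_invariant:
  fixes \<phi> :: "real \<Rightarrow> real"
  assumes lip: "L-lipschitz_on {0..T} \<phi>" and T: "0 \<le> T"
    and deriv: "AE t in lebesgue. t \<in> {0<..<T} \<longrightarrow> (\<exists>d. (\<phi> has_real_derivative d) (at t) \<and> (W < \<phi> t \<longrightarrow> d \<le> 0))"
  shows "\<phi> T \<le> max (\<phi> 0) W"
proof (rule ccontr)
  assume *: "\<not> \<phi> T \<le> max (\<phi> 0) W"
  define Z where "Z = {0..T} \<inter> \<phi> -` {..max (\<phi> 0) W}"
  have "closed Z" unfolding Z_def
    by (intro continuous_closed_preimage lipschitz_on_continuous_on[OF lip]) auto
  then have "compact Z" using bounded_subset[of "{0..T}" Z] by (auto simp: Z_def compact_eq_bounded_closed)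
  moreover have "0 \<in> Z" using T by (simp add: Z_def)
  ultimately obtain s where s: "s \<in> Z" "\<And>u. u \<in> Z \<Longrightarrow> u \<le> s" using compact_attains_sup[of Z] by blast
  have sT: "0 \<le> s" "s \<le> T" "\<phi> s \<le> max (\<phi> 0) W" using s(1) by (auto simp: Z_def)
  have "\<phi> T - \<phi> s \<le> 0 * (T - s)"
  proof (rule lipschitz_increment_le[OF lipschitz_on_subset[OF lip] sT(2)])
    show "AE t in lebesgue. t \<in> {s<..<T} \<longrightarrow> (\<exists>d. (\<phi> has_real_derivative d) (at t) \<and> d \<le> 0)"
      using deriv
    proof eventually_elim
      case (elim t)
      show ?case
      proof
        assume t: "t \<in> {s<..<T}"
        then have "t \<notin> Z" using s(2)[of t] by auto
        then have "W < \<phi> t" using t sT by (auto simp: Z_def)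
        then show "\<exists>d. (\<phi> has_real_derivative d) (at t) \<and> d \<le> 0" using elim t sT by auto
      qed
    qed
  qed (use sT in auto)
  then show False using * sT by auto
qed

lemma lipschitz_norm_increment_le:
  fixes x :: "real \<Rightarrow> 'a::real_inner"
  assumes "L-lipschitz_on {a..b} x" "a \<le> b"
    and "AE t in lebesgue. t \<in> {a<..<b} \<longrightarrow> (\<exists>d. (x has_vector_derivative d) (at t) \<and> norm d \<le> M)"
  shows "norm (x b - x a) \<le> M * (b - a)"
proof (rule abs_continuous_norm_increment_le[OF lipschitz_on_imp_abs_continuous[OF assms(1)] assms(2)])
  have "AE t in lebesgue. t \<noteq> c" for c :: real
    by (rule AE_I'[of "{c}"]) (auto simp: negligible_iff_null_sets[symmetric])
  from this[of a] this[of b] assms(3)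
  show "AE t in lebesgue. t \<in> {a..b} \<longrightarrow> (\<exists>x'. (x has_vector_derivative x') (at t within {a..b}) \<and> norm x' \<le> M)"
    by eventually_elim (auto intro: has_vector_derivative_at_within simp: less_le)
qed

text \<open>Subtracting the linear function with slope \<open>\<phi> t\<close> leaves a curve whose
  derivative is small near t almost everywhere, hence with small increments. This makes the leader
  part of a Filippov solution a classical solution, as its stability assumption requires.\<close>

lemma lipschitz_AE_derivative_imp_derivative:
  fixes x :: "real \<Rightarrow> 'a::euclidean_space"
  assumes lip: "L-lipschitz_on {a..b} x" and cont: "continuous_on {a..b} \<phi>"
    and deriv: "AE t in lebesgue. t \<in> {a<..<b} \<longrightarrow> (x has_vector_derivative \<phi> t) (at t)"
    and t: "t \<in> {a..b}"
  shows "(x has_vector_derivative \<phi> t) (at t within {a..b})"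
  unfolding has_vector_derivative_def has_derivative_within_alt
proof (intro conjI allI impI)
  fix e :: real assume "0 < e"
  then obtain d where d: "d > 0" "\<And>s. s \<in> {a..b} \<Longrightarrow> dist s t < d \<Longrightarrow> dist (\<phi> s) (\<phi> t) < e"
    using cont t unfolding continuous_on_iff by blast
  define y where "y s = x s - s *\<^sub>R \<phi> t" for s
  have *: "norm (y v - y u) \<le> e * (v - u)" if uv: "u \<in> {a..b}" "v \<in> {a..b}" "u \<le> v" "dist u t < d" "dist v t < d" for u v
  proof -
    have "(L + (norm (\<phi> t)))-lipschitz_on {u..v} y"
      unfolding y_def
    proof (intro lipschitz_on_diff lipschitz_on_subset[OF lip])
      show "(norm (\<phi> t))-lipschitz_on {u..v} (\<lambda>s. s *\<^sub>R \<phi> t)"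
        by (rule lipschitz_onI) (auto simp: dist_norm scaleR_left_diff_distrib[symmetric])
    qed (use uv in auto)
    then show ?thesis
    proof (rule lipschitz_norm_increment_le[OF _ uv(3)])
      show "AE s in lebesgue. s \<in> {u<..<v} \<longrightarrow> (\<exists>d. (y has_vector_derivative d) (at s) \<and> norm d \<le> e)"
        using deriv
      proof eventually_elim
        case (elim s)
        show ?case
        proof
          assume s: "s \<in> {u<..<v}"
          then have "(x has_vector_derivative \<phi> s) (at s)" using elim uv by auto
          then have "(y has_vector_derivative (\<phi> s - 1 *\<^sub>R \<phi> t)) (at s)"
            unfolding y_def by (auto intro!: derivative_eq_intros)
          moreover have "norm (\<phi> s - 1 *\<^sub>R \<phi> t) \<le> e"
            using d(2)[of s] s uv by (auto simp: dist_norm abs_less_iff)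
          ultimately show "\<exists>d. (y has_vector_derivative d) (at s) \<and> norm d \<le> e" by blast
        qed
      qed
    qed
  qed
  show "\<exists>d>0. \<forall>s\<in>{a..b}. norm (s - t) < d \<longrightarrow> norm (x s - x t - (s - t) *\<^sub>R \<phi> t) \<le> e * norm (s - t)"
  proof (intro exI[of _ d] conjI ballI impI d(1))
    fix s assume s: "s \<in> {a..b}" "norm (s - t) < d"
    have "x s - x t - (s - t) *\<^sub>R \<phi> t = y s - y t" by (simp add: y_def algebra_simps)
    moreover have "norm (y s - y t) \<le> e * norm (s - t)"
      using *[of s t] *[of t s] s t d(1) by (cases "s \<le> t") (auto simp: dist_norm norm_minus_commute)
    ultimately show "norm (x s - x t - (s - t) *\<^sub>R \<phi> t) \<le> e * norm (s - t)" by simp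
  qed
qed (rule bounded_linear_scaleR_left)

text \<open>Barbalat's lemma: each time \<open>u\<close> exceeds \<open>\<epsilon>\<close>, the function \<open>\<theta>\<close> gains a fixed amount.\<close>

lemma barbalat:
  fixes u \<theta> :: "real \<Rightarrow> real"
  assumes lip: "L-lipschitz_on {0..} u"
    and gain: "\<And>s t c. 0 \<le> s \<Longrightarrow> s \<le> t \<Longrightarrow> (\<And>r. r \<in> {s..t} \<Longrightarrow> c \<le> \<bar>u r\<bar>) \<Longrightarrow> c * (t - s) \<le> \<theta> t - \<theta> s"
    and bound: "\<And>t. 0 \<le> t \<Longrightarrow> \<theta> t \<le> B"
  shows "(u \<longlongrightarrow> 0) at_top"
proof (rule ccontr)
  assume "\<not> (u \<longlongrightarrow> 0) at_top"
  then obtain \<epsilon> where \<epsilon>: "\<epsilon> > 0" "\<And>T. \<exists>t\<ge>T. \<epsilon> \<le> \<bar>u t\<bar>"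
    by (auto simp: tendsto_iff eventually_at_top_linorder not_less dist_real_def)
  have L: "0 \<le> L" using lip by (rule lipschitz_on_nonneg)
  have mono: "\<theta> s \<le> \<theta> t" if "0 \<le> s" "s \<le> t" for s t using gain[OF that, of 0] by simp
  \<comment> \<open>During a time \<eta> after an excursion to height \<epsilon> the function u
    loses at most \<epsilon>/2, so \<theta> gains at least \<epsilon>/2 times \<eta>.\<close>
  define \<eta> where "\<eta> = \<epsilon> / (2 * (L + 1))"
  have \<eta>: "0 < \<eta>" "L * \<eta> \<le> \<epsilon> / 2"
  proof -
    show "0 < \<eta>" using \<epsilon>(1) L by (simp add: \<eta>_def)
    moreover have "\<eta> * (2 * (L + 1)) = \<epsilon>" using L by (simp add: \<eta>_def)
    ultimately show "L * \<eta> \<le> \<epsilon> / 2" by (simp add: algebra_simps)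
  qed
  have step: "\<exists>t'\<ge>t. \<theta> t + \<epsilon> / 2 * \<eta> \<le> \<theta> t'" if "0 \<le> t" for t
  proof -
    obtain s where s: "t \<le> s" "\<epsilon> \<le> \<bar>u s\<bar>" using \<epsilon>(2) by blast
    have "\<epsilon> / 2 * (s + \<eta> - s) \<le> \<theta> (s + \<eta>) - \<theta> s"
    proof (rule gain)
      fix r assume r: "r \<in> {s..s + \<eta>}"
      have "\<bar>u r - u s\<bar> \<le> L * \<bar>r - s\<bar>"
        using lipschitz_onD[OF lip, of r s] r s that by (simp add: dist_real_def)
      also have "\<dots> \<le> L * \<eta>" using r L by (intro mult_left_mono) auto
      finally show "\<epsilon> / 2 \<le> \<bar>u r\<bar>" using \<eta>(2) s(2) by linarith
    qed (use s that \<eta> in auto)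
    then show ?thesis using mono[OF that s(1)] s \<eta> by (intro exI[of _ "s + \<eta>"]) auto
  qed
  have "\<exists>t\<ge>0. \<theta> 0 + real n * (\<epsilon> / 2 * \<eta>) \<le> \<theta> t" for n
  proof (induction n)
    case (Suc n)
    then obtain t where t: "t \<ge> 0" "\<theta> 0 + real n * (\<epsilon> / 2 * \<eta>) \<le> \<theta> t" by blast
    then obtain t' where "t' \<ge> t" "\<theta> t + \<epsilon> / 2 * \<eta> \<le> \<theta> t'" using step by blast
    then show ?case using t unfolding of_nat_Suc distrib_right by (intro exI[of _ t']) linarith
  qed auto
  moreover have "0 < \<epsilon> / 2 * \<eta>" using \<epsilon>(1) \<eta>(1) by simp
  then obtain n :: nat where "B - \<theta> 0 < real n * (\<epsilon> / 2 * \<eta>)"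
    using reals_Archimedean3 by blast
  moreover obtain t where "t \<ge> 0" "\<theta> 0 + real n * (\<epsilon> / 2 * \<eta>) \<le> \<theta> t" using calculation(1) by blast
  ultimately show False using bound[of t] by linarith
qed

subsection \<open>Matrices acting on coordinate subspaces\<close>

lemma to_nat_on_UNIV_from_nat_into:
  "j < CARD('k::finite) \<Longrightarrow> to_nat_on (UNIV :: 'k set) (from_nat_into UNIV j) = j"
proof (rule to_nat_on_from_nat_into)
  assume "j < CARD('k)"
  then show "j \<in> to_nat_on (UNIV :: 'k set) ` UNIV"
    using bij_betw_imp_surj_on[OF to_nat_on_finite[of "UNIV :: 'k set"]] by auto
qed

lemma from_nat_into_to_nat_on_UNIV [simp]:
  "from_nat_into UNIV (to_nat_on (UNIV :: 'k::finite set) k) = k"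
  by (rule from_nat_into_to_nat_on) (auto intro: countable_finite)

lemma mat_act_nth:
  "mat_act M x $ (k :: 'k::finite) = (if to_nat_on (UNIV :: 'k set) k < dim_row M
     then \<Sum>j<dim_col M. M $$ (to_nat_on (UNIV :: 'k set) k, j) * x $ from_nat_into UNIV j else 0)"
  by (simp add: mat_act_def of_vec_def to_vec_def scalar_prod_def lessThan_atLeast0)

lemma row_act_eq:
  "0 < dim_row M \<Longrightarrow> row_act M x = (\<Sum>j<dim_col M. M $$ (0, j) * x $ from_nat_into UNIV j)"
  by (simp add: row_act_def to_vec_def scalar_prod_def lessThan_atLeast0)

lemma col_act_nth:
  "col_act M u $ (k :: 'k::finite) = (if to_nat_on (UNIV :: 'k set) k < dim_row M
     then u * M $$ (to_nat_on (UNIV :: 'k set) k, 0) else 0)"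
  by (simp add: col_act_def of_vec_def col_def)

lemma coord_proj_nth:
  "coord_proj m x $ (k :: 'k::finite) = (if to_nat_on (UNIV :: 'k set) k < m then x $ k else 0)"
  by (simp add: coord_proj_def)

lemma bounded_linear_mat_act: "bounded_linear (mat_act M :: real ^ 'k::finite \<Rightarrow> _)"
  unfolding linear_conv_bounded_linear[symmetric]
  by (rule linearI)
    (simp_all add: Finite_Cartesian_Product.vec_eq_iff mat_act_nth sum.distrib distrib_left sum_distrib_left mult.left_commute)

lemma bounded_linear_row_act: "0 < dim_row M \<Longrightarrow> bounded_linear (row_act M :: real ^ 'k::finite \<Rightarrow> _)"
  unfolding linear_conv_bounded_linear[symmetric]
  by (rule linearI) (simp_all add: row_act_eq sum.distrib distrib_left sum_distrib_left mult.left_commute)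

lemma bounded_linear_col_act: "bounded_linear (col_act M :: real \<Rightarrow> real ^ 'k::finite)"
  unfolding linear_conv_bounded_linear[symmetric]
  by (rule linearI) (simp_all add: Finite_Cartesian_Product.vec_eq_iff col_act_nth algebra_simps)

lemma bounded_linear_coord_proj: "bounded_linear (coord_proj m :: real ^ 'k::finite \<Rightarrow> _)"
  unfolding linear_conv_bounded_linear[symmetric]
  by (rule linearI) (simp_all add: Finite_Cartesian_Product.vec_eq_iff coord_proj_nth)

lemma mat_act_in_coord_space: "dim_row M \<le> m \<Longrightarrow> mat_act M x \<in> coord_space m"
  by (auto simp: coord_space_def mat_act_nth)

lemma col_act_in_coord_space: "dim_row M \<le> m \<Longrightarrow> col_act M x \<in> coord_space m"
  by (auto simp: coord_space_def col_act_nth)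

lemma coord_proj_in_coord_space: "coord_proj m x \<in> coord_space m"
  by (auto simp: coord_space_def coord_proj_nth)

lemma coord_proj_eq_self: "x \<in> coord_space m \<Longrightarrow> coord_proj m x = x"
  by (auto simp: coord_space_def coord_proj_nth Finite_Cartesian_Product.vec_eq_iff not_less)

text \<open>The bound on \<open>dim_row B\<close> is needed because the intermediate vector is
  stored in \<open>real ^ 'k\<close> and would otherwise be truncated.\<close>

lemma mat_act_mult:
  fixes x :: "real ^ 'k::finite"
  assumes "dim_col A = dim_row B" "dim_row B \<le> CARD('k)"
  shows "mat_act (A * B) x = mat_act A (mat_act B x)"
proof (subst Finite_Cartesian_Product.vec_eq_iff, rule allI)
  fix k :: 'k
  let ?i = "to_nat_on (UNIV :: 'k set) k"
  have "(\<Sum>j<dim_col B. (\<Sum>l<dim_row B. A $$ (?i, l) * B $$ (l, j)) * x $ from_nat_into UNIV j) =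
      (\<Sum>l<dim_row B. A $$ (?i, l) * (\<Sum>j<dim_col B. B $$ (l, j) * x $ from_nat_into UNIV j))"
    by (simp add: sum_distrib_left sum_distrib_right mult.assoc) (rule sum.swap)
  then show "mat_act (A * B) x $ k = mat_act A (mat_act B x) $ k"
    using assms
    by (simp add: mat_act_nth scalar_prod_def lessThan_atLeast0[symmetric] to_nat_on_UNIV_from_nat_into)
qed

lemma mat_act_one: "mat_act (1\<^sub>m m) (x :: real ^ 'k::finite) = coord_proj m x"
proof (subst Finite_Cartesian_Product.vec_eq_iff, rule allI)
  fix k :: 'k
  let ?i = "to_nat_on (UNIV :: 'k set) k"
  have "(\<Sum>j<m. 1\<^sub>m m $$ (?i, j) * x $ from_nat_into UNIV j) = (\<Sum>j<m. if j = ?i then x $ k else 0)" if "?i < m"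
    by (rule sum.cong) (use that in auto)
  then show "mat_act (1\<^sub>m m) x $ k = coord_proj m x $ k"
    by (simp add: mat_act_nth coord_proj_nth)
qed

lemma mat_act_add:
  "A \<in> carrier_mat n m \<Longrightarrow> B \<in> carrier_mat n m \<Longrightarrow> mat_act (A + B) (x :: real ^ 'k::finite) = mat_act A x + mat_act B x"
  by (auto simp: Finite_Cartesian_Product.vec_eq_iff mat_act_nth sum.distrib distrib_right)

lemma mat_act_smult: "mat_act (c \<cdot>\<^sub>m A) (x :: real ^ 'k::finite) = c *\<^sub>R mat_act A x"
  by (auto simp: Finite_Cartesian_Product.vec_eq_iff mat_act_nth sum_distrib_left mult.assoc)

lemma mat_act_coord_proj:
  fixes x :: "real ^ 'k::finite"
  assumes "dim_col M \<le> m" "dim_col M \<le> CARD('k)"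
  shows "mat_act M (coord_proj m x) = mat_act M x"
  using assms by (auto simp: Finite_Cartesian_Product.vec_eq_iff mat_act_nth coord_proj_nth
      to_nat_on_UNIV_from_nat_into intro!: sum.cong)

lemma row_act_coord_proj:
  fixes x :: "real ^ 'k::finite"
  assumes "0 < dim_row M" "dim_col M \<le> m" "dim_col M \<le> CARD('k)"
  shows "row_act M (coord_proj m x) = row_act M x"
  using assms by (auto simp: row_act_eq coord_proj_nth to_nat_on_UNIV_from_nat_into intro!: sum.cong)

lemma mat_act_pow_Suc:
  fixes x :: "real ^ 'k::finite"
  assumes "M \<in> carrier_mat n n" "n \<le> CARD('k)"
  shows "mat_act (M ^\<^sub>m Suc j) x = mat_act (M ^\<^sub>m j) (mat_act M x)"
  using assms by (subst mat_act_mult[symmetric]) auto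

subsection \<open>Hurwitz matrices\<close>

lemma pow_mat_smult:
  fixes A :: "'a::comm_semiring_1 mat"
  assumes A: "A \<in> carrier_mat n n"
  shows "(c \<cdot>\<^sub>m A) ^\<^sub>m k = c ^ k \<cdot>\<^sub>m (A ^\<^sub>m k)"
proof (induction k)
  case 0
  then show ?case using A by (intro eq_matI) auto
next
  case (Suc k)
  have "(c \<cdot>\<^sub>m A) ^\<^sub>m Suc k = (c ^ k \<cdot>\<^sub>m (A ^\<^sub>m k)) * (c \<cdot>\<^sub>m A)" by (simp add: Suc)
  also have "\<dots> = c ^ Suc k \<cdot>\<^sub>m (A ^\<^sub>m Suc k)"
    by (intro eq_matI) (use A in \<open>auto simp: scalar_prod_def sum_distrib_left mult_ac\<close>)
  finally show ?case .
qed

text \<open>For small \<open>h > 0\<close> the eigenvalues \<open>1 + h \<lambda>\<close> of \<open>1 + h F\<close> lie in the open unit disc.\<close>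

lemma hurwitz_power_bound:
  assumes F: "F \<in> carrier_mat n n" and n: "0 < n" and hur: "hurwitz F"
  obtains h q c :: real where "0 < h" "0 < q" "q < 1"
    "\<And>k i j. i < n \<Longrightarrow> j < n \<Longrightarrow> \<bar>((1\<^sub>m n + h \<cdot>\<^sub>m F) ^\<^sub>m k) $$ (i, j)\<bar> \<le> c * q ^ k"
proof -
  define Fc where "Fc = map_mat complex_of_real F"
  have Fc: "Fc \<in> carrier_mat n n" using F by (simp add: Fc_def)
  have fin: "finite (spectrum Fc)" and ne: "spectrum Fc \<noteq> {}"
    using card_finite_spectrum[OF Fc] spectrum_non_empty[OF Fc n] by auto
  have neg: "Re l < 0" if "l \<in> spectrum Fc" for l
    using hur that by (simp add: hurwitz_def complex_eigenvalue_def spectrum_def Fc_def)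
  have "\<forall>\<^sub>F h in at_right 0. \<forall>l\<in>spectrum Fc. cmod (1 + of_real h * l) < 1"
    unfolding eventually_ball_finite_distrib[OF fin]
  proof
    fix l assume l: "l \<in> spectrum Fc"
    have "((\<lambda>h. 2 * Re l + h * (cmod l)\<^sup>2) \<longlongrightarrow> 2 * Re l + 0 * (cmod l)\<^sup>2) (at_right 0)"
      by (intro tendsto_intros)
    then have "\<forall>\<^sub>F h in at_right 0. 2 * Re l + h * (cmod l)\<^sup>2 < 0"
      by (rule order_tendstoD(2)) (use neg[OF l] in simp)
    then show "\<forall>\<^sub>F h in at_right 0. cmod (1 + of_real h * l) < 1"
      using eventually_at_right_less[of 0]
    proof eventually_elim
      case (elim h)
      have "(cmod (1 + of_real h * l))\<^sup>2 = 1 + h * (2 * Re l + h * (cmod l)\<^sup>2)"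
        unfolding cmod_power2 by (simp add: power2_eq_square algebra_simps)
      also have "\<dots> < 1" using elim by (simp add: mult_pos_neg)
      finally show ?case by (simp add: power2_less_imp_less abs_square_less_1[symmetric])
    qed
  qed
  from eventually_happens'[OF trivial_limit_at_right_real eventually_conj[OF this eventually_at_right_less[of 0]]]
  obtain h where h: "0 < h" "\<And>l. l \<in> spectrum Fc \<Longrightarrow> cmod (1 + of_real h * l) < 1" by blast
  define r where "r = Max ((\<lambda>l. cmod (1 + of_real h * l)) ` spectrum Fc)"
  have r: "\<And>l. l \<in> spectrum Fc \<Longrightarrow> cmod (1 + of_real h * l) \<le> r" "r < 1"
    using fin ne h by (auto simp: r_def)
  have "0 \<le> r" using ne r(1) norm_ge_zero order_trans by blast
  \<comment> \<open>A number strictly between r and 1: dividing 1 + h F by q still leaves spectral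
    radius below 1, so the powers of the quotient are bounded and those of 1 + h F decay like
    q^k.\<close>
  define q where "q = (1 + r) / 2"
  have q: "0 < q" "q < 1" "r < q" using r \<open>0 \<le> r\<close> by (auto simp: q_def)
  define M where "M = 1\<^sub>m n + h \<cdot>\<^sub>m F"
  have M: "M \<in> carrier_mat n n" using F by (simp add: M_def)
  define Mc where "Mc = map_mat complex_of_real M"
  have Mc: "Mc \<in> carrier_mat n n" using M by (simp add: Mc_def)
  define N where "N = complex_of_real (1 / q) \<cdot>\<^sub>m Mc"
  have N: "N \<in> carrier_mat n n" using Mc by (simp add: N_def)
  obtain ev where ev: "ev \<in> spectrum N" "spectral_radius N = cmod ev"
    using spectral_radius_mem_max(1)[OF N n] by auto
  then obtain v where v: "v \<in> carrier_vec n" "v \<noteq> 0\<^sub>v n" "N *\<^sub>v v = ev \<cdot>\<^sub>v v"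
    using N by (auto simp: spectrum_def eigenvalue_def eigenvector_def)
  have Nv: "vec_index (N *\<^sub>v v) i = (vec_index v i + of_real h * vec_index (Fc *\<^sub>v v) i) / of_real q"
    if i: "i < n" for i
  proof -
    have "vec_index (N *\<^sub>v v) i = (\<Sum>j<n. N $$ (i, j) * vec_index v j)"
      using N v(1) i by (simp add: scalar_prod_def lessThan_atLeast0)
    also have "\<dots> = (\<Sum>j<n. ((if j = i then vec_index v i else 0) + of_real h * (Fc $$ (i, j) * vec_index v j)) / of_real q)"
      by (rule sum.cong) (use i F in \<open>auto simp: N_def Mc_def M_def Fc_def field_simps\<close>)
    also have "\<dots> = (vec_index v i + of_real h * (\<Sum>j<n. Fc $$ (i, j) * vec_index v j)) / of_real q"
      using i by (simp add: sum_divide_distrib[symmetric] sum.distrib sum_distrib_left[symmetric])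
    also have "(\<Sum>j<n. Fc $$ (i, j) * vec_index v j) = vec_index (Fc *\<^sub>v v) i"
      using Fc v(1) i by (simp add: scalar_prod_def lessThan_atLeast0)
    finally show ?thesis .
  qed
  \<comment> \<open>Solving q ev = 1 + h l: an eigenvalue of the scaled matrix comes from the
    eigenvalue l of F with the same eigenvector.\<close>
  define l where "l = (of_real q * ev - 1) / of_real h"
  have "Fc *\<^sub>v v = l \<cdot>\<^sub>v v"
  proof (rule eq_vecI)
    fix i assume "i < dim_vec (l \<cdot>\<^sub>v v)"
    then have i: "i < n" using v by simp
    have "vec_index (N *\<^sub>v v) i = ev * vec_index v i" using v i by simp
    then have "vec_index v i + of_real h * vec_index (Fc *\<^sub>v v) i = of_real q * (ev * vec_index v i)"
      using q by (simp add: Nv[OF i] field_simps)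
    then show "vec_index (Fc *\<^sub>v v) i = vec_index (l \<cdot>\<^sub>v v) i"
      using h(1) v i by (simp add: l_def field_simps)
  qed (use Fc v in auto)
  then have "l \<in> spectrum Fc" using v Fc by (auto simp: spectrum_def eigenvalue_def eigenvector_def)
  moreover have "1 + of_real h * l = of_real q * ev" using h(1) by (simp add: l_def)
  ultimately have "q * cmod ev \<le> r" using r(1)[of l] q(1) by (simp add: norm_mult)
  then have "q * cmod ev < q * 1" using q(3) by linarith
  then have "spectral_radius N < 1" using q(1) unfolding ev(2) by (rule mult_less_cancel_left_pos[THEN iffD1, rotated])
  then obtain c where c: "\<And>k. norm_bound (N ^\<^sub>m k) c"
    using spectral_radius_jnf_norm_bound_less_1_upper_triangular[OF N] by blast
  show ?thesis
  proof
    fix k i j assume ij: "i < n" "j < n"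
    have "map_mat complex_of_real (M ^\<^sub>m k) = Mc ^\<^sub>m k"
      unfolding Mc_def by (rule of_real_hom.mat_hom_pow[OF M])
    then have "(Mc ^\<^sub>m k) $$ (i, j) = of_real ((M ^\<^sub>m k) $$ (i, j))"
      using ij pow_carrier_mat[OF M, of k] by (metis (no_types) carrier_matD index_map_mat(1))
    moreover have "N ^\<^sub>m k = of_real (1 / q) ^ k \<cdot>\<^sub>m (Mc ^\<^sub>m k)"
      unfolding N_def by (rule pow_mat_smult[OF Mc])
    ultimately have "(N ^\<^sub>m k) $$ (i, j) = of_real ((1 / q) ^ k * (M ^\<^sub>m k) $$ (i, j))"
      using ij Mc by simp
    moreover have "cmod ((N ^\<^sub>m k) $$ (i, j)) \<le> c"
      using c[of k] ij N by (auto simp: norm_bound_def split: if_splits)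
    ultimately have "\<bar>(1 / q) ^ k * (M ^\<^sub>m k) $$ (i, j)\<bar> \<le> c" by (simp only: norm_of_real real_norm_def)
    then show "\<bar>((1\<^sub>m n + h \<cdot>\<^sub>m F) ^\<^sub>m k) $$ (i, j)\<bar> \<le> c * q ^ k"
      using q by (simp add: M_def[symmetric] abs_mult power_divide field_simps)
  qed (use h q in auto)
qed

text \<open>With \<open>M = 1 + h F\<close>, the form \<open>\<Sum> M\<^sup>j x \<bullet> M\<^sup>j y\<close> loses exactly \<open>x \<bullet> y\<close> under \<open>M\<close>.\<close>

lemma hurwitz_quadratic_form:
  assumes F: "F \<in> carrier_mat n n" and n: "0 < n" "n \<le> CARD('k::finite)" and hur: "hurwitz F"
  obtains B :: "real ^ 'k \<Rightarrow> real ^ 'k \<Rightarrow> real" and c where "bounded_bilinear B" "\<And>x y. B x y = B y x" "0 < c"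
    "\<And>x. x \<in> coord_space n \<Longrightarrow> c * (norm x)\<^sup>2 \<le> B x x"
    "\<And>x. x \<in> coord_space n \<Longrightarrow> B x (mat_act F x) \<le> - (norm x)\<^sup>2"
proof -
  obtain h q c :: real where h: "0 < h" and q: "0 < q" "q < 1"
    and c: "\<And>k i j. i < n \<Longrightarrow> j < n \<Longrightarrow> \<bar>((1\<^sub>m n + h \<cdot>\<^sub>m F) ^\<^sub>m k) $$ (i, j)\<bar> \<le> c * q ^ k"
    using hurwitz_power_bound[OF F n(1) hur] by metis
  define M where "M = 1\<^sub>m n + h \<cdot>\<^sub>m F"
  have M: "M \<in> carrier_mat n n" using F by (simp add: M_def)
  define L :: "nat \<Rightarrow> real ^ 'k \<Rightarrow> real ^ 'k" where "L k = mat_act (M ^\<^sub>m k)" for k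
  have bl: "bounded_linear (L k)" for k unfolding L_def by (rule bounded_linear_mat_act)
  define K where "K = real CARD('k) * (real n * \<bar>c\<bar>)"
  have Mk: "dim_row (M ^\<^sub>m k) = n" "dim_col (M ^\<^sub>m k) = n" for k using pow_carrier_mat[OF M, of k] by auto
  have L_bound: "norm (L k x) \<le> K * q ^ k * norm x" for k x
  proof -
    have nth: "\<bar>L k x $ i\<bar> \<le> real n * \<bar>c\<bar> * q ^ k * norm x" for i
    proof (cases "to_nat_on (UNIV :: 'k set) i < n")
      case True
      have "\<bar>L k x $ i\<bar> \<le> (\<Sum>j<n. \<bar>(M ^\<^sub>m k) $$ (to_nat_on (UNIV :: 'k set) i, j) * x $ from_nat_into UNIV j\<bar>)"
        using True by (simp only: L_def mat_act_nth Mk if_True sum_abs)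
      also have "\<dots> \<le> (\<Sum>j<n. (\<bar>c\<bar> * q ^ k) * norm x)"
      proof (rule sum_mono)
        fix j assume "j \<in> {..<n}"
        then have "\<bar>(M ^\<^sub>m k) $$ (to_nat_on (UNIV :: 'k set) i, j)\<bar> \<le> c * q ^ k"
          using c[OF True, of j k] by (simp add: M_def)
        also have "\<dots> \<le> \<bar>c\<bar> * q ^ k" using q by (intro mult_right_mono) auto
        finally show "\<bar>(M ^\<^sub>m k) $$ (to_nat_on (UNIV :: 'k set) i, j) * x $ from_nat_into UNIV j\<bar> \<le> (\<bar>c\<bar> * q ^ k) * norm x"
          unfolding abs_mult using q by (intro mult_mono component_le_norm_cart) auto
      qed
      finally show ?thesis by (simp add: mult_ac)
    next
      case False
      then have "L k x $ i = 0" by (simp only: L_def mat_act_nth Mk if_False)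
      then show ?thesis using q by simp
    qed
    have "norm (L k x) \<le> (\<Sum>i\<in>UNIV. \<bar>L k x $ i\<bar>)" by (rule norm_le_l1_cart)
    also have "\<dots> \<le> (\<Sum>i\<in>(UNIV :: 'k set). real n * \<bar>c\<bar> * q ^ k * norm x)" by (rule sum_mono) (rule nth)
    finally show ?thesis by (simp add: K_def mult_ac)
  qed
  have K: "0 \<le> K" by (simp add: K_def)
  have term_bound: "norm (L k x \<bullet> L k y) \<le> (K\<^sup>2 * norm x * norm y) * (q\<^sup>2) ^ k" for k x y
  proof -
    have "norm (L k x \<bullet> L k y) \<le> norm (L k x) * norm (L k y)" by (simp add: Cauchy_Schwarz_ineq2)
    also have "\<dots> \<le> (K * q ^ k * norm x) * (K * q ^ k * norm y)"
      using K q by (intro mult_mono L_bound) auto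
    finally show ?thesis by (simp add: power2_eq_square power_mult_distrib mult_ac)
  qed
  have "q\<^sup>2 < 1" using q by (simp add: abs_square_less_1)
  then have geo: "summable (\<lambda>k. C * (q\<^sup>2) ^ k)" for C :: real
    using q by (intro summable_mult summable_geometric) simp
  have summ: "summable (\<lambda>k. L k x \<bullet> L k y)" for x y
    by (rule summable_comparison_test'[OF geo term_bound])
  define B where "B x y = (\<Sum>k. L k x \<bullet> L k y)" for x y
  have bil: "bounded_bilinear B"
  proof
    fix a a' b b' :: "real ^ 'k" and r :: real
    show "B (a + a') b = B a b + B a' b" "B a (b + b') = B a b + B a b'"
      unfolding B_def
      by (simp_all add: suminf_add[OF summ summ] linear_add[OF bounded_linear.linear[OF bl]] inner_add_left inner_add_right)
    show "B (r *\<^sub>R a) b = r *\<^sub>R B a b" "B a (r *\<^sub>R b) = r *\<^sub>R B a b"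
      unfolding B_def
      by (simp_all add: suminf_mult[OF summ, symmetric] linear_cmul[OF bounded_linear.linear[OF bl]])
  next
    have "norm (B x y) \<le> norm x * norm y * (\<Sum>k. K\<^sup>2 * (q\<^sup>2) ^ k)" for x y :: "real ^ 'k"
    proof -
      have sn: "summable (\<lambda>k. norm (L k x \<bullet> L k y))"
        by (rule summable_comparison_test'[OF geo[of "K\<^sup>2 * norm x * norm y"], of 0])
          (use term_bound in simp)
      have "norm (B x y) \<le> (\<Sum>k. norm (L k x \<bullet> L k y))" unfolding B_def by (rule summable_norm[OF sn])
      also have "\<dots> \<le> (\<Sum>k. (K\<^sup>2 * norm x * norm y) * (q\<^sup>2) ^ k)"
        by (rule suminf_le[OF term_bound sn geo])
      also have "\<dots> = (\<Sum>k. (norm x * norm y) * (K\<^sup>2 * (q\<^sup>2) ^ k))" by (simp add: mult_ac)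
      also have "\<dots> = (norm x * norm y) * (\<Sum>k. K\<^sup>2 * (q\<^sup>2) ^ k)" by (rule suminf_mult[OF geo])
      finally show ?thesis .
    qed
    then show "\<exists>K. \<forall>a b. norm (B a b) \<le> norm a * norm b * K" by blast
  qed
  have sym: "B x y = B y x" for x y by (simp add: B_def inner_commute)
  \<comment> \<open>The zeroth power acts as the projection onto the first n coordinates; this is
    why the definiteness and decay of B are claimed on \<open>coord_space n\<close> only.\<close>
  have L0: "L 0 x = x" if "x \<in> coord_space n" for x
    using that M by (simp add: L_def mat_act_one coord_proj_eq_self)
  have shift: "B x x = (norm x)\<^sup>2 + B (mat_act M x) (mat_act M x)" if "x \<in> coord_space n" for x
  proof -
    have "B x x = L 0 x \<bullet> L 0 x + (\<Sum>k. L (Suc k) x \<bullet> L (Suc k) x)"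
      unfolding B_def using suminf_split_head[OF summ, of x x] by simp
    moreover have "L (Suc k) x = L k (mat_act M x)" for k
      unfolding L_def by (rule mat_act_pow_Suc[OF M n(2)])
    ultimately show ?thesis by (simp add: L0[OF that] power2_norm_eq_inner B_def)
  qed
  have pos: "0 \<le> B x x" for x unfolding B_def by (intro suminf_nonneg summ) simp
  have ge: "(norm x)\<^sup>2 \<le> B x x" if "x \<in> coord_space n" for x using shift[OF that] pos by simp
  have dec: "B x (mat_act F x) \<le> - (norm x)\<^sup>2 / (2 * h)" if x: "x \<in> coord_space n" for x
  proof -
    interpret bounded_bilinear B by (rule bil)
    have "mat_act M x = x + h *\<^sub>R mat_act F x"
      using F x unfolding M_def
      by (simp add: mat_act_add[of _ n n] mat_act_smult mat_act_one coord_proj_eq_self)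
    \<comment> \<open>The left side equals \<open>B x x\<close> minus the squared norm of x, and the
      last term is nonnegative; what remains is the decay along F up to the factor 2 h, which the
      final form absorbs.\<close>
    then have "B (mat_act M x) (mat_act M x) = B x x + 2 * h * B x (mat_act F x) + h\<^sup>2 * B (mat_act F x) (mat_act F x)"
      by (simp add: add_left add_right scaleR_left scaleR_right sym[of "mat_act F x" x] power2_eq_square algebra_simps)
    then have "2 * h * B x (mat_act F x) \<le> - (norm x)\<^sup>2"
      using shift[OF x] mult_nonneg_nonneg[OF zero_le_power2[of h] pos[of "mat_act F x"]] by linarith
    then show ?thesis using h by (simp add: field_simps)
  qed
  show ?thesis
  proof
    interpret bounded_bilinear B by (rule bil)
    show "bounded_bilinear (\<lambda>x y. 2 * h * B x y)"
    proof
      obtain C where C: "\<And>a b. norm (B a b) \<le> norm a * norm b * C" using bounded by blast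
      have "norm (2 * h * B a b) \<le> norm a * norm b * (2 * h * C)" for a b
        using mult_left_mono[OF C[of a b], of "2 * h"] h by (simp add: abs_mult mult_ac)
      then show "\<exists>C. \<forall>a b. norm (2 * h * B a b) \<le> norm a * norm b * C" by blast
    qed (simp_all add: add_left add_right scaleR_left scaleR_right algebra_simps)
    show "2 * h * (norm x)\<^sup>2 \<le> 2 * h * B x x" if "x \<in> coord_space n" for x using ge[OF that] h by simp
    show "2 * h * B x (mat_act F x) \<le> - (norm x)\<^sup>2" if "x \<in> coord_space n" for x
      using dec[OF that] h by (simp add: field_simps)
  qed (use h sym in auto)
qed

subsection \<open>The internal model\<close>

text \<open>Cayley-Hamilton: the coefficients \<open>B\<^sub>k\<close> of the adjugate of \<open>s - A\<close> satisfy
  \<open>c\<^sub>k 1 = B\<^sub>k\<^sub>-\<^sub>1 - A B\<^sub>k\<close>, so that \<open>\<Sum> c\<^sub>k A\<^sup>k\<close> telescopes.\<close>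

lemma cayley_hamilton:
  fixes A :: "real mat"
  assumes A: "A \<in> carrier_mat n n"
  shows "poly_of_mat (char_poly A) A = 0\<^sub>m n n"
proof -
  define C where "C = char_poly_matrix A"
  have C: "C \<in> carrier_mat n n" using A by (simp add: C_def)
  define J where "J = adj_mat C"
  have J: "J \<in> carrier_mat n n" and CJ: "C * J = char_poly A \<cdot>\<^sub>m 1\<^sub>m n"
    using adj_mat[OF C] by (auto simp: J_def C_def char_poly_def)
  define b where "b k i j = coeff (J $$ (i, j)) k" for k i j
  define c where "c k = coeff (char_poly A) k" for k
  have key: "(if i = j then c k else 0) = (if k = 0 then 0 else b (k - 1) i j) - (\<Sum>l<n. A $$ (i, l) * b k l j)"
    if ij: "i < n" "j < n" for i j k
  proof -
    have Cil: "C $$ (i, l) = [:- A $$ (i, l):] + (if i = l then [:0, 1:] else 0)" if "l < n" for l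
      using A ij that by (auto simp: C_def char_poly_matrix_def)
    have "(C * J) $$ (i, j) = (\<Sum>l<n. C $$ (i, l) * J $$ (l, j))"
      using C J ij by (simp add: scalar_prod_def lessThan_atLeast0)
    also have "\<dots> = (\<Sum>l<n. [:- A $$ (i, l):] * J $$ (l, j) + (if i = l then [:0, 1:] * J $$ (l, j) else 0))"
      by (intro sum.cong) (auto simp: Cil distrib_right)
    also have "\<dots> = (\<Sum>l<n. [:- A $$ (i, l):] * J $$ (l, j)) + [:0, 1:] * J $$ (i, j)"
      unfolding sum.distrib using ij by simp
    finally have "coeff ((C * J) $$ (i, j)) k = (if k = 0 then 0 else b (k - 1) i j) - (\<Sum>l<n. A $$ (i, l) * b k l j)"
      by (simp add: coeff_sum b_def sum_negf coeff_pCons split: nat.split)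
    then show ?thesis using ij unfolding CJ by (auto simp: c_def)
  qed
  \<comment> \<open>Beyond all degrees that occur, the last telescope term vanishes and extra
    coefficients of the characteristic polynomial are zero.\<close>
  obtain N where N: "\<And>i j. i < n \<Longrightarrow> j < n \<Longrightarrow> degree (J $$ (i, j)) < N" "degree (char_poly A) < N"
  proof -
    have "finite ((\<lambda>(i, j). degree (J $$ (i, j))) ` ({..<n} \<times> {..<n}) \<union> {degree (char_poly A)})" by simp
    from finite_nat_bounded[OF this] obtain N where
      "(\<lambda>(i, j). degree (J $$ (i, j))) ` ({..<n} \<times> {..<n}) \<union> {degree (char_poly A)} \<subseteq> {..<N}" ..
    then show ?thesis by (intro that[of N]) auto
  qed
  show ?thesis
  proof (rule eq_matI)
    fix i j assume "i < dim_row (0\<^sub>m n n :: real mat)" "j < dim_col (0\<^sub>m n n :: real mat)"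
    then have ij: "i < n" "j < n" by auto
    \<comment> \<open>The entry of A^k times the coefficient matrix of index k - 1; by
      \<open>key\<close>, the k-th summand of the characteristic polynomial at A is U k - U (k +
      1).\<close>
    define U where "U k = (if k = 0 then 0 else \<Sum>l<n. (A ^\<^sub>m k) $$ (i, l) * b (k - 1) l j)" for k
    have pow: "(A ^\<^sub>m Suc k) $$ (i, m) = (\<Sum>l<n. (A ^\<^sub>m k) $$ (i, l) * A $$ (l, m))" if "m < n" for k m
      using A ij that pow_carrier_mat[OF A, of k] by (simp add: scalar_prod_def lessThan_atLeast0)
    have "c k * (A ^\<^sub>m k) $$ (i, j) = U k - U (Suc k)" for k
    proof -
      have "c k * (A ^\<^sub>m k) $$ (i, j) = (\<Sum>l<n. (A ^\<^sub>m k) $$ (i, l) * (if l = j then c k else 0))"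
        using ij by (simp add: if_distrib[of "\<lambda>x. _ * x"] cong: if_cong)
      also have "\<dots> = (\<Sum>l<n. (A ^\<^sub>m k) $$ (i, l) * (if k = 0 then 0 else b (k - 1) l j))
          - (\<Sum>l<n. (A ^\<^sub>m k) $$ (i, l) * (\<Sum>m<n. A $$ (l, m) * b k m j))"
        by (subst sum_subtractf[symmetric], rule sum.cong) (simp_all only: key ij(2) right_diff_distrib lessThan_iff)
      also have "(\<Sum>l<n. (A ^\<^sub>m k) $$ (i, l) * (if k = 0 then 0 else b (k - 1) l j)) = U k"
        by (simp add: U_def)
      also have "(\<Sum>l<n. (A ^\<^sub>m k) $$ (i, l) * (\<Sum>m<n. A $$ (l, m) * b k m j)) =
          (\<Sum>m<n. (\<Sum>l<n. (A ^\<^sub>m k) $$ (i, l) * A $$ (l, m)) * b k m j)"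
        by (simp add: sum_distrib_left sum_distrib_right mult.assoc) (rule sum.swap)
      also have "\<dots> = U (Suc k)" by (simp add: U_def pow del: pow_mat.simps)
      finally show ?thesis .
    qed
    then have "(\<Sum>k<Suc N. c k * (A ^\<^sub>m k) $$ (i, j)) = U 0 - U (Suc N)"
      by (simp only: sum_lessThan_telescope')
    also have "\<dots> = 0"
      using N(1)[OF _ ij(2)] by (simp add: U_def b_def coeff_eq_0 del: pow_mat.simps)
    finally have "(\<Sum>k<Suc N. c k * (A ^\<^sub>m k) $$ (i, j)) = 0" .
    moreover have "(\<Sum>k\<le>degree (char_poly A). c k * (A ^\<^sub>m k) $$ (i, j)) = (\<Sum>k<Suc N. c k * (A ^\<^sub>m k) $$ (i, j))"
      by (rule sum.mono_neutral_left) (use N(2) in \<open>auto simp: c_def coeff_eq_0\<close>)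
    ultimately show "poly_of_mat (char_poly A) A $$ (i, j) = 0\<^sub>m n n $$ (i, j)"
      using A ij by (simp add: poly_of_mat_def c_def)
  qed (use A in \<open>auto simp: poly_of_mat_def\<close>)
qed

text \<open>It ensures that the state of the internal model fits into \<open>real ^ 'k\<close>
  whenever the disturbance state does.\<close>

lemma degree_minimal_polynomial_le:
  assumes A: "A \<in> carrier_mat n n" and P: "minimal_polynomial A P"
  shows "degree P \<le> n"
proof -
  have "char_poly A \<noteq> 0" "degree (char_poly A) = n"
    using degree_monic_char_poly[OF A] by auto
  then show ?thesis
    using P cayley_hamilton[OF A] A unfolding minimal_polynomial_def by (metis carrier_matD(1))
qed

text \<open>A monic polynomial of degree 0 is 1, and its value at a nonempty matrix is the identity,
  not 0. So the internal model has at least one state.\<close>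

lemma degree_minimal_polynomial_pos:
  assumes A: "A \<in> carrier_mat n n" "0 < n" and P: "minimal_polynomial A P"
  shows "0 < degree P"
proof (rule ccontr)
  assume "\<not> 0 < degree P"
  then have d: "degree P = 0" by simp
  have "poly_of_mat P A $$ (0, 0) = 0" using P A by (simp add: minimal_polynomial_def)
  then show False using P A d by (simp add: poly_of_mat_def minimal_polynomial_def)
qed

lemma mat_act_F_mat:
  fixes x :: "real ^ 'k::finite"
  assumes "G \<in> carrier_mat (degree P) 1" "0 < degree P"
  shows "mat_act (F_mat P G) x = mat_act (Phi_mat P) x + col_act G (row_act (Psi_mat (degree P)) x)"
proof -
  have "mat_act (G * Psi_mat (degree P)) x = col_act G (row_act (Psi_mat (degree P)) x)"
    using assms
    by (auto simp: Finite_Cartesian_Product.vec_eq_iff mat_act_nth col_act_nth row_act_eq Psi_mat_def scalar_prod_def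
        sum_distrib_right sum_distrib_left mult_ac intro!: sum.cong)
  moreover have "Phi_mat P \<in> carrier_mat (degree P) (degree P)" "G * Psi_mat (degree P) \<in> carrier_mat (degree P) (degree P)"
    using assms by (auto simp: Phi_mat_def Psi_mat_def)
  ultimately show ?thesis unfolding F_mat_def by (simp add: mat_act_add[of _ "degree P" "degree P"])
qed

text \<open>The steady state of the internal model is \<open>(D \<omega>, D S \<omega>, D S\<^sup>2 \<omega>, \<dots>)\<close>.\<close>

lemma internal_model:
  assumes S: "S \<in> carrier_mat n n" and n: "0 < n" "n \<le> CARD('k::finite)" and D: "D \<in> carrier_mat 1 n"
    and P: "minimal_polynomial S P"
  obtains T :: "real ^ 'k \<Rightarrow> real ^ 'k" where "bounded_linear T"
    "\<And>w. T w \<in> coord_space (degree P)"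
    "\<And>w. T (mat_act S w) = mat_act (Phi_mat P) (T w)"
    "\<And>w. row_act (Psi_mat (degree P)) (T w) = row_act D w"
proof -
  let ?i = "to_nat_on (UNIV :: 'k set)"
  have dP: "0 < degree P" "degree P \<le> CARD('k)"
    using degree_minimal_polynomial_pos[OF S n(1) P] degree_minimal_polynomial_le[OF S P] n(2) by auto
  define T :: "real ^ 'k \<Rightarrow> real ^ 'k" where
    "T w = (\<chi> k. if ?i k < degree P then row_act D (mat_act (S ^\<^sub>m ?i k) w) else 0)" for w
  have T_nth: "T w $ from_nat_into UNIV j = row_act D (mat_act (S ^\<^sub>m j) w)" if "j < degree P" for w j
    using that dP by (simp add: T_def to_nat_on_UNIV_from_nat_into)
  have blD: "bounded_linear (row_act D :: real ^ 'k \<Rightarrow> real)" using D by (intro bounded_linear_row_act) simp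
  have D0: "row_act D (mat_act (S ^\<^sub>m 0) w) = row_act D w" for w :: "real ^ 'k"
    using S D n by (simp add: mat_act_one row_act_coord_proj)
  show ?thesis
  proof
    show "bounded_linear T"
      unfolding linear_conv_bounded_linear[symmetric]
      by (rule linearI)
        (simp_all add: Finite_Cartesian_Product.vec_eq_iff T_def linear_add[OF bounded_linear.linear[OF bounded_linear_mat_act]]
          linear_cmul[OF bounded_linear.linear[OF bounded_linear_mat_act]]
          linear_add[OF bounded_linear.linear[OF blD]] linear_cmul[OF bounded_linear.linear[OF blD]])
    show "T w \<in> coord_space (degree P)" for w by (auto simp: coord_space_def T_def)
    show "row_act (Psi_mat (degree P)) (T w) = row_act D w" for w
    proof -
      have "T w $ from_nat_into UNIV 0 = row_act D w" using T_nth[OF dP(1), of w] by (simp only: D0)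
      then have "row_act (Psi_mat (degree P)) (T w) = (\<Sum>j<degree P. if j = 0 then row_act D w else 0)"
        using dP unfolding Psi_mat_def by (subst row_act_eq) (auto simp: mult_if_delta)
      then show ?thesis using dP by simp
    qed
    fix w :: "real ^ 'k"
    \<comment> \<open>The minimal polynomial annihilates S; this linear recursion for D S^j w is the
      last row of the companion matrix, the other rows being shifts.\<close>
    have rec: "(\<Sum>j\<le>degree P. coeff P j * row_act D (mat_act (S ^\<^sub>m j) w)) = 0"
    proof -
      have "(\<Sum>j\<le>degree P. coeff P j *\<^sub>R mat_act (S ^\<^sub>m j) w) = 0"
      proof (subst Finite_Cartesian_Product.vec_eq_iff, rule allI)
        fix k :: 'k
        show "(\<Sum>j\<le>degree P. coeff P j *\<^sub>R mat_act (S ^\<^sub>m j) w) $ k = 0 $ k"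
        proof (cases "?i k < n")
          case True
          have Sj: "dim_row (S ^\<^sub>m j) = n" "dim_col (S ^\<^sub>m j) = n" for j using pow_carrier_mat[OF S, of j] by auto
          have "(\<Sum>j\<le>degree P. coeff P j *\<^sub>R mat_act (S ^\<^sub>m j) w) $ k =
              (\<Sum>j\<le>degree P. \<Sum>l<n. coeff P j * ((S ^\<^sub>m j) $$ (?i k, l) * w $ from_nat_into UNIV l))"
            using True by (simp only: sum_component vector_scaleR_component mat_act_nth Sj if_True sum_distrib_left real_scaleR_def)
          also have "\<dots> = (\<Sum>l<n. (\<Sum>j\<le>degree P. coeff P j * (S ^\<^sub>m j) $$ (?i k, l)) * w $ from_nat_into UNIV l)"
            by (subst sum.swap) (simp add: sum_distrib_right mult.assoc)
          also have "\<dots> = (\<Sum>l<n. poly_of_mat P S $$ (?i k, l) * w $ from_nat_into UNIV l)"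
            using True S by (simp add: poly_of_mat_def)
          also have "\<dots> = 0" using P S True by (simp add: minimal_polynomial_def)
          finally show ?thesis by simp
        next
          case False
          have Sj: "dim_row (S ^\<^sub>m j) = n" for j using pow_carrier_mat[OF S, of j] by auto
          show ?thesis using False
            by (simp only: sum_component vector_scaleR_component mat_act_nth Sj if_False) simp
        qed
      qed
      then have "row_act D (\<Sum>j\<le>degree P. coeff P j *\<^sub>R mat_act (S ^\<^sub>m j) w) = 0"
        using linear_0[OF bounded_linear.linear[OF blD]] by simp
      then show ?thesis
        by (simp add: linear_sum[OF bounded_linear.linear[OF blD]] linear_cmul[OF bounded_linear.linear[OF blD]])
    qed
    show "T (mat_act S w) = mat_act (Phi_mat P) (T w)"
    proof (subst Finite_Cartesian_Product.vec_eq_iff, rule allI)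
      fix k :: 'k
      show "T (mat_act S w) $ k = mat_act (Phi_mat P) (T w) $ k"
      proof (cases "?i k < degree P")
        case True
        have lhs: "T (mat_act S w) $ k = row_act D (mat_act (S ^\<^sub>m Suc (?i k)) w)"
          using True by (simp add: T_def mat_act_pow_Suc[OF S n(2)] del: pow_mat.simps)
        have rhs: "mat_act (Phi_mat P) (T w) $ k =
            (\<Sum>j<degree P. Phi_mat P $$ (?i k, j) * row_act D (mat_act (S ^\<^sub>m j) w))"
          using True by (simp add: mat_act_nth T_nth) (simp add: Phi_mat_def T_nth)
        show ?thesis
        proof (cases "Suc (?i k) = degree P")
          case last: True
          have "(\<Sum>j<degree P. Phi_mat P $$ (?i k, j) * row_act D (mat_act (S ^\<^sub>m j) w)) =
              - (\<Sum>j<degree P. coeff P j * row_act D (mat_act (S ^\<^sub>m j) w))"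
            using True last by (simp add: Phi_mat_def sum_negf)
          moreover have "coeff P (degree P) = 1" using P by (simp add: minimal_polynomial_def)
          ultimately show ?thesis
            using rec unfolding lhs rhs last lessThan_Suc_atMost[symmetric] by (simp del: pow_mat.simps)
        next
          case False
          have "(\<Sum>j<degree P. Phi_mat P $$ (?i k, j) * row_act D (mat_act (S ^\<^sub>m j) w)) =
              (\<Sum>j<degree P. if j = Suc (?i k) then row_act D (mat_act (S ^\<^sub>m j) w) else 0)"
            using True False by (intro sum.cong) (auto simp: Phi_mat_def)
          then show ?thesis unfolding lhs rhs using True False by (simp del: pow_mat.simps)
        qed
      qed (simp add: T_def mat_act_nth Phi_mat_def)
    qed
  qed
qed

subsection \<open>The grounded Laplacian of the follower graph\<close>

definition follower_laplacian :: "real ^ 'n::finite option ^ 'n option \<Rightarrow> real ^ 'n \<Rightarrow> real ^ 'n" where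
  "follower_laplacian A x =
     (\<chi> i. A $ Some i $ None * x $ i + (\<Sum>j\<in>UNIV. A $ Some i $ Some j * (x $ i - x $ j)))"

lemma virtual_error_eq_laplacian:
  "virtual_error A y0 y i = follower_laplacian A (\<chi> i. y $ i - y0) $ i"
proof -
  have "(\<Sum>j\<in>UNIV. F j) = F None + (\<Sum>j\<in>UNIV. F (Some j))" for F :: "'a option \<Rightarrow> real"
    by (simp add: UNIV_option_conv sum.reindex)
  then show ?thesis by (simp add: virtual_error_def follower_laplacian_def)
qed

lemma linear_follower_laplacian: "linear (follower_laplacian A)"
proof (rule linearI; subst Finite_Cartesian_Product.vec_eq_iff; rule allI)
  fix x y :: "real ^ 'a" and c :: real and i
  have "(\<Sum>j\<in>UNIV. A $ Some i $ Some j * (x $ i + y $ i - (x $ j + y $ j))) =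
      (\<Sum>j\<in>UNIV. A $ Some i $ Some j * (x $ i - x $ j)) + (\<Sum>j\<in>UNIV. A $ Some i $ Some j * (y $ i - y $ j))"
    unfolding sum.distrib[symmetric] by (intro sum.cong refl) (simp add: algebra_simps)
  then show "follower_laplacian A (x + y) $ i = (follower_laplacian A x + follower_laplacian A y) $ i"
    by (simp add: follower_laplacian_def distrib_left)
  have "(\<Sum>j\<in>UNIV. A $ Some i $ Some j * (c * x $ i - c * x $ j)) = c * (\<Sum>j\<in>UNIV. A $ Some i $ Some j * (x $ i - x $ j))"
    unfolding sum_distrib_left by (intro sum.cong refl) (simp add: algebra_simps)
  then show "follower_laplacian A (c *\<^sub>R x) $ i = (c *\<^sub>R follower_laplacian A x) $ i"
    by (simp add: follower_laplacian_def distrib_left)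
qed

context
  fixes A :: "real ^ 'n::finite option ^ 'n option"
  assumes nonneg: "\<And>i j. 0 \<le> A $ i $ j"
    and reach: "\<And>i. (None, Some i) \<in> (arcs A)\<^sup>*"
    and sym: "\<And>i j. A $ Some i $ Some j = A $ Some j $ Some i"
begin

text \<open>Because the follower graph is undirected, the double sum can be averaged with its copy
  under exchange of i and j. Symmetry and nonnegativity of the form can then be read off.\<close>

lemma inner_follower_laplacian:
  "x \<bullet> follower_laplacian A y = (\<Sum>i\<in>UNIV. A $ Some i $ None * x $ i * y $ i) +
    (\<Sum>i\<in>UNIV. \<Sum>j\<in>UNIV. A $ Some i $ Some j * (x $ i - x $ j) * (y $ i - y $ j)) / 2"
proof -
  let ?a = "\<lambda>i j. A $ Some i $ Some j"
  have "(\<Sum>i\<in>UNIV. \<Sum>j\<in>UNIV. ?a i j * x $ j * (y $ i - y $ j)) = (\<Sum>j\<in>UNIV. \<Sum>i\<in>UNIV. ?a i j * x $ j * (y $ i - y $ j))"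
    by (rule sum.swap)
  also have "\<dots> = (\<Sum>i\<in>UNIV. \<Sum>j\<in>UNIV. - (?a i j * x $ i * (y $ i - y $ j)))"
    by (intro sum.cong refl) (simp add: sym algebra_simps)
  finally have swap: "(\<Sum>i\<in>UNIV. \<Sum>j\<in>UNIV. ?a i j * x $ j * (y $ i - y $ j)) =
      - (\<Sum>i\<in>UNIV. \<Sum>j\<in>UNIV. ?a i j * x $ i * (y $ i - y $ j))"
    by (simp only: sum_negf)
  have "(\<Sum>i\<in>UNIV. \<Sum>j\<in>UNIV. ?a i j * (x $ i - x $ j) * (y $ i - y $ j)) =
      (\<Sum>i\<in>UNIV. \<Sum>j\<in>UNIV. ?a i j * x $ i * (y $ i - y $ j)) - (\<Sum>i\<in>UNIV. \<Sum>j\<in>UNIV. ?a i j * x $ j * (y $ i - y $ j))"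
    unfolding sum_subtractf[symmetric] by (intro sum.cong refl) (simp add: algebra_simps)
  then have half: "(\<Sum>i\<in>UNIV. \<Sum>j\<in>UNIV. ?a i j * (x $ i - x $ j) * (y $ i - y $ j)) / 2 =
      (\<Sum>i\<in>UNIV. \<Sum>j\<in>UNIV. ?a i j * x $ i * (y $ i - y $ j))"
    unfolding swap by simp
  show ?thesis
    unfolding half
    by (simp add: inner_vec_def follower_laplacian_def distrib_left sum.distrib sum_distrib_left mult_ac)
qed

lemma follower_laplacian_self_adjoint: "follower_laplacian A x \<bullet> y = x \<bullet> follower_laplacian A y"
proof -
  have "y \<bullet> follower_laplacian A x = x \<bullet> follower_laplacian A y"
    unfolding inner_follower_laplacian by (simp add: mult_ac)
  then show ?thesis by (simp add: inner_commute)
qed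

lemma follower_laplacian_nonneg: "0 \<le> x \<bullet> follower_laplacian A x"
  unfolding inner_follower_laplacian
  by (intro add_nonneg_nonneg divide_nonneg_nonneg sum_nonneg) (simp_all add: mult.assoc nonneg)

text \<open>If the form vanishes, then so does each edge term: x is 0 at the neighbours of the
  leader and constant along follower arcs. The value 0 then spreads along the walks that start at
  the leader.\<close>

lemma follower_laplacian_positive:
  assumes "x \<bullet> follower_laplacian A x = 0"
  shows "x = 0"
proof -
  let ?S1 = "\<Sum>i\<in>UNIV. A $ Some i $ None * x $ i * x $ i"
  let ?S2 = "\<Sum>i\<in>UNIV. \<Sum>j\<in>UNIV. A $ Some i $ Some j * (x $ i - x $ j) * (x $ i - x $ j)"
  have t1: "0 \<le> A $ Some i $ None * x $ i * x $ i" for i by (simp add: mult.assoc nonneg)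
  have t2: "0 \<le> A $ Some i $ Some j * (x $ i - x $ j) * (x $ i - x $ j)" for i j by (simp add: mult.assoc nonneg)
  have "0 \<le> ?S1" "0 \<le> ?S2" using t1 t2 by (auto intro!: sum_nonneg)
  then have "?S1 = 0" "?S2 = 0" using assms unfolding inner_follower_laplacian by linarith+
  then have z1: "A $ Some i $ None * x $ i * x $ i = 0" for i
    using sum_nonneg_eq_0_iff[of UNIV "\<lambda>i. A $ Some i $ None * x $ i * x $ i"] t1 by simp
  have z2: "A $ Some i $ Some j * (x $ i - x $ j) * (x $ i - x $ j) = 0" for i j
  proof -
    have "(\<Sum>j\<in>UNIV. A $ Some i $ Some j * (x $ i - x $ j) * (x $ i - x $ j)) = 0"
      using sum_nonneg_eq_0_iff[of UNIV "\<lambda>i. \<Sum>j\<in>UNIV. A $ Some i $ Some j * (x $ i - x $ j) * (x $ i - x $ j)"]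
        t2 \<open>?S2 = 0\<close> by (simp add: sum_nonneg)
    then show ?thesis
      using sum_nonneg_eq_0_iff[of UNIV "\<lambda>j. A $ Some i $ Some j * (x $ i - x $ j) * (x $ i - x $ j)"] t2 by simp
  qed
  have "case node of None \<Rightarrow> True | Some i \<Rightarrow> x $ i = 0" if "(None, node) \<in> (arcs A)\<^sup>*" for node
    using that
  proof (induction rule: rtrancl_induct)
    case (step b c)
    show ?case
    proof (cases c)
      case (Some i)
      show ?thesis
      proof (cases b)
        case None
        then show ?thesis using Some step(2) z1[of i] by (auto simp: arcs_def)
      next
        case (Some j)
        then show ?thesis using \<open>c = Some i\<close> step(2,3) z2[of i j] by (auto simp: arcs_def)
      qed
    qed simp
  qed simp
  from this[OF reach] show ?thesis by (simp add: Finite_Cartesian_Product.vec_eq_iff)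
qed

text \<open>The constant is the minimum of the form on the unit sphere; homogeneity does the
  rest.\<close>

lemma follower_laplacian_coercive:
  obtains c where "0 < c" "\<And>x. c * (norm x)\<^sup>2 \<le> x \<bullet> follower_laplacian A x"
proof -
  have lin: "linear (follower_laplacian A)" by (rule linear_follower_laplacian)
  have "continuous_on (sphere 0 1) (\<lambda>x. x \<bullet> follower_laplacian A x)"
    by (intro continuous_intros linear_continuous_on) (use lin in \<open>simp add: linear_conv_bounded_linear\<close>)
  from continuous_attains_inf[OF compact_sphere _ this]
  obtain u :: "real ^ 'n" where u: "u \<in> sphere 0 1"
    "\<And>x. x \<in> sphere 0 1 \<Longrightarrow> u \<bullet> follower_laplacian A u \<le> x \<bullet> follower_laplacian A x"
    by (auto simp: sphere_eq_empty)
  define c where "c = u \<bullet> follower_laplacian A u"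
  have "u \<noteq> 0" using u(1) by auto
  then have "0 < c" using follower_laplacian_positive[of u] follower_laplacian_nonneg[of u] by (auto simp: c_def less_le)
  moreover have "c * (norm x)\<^sup>2 \<le> x \<bullet> follower_laplacian A x" for x
  proof (cases "x = 0")
    case False
    have x: "norm x *\<^sub>R sgn x = x" using False by (simp add: sgn_div_norm)
    have "(norm x)\<^sup>2 * (sgn x \<bullet> follower_laplacian A (sgn x)) = (norm x *\<^sub>R sgn x) \<bullet> (norm x *\<^sub>R follower_laplacian A (sgn x))"
      by (simp only: inner_scaleR_left inner_scaleR_right power2_eq_square mult.assoc)
    also have "norm x *\<^sub>R follower_laplacian A (sgn x) = follower_laplacian A (norm x *\<^sub>R sgn x)"
      by (rule linear_cmul[OF lin, symmetric])
    finally have "x \<bullet> follower_laplacian A x = (norm x)\<^sup>2 * (sgn x \<bullet> follower_laplacian A (sgn x))"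
      unfolding x by simp
    moreover have c: "c \<le> sgn x \<bullet> follower_laplacian A (sgn x)"
      unfolding c_def using False by (intro u(2)) (simp add: norm_sgn)
    ultimately show ?thesis using mult_left_mono[OF c, of "(norm x)\<^sup>2"] by (simp add: mult.commute)
  qed (simp add: linear_0[OF lin])
  ultimately show ?thesis using that by blast
qed

lemma follower_laplacian_inj: "inj (follower_laplacian A)"
  unfolding linear_injective_0[OF linear_follower_laplacian] using follower_laplacian_positive by force

end

subsection \<open>Changing the supply rate\<close>

lemma class_K_inf_nonneg: "class_K_inf \<alpha> \<Longrightarrow> 0 \<le> s \<Longrightarrow> 0 \<le> \<alpha> s"
  unfolding class_K_inf_def class_K_def using strict_mono_onD[of "{0..}" \<alpha> 0 s] by (cases "s = 0") auto

lemma class_K_inf_mono: "class_K_inf \<alpha> \<Longrightarrow> 0 \<le> s \<Longrightarrow> s \<le> t \<Longrightarrow> \<alpha> s \<le> \<alpha> t"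
  unfolding class_K_inf_def class_K_def using strict_mono_onD[of "{0..}" \<alpha> s t] by (cases "s = t") auto

lemma class_K_inf_eventually_ge:
  assumes "class_K_inf \<alpha>"
  obtains n :: nat where "\<And>s. real n \<le> s \<Longrightarrow> c \<le> \<alpha> s"
proof -
  have "filterlim \<alpha> at_top at_top" using assms by (simp add: class_K_inf_def)
  then obtain N where "\<And>s. N \<le> s \<Longrightarrow> c \<le> \<alpha> s" by (auto simp: filterlim_at_top eventually_at_top_linorder)
  then show ?thesis using that[of "nat \<lceil>N\<rceil>"] real_nat_ceiling_ge[of N] by force
qed

text \<open>\<open>U = K \<circ> V\<close>, where \<open>K\<close> has a derivative \<open>\<kappa>\<close> that grows fast enough for the decay
  \<open>\<kappa> (V x) \<alpha> (norm x)\<close> to absorb \<open>h\<close>.\<close>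

lemma change_of_supply:
  fixes V :: "'a::euclidean_space \<Rightarrow> real" and fb :: "'a \<Rightarrow> real \<Rightarrow> 'p::metric_space \<Rightarrow> 'a"
  assumes V: "smooth V" and \<alpha>: "class_K_inf \<alpha>" "class_K_inf \<alpha>\<^sub>1" "class_K_inf \<alpha>\<^sub>2"
    and V_bounds: "\<And>x. x \<in> Z \<Longrightarrow> \<alpha>\<^sub>1 (norm x) \<le> V x \<and> V x \<le> \<alpha>\<^sub>2 (norm x)"
    and \<Sigma>: "compact \<Sigma>"
    and \<Gamma>: "continuous_on UNIV (\<lambda>(e, p). \<Gamma> e p)"
    and V_deriv: "\<And>x e p. x \<in> Z \<Longrightarrow> p \<in> \<Sigma> \<Longrightarrow> frechet_derivative V (at x) (fb x e p) \<le> - \<alpha> (norm x) + \<Gamma> e p"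
    and h: "continuous_on UNIV (\<lambda>(x, e, p). h x e p)"
  obtains U :: "'a \<Rightarrow> real" and U' \<Theta> where "\<And>x. (U has_derivative U' x) (at x)" "locally_lipschitz U"
    "\<And>x. x \<in> Z \<Longrightarrow> \<alpha>\<^sub>1 (norm x) \<le> U x"
    "\<And>m x e p. x \<in> Z \<Longrightarrow> p \<in> \<Sigma> \<Longrightarrow> \<bar>e\<bar> \<le> real m \<Longrightarrow> U' x (fb x e p) + h x e p \<le> \<Theta> m"
proof -
  have "\<exists>b. \<forall>x e p. norm x \<le> real j \<and> \<bar>e\<bar> \<le> real j \<and> p \<in> \<Sigma> \<longrightarrow> h x e p \<le> b" for j
  proof -
    have "compact ((\<lambda>(x, e, p). h x e p) ` (cball 0 (real j) \<times> {- real j..real j} \<times> \<Sigma>))"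
      by (intro compact_continuous_image continuous_on_subset[OF h] compact_Times \<Sigma>) auto
    then have "bounded ((\<lambda>(x, e, p). h x e p) ` (cball 0 (real j) \<times> {- real j..real j} \<times> \<Sigma>))"
      by (rule compact_imp_bounded)
    then obtain b where b: "\<And>y. y \<in> (\<lambda>(x, e, p). h x e p) ` (cball 0 (real j) \<times> {- real j..real j} \<times> \<Sigma>) \<Longrightarrow> norm y \<le> b"
      unfolding bounded_iff by blast
    have "h x e p \<le> b" if "norm x \<le> real j" "\<bar>e\<bar> \<le> real j" "p \<in> \<Sigma>" for x e p
    proof -
      have "norm (h x e p) \<le> b" using that by (intro b image_eqI[of _ _ "(x, e, p)"]) (auto simp: abs_le_iff)
      then show ?thesis by simp
    qed
    then show ?thesis by blast
  qed
  then obtain mh0 where mh0: "\<And>j x e p. norm x \<le> real j \<Longrightarrow> \<bar>e\<bar> \<le> real j \<Longrightarrow> p \<in> \<Sigma> \<Longrightarrow> h x e p \<le> mh0 j"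
    by metis
  \<comment> \<open>A nondecreasing majorant; with it the bound for h splits into a part depending
    on norm x and a part depending on |e|.\<close>
  define mh where "mh j = (\<Sum>i\<le>j. \<bar>mh0 i\<bar>)" for j :: nat
  have mh_nonneg: "0 \<le> mh j" for j by (simp add: mh_def sum_nonneg)
  have mh_mono: "mh i \<le> mh j" if "i \<le> j" for i j
    unfolding mh_def using that by (intro sum_mono2) auto
  have mh_ge: "mh0 j \<le> mh j" for j
    unfolding mh_def using member_le_sum[of j "{..j}" "\<lambda>i. \<bar>mh0 i\<bar>"] by simp
  have h_le: "h x e p \<le> mh n + mh m" if "norm x \<le> real n" "\<bar>e\<bar> \<le> real m" "p \<in> \<Sigma>" for x e p n m
  proof -
    have "h x e p \<le> mh0 (max n m)" using that by (intro mh0) auto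
    also have "\<dots> \<le> mh (max n m)" by (rule mh_ge)
    also have "\<dots> \<le> mh n + mh m" using mh_nonneg[of n] mh_nonneg[of m] by (cases "n \<le> m") (auto simp: max_def)
    finally show ?thesis .
  qed
  have "\<exists>a\<ge>0. \<forall>e p. \<bar>e\<bar> \<le> real m \<and> p \<in> \<Sigma> \<longrightarrow> \<Gamma> e p \<le> a" for m
  proof -
    have "compact ((\<lambda>(e, p). \<Gamma> e p) ` ({- real m..real m} \<times> \<Sigma>))"
      by (intro compact_continuous_image continuous_on_subset[OF \<Gamma>] compact_Times \<Sigma>) auto
    then have "bounded ((\<lambda>(e, p). \<Gamma> e p) ` ({- real m..real m} \<times> \<Sigma>))" by (rule compact_imp_bounded)
    then obtain b where b: "\<And>y. y \<in> (\<lambda>(e, p). \<Gamma> e p) ` ({- real m..real m} \<times> \<Sigma>) \<Longrightarrow> norm y \<le> b"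
      unfolding bounded_iff by blast
    have "\<Gamma> e p \<le> max b 0" if "\<bar>e\<bar> \<le> real m" "p \<in> \<Sigma>" for e p
    proof -
      have "norm (\<Gamma> e p) \<le> b" using that by (intro b image_eqI[of _ _ "(e, p)"]) (auto simp: abs_le_iff)
      then show ?thesis by simp
    qed
    then show ?thesis by (intro exI[of _ "max b 0"]) auto
  qed
  then obtain a where a: "\<And>m. 0 \<le> a m" "\<And>m e p. \<bar>e\<bar> \<le> real m \<Longrightarrow> p \<in> \<Sigma> \<Longrightarrow> \<Gamma> e p \<le> a m"
    by metis
  \<comment> \<open>Beyond this radius half of \<alpha> pays for the supply and the other half is
    left for h. A radius of at least 1 allows \<open>\<alpha> 1\<close> as a positive lower bound
    for \<alpha>.\<close>
  have "\<exists>n :: nat. 1 \<le> n \<and> (\<forall>s. real n \<le> s \<longrightarrow> 2 * a m \<le> \<alpha> s)" for m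
  proof -
    obtain n :: nat where "\<And>s. real n \<le> s \<Longrightarrow> 2 * a m \<le> \<alpha> s"
      by (rule class_K_inf_eventually_ge[OF \<alpha>(1), where c = "2 * a m"]) blast
    then show ?thesis by (intro exI[of _ "Suc n"]) auto
  qed
  then obtain S :: "nat \<Rightarrow> nat" where S: "\<And>m. 1 \<le> S m" "\<And>m s. real (S m) \<le> s \<Longrightarrow> 2 * a m \<le> \<alpha> s"
    by metis
  \<comment> \<open>\<kappa> sees x only through V. Since V x lies below its integer part plus 1,
    this radius bounds norm x in terms of that integer part.\<close>
  have "\<exists>n :: nat. \<forall>s. real n \<le> s \<longrightarrow> real j + 1 \<le> \<alpha>\<^sub>1 s" for j
    using class_K_inf_eventually_ge[OF \<alpha>(2), of "real j + 1"] by metis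
  then obtain T :: "nat \<Rightarrow> nat" where T: "\<And>j s. real (T j) \<le> s \<Longrightarrow> real j + 1 \<le> \<alpha>\<^sub>1 s"
    by metis
  have \<alpha>1: "0 < \<alpha> 1"
    using \<alpha>(1) strict_mono_onD[of "{0..}" \<alpha> 0 1] by (auto simp: class_K_inf_def class_K_def)
  \<comment> \<open>The remaining decay \<kappa> \<alpha> / 2 has to exceed the part of h governed
    by norm x, and \<alpha> is at least \<open>\<alpha> 1\<close> there. The bound 1 \<le> \<kappa>
    makes U at least as large as V.\<close>
  obtain \<kappa> :: "real \<Rightarrow> real" where \<kappa>: "smooth \<kappa>" "\<And>u. 1 \<le> \<kappa> u" "\<And>u. 2 * mh (T (nat \<lfloor>\<bar>u\<bar>\<rfloor>)) / \<alpha> 1 \<le> \<kappa> u"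
    using smooth_dominating[of "\<lambda>j. 2 * mh (T j) / \<alpha> 1"] by blast
  have cont\<kappa>: "continuous_on UNIV \<kappa>" using \<kappa>(1) by (rule smooth_continuous_on)
  obtain K0 where "\<And>u. (K0 has_vector_derivative \<kappa> u) (at u)"
    using einterval_antiderivative[of "- \<infinity>" \<infinity> \<kappa>] cont\<kappa> by (auto simp: continuous_on_eq_continuous_at)
  then have K0: "(K0 has_real_derivative \<kappa> u) (at u)" for u
    by (simp add: has_real_derivative_iff_has_vector_derivative)
  define K where "K u = K0 u - K0 0" for u
  have K: "(K has_real_derivative \<kappa> u) (at u)" for u
    unfolding K_def using DERIV_diff[OF K0 DERIV_const] by simp
  have K_ge: "u \<le> K u" if "0 \<le> u" for u
  proof -
    have "K 0 - 0 \<le> K u - u"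
    proof (rule DERIV_nonneg_imp_nondecreasing[OF that])
      fix s
      have "((\<lambda>u. K u - u) has_real_derivative (\<kappa> s - 1)) (at s)" by (rule DERIV_diff[OF K DERIV_ident])
      then show "\<exists>y. ((\<lambda>u. K u - u) has_real_derivative y) (at s) \<and> 0 \<le> y" using \<kappa>(2)[of s] by auto
    qed
    then show ?thesis by (simp add: K_def)
  qed
  define U where "U x = K (V x)" for x
  define U' where "U' x d = \<kappa> (V x) * frechet_derivative V (at x) d" for x d
  have "\<exists>b. \<forall>u. 0 \<le> u \<and> u \<le> c \<longrightarrow> \<kappa> u \<le> b" for c
  proof -
    have "compact (\<kappa> ` {0..c})" by (intro compact_continuous_image continuous_on_subset[OF cont\<kappa>]) auto
    then have "bounded (\<kappa> ` {0..c})" by (rule compact_imp_bounded)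
    then show ?thesis unfolding bounded_iff by (metis abs_le_D1 atLeastAtMost_iff image_eqI real_norm_def)
  qed
  then obtain b\<kappa> where b\<kappa>: "\<And>c u. 0 \<le> u \<Longrightarrow> u \<le> c \<Longrightarrow> \<kappa> u \<le> b\<kappa> c" by metis
  \<comment> \<open>Inside the radius S m nothing is absorbed: V is at most
    \<open>\<alpha>\<^sub>2 (real (S m))\<close> there, and the supply and h are simply bounded.
    Outside, \<open>mh m\<close> alone suffices.\<close>
  define \<Theta> where "\<Theta> m = b\<kappa> (\<alpha>\<^sub>2 (real (S m))) * a m + mh (S m) + mh m" for m
  have V0: "0 \<le> V x" if "x \<in> Z" for x
    using V_bounds[OF that] class_K_inf_nonneg[OF \<alpha>(2), of "norm x"] by simp
  show ?thesis
  proof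
    show "(U has_derivative U' x) (at x)" for x
    proof -
      have "((\<lambda>x. K (V x)) has_derivative (\<lambda>d. frechet_derivative V (at x) d * \<kappa> (V x))) (at x)"
        using has_derivative_compose[OF smooth_has_derivative[OF V] K[of "V x", unfolded has_field_derivative_def]]
        by (simp add: mult.commute)
      then show ?thesis by (simp add: U_def[abs_def] U'_def[abs_def] mult.commute)
    qed
    have "locally_lipschitz K"
      by (rule locally_lipschitz_C1[where f' = "\<lambda>u d. \<kappa> u * d"])
        (use K in \<open>auto simp: has_field_derivative_def split_beta intro!: continuous_intros continuous_on_compose2[OF cont\<kappa>]\<close>)
    then show "locally_lipschitz U"
      unfolding U_def[abs_def] by (rule locally_lipschitz_compose[OF _ locally_lipschitz_smooth[OF V]])
    show "\<alpha>\<^sub>1 (norm x) \<le> U x" if "x \<in> Z" for x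
      using V_bounds[OF that] K_ge[OF V0[OF that]] by (simp add: U_def)
    fix m x e p assume x: "x \<in> Z" and p: "p \<in> \<Sigma>" and e: "\<bar>e\<bar> \<le> real m"
    have \<kappa>0: "0 \<le> \<kappa> u" for u using \<kappa>(2)[of u] by linarith
    have der: "U' x (fb x e p) \<le> \<kappa> (V x) * (- \<alpha> (norm x) + a m)"
      unfolding U'_def using V_deriv[OF x p, of e] a(2)[OF e p] \<kappa>0 by (intro mult_left_mono) auto
    show "U' x (fb x e p) + h x e p \<le> \<Theta> m"
    proof (cases "real (S m) \<le> norm x")
      case True
      define n where "n = nat \<lceil>norm x\<rceil>"
      have n: "norm x \<le> real n" unfolding n_def by (rule real_nat_ceiling_ge)
      have "1 \<le> norm x" using True S(1)[of m] by linarith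
      have "n \<le> T (nat \<lfloor>\<bar>V x\<bar>\<rfloor>)"
      proof (rule ccontr)
        assume "\<not> n \<le> T (nat \<lfloor>\<bar>V x\<bar>\<rfloor>)"
        then have "real (T (nat \<lfloor>\<bar>V x\<bar>\<rfloor>)) \<le> norm x" unfolding n_def by linarith
        then have "real (nat \<lfloor>\<bar>V x\<bar>\<rfloor>) + 1 \<le> \<alpha>\<^sub>1 (norm x)" by (rule T)
        then show False using V_bounds[OF x] V0[OF x] by linarith
      qed
      then have "2 * mh n / \<alpha> 1 \<le> 2 * mh (T (nat \<lfloor>\<bar>V x\<bar>\<rfloor>)) / \<alpha> 1"
        using \<alpha>1 mh_mono by (simp add: divide_right_mono)
      then have "2 * mh n / \<alpha> 1 \<le> \<kappa> (V x)" using \<kappa>(3)[of "V x"] by linarith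
      then have "2 * mh n \<le> \<kappa> (V x) * \<alpha> 1" using \<alpha>1 by (simp add: pos_divide_le_eq)
      also have "\<dots> \<le> \<kappa> (V x) * \<alpha> (norm x)"
        using class_K_inf_mono[OF \<alpha>(1) _ \<open>1 \<le> norm x\<close>] \<kappa>0 by (intro mult_left_mono) auto
      finally have "mh n \<le> \<kappa> (V x) * (\<alpha> (norm x) / 2)" by simp
      moreover have "\<kappa> (V x) * (- \<alpha> (norm x) + a m) \<le> \<kappa> (V x) * (- (\<alpha> (norm x) / 2))"
        using S(2)[OF True] \<kappa>0 by (intro mult_left_mono) auto
      moreover have "h x e p \<le> mh n + mh m" by (rule h_le[OF n e p])
      ultimately have "U' x (fb x e p) + h x e p \<le> mh m" using der by simp
      moreover have "0 \<le> \<alpha>\<^sub>2 (real (S m))" by (rule class_K_inf_nonneg[OF \<alpha>(3)]) simp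
      then have "0 \<le> b\<kappa> (\<alpha>\<^sub>2 (real (S m)))" using b\<kappa>[of 0] \<kappa>0[of 0] order_trans by blast
      ultimately show ?thesis using mh_nonneg[of "S m"] a(1)[of m] by (simp add: \<Theta>_def add_increasing)
    next
      case False
      then have "V x \<le> \<alpha>\<^sub>2 (real (S m))"
        using V_bounds[OF x] class_K_inf_mono[OF \<alpha>(3), of "norm x" "real (S m)"] by simp
      then have "\<kappa> (V x) \<le> b\<kappa> (\<alpha>\<^sub>2 (real (S m)))" using V0[OF x] b\<kappa> by blast
      have "\<kappa> (V x) * (- \<alpha> (norm x) + a m) \<le> \<kappa> (V x) * a m"
        using class_K_inf_nonneg[OF \<alpha>(1), of "norm x"] \<kappa>0 by (intro mult_left_mono) auto
      also have "\<dots> \<le> b\<kappa> (\<alpha>\<^sub>2 (real (S m))) * a m"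
        using \<open>\<kappa> (V x) \<le> b\<kappa> (\<alpha>\<^sub>2 (real (S m)))\<close> a(1) by (rule mult_right_mono)
      finally have "\<kappa> (V x) * (- \<alpha> (norm x) + a m) \<le> b\<kappa> (\<alpha>\<^sub>2 (real (S m))) * a m" .
      moreover have "h x e p \<le> mh (S m) + mh m" using False by (intro h_le e p) auto
      ultimately show ?thesis using der by (simp add: \<Theta>_def)
    qed
  qed
qed

lemma young: "2 * a * b \<le> a\<^sup>2 + (b::real)\<^sup>2"
  using sum_squares_bound[of a b] by simp

text \<open>The left side is the part of the Lyapunov derivative due to the quadratic form in x, to
  e and to k. Cross terms with x are absorbed by its decay through Young's inequality. What is left
  is quadratic in e, \<nu> and h: the first two are paid for by \<rho>, and h will be absorbed by
  the changed supply rate.\<close>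

lemma coupling_bound:
  fixes B :: "'a::real_normed_vector \<Rightarrow> 'a \<Rightarrow> real" and g :: "real \<Rightarrow> 'a"
  assumes B: "bounded_bilinear B" and BF: "\<And>x. x \<in> Z \<Longrightarrow> B x (F x) \<le> - (norm x)\<^sup>2"
    and F: "bounded_linear F" and g: "bounded_linear g" and \<psi>: "bounded_linear \<psi>"
  obtains C where "0 \<le> C" "\<And>x e \<nu> h k r \<theta> \<sigma> lam. \<lbrakk>x \<in> Z; 0 < lam; 0 \<le> \<theta>; \<sigma> * \<nu> = \<bar>\<nu>\<bar>\<rbrakk> \<Longrightarrow>
      2 * B x (F (x + g e) - g h) + \<nu> * (h - \<psi> (x + g e) - k * r * \<nu> - \<theta> * \<sigma>) + (k - 1) * (- lam * k + r * \<nu>\<^sup>2)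
      \<le> C * (e\<^sup>2 + \<nu>\<^sup>2 + h\<^sup>2) - r * \<nu>\<^sup>2 - (norm x)\<^sup>2 / 2 - lam / 2 * (k - 1)\<^sup>2 + lam / 2"
proof -
  obtain K where K: "0 \<le> K" "\<And>x y. norm (B x y) \<le> norm x * norm y * K" using bounded_bilinear.nonneg_bounded[OF B] by blast
  obtain KF where KF: "0 \<le> KF" "\<And>x. norm (F x) \<le> norm x * KF" using bounded_linear.nonneg_bounded[OF F] by blast
  obtain G where G: "0 \<le> G" "\<And>e. norm (g e) \<le> \<bar>e\<bar> * G" using bounded_linear.nonneg_bounded[OF g] by auto
  obtain P where P: "0 \<le> P" "\<And>x. \<bar>\<psi> x\<bar> \<le> norm x * P" using bounded_linear.nonneg_bounded[OF \<psi>] by auto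
  \<comment> \<open>A crude common bound for the coefficients of the three squares that Young's
    inequality leaves.\<close>
  define C where "C = 2 * (K * G)\<^sup>2 * (KF\<^sup>2 + 1) + 1 + P\<^sup>2 + P * G"
  show ?thesis
  proof
    show "0 \<le> C" using K G P KF by (simp add: C_def)
    fix x e \<nu> h k r \<theta> \<sigma> lam :: real and z assume z: "z \<in> Z" and lam: "0 < lam" and \<theta>: "0 \<le> \<theta>" and \<sigma>: "\<sigma> * \<nu> = \<bar>\<nu>\<bar>"
    define n where "n = norm z"
    define d where "d = K * G * (KF * \<bar>e\<bar> + \<bar>h\<bar>)"
    have "B z (F (z + g e) - g h) = B z (F z) + B z (F (g e) - g h)"
      by (simp add: bounded_bilinear.add_right[OF B, symmetric] linear_add[OF bounded_linear.linear[OF F]] add_diff_eq)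
    moreover have "B z (F (g e) - g h) \<le> n * d"
    proof -
      have "norm (F (g e) - g h) \<le> norm (F (g e)) + norm (g h)" by (rule norm_triangle_ineq4)
      also have "\<dots> \<le> \<bar>e\<bar> * G * KF + \<bar>h\<bar> * G"
        using KF(2)[of "g e"] mult_right_mono[OF G(2)[of e] KF(1)] G(2)[of h] by linarith
      finally have "norm z * norm (F (g e) - g h) * K \<le> n * (\<bar>e\<bar> * G * KF + \<bar>h\<bar> * G) * K"
        unfolding n_def using K(1) by (intro mult_right_mono mult_left_mono) auto
      then show ?thesis using K(2)[of z "F (g e) - g h"] by (simp add: d_def algebra_simps abs_le_iff)
    qed
    ultimately have t1: "2 * B z (F (z + g e) - g h) \<le> - n\<^sup>2 + d\<^sup>2"
      using BF[OF z] young[of n d] by (simp add: n_def)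
    have "(KF * \<bar>e\<bar> + \<bar>h\<bar>)\<^sup>2 \<le> 2 * (KF\<^sup>2 * e\<^sup>2 + h\<^sup>2)"
      using young[of "KF * \<bar>e\<bar>" "\<bar>h\<bar>"] by (simp add: power2_sum power_mult_distrib)
    then have d2: "d\<^sup>2 \<le> 2 * (K * G)\<^sup>2 * (KF\<^sup>2 * e\<^sup>2 + h\<^sup>2)"
      unfolding d_def power_mult_distrib[of "K * G"] using mult_left_mono[of _ _ "(K * G)\<^sup>2"] by (metis mult.assoc mult.left_commute zero_le_power2)
    have \<psi>z: "- (\<nu> * \<psi> (z + g e)) \<le> n\<^sup>2 / 2 + P\<^sup>2 * \<nu>\<^sup>2 / 2 + P * G * (\<nu>\<^sup>2 + e\<^sup>2) / 2"
    proof -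
      have "- (\<nu> * \<psi> (z + g e)) = - (\<nu> * \<psi> z) - \<nu> * \<psi> (g e)"
        by (simp add: linear_add[OF bounded_linear.linear[OF \<psi>]] distrib_left)
      moreover have "- (\<nu> * \<psi> z) \<le> n * (P * \<bar>\<nu>\<bar>)"
      proof -
        have "- (\<nu> * \<psi> z) \<le> \<bar>\<nu>\<bar> * \<bar>\<psi> z\<bar>" by (metis abs_ge_minus_self abs_mult)
        also have "\<dots> \<le> \<bar>\<nu>\<bar> * (n * P)" using P(2)[of z] by (intro mult_left_mono) (auto simp: n_def)
        finally show ?thesis by (simp add: mult_ac)
      qed
      moreover have "- (\<nu> * \<psi> (g e)) \<le> (P * G) * (\<bar>\<nu>\<bar> * \<bar>e\<bar>)"
      proof -
        have "- (\<nu> * \<psi> (g e)) \<le> \<bar>\<nu>\<bar> * \<bar>\<psi> (g e)\<bar>" by (metis abs_ge_minus_self abs_mult)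
        also have "\<dots> \<le> \<bar>\<nu>\<bar> * (\<bar>e\<bar> * G * P)"
          using P(2)[of "g e"] mult_right_mono[OF G(2)[of e] P(1)] by (intro mult_left_mono) auto
        finally show ?thesis by (simp add: mult_ac)
      qed
      moreover have "(P * G) * (\<bar>\<nu>\<bar> * \<bar>e\<bar>) \<le> P * G * (\<nu>\<^sup>2 + e\<^sup>2) / 2"
        using mult_left_mono[of "2 * \<bar>\<nu>\<bar> * \<bar>e\<bar>" "\<nu>\<^sup>2 + e\<^sup>2" "P * G"] young[of "\<bar>\<nu>\<bar>" "\<bar>e\<bar>"] P G
        by (simp add: mult_ac)
      moreover have "n * (P * \<bar>\<nu>\<bar>) \<le> n\<^sup>2 / 2 + P\<^sup>2 * \<nu>\<^sup>2 / 2"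
        using young[of n "P * \<bar>\<nu>\<bar>"] by (simp add: power_mult_distrib)
      ultimately show ?thesis by linarith
    qed
    have \<nu>h: "\<nu> * h \<le> \<nu>\<^sup>2 / 2 + h\<^sup>2 / 2" using young[of \<nu> h] by simp
    \<comment> \<open>The right side exceeds the left by exactly lam k^2 / 2. The leakage of k thus
      gives decay towards 1 at the cost of a constant.\<close>
    have kk: "- (k - 1) * lam * k \<le> - (lam / 2 * (k - 1)\<^sup>2) + lam / 2"
    proof -
      have "- (lam / 2 * (k - 1)\<^sup>2) + lam / 2 + (k - 1) * lam * k = lam / 2 * k\<^sup>2"
        by (simp add: power2_eq_square algebra_simps)
      moreover have "0 \<le> lam / 2 * k\<^sup>2" using lam by simp
      ultimately show ?thesis by (simp add: algebra_simps)
    qed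
    have \<theta>\<sigma>: "- (\<nu> * (\<theta> * \<sigma>)) \<le> 0"
      using \<theta> \<sigma> by (metis abs_ge_zero mult.commute mult.left_commute mult_nonneg_nonneg neg_le_0_iff_le)
    have expand: "2 * B z (F (z + g e) - g h) + \<nu> * (h - \<psi> (z + g e) - k * r * \<nu> - \<theta> * \<sigma>) + (k - 1) * (- lam * k + r * \<nu>\<^sup>2) =
       2 * B z (F (z + g e) - g h) + \<nu> * h + (- (\<nu> * \<psi> (z + g e))) + (- (\<nu> * (\<theta> * \<sigma>))) + (- (k - 1) * lam * k) - r * \<nu>\<^sup>2"
      by (simp add: power2_eq_square algebra_simps)
    have "2 * (K * G)\<^sup>2 * (KF\<^sup>2 * e\<^sup>2 + h\<^sup>2) + \<nu>\<^sup>2 / 2 + h\<^sup>2 / 2 + P\<^sup>2 * \<nu>\<^sup>2 / 2 + P * G * (\<nu>\<^sup>2 + e\<^sup>2) / 2 \<le> C * (e\<^sup>2 + \<nu>\<^sup>2 + h\<^sup>2)"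
    proof -
      define Ke where "Ke = 2 * (K * G)\<^sup>2"
      have nn: "0 \<le> Ke" "0 \<le> KF\<^sup>2" "0 \<le> P\<^sup>2" "0 \<le> P * G" "0 \<le> e\<^sup>2" "0 \<le> \<nu>\<^sup>2" "0 \<le> h\<^sup>2"
        using P G by (auto simp: Ke_def)
      have prods: "0 \<le> Ke * KF\<^sup>2 * \<nu>\<^sup>2" "0 \<le> Ke * KF\<^sup>2 * h\<^sup>2" "0 \<le> Ke * e\<^sup>2" "0 \<le> Ke * \<nu>\<^sup>2" "0 \<le> P\<^sup>2 * e\<^sup>2" "0 \<le> P\<^sup>2 * h\<^sup>2"
        "0 \<le> P\<^sup>2 * \<nu>\<^sup>2" "0 \<le> P * G * h\<^sup>2" "0 \<le> P * G * e\<^sup>2" "0 \<le> P * G * \<nu>\<^sup>2"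
        using nn by (simp_all del: zero_le_power2)
      have "C * (e\<^sup>2 + \<nu>\<^sup>2 + h\<^sup>2) = Ke * KF\<^sup>2 * e\<^sup>2 + Ke * KF\<^sup>2 * \<nu>\<^sup>2 + Ke * KF\<^sup>2 * h\<^sup>2 + Ke * e\<^sup>2 + Ke * \<nu>\<^sup>2 + Ke * h\<^sup>2
          + e\<^sup>2 + \<nu>\<^sup>2 + h\<^sup>2 + P\<^sup>2 * e\<^sup>2 + P\<^sup>2 * \<nu>\<^sup>2 + P\<^sup>2 * h\<^sup>2 + P * G * e\<^sup>2 + P * G * \<nu>\<^sup>2 + P * G * h\<^sup>2"
        unfolding C_def Ke_def[symmetric] by (simp add: algebra_simps)
      moreover have "Ke * (KF\<^sup>2 * e\<^sup>2 + h\<^sup>2) + \<nu>\<^sup>2 / 2 + h\<^sup>2 / 2 + P\<^sup>2 * \<nu>\<^sup>2 / 2 + P * G * (\<nu>\<^sup>2 + e\<^sup>2) / 2 =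
          Ke * KF\<^sup>2 * e\<^sup>2 + Ke * h\<^sup>2 + \<nu>\<^sup>2 / 2 + h\<^sup>2 / 2 + P\<^sup>2 * \<nu>\<^sup>2 / 2 + P * G * \<nu>\<^sup>2 / 2 + P * G * e\<^sup>2 / 2"
        by (simp add: distrib_left distrib_right add_divide_distrib mult.assoc)
      ultimately show ?thesis unfolding Ke_def[symmetric] using prods nn by linarith
    qed
    then show "2 * B z (F (z + g e) - g h) + \<nu> * (h - \<psi> (z + g e) - k * r * \<nu> - \<theta> * \<sigma>) + (k - 1) * (- lam * k + r * \<nu>\<^sup>2)
      \<le> C * (e\<^sup>2 + \<nu>\<^sup>2 + h\<^sup>2) - r * \<nu>\<^sup>2 - (norm z)\<^sup>2 / 2 - lam / 2 * (k - 1)\<^sup>2 + lam / 2"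
      unfolding expand n_def[symmetric] using t1 d2 \<psi>z \<nu>h kk \<theta>\<sigma> by linarith
  qed
qed

subsection \<open>Partial derivatives of smooth functions\<close>

lemma
  fixes F :: "'a::euclidean_space \<Rightarrow> 'b::euclidean_space \<Rightarrow> 'c::real_normed_vector"
  assumes F: "smooth (\<lambda>(v, \<mu>). F v \<mu>)"
  shows smooth_partial_has_derivative:
      "((\<lambda>v. F v \<mu>) has_derivative frechet_derivative (\<lambda>v. F v \<mu>) (at v)) (at v)"
    and smooth_partial_derivative_continuous:
      "continuous_on UNIV (\<lambda>(v, \<mu>, d). frechet_derivative (\<lambda>v. F v \<mu>) (at v) d)"
    and smooth_partial_locally_lipschitz: "locally_lipschitz (\<lambda>v. F v \<mu>)"
proof -
  let ?F = "\<lambda>(v, \<mu>). F v \<mu>"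
  have D: "((\<lambda>v. F v \<mu>) has_derivative (\<lambda>d. frechet_derivative ?F (at (v, \<mu>)) (d, 0))) (at v)" for v \<mu>
  proof -
    have "((\<lambda>v. (v, \<mu>)) has_derivative (\<lambda>d. (d, 0))) (at v)"
      by (intro has_derivative_Pair has_derivative_ident has_derivative_const)
    from has_derivative_compose[OF this smooth_has_derivative[OF F]] show ?thesis by simp
  qed
  then have eq: "frechet_derivative (\<lambda>v. F v \<mu>) (at v) = (\<lambda>d. frechet_derivative ?F (at (v, \<mu>)) (d, 0))" for v \<mu>
    using frechet_derivative_at by metis
  show "((\<lambda>v. F v \<mu>) has_derivative frechet_derivative (\<lambda>v. F v \<mu>) (at v)) (at v)" for v
    unfolding eq by (rule D)
  have "continuous_on UNIV (\<lambda>q. (\<lambda>(x, h). frechet_derivative ?F (at x) h) ((fst q, fst (snd q)), (snd (snd q), 0)))"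
    by (rule continuous_on_compose2[OF smooth_derivative_continuous[OF F]]) (auto intro!: continuous_intros)
  then show "continuous_on UNIV (\<lambda>(v, \<mu>, d). frechet_derivative (\<lambda>v. F v \<mu>) (at v) d)"
    by (simp add: split_beta eq)
  have "locally_lipschitz (\<lambda>v. ?F (v, \<mu>))"
  proof (rule locally_lipschitz_compose[OF locally_lipschitz_smooth[OF F]])
    have "1-lipschitz_on (cball 0 R) (\<lambda>v::'a. (v, \<mu>))" for R
      by (rule lipschitz_onI) (auto simp: dist_Pair_Pair)
    then show "locally_lipschitz (\<lambda>v::'a. (v, \<mu>))" unfolding locally_lipschitz_def by blast
  qed
  then show "locally_lipschitz (\<lambda>v. F v \<mu>)" by simp
qed

lemma continuous_on_matrix_vector_mult:
  fixes f :: "'a::topological_space \<Rightarrow> real ^ 'w::finite ^ 'v::finite"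
  assumes "continuous_on S f" "continuous_on S g"
  shows "continuous_on S (\<lambda>x. f x *v g x)"
  unfolding matrix_vector_mult_def
  by (intro continuous_on_vec_lambda continuous_on_sum continuous_on_mult continuous_on_component assms)

subsection \<open>The error system\<close>

locale leader_follower =
  fixes p :: "real ^ 'v::finite \<Rightarrow> real ^ 'v"
    and q :: "real ^ 'v \<Rightarrow> real ^ 'w::finite ^ 'v"
    and r :: "real ^ 'v \<Rightarrow> real ^ 'm::finite \<Rightarrow> real"
    and nz no :: "'n::finite \<Rightarrow> nat"
    and f :: "'n \<Rightarrow> real ^ 'k::finite \<Rightarrow> real \<Rightarrow> real ^ 'm \<Rightarrow> real ^ 'k"
    and g :: "'n \<Rightarrow> real ^ 'k \<Rightarrow> real \<Rightarrow> real ^ 'm \<Rightarrow> real"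
    and S :: "'n \<Rightarrow> real mat"
    and D :: "'n \<Rightarrow> real ^ 'm \<Rightarrow> real mat"
    and A :: "real ^ 'n option ^ 'n option"
    and \<alpha>\<^sub>0 \<gamma>\<^sub>0 :: "real \<Rightarrow> real"
    and zs :: "'n \<Rightarrow> real ^ 'v \<Rightarrow> real ^ 'm \<Rightarrow> real ^ 'k"
    and P :: "'n \<Rightarrow> real poly"
    and G :: "'n \<Rightarrow> real mat"
    and lam :: real
  assumes p: "smooth p" and q: "smooth q" and r: "smooth (\<lambda>(v, \<mu>). r v \<mu>)"
    and f_coord: "\<And>i z y \<mu>. z \<in> coord_space (nz i) \<Longrightarrow> f i z y \<mu> \<in> coord_space (nz i)"
    and f: "\<And>i. smooth (\<lambda>(z, y, \<mu>). f i (coord_proj (nz i) z) y \<mu>)"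
    and g: "\<And>i. smooth (\<lambda>(z, y, \<mu>). g i (coord_proj (nz i) z) y \<mu>)"
    and no: "\<And>i. 0 < no i" "\<And>i. no i \<le> CARD('k)"
    and S: "\<And>i. S i \<in> carrier_mat (no i) (no i)"
    and D: "\<And>i \<mu>. D i \<mu> \<in> carrier_mat 1 (no i)"
    and A_nonneg: "\<And>i j. 0 \<le> A $ i $ j"
    and A_reach: "\<And>i. (None, Some i) \<in> (arcs A)\<^sup>*"
    and A_sym: "\<And>i j. A $ Some i $ Some j = A $ Some j $ Some i"
    and leader_bound: "\<And>w T v. admissible_input w \<Longrightarrow> 0 < T \<Longrightarrow> leader_solution p q w T v \<Longrightarrow>
           \<forall>t\<in>{0..T}. norm (v t) \<le> \<alpha>\<^sub>0 (norm (v 0)) + \<gamma>\<^sub>0 (SUP s\<in>{0..}. infnorm (w s))"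
    and zs: "\<And>i. smooth (\<lambda>(v, \<mu>). zs i v \<mu>)"
    and zs_coord: "\<And>i v \<mu>. zs i v \<mu> \<in> coord_space (nz i)"
    and regulator: "\<And>i v \<mu>. frechet_derivative (\<lambda>v. zs i v \<mu>) (at v) (p v) = f i (zs i v \<mu>) (r v \<mu>) \<mu>"
    and z_stable: "\<And>i (\<Sigma> :: ((real ^ 'v) \<times> (real ^ 'w) \<times> (real ^ 'm)) set). compact \<Sigma> \<Longrightarrow>
           \<exists>(\<gamma>\<^sub>1 :: real \<Rightarrow> real) (\<gamma>\<^sub>2 :: real ^ 'w \<Rightarrow> real) \<alpha> (V :: real ^ 'k \<Rightarrow> real) \<alpha>\<^sub>1 \<alpha>\<^sub>2 \<delta>\<^sub>1 \<delta>\<^sub>2.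
             smooth \<gamma>\<^sub>1 \<and> smooth \<gamma>\<^sub>2 \<and> class_K_inf \<alpha> \<and> smooth V \<and> class_K_inf \<alpha>\<^sub>1 \<and> class_K_inf \<alpha>\<^sub>2 \<and>
             (\<forall>zb\<in>coord_space (nz i). \<alpha>\<^sub>1 (norm zb) \<le> V zb \<and> V zb \<le> \<alpha>\<^sub>2 (norm zb)) \<and>
             (\<forall>(v, w, \<mu>)\<in>\<Sigma>. \<forall>zb\<in>coord_space (nz i). \<forall>e.
                frechet_derivative V (at zb) (f_bar (f i) r q (zs i) zb e v w \<mu>)
                  \<le> - \<alpha> (norm zb) + \<delta>\<^sub>1 * \<gamma>\<^sub>1 e + \<delta>\<^sub>2 * \<gamma>\<^sub>2 w)"
    and lam: "0 < lam"
    and P: "\<And>i. minimal_polynomial (S i) (P i)"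
    and G: "\<And>i. G i \<in> carrier_mat (degree (P i)) 1"
    and hurwitz: "\<And>i. hurwitz (F_mat (P i) (G i))"
begin

abbreviation "np i \<equiv> degree (P i)"
abbreviation "\<Psi> i \<equiv> Psi_mat (np i)"
abbreviation "F i \<equiv> F_mat (P i) (G i)"
abbreviation "H \<equiv> follower_laplacian A"

lemma np: "0 < np i" "np i \<le> CARD('k)"
  using degree_minimal_polynomial_pos[OF S no(1) P] degree_minimal_polynomial_le[OF S P] no(2) order_trans by blast+

lemma F_carrier: "F i \<in> carrier_mat (np i) (np i)"
  using G[of i] by (auto simp: F_mat_def Phi_mat_def Psi_mat_def)

lemma bounded_linear_\<Psi>: "bounded_linear (row_act (\<Psi> i) :: real ^ 'k \<Rightarrow> real)"
  by (rule bounded_linear_row_act) (simp add: Psi_mat_def)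

lemma r_continuous: "continuous_on UNIV (\<lambda>(v, \<mu>). r v \<mu>)" and zs_continuous: "continuous_on UNIV (\<lambda>(v, \<mu>). zs i v \<mu>)"
  using smooth_continuous_on[OF r] smooth_continuous_on[OF zs] by auto

text \<open>The part of the derivative of e_i that is neither control nor disturbance, in error
  coordinates.\<close>

definition h_term :: "'n \<Rightarrow> real ^ 'k \<Rightarrow> real \<Rightarrow> real ^ 'v \<Rightarrow> real ^ 'w \<Rightarrow> real ^ 'm \<Rightarrow> real" where
  "h_term i zb e v w \<mu> = g i (coord_proj (nz i) (zb + zs i v \<mu>)) (e + r v \<mu>) \<mu>
     - frechet_derivative (\<lambda>v. r v \<mu>) (at v) (p v + q v *v w)"

lemma h_term_continuous: "continuous_on UNIV (\<lambda>(zb, e, v, w, \<mu>). h_term i zb e v w \<mu>)"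
proof -
  have 1: "continuous_on UNIV (\<lambda>x :: (real ^ 'k) \<times> real \<times> (real ^ 'v) \<times> (real ^ 'w) \<times> (real ^ 'm).
      (\<lambda>(v, \<mu>). zs i v \<mu>) (fst (snd (snd x)), snd (snd (snd (snd x)))))"
    by (rule continuous_on_compose2[OF zs_continuous[of i]]) (auto intro!: continuous_intros)
  have 2: "continuous_on UNIV (\<lambda>x :: (real ^ 'k) \<times> real \<times> (real ^ 'v) \<times> (real ^ 'w) \<times> (real ^ 'm).
      (\<lambda>(v, \<mu>). r v \<mu>) (fst (snd (snd x)), snd (snd (snd (snd x)))))"
    by (rule continuous_on_compose2[OF r_continuous]) (auto intro!: continuous_intros)
  have 3: "continuous_on UNIV (\<lambda>x :: (real ^ 'k) \<times> real \<times> (real ^ 'v) \<times> (real ^ 'w) \<times> (real ^ 'm). p (fst (snd (snd x))))"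
    by (rule continuous_on_compose2[OF smooth_continuous_on[OF p]]) (auto intro!: continuous_intros)
  have 4: "continuous_on UNIV (\<lambda>x :: (real ^ 'k) \<times> real \<times> (real ^ 'v) \<times> (real ^ 'w) \<times> (real ^ 'm). q (fst (snd (snd x))))"
    by (rule continuous_on_compose2[OF smooth_continuous_on[OF q]]) (auto intro!: continuous_intros)
  have "continuous_on UNIV (\<lambda>x :: (real ^ 'k) \<times> real \<times> (real ^ 'v) \<times> (real ^ 'w) \<times> (real ^ 'm).
      (\<lambda>(z, y, \<mu>). g i (coord_proj (nz i) z) y \<mu>)
        (fst x + (\<lambda>(v, \<mu>). zs i v \<mu>) (fst (snd (snd x)), snd (snd (snd (snd x)))),
         fst (snd x) + (\<lambda>(v, \<mu>). r v \<mu>) (fst (snd (snd x)), snd (snd (snd (snd x)))),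
         snd (snd (snd (snd x))))
    - (\<lambda>(v, \<mu>, d). frechet_derivative (\<lambda>v. r v \<mu>) (at v) d)
        (fst (snd (snd x)), snd (snd (snd (snd x))),
         p (fst (snd (snd x))) + q (fst (snd (snd x))) *v fst (snd (snd (snd x)))))"
    by (intro continuous_on_diff continuous_on_compose2[OF smooth_continuous_on[OF g[of i]]]
        continuous_on_compose2[OF smooth_partial_derivative_continuous[OF r]]
        continuous_on_Pair continuous_on_add 1 2 3 4 continuous_on_matrix_vector_mult
        continuous_on_fst continuous_on_snd continuous_on_id) auto
  then show ?thesis by (simp add: h_term_def split_beta)
qed

text \<open>The contribution of follower \<open>i\<close> to the derivative of the Lyapunov function; \<open>\<nu>\<close> and \<open>\<rho>\<close> stand for
  \<open>e\<^sub>v\<^sub>i\<close> and \<open>\<rho>\<^sub>i(e\<^sub>v\<^sub>i)\<close>, and \<open>\<sigma>\<close> for the Filippov value of \<open>sgn(e\<^sub>v\<^sub>i)\<close>.\<close>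

definition rate :: "'n \<Rightarrow> (real ^ 'k \<Rightarrow> real ^ 'k \<Rightarrow> real) \<Rightarrow> (real ^ 'k \<Rightarrow> real ^ 'k \<Rightarrow> real) \<Rightarrow> real ^ 'k \<Rightarrow> real ^ 'k \<Rightarrow>
    real \<Rightarrow> real \<Rightarrow> real \<Rightarrow> real \<Rightarrow> real \<Rightarrow> real \<Rightarrow> real ^ 'v \<Rightarrow> real ^ 'w \<Rightarrow> real ^ 'm \<Rightarrow> real" where
  "rate i U' B zb x e \<nu> k \<rho> \<theta> \<sigma> v w \<mu> = U' zb (f_bar (f i) r q (zs i) zb e v w \<mu>)
     + (2 * B x (mat_act (F i) (x + col_act (G i) e) - col_act (G i) (h_term i zb e v w \<mu>))
        + \<nu> * (h_term i zb e v w \<mu> - row_act (\<Psi> i) (x + col_act (G i) e) - k * \<rho> * \<nu> - \<theta> * \<sigma>)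
        + (k - 1) * (- lam * k + \<rho> * \<nu>\<^sup>2))"

text \<open>Here \<rho> is a number, quantified after \<Theta>: neither the functions nor the bound
  depend on the gain. This is what permits choosing the gain function after the data. The index m
  bounds both e and \<nu>, because U is driven by e while the control acts through \<nu>.\<close>

definition lyapunov_data where
  "lyapunov_data i \<Sigma> U U' B \<Theta> \<longleftrightarrow>
     (\<forall>x. (U has_derivative U' x) (at x)) \<and> locally_lipschitz U \<and>
     (\<forall>x\<in>coord_space (nz i). 0 \<le> U x) \<and> (\<forall>c. \<exists>R. \<forall>x\<in>coord_space (nz i). U x \<le> c \<longrightarrow> norm x \<le> R) \<and>
     bounded_bilinear B \<and> (\<forall>x y. B x y = B y x) \<and> (\<exists>c>0. \<forall>x\<in>coord_space (np i). c * (norm x)\<^sup>2 \<le> B x x) \<and>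
     (\<forall>(m :: nat) zb x e \<nu> k \<rho> \<theta> \<sigma> v w \<mu>. zb \<in> coord_space (nz i) \<longrightarrow> x \<in> coord_space (np i) \<longrightarrow> (v, w, \<mu>) \<in> \<Sigma> \<longrightarrow>
        \<bar>e\<bar> \<le> real m \<longrightarrow> \<bar>\<nu>\<bar> \<le> real m \<longrightarrow> 0 \<le> \<theta> \<longrightarrow> \<sigma> * \<nu> = \<bar>\<nu>\<bar> \<longrightarrow>
        rate i U' B zb x e \<nu> k \<rho> \<theta> \<sigma> v w \<mu>
          \<le> \<Theta> m - \<rho> * \<nu>\<^sup>2 - norm zb - (norm x)\<^sup>2 / 2 - lam / 2 * (k - 1)\<^sup>2)"

lemma lyapunov_data_rate:
  assumes "lyapunov_data i \<Sigma> U U' B \<Theta>" "zb \<in> coord_space (nz i)" "x \<in> coord_space (np i)" "(v, w, \<mu>) \<in> \<Sigma>"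
    "\<bar>e\<bar> \<le> real m" "\<bar>\<nu>\<bar> \<le> real m" "0 \<le> \<theta>" "\<sigma> * \<nu> = \<bar>\<nu>\<bar>"
  shows "rate i U' B zb x e \<nu> k \<rho> \<theta> \<sigma> v w \<mu>
    \<le> \<Theta> m - \<rho> * \<nu>\<^sup>2 - norm zb - (norm x)\<^sup>2 / 2 - lam / 2 * (k - 1)\<^sup>2"
  using assms unfolding lyapunov_data_def by simp

lemma lyapunov_data_exists:
  assumes \<Sigma>: "compact \<Sigma>"
  shows "\<exists>U U' B \<Theta>. lyapunov_data i \<Sigma> U U' B \<Theta>"
proof -
  obtain B :: "real ^ 'k \<Rightarrow> real ^ 'k \<Rightarrow> real" and c where B: "bounded_bilinear B" "\<And>x y. B x y = B y x" "0 < c"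
    "\<And>x. x \<in> coord_space (np i) \<Longrightarrow> c * (norm x)\<^sup>2 \<le> B x x"
    "\<And>x. x \<in> coord_space (np i) \<Longrightarrow> B x (mat_act (F i) x) \<le> - (norm x)\<^sup>2"
    using hurwitz_quadratic_form[OF F_carrier np hurwitz] by metis
  obtain C where C: "0 \<le> C" "\<And>x e \<nu> h k \<rho> \<theta> \<sigma> lam. \<lbrakk>x \<in> coord_space (np i); 0 < lam; 0 \<le> \<theta>; \<sigma> * \<nu> = \<bar>\<nu>\<bar>\<rbrakk> \<Longrightarrow>
      2 * B x (mat_act (F i) (x + col_act (G i) e) - col_act (G i) h) + \<nu> * (h - row_act (\<Psi> i) (x + col_act (G i) e) - k * \<rho> * \<nu> - \<theta> * \<sigma>)
        + (k - 1) * (- lam * k + \<rho> * \<nu>\<^sup>2)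
      \<le> C * (e\<^sup>2 + \<nu>\<^sup>2 + h\<^sup>2) - \<rho> * \<nu>\<^sup>2 - (norm x)\<^sup>2 / 2 - lam / 2 * (k - 1)\<^sup>2 + lam / 2"
    using coupling_bound[OF B(1,5) bounded_linear_mat_act bounded_linear_col_act bounded_linear_\<Psi>] by blast
  obtain \<gamma>\<^sub>1 :: "real \<Rightarrow> real" and \<gamma>\<^sub>2 :: "real ^ 'w \<Rightarrow> real" and \<alpha> and V :: "real ^ 'k \<Rightarrow> real" and \<alpha>\<^sub>1 \<alpha>\<^sub>2 \<delta>\<^sub>1 \<delta>\<^sub>2
    where V0: "smooth \<gamma>\<^sub>1 \<and> smooth \<gamma>\<^sub>2 \<and> class_K_inf \<alpha> \<and> smooth V \<and> class_K_inf \<alpha>\<^sub>1 \<and> class_K_inf \<alpha>\<^sub>2 \<and>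
             (\<forall>zb\<in>coord_space (nz i). \<alpha>\<^sub>1 (norm zb) \<le> V zb \<and> V zb \<le> \<alpha>\<^sub>2 (norm zb)) \<and>
             (\<forall>(v, w, \<mu>)\<in>\<Sigma>. \<forall>zb\<in>coord_space (nz i). \<forall>e.
                frechet_derivative V (at zb) (f_bar (f i) r q (zs i) zb e v w \<mu>)
                  \<le> - \<alpha> (norm zb) + \<delta>\<^sub>1 * \<gamma>\<^sub>1 e + \<delta>\<^sub>2 * \<gamma>\<^sub>2 w)"
    using z_stable[OF \<Sigma>, of i] by (elim exE) (rule that)
  then have V: "smooth \<gamma>\<^sub>1" "smooth \<gamma>\<^sub>2" "class_K_inf \<alpha>" "smooth V" "class_K_inf \<alpha>\<^sub>1" "class_K_inf \<alpha>\<^sub>2"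
      "\<And>zb. zb \<in> coord_space (nz i) \<Longrightarrow> \<alpha>\<^sub>1 (norm zb) \<le> V zb \<and> V zb \<le> \<alpha>\<^sub>2 (norm zb)"
      "\<And>v w \<mu> zb e. (v, w, \<mu>) \<in> \<Sigma> \<Longrightarrow> zb \<in> coord_space (nz i) \<Longrightarrow>
          frechet_derivative V (at zb) (f_bar (f i) r q (zs i) zb e v w \<mu>) \<le> - \<alpha> (norm zb) + \<delta>\<^sub>1 * \<gamma>\<^sub>1 e + \<delta>\<^sub>2 * \<gamma>\<^sub>2 w"
    by blast+
  define \<Gamma> where "\<Gamma> e s = \<delta>\<^sub>1 * \<gamma>\<^sub>1 e + \<delta>\<^sub>2 * \<gamma>\<^sub>2 (fst (snd s))" for e and s :: "(real ^ 'v) \<times> (real ^ 'w) \<times> (real ^ 'm)"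
  define fb where "fb zb e s = f_bar (f i) r q (zs i) zb e (fst s) (fst (snd s)) (snd (snd s))"
    for zb e and s :: "(real ^ 'v) \<times> (real ^ 'w) \<times> (real ^ 'm)"
  \<comment> \<open>The first summand cancels the square that the coupling estimate leaves over; the
    second one leaves -norm zb as decay in zb.\<close>
  define h where "h zb e s = C * (h_term i zb e (fst s) (fst (snd s)) (snd (snd s)))\<^sup>2 + norm zb"
    for zb e and s :: "(real ^ 'v) \<times> (real ^ 'w) \<times> (real ^ 'm)"
  have "continuous_on UNIV (\<lambda>(e, s). \<Gamma> e s)"
    unfolding \<Gamma>_def split_beta
    by (intro continuous_intros continuous_on_compose2[OF smooth_continuous_on[OF V(1)]]
        continuous_on_compose2[OF smooth_continuous_on[OF V(2)]]) auto
  moreover have "continuous_on UNIV (\<lambda>(zb, e, s). h zb e s)"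
  proof -
    have "continuous_on UNIV (\<lambda>x. C * ((\<lambda>(zb, e, v, w, \<mu>). h_term i zb e v w \<mu>) x)\<^sup>2 + norm (fst x))"
      by (intro continuous_intros h_term_continuous)
    then show ?thesis by (simp add: h_def split_beta)
  qed
  moreover have "frechet_derivative V (at x) (fb x e s) \<le> - \<alpha> (norm x) + \<Gamma> e s"
    if "x \<in> coord_space (nz i)" "s \<in> \<Sigma>" for x e s
    using V(8)[of "fst s" "fst (snd s)" "snd (snd s)" x e] that by (simp add: fb_def \<Gamma>_def)
  ultimately obtain U U' \<Theta> where U: "\<And>x. (U has_derivative U' x) (at x)" "locally_lipschitz U"
    "\<And>x. x \<in> coord_space (nz i) \<Longrightarrow> \<alpha>\<^sub>1 (norm x) \<le> U x"
    "\<And>m x e s. x \<in> coord_space (nz i) \<Longrightarrow> s \<in> \<Sigma> \<Longrightarrow> \<bar>e\<bar> \<le> real m \<Longrightarrow> U' x (fb x e s) + h x e s \<le> \<Theta> m"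
    using change_of_supply[where fb = fb and h = h and \<Gamma> = \<Gamma> and Z = "coord_space (nz i)" and \<Sigma> = \<Sigma>, OF V(4,3,5,6,7) \<Sigma>] by blast
  define \<Theta>' where "\<Theta>' m = \<Theta> m + C * (2 * (real m)\<^sup>2) + lam / 2" for m :: nat
  have "lyapunov_data i \<Sigma> U U' B \<Theta>'"
    unfolding lyapunov_data_def
  proof (intro conjI allI impI ballI)
    show "0 \<le> U x" if "x \<in> coord_space (nz i)" for x
      using U(3)[OF that] class_K_inf_nonneg[OF V(5), of "norm x"] by simp
    show "\<exists>R. \<forall>x\<in>coord_space (nz i). U x \<le> c \<longrightarrow> norm x \<le> R" for c
    proof -
      obtain n :: nat where n: "\<And>s. real n \<le> s \<Longrightarrow> c + 1 \<le> \<alpha>\<^sub>1 s"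
        by (rule class_K_inf_eventually_ge[OF V(5), where c = "c + 1"]) blast
      have "norm x \<le> real n" if "x \<in> coord_space (nz i)" "U x \<le> c" for x
        using n[of "norm x"] U(3)[OF that(1)] that(2) by linarith
      then show ?thesis by blast
    qed
    show "\<exists>c>0. \<forall>x\<in>coord_space (np i). c * (norm x)\<^sup>2 \<le> B x x" using B(3,4) by blast
    fix m :: nat and zb x :: "real ^ 'k" and e \<nu> k \<rho> \<theta> \<sigma> :: real and v w \<mu>
    assume zb: "zb \<in> coord_space (nz i)" and x: "x \<in> coord_space (np i)" and s: "(v, w, \<mu>) \<in> \<Sigma>"
      and e: "\<bar>e\<bar> \<le> real m" and \<nu>: "\<bar>\<nu>\<bar> \<le> real m" and \<theta>: "0 \<le> \<theta>" and \<sigma>: "\<sigma> * \<nu> = \<bar>\<nu>\<bar>"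
    have "e\<^sup>2 \<le> (real m)\<^sup>2" "\<nu>\<^sup>2 \<le> (real m)\<^sup>2" using e \<nu> by (simp_all add: abs_le_square_iff[symmetric])
    then have "C * (e\<^sup>2 + \<nu>\<^sup>2) \<le> C * (2 * (real m)\<^sup>2)" using C(1) by (intro mult_left_mono) auto
    moreover have "U' zb (f_bar (f i) r q (zs i) zb e v w \<mu>) + (C * (h_term i zb e v w \<mu>)\<^sup>2 + norm zb) \<le> \<Theta> m"
      using U(4)[OF zb s e] by (simp add: fb_def h_def)
    ultimately show "rate i U' B zb x e \<nu> k \<rho> \<theta> \<sigma> v w \<mu>
        \<le> \<Theta>' m - \<rho> * \<nu>\<^sup>2 - norm zb - (norm x)\<^sup>2 / 2 - lam / 2 * (k - 1)\<^sup>2"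
      using C(2)[OF x lam \<theta> \<sigma>, of e "h_term i zb e v w \<mu>" k \<rho>]
      unfolding rate_def \<Theta>'_def distrib_left by linarith
  qed (use U(1,2) B(1,2) in auto)
  then show ?thesis by blast
qed

text \<open>H is injective on a finite-dimensional space, hence bounded below. It converts a bound
  for all virtual errors into one for all tracking errors; c is a natural number so that c m can
  again serve as an index of \<Theta>.\<close>

lemma laplacian_inverse_bound:
  obtains c :: nat where "1 \<le> c" "\<And>e s i. (\<And>j. \<bar>H e $ j\<bar> \<le> s) \<Longrightarrow> \<bar>e $ i\<bar> \<le> real c * s"
proof -
  obtain b where b: "b > 0" "\<And>e. b * norm e \<le> norm (H e)"
    using linear_inj_bounded_below_pos[OF linear_follower_laplacian follower_laplacian_inj[OF A_nonneg A_reach A_sym]] by metis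
  define c where "c = Suc (nat \<lceil>real CARD('n) / b\<rceil>)"
  show ?thesis
  proof
    show "1 \<le> c" by (simp add: c_def)
    fix e s i assume s: "\<And>j. \<bar>H e $ j\<bar> \<le> s"
    have "0 \<le> s" using s[of i] by linarith
    have "norm (H e) \<le> (\<Sum>j\<in>UNIV. \<bar>H e $ j\<bar>)" by (rule norm_le_l1_cart)
    also have "\<dots> \<le> real CARD('n) * s" using sum_mono[of UNIV "\<lambda>j. \<bar>H e $ j\<bar>" "\<lambda>_. s"] s by simp
    finally have "b * norm e \<le> real CARD('n) * s" using b(2)[of e] by linarith
    then have "norm e \<le> (real CARD('n) / b) * s" using b(1) by (simp add: field_simps)
    also have "\<dots> \<le> real c * s"
    proof (rule mult_right_mono[OF _ \<open>0 \<le> s\<close>])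
      have "real CARD('n) / b \<le> real (nat \<lceil>real CARD('n) / b\<rceil>)" by (rule real_nat_ceiling_ge)
      then show "real CARD('n) / b \<le> real c" unfolding c_def by linarith
    qed
    finally show "\<bar>e $ i\<bar> \<le> real c * s" using component_le_norm_cart[of e i] by linarith
  qed
qed

text \<open>N is quantified under the fixed \<rho>: one gain serves every ball, and only U, B and C
  change with it. The term with an arbitrary j makes the right side tend to minus infinity with the
  virtual errors too, so that it is positive on a bounded set only.\<close>

definition gain_function :: "(real \<Rightarrow> real) \<Rightarrow> bool" where
  "gain_function \<rho> \<longleftrightarrow> (\<forall>N. \<exists>U U' B C. (\<forall>i. \<exists>\<Theta>. lyapunov_data i (cball 0 (real N)) (U i) (U' i) (B i) \<Theta>) \<and>
      (\<forall>zb x (e :: real ^ 'n) (k :: real ^ 'n) (\<theta> :: real ^ 'n) (\<sigma> :: real ^ 'n) v w \<mu> j.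
        (\<forall>i. zb i \<in> coord_space (nz i) \<and> x i \<in> coord_space (np i) \<and> 0 \<le> \<theta> $ i \<and> \<sigma> $ i * H e $ i = \<bar>H e $ i\<bar>) \<longrightarrow>
        (v, w, \<mu>) \<in> cball 0 (real N) \<longrightarrow>
        (\<Sum>i\<in>UNIV. rate i (U' i) (B i) (zb i) (x i) (e $ i) (H e $ i) (k $ i) (\<rho> (H e $ i)) (\<theta> $ i) (\<sigma> $ i) v w \<mu>)
        \<le> C - (\<Sum>i\<in>UNIV. norm (zb i) + (norm (x i))\<^sup>2 / 2 + lam / 2 * (k $ i - 1)\<^sup>2) - \<bar>H e $ j\<bar>))"

text \<open>The compact sets that occur are covered by the balls of radius \<open>N\<close>; the gain function has to
  dominate the bound for the \<open>N\<close>-th ball only where its argument exceeds \<open>N\<close>.\<close>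

lemma gain_function_exists:
  obtains \<rho> :: "real \<Rightarrow> real" where "smooth \<rho>" "\<And>s. 0 < \<rho> s"
    "gain_function \<rho>"
proof -
  have "\<forall>Ni. \<exists>d. lyapunov_data (snd Ni) (cball 0 (real (fst Ni))) (fst d) (fst (snd d)) (fst (snd (snd d))) (snd (snd (snd d)))"
    using lyapunov_data_exists[OF compact_cball] by fastforce
  from choice[OF this] obtain d where d: "\<And>Ni. lyapunov_data (snd Ni) (cball 0 (real (fst Ni))) (fst (d Ni)) (fst (snd (d Ni)))
      (fst (snd (snd (d Ni)))) (snd (snd (snd (d Ni))))" by blast
  define U where "U N i = fst (d (N, i))" for N i
  define U' where "U' N i = fst (snd (d (N, i)))" for N i
  define B where "B N i = fst (snd (snd (d (N, i))))" for N i
  define \<Theta> where "\<Theta> N i = snd (snd (snd (d (N, i))))" for N i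
  have L: "lyapunov_data i (cball 0 (real N)) (U N i) (U' N i) (B N i) (\<Theta> N i)" for N i
    using d[of "(N, i)"] by (simp add: U_def U'_def B_def \<Theta>_def)
  obtain c :: nat where c: "1 \<le> c" "\<And>e s i. (\<And>j. \<bar>H e $ j\<bar> \<le> s) \<Longrightarrow> \<bar>e $ i\<bar> \<le> real c * s"
    using laplacian_inverse_bound by metis
  \<comment> \<open>The total price for all followers when every virtual error is at most m, and
    hence every tracking error at most c m.\<close>
  define T where "T N m = (\<Sum>i\<in>UNIV. \<bar>\<Theta> N i (c * m)\<bar>)" for N m
  have T0: "0 \<le> T N m" for N m by (simp add: T_def sum_nonneg)
  \<comment> \<open>Diagonal choice: at |s| the gain beats the bounds of all balls N up to the
    integer part of |s|. The extra summands leave room for the decay -|\<nu>_j|.\<close>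
  obtain \<rho> :: "real \<Rightarrow> real" where \<rho>: "smooth \<rho>" "\<And>s. 1 \<le> \<rho> s"
    "\<And>s. (\<Sum>N\<le>nat \<lfloor>\<bar>s\<bar>\<rfloor>. T N (nat \<lfloor>\<bar>s\<bar>\<rfloor> + 1) + real (nat \<lfloor>\<bar>s\<bar>\<rfloor>) + 1) \<le> \<rho> s"
    using smooth_dominating[of "\<lambda>j. \<Sum>N\<le>j. T N (j + 1) + real j + 1"] by blast
  have "gain_function \<rho>"
    unfolding gain_function_def
  proof
    fix N
    \<comment> \<open>It covers the finitely many levels m below which \<rho> does not yet see the
      N-th ball, together with the size of the virtual errors there.\<close>
    define C where "C = (\<Sum>m\<le>N + 2. T N m) + real N + 2"
    have bound: "(\<Sum>i\<in>UNIV. rate i (U' N i) (B N i) (zb i) (x i) (e $ i) (H e $ i) (k $ i) (\<rho> (H e $ i)) (\<theta> $ i) (\<sigma> $ i) v w \<mu>)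
        \<le> C - (\<Sum>i\<in>UNIV. norm (zb i) + (norm (x i))\<^sup>2 / 2 + lam / 2 * (k $ i - 1)\<^sup>2) - \<bar>H e $ j0\<bar>"
      if *: "\<forall>i. zb i \<in> coord_space (nz i) \<and> x i \<in> coord_space (np i) \<and> 0 \<le> \<theta> $ i \<and> \<sigma> $ i * H e $ i = \<bar>H e $ i\<bar>"
        and s: "(v, w, \<mu>) \<in> cball 0 (real N)" for zb x and e k \<theta> \<sigma> :: "real ^ 'n" and v w \<mu> j0
    proof -
      define Q where "Q = (\<Sum>i\<in>UNIV. norm (zb i) + (norm (x i))\<^sup>2 / 2 + lam / 2 * (k $ i - 1)\<^sup>2)"
      define M where "M = Max (range (\<lambda>j. \<bar>H e $ j\<bar>))"
      have M: "\<And>j. \<bar>H e $ j\<bar> \<le> M" unfolding M_def by (intro Max_ge) auto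
      have "M \<in> range (\<lambda>j. \<bar>H e $ j\<bar>)" unfolding M_def by (intro Max_in) auto
      then obtain j where j: "M = \<bar>H e $ j\<bar>" by auto
      define m where "m = nat \<lfloor>M\<rfloor> + 1"
      have "0 \<le> M" using j by simp
      then have Mm: "M \<le> real m" "real (nat \<lfloor>M\<rfloor>) \<le> M" unfolding m_def by linarith+
      have cm: "\<bar>H e $ i\<bar> \<le> real (c * m)" "\<bar>e $ i\<bar> \<le> real (c * m)" for i
      proof -
        have "real m \<le> real c * real m" using c(1) mult_right_mono[of 1 "real c" "real m"] by simp
        then show "\<bar>H e $ i\<bar> \<le> real (c * m)" using M[of i] Mm by simp
        have "\<bar>e $ i\<bar> \<le> real c * M" by (rule c(2)[OF M])
        also have "\<dots> \<le> real c * real m" using Mm by (intro mult_left_mono) auto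
        finally show "\<bar>e $ i\<bar> \<le> real (c * m)" by simp
      qed
      have "rate i (U' N i) (B N i) (zb i) (x i) (e $ i) (H e $ i) (k $ i) (\<rho> (H e $ i)) (\<theta> $ i) (\<sigma> $ i) v w \<mu>
          \<le> \<bar>\<Theta> N i (c * m)\<bar> - \<rho> (H e $ i) * (H e $ i)\<^sup>2 - (norm (zb i) + (norm (x i))\<^sup>2 / 2 + lam / 2 * (k $ i - 1)\<^sup>2)" for i
      proof -
        have "rate i (U' N i) (B N i) (zb i) (x i) (e $ i) (H e $ i) (k $ i) (\<rho> (H e $ i)) (\<theta> $ i) (\<sigma> $ i) v w \<mu>
          \<le> \<Theta> N i (c * m) - \<rho> (H e $ i) * (H e $ i)\<^sup>2 - norm (zb i) - (norm (x i))\<^sup>2 / 2 - lam / 2 * (k $ i - 1)\<^sup>2"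
          by (rule lyapunov_data_rate[OF L _ _ s cm(2,1)]) (use * in auto)
        then show ?thesis by linarith
      qed
      then have "(\<Sum>i\<in>UNIV. rate i (U' N i) (B N i) (zb i) (x i) (e $ i) (H e $ i) (k $ i) (\<rho> (H e $ i)) (\<theta> $ i) (\<sigma> $ i) v w \<mu>)
          \<le> (\<Sum>i\<in>UNIV. \<bar>\<Theta> N i (c * m)\<bar> - \<rho> (H e $ i) * (H e $ i)\<^sup>2 - (norm (zb i) + (norm (x i))\<^sup>2 / 2 + lam / 2 * (k $ i - 1)\<^sup>2))"
        by (rule sum_mono)
      also have "\<dots> = T N m - (\<Sum>i\<in>UNIV. \<rho> (H e $ i) * (H e $ i)\<^sup>2) - Q"
        by (simp only: sum_subtractf T_def Q_def)
      also have "T N m - (\<Sum>i\<in>UNIV. \<rho> (H e $ i) * (H e $ i)\<^sup>2) \<le> C - M"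
      proof -
        have \<rho>0: "0 \<le> \<rho> s" for s using \<rho>(2)[of s] by linarith
        have big: "\<rho> (H e $ j) * M\<^sup>2 \<le> (\<Sum>i\<in>UNIV. \<rho> (H e $ i) * (H e $ i)\<^sup>2)"
          using member_le_sum[of j UNIV "\<lambda>i. \<rho> (H e $ i) * (H e $ i)\<^sup>2"] \<rho>0 by (simp add: j)
        have "0 \<le> \<rho> (H e $ j) * M\<^sup>2" using \<rho>0 by simp
        have C0: "0 \<le> C" unfolding C_def using T0 by (simp add: sum_nonneg)
        show ?thesis
        \<comment> \<open>The largest virtual error M alone has to pay for everything. The 1 ensures
          M \<ge> 1, so that \<rho> M^2 is at least \<rho>.\<close>
        proof (cases "max N 1 \<le> nat \<lfloor>M\<rfloor>")
          case True
          have "1 \<le> M" using True Mm(2) by linarith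
          have "T N (nat \<lfloor>M\<rfloor> + 1) + real (nat \<lfloor>M\<rfloor>) + 1 \<le> (\<Sum>N\<le>nat \<lfloor>M\<rfloor>. T N (nat \<lfloor>M\<rfloor> + 1) + real (nat \<lfloor>M\<rfloor>) + 1)"
            by (rule member_le_sum[of N "{..nat \<lfloor>M\<rfloor>}" "\<lambda>N. T N (nat \<lfloor>M\<rfloor> + 1) + real (nat \<lfloor>M\<rfloor>) + 1"])
              (use True T0 in \<open>auto intro!: add_nonneg_nonneg\<close>)
          also have "\<dots> \<le> \<rho> (H e $ j)" using \<rho>(3)[of "H e $ j"] by (simp add: j)
          also have "\<dots> \<le> \<rho> (H e $ j) * M\<^sup>2"
            using mult_left_mono[OF one_le_power[OF \<open>1 \<le> M\<close>, of 2] \<rho>0[of "H e $ j"]] by simp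
          finally have "T N m + M \<le> \<rho> (H e $ j) * M\<^sup>2" using Mm(1) by (simp add: m_def)
          then show ?thesis using big C0 by linarith
        next
          case False
          then have "m \<le> N + 2" by (auto simp: m_def)
          then have "T N m \<le> (\<Sum>m\<le>N + 2. T N m)" using T0 by (intro member_le_sum) auto
          moreover have "M \<le> real N + 2" using Mm(1) \<open>m \<le> N + 2\<close> by linarith
          ultimately show ?thesis using big \<open>0 \<le> \<rho> (H e $ j) * M\<^sup>2\<close> by (simp add: C_def)
        qed
      qed
      finally show ?thesis using M[of j0] by (simp add: Q_def)
    qed
    show "\<exists>U U' B C. (\<forall>i. \<exists>\<Theta>. lyapunov_data i (cball 0 (real N)) (U i) (U' i) (B i) \<Theta>) \<and>
      (\<forall>zb x (e :: real ^ 'n) (k :: real ^ 'n) (\<theta> :: real ^ 'n) (\<sigma> :: real ^ 'n) v w \<mu> j.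
        (\<forall>i. zb i \<in> coord_space (nz i) \<and> x i \<in> coord_space (np i) \<and> 0 \<le> \<theta> $ i \<and> \<sigma> $ i * H e $ i = \<bar>H e $ i\<bar>) \<longrightarrow>
        (v, w, \<mu>) \<in> cball 0 (real N) \<longrightarrow>
        (\<Sum>i\<in>UNIV. rate i (U' i) (B i) (zb i) (x i) (e $ i) (H e $ i) (k $ i) (\<rho> (H e $ i)) (\<theta> $ i) (\<sigma> $ i) v w \<mu>)
        \<le> C - (\<Sum>i\<in>UNIV. norm (zb i) + (norm (x i))\<^sup>2 / 2 + lam / 2 * (k $ i - 1)\<^sup>2) - \<bar>H e $ j\<bar>)"
    proof (rule exI[of _ "U N"], rule exI[of _ "U' N"], rule exI[of _ "B N"], rule exI[of _ C], intro conjI)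
      show "\<forall>i. \<exists>\<Theta>. lyapunov_data i (cball 0 (real N)) (U N i) (U' N i) (B N i) \<Theta>" using L by blast
    qed (intro allI impI, rule bound)
  qed
  moreover have "0 < \<rho> s" for s using \<rho>(2)[of s] by linarith
  ultimately show ?thesis using \<rho>(1) that by blast
qed

end

subsection \<open>The closed loop in error coordinates\<close>

locale closed_loop_run = leader_follower p q r nz no f g S D A \<alpha>\<^sub>0 \<gamma>\<^sub>0 zs P G lam
  for p :: "real ^ 'v::finite \<Rightarrow> real ^ 'v"
    and q :: "real ^ 'v \<Rightarrow> real ^ 'w::finite ^ 'v"
    and r :: "real ^ 'v \<Rightarrow> real ^ 'm::finite \<Rightarrow> real"
    and nz no :: "'n::finite \<Rightarrow> nat"
    and f :: "'n \<Rightarrow> real ^ 'k::finite \<Rightarrow> real \<Rightarrow> real ^ 'm \<Rightarrow> real ^ 'k"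
    and g :: "'n \<Rightarrow> real ^ 'k \<Rightarrow> real \<Rightarrow> real ^ 'm \<Rightarrow> real"
    and S :: "'n \<Rightarrow> real mat"
    and D :: "'n \<Rightarrow> real ^ 'm \<Rightarrow> real mat"
    and A :: "real ^ 'n option ^ 'n option"
    and \<alpha>\<^sub>0 \<gamma>\<^sub>0 :: "real \<Rightarrow> real"
    and zs :: "'n \<Rightarrow> real ^ 'v \<Rightarrow> real ^ 'm \<Rightarrow> real ^ 'k"
    and P :: "'n \<Rightarrow> real poly"
    and G :: "'n \<Rightarrow> real mat"
    and lam :: real +
  fixes \<rho> :: "real \<Rightarrow> real" and \<mu> :: "real ^ 'm" and w :: "real \<Rightarrow> real ^ 'w"
  assumes \<rho>: "smooth \<rho>" and w: "admissible_input w"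
begin

abbreviation vS :: "('v, 'k, 'n) state \<Rightarrow> real ^ 'v" where "vS X \<equiv> fst X"
abbreviation zS :: "('v, 'k, 'n) state \<Rightarrow> real ^ 'k ^ 'n" where "zS X \<equiv> fst (snd X)"
abbreviation yS :: "('v, 'k, 'n) state \<Rightarrow> real ^ 'n" where "yS X \<equiv> fst (snd (snd X))"
abbreviation \<omega>S :: "('v, 'k, 'n) state \<Rightarrow> real ^ 'k ^ 'n" where "\<omega>S X \<equiv> fst (snd (snd (snd X)))"
abbreviation \<eta>S :: "('v, 'k, 'n) state \<Rightarrow> real ^ 'k ^ 'n" where "\<eta>S X \<equiv> fst (snd (snd (snd (snd X))))"
abbreviation kS :: "('v, 'k, 'n) state \<Rightarrow> real ^ 'n" where "kS X \<equiv> fst (snd (snd (snd (snd (snd X)))))"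
abbreviation \<theta>S :: "('v, 'k, 'n) state \<Rightarrow> real ^ 'n" where "\<theta>S X \<equiv> snd (snd (snd (snd (snd (snd X)))))"

definition err :: "('v, 'k, 'n) state \<Rightarrow> real ^ 'n" where
  "err X = (\<chi> i. yS X $ i - r (vS X) \<mu>)"

abbreviation \<nu> :: "('v, 'k, 'n) state \<Rightarrow> real ^ 'n" where "\<nu> X \<equiv> H (err X)"

definition control :: "'n \<Rightarrow> ('v, 'k, 'n) state \<Rightarrow> real \<Rightarrow> real" where
  "control i X s = - row_act (\<Psi> i) (\<eta>S X $ i) - kS X $ i * \<rho> (\<nu> X $ i) * \<nu> X $ i - \<theta>S X $ i * s"

text \<open>The closed loop with \<open>\<sigma>\<close> in place of the vector of the signs of the virtual errors.\<close>

definition sfield :: "('v, 'k, 'n) state \<Rightarrow> real ^ 'n \<Rightarrow> real ^ 'w \<Rightarrow> ('v, 'k, 'n) state" where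
  "sfield X \<sigma> w' = (p (vS X) + q (vS X) *v w',
     \<chi> i. f i (coord_proj (nz i) (zS X $ i)) (yS X $ i) \<mu>,
     \<chi> i. g i (coord_proj (nz i) (zS X $ i)) (yS X $ i) \<mu> + control i X (\<sigma> $ i) + row_act (D i \<mu>) (\<omega>S X $ i),
     \<chi> i. mat_act (S i) (\<omega>S X $ i),
     \<chi> i. mat_act (F i) (\<eta>S X $ i) + col_act (G i) (control i X (\<sigma> $ i)),
     \<chi> i. - lam * kS X $ i + \<rho> (\<nu> X $ i) * (\<nu> X $ i)\<^sup>2,
     \<chi> i. \<bar>\<nu> X $ i\<bar>)"

definition field :: "real \<Rightarrow> ('v, 'k, 'n) state \<Rightarrow> ('v, 'k, 'n) state" where
  "field = closed_loop p q r nz f g S D A \<Psi> F G lam (\<lambda>_. \<rho>) \<mu> w"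

lemma field_eq: "field t X = sfield X (\<chi> i. sgn (\<nu> X $ i)) (w t)"
  by (simp add: field_def closed_loop_def sfield_def split_beta virtual_error_eq_laplacian control_def err_def Let_def)

lemma bounded_linear_D: "bounded_linear (row_act (D i \<mu>) :: real ^ 'k \<Rightarrow> real)"
  using D[of i \<mu>] by (intro bounded_linear_row_act) simp

lemma bounded_linear_H: "bounded_linear H"
  using linear_follower_laplacian linear_conv_bounded_linear by blast

lemma err_continuous: "continuous_on UNIV err"
proof -
  have "continuous_on UNIV (\<lambda>X :: ('v, 'k, 'n) state. (\<lambda>(v, \<mu>). r v \<mu>) (vS X, \<mu>))"
    by (rule continuous_on_compose2[OF r_continuous]) (auto intro!: continuous_intros)
  then show ?thesis unfolding err_def[abs_def] by (auto intro!: continuous_intros)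
qed

lemma \<nu>_continuous: "continuous_on UNIV \<nu>"
  by (rule bounded_linear.continuous_on[OF bounded_linear_H err_continuous])

lemma control_continuous: "continuous_on UNIV (\<lambda>(X, s). control i X s)"
proof -
  have \<nu>: "continuous_on UNIV (\<lambda>x :: ('v, 'k, 'n) state \<times> real. \<nu> (fst x) $ i)"
    by (intro continuous_on_component continuous_on_compose2[OF \<nu>_continuous continuous_on_fst[OF continuous_on_id]]) auto
  have \<rho>\<nu>: "continuous_on UNIV (\<lambda>x :: ('v, 'k, 'n) state \<times> real. \<rho> (\<nu> (fst x) $ i))"
    by (rule continuous_on_compose2[OF smooth_continuous_on[OF \<rho>] \<nu>]) auto
  have \<eta>: "continuous_on UNIV (\<lambda>x :: ('v, 'k, 'n) state \<times> real. row_act (\<Psi> i) (\<eta>S (fst x) $ i))"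
    by (intro bounded_linear.continuous_on[OF bounded_linear_\<Psi>] continuous_intros)
  show ?thesis unfolding control_def[abs_def] split_beta by (intro continuous_intros \<nu> \<rho>\<nu> \<eta>)
qed

lemma sfield_continuous: "continuous_on UNIV (\<lambda>(X, \<sigma>, w'). sfield X \<sigma> w')"
proof -
  let ?T = "UNIV :: (('v, 'k, 'n) state \<times> (real ^ 'n) \<times> (real ^ 'w)) set"
  have X: "continuous_on ?T fst" by (intro continuous_intros)
  have \<nu>: "continuous_on ?T (\<lambda>x. \<nu> (fst x) $ i)" for i
    by (intro continuous_on_component continuous_on_compose2[OF \<nu>_continuous X]) auto
  have \<rho>\<nu>: "continuous_on ?T (\<lambda>x. \<rho> (\<nu> (fst x) $ i))" for i
    by (rule continuous_on_compose2[OF smooth_continuous_on[OF \<rho>] \<nu>]) auto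
  have c: "continuous_on ?T (\<lambda>x. control i (fst x) (fst (snd x) $ i))" for i
    using continuous_on_compose2[OF control_continuous[of i], of ?T "\<lambda>x. (fst x, fst (snd x) $ i)"]
    by (simp add: split_beta continuous_intros)
  have pv: "continuous_on ?T (\<lambda>x. p (vS (fst x)))" and qv: "continuous_on ?T (\<lambda>x. q (vS (fst x)))"
    by (rule continuous_on_compose2[OF smooth_continuous_on[OF p]] continuous_on_compose2[OF smooth_continuous_on[OF q]];
        auto intro!: continuous_intros)+
  have ff: "continuous_on ?T (\<lambda>x. f i (coord_proj (nz i) (zS (fst x) $ i)) (yS (fst x) $ i) \<mu>)" for i
    using continuous_on_compose2[OF smooth_continuous_on[OF f[of i]], of ?T "\<lambda>x. (zS (fst x) $ i, yS (fst x) $ i, \<mu>)"]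
    by (simp add: continuous_intros)
  have gg: "continuous_on ?T (\<lambda>x. g i (coord_proj (nz i) (zS (fst x) $ i)) (yS (fst x) $ i) \<mu>)" for i
    using continuous_on_compose2[OF smooth_continuous_on[OF g[of i]], of ?T "\<lambda>x. (zS (fst x) $ i, yS (fst x) $ i, \<mu>)"]
    by (simp add: continuous_intros)
  show ?thesis
    unfolding sfield_def[abs_def] split_beta
    by (intro continuous_on_Pair continuous_on_add continuous_on_matrix_vector_mult continuous_on_vec_lambda pv qv ff gg c
        bounded_linear.continuous_on[OF bounded_linear_D] bounded_linear.continuous_on[OF bounded_linear_mat_act]
        bounded_linear.continuous_on[OF bounded_linear_col_act] \<nu> \<rho>\<nu> continuous_intros)
qed

lemma sfield_affine:
  assumes "u + v = 1"
  shows "sfield X (u *\<^sub>R s + v *\<^sub>R s') w' = u *\<^sub>R sfield X s w' + v *\<^sub>R sfield X s' w'"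
proof -
  have const: "u *\<^sub>R c + v *\<^sub>R c = c" for c :: "'x::real_vector"
    using assms by (simp add: scaleR_left_distrib[symmetric])
  have const': "u * c + v * c = c" for c :: real
    using assms by (simp add: distrib_right[symmetric])
  have ctrl: "control i X (u * s $ i + v * s' $ i) = u * control i X (s $ i) + v * control i X (s' $ i)" for i
  proof -
    define a where "a = - row_act (\<Psi> i) (\<eta>S X $ i) - kS X $ i * \<rho> (\<nu> X $ i) * \<nu> X $ i"
    have c: "control i X t = a - \<theta>S X $ i * t" for t by (simp add: control_def a_def)
    have "u * a + v * a = a" by (rule const')
    then show ?thesis unfolding c by (simp add: algebra_simps)
  qed
  have split3: "c + (u * d + v * d') + e = u * (c + d + e) + v * (c + d' + e)" for c d d' e :: real
    using const'[of c] const'[of e] by (simp add: algebra_simps)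
  have split2: "c + col_act (G i) (u * d + v * d') = u *\<^sub>R (c + col_act (G i) d) + v *\<^sub>R (c + col_act (G i) d')"
    for i d d' and c :: "real ^ 'k"
  proof -
    have lin: "linear (col_act (G i) :: real \<Rightarrow> real ^ 'k)" by (rule bounded_linear.linear[OF bounded_linear_col_act])
    have "col_act (G i) (u * d + v * d') = (u *\<^sub>R col_act (G i) d + v *\<^sub>R col_act (G i) d' :: real ^ 'k)"
      using linear_add[OF lin, of "u * d" "v * d'"] linear_cmul[OF lin, of u d] linear_cmul[OF lin, of v d']
      by (simp only: real_scaleR_def)
    then have "c + col_act (G i) (u * d + v * d') = (u *\<^sub>R c + v *\<^sub>R c) + (u *\<^sub>R col_act (G i) d + v *\<^sub>R col_act (G i) d')"
      by (simp only: const)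
    then show ?thesis by (simp only: scaleR_right_distrib ac_simps)
  qed
  show ?thesis
    unfolding sfield_def scaleR_Pair add_Pair prod.inject
    by (intro conjI; (simp add: const)?; subst Finite_Cartesian_Product.vec_eq_iff; simp add: const' ctrl split3 split2 const)
qed

text \<open>Shifting y by multiples of the preimage of (1, ..., 1) under H moves all virtual errors
  by the same amount, so one line leaves all switching surfaces at once.\<close>

lemma direction_exists:
  obtains c :: "('v, 'k, 'n) state" and b where "\<And>X h. \<nu> (X + h *\<^sub>R c) = \<nu> X + h *\<^sub>R b" "\<And>i. 0 < b $ i"
proof -
  have "surj H"
    by (rule linear_injective_imp_surjective[OF linear_follower_laplacian follower_laplacian_inj[OF A_nonneg A_reach A_sym]]) simp
  then obtain d where d: "(\<chi> i. 1) = H d" by (metis surj_def)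
  define c :: "('v, 'k, 'n) state" where "c = (0, 0, d, 0, 0, 0, 0)"
  have "err (X + h *\<^sub>R c) = err X + h *\<^sub>R d" for X h
    by (simp add: err_def c_def Finite_Cartesian_Product.vec_eq_iff algebra_simps)
  then have "\<nu> (X + h *\<^sub>R c) = \<nu> X + h *\<^sub>R (\<chi> i. 1)" for X h
    by (simp only: linear_add[OF linear_follower_laplacian] linear_cmul[OF linear_follower_laplacian] d)
  then show ?thesis by (rule that) simp
qed

lemma sgn_vec_in_cbox: "(\<chi> i. sgn (x $ i)) \<in> cbox (\<chi> i. - 1) (\<chi> i. (1 :: real))"
  by (auto simp: mem_box_cart sgn_if)

lemma w_continuous: "continuous_on {0..} w"
  using w by (simp add: admissible_input_def)

lemma w_bounded: obtains l where "\<And>t. 0 \<le> t \<Longrightarrow> norm (w t) \<le> l"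
proof -
  obtain l where l: "\<And>t. 0 \<le> t \<Longrightarrow> infnorm (w t) \<le> l" using w unfolding admissible_input_def by blast
  have "norm (w t) \<le> sqrt (real CARD('w)) * l" if "0 \<le> t" for t
    using norm_le_infnorm[of "w t"] l[OF that] by (simp add: mult_left_mono order_trans)
  then show ?thesis by (rule that)
qed

sublocale filippov_field field
proof
  fix T R :: real
  obtain l where l: "\<And>t. 0 \<le> t \<Longrightarrow> norm (w t) \<le> l" using w_bounded by blast
  have "compact ((\<lambda>(X, \<sigma>, w'). sfield X \<sigma> w') ` (cball 0 R \<times> cbox (\<chi> i. - 1) (\<chi> i. 1) \<times> cball 0 l))"
    by (intro compact_continuous_image continuous_on_subset[OF sfield_continuous] compact_Times compact_cball compact_cbox) auto
  then have "bounded ((\<lambda>(X, \<sigma>, w'). sfield X \<sigma> w') ` (cball 0 R \<times> cbox (\<chi> i. - 1) (\<chi> i. 1) \<times> cball 0 l))"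
    by (rule compact_imp_bounded)
  then obtain M where M: "\<And>y. y \<in> (\<lambda>(X, \<sigma>, w'). sfield X \<sigma> w') ` (cball 0 R \<times> cbox (\<chi> i. - 1) (\<chi> i. 1) \<times> cball 0 l) \<Longrightarrow> norm y \<le> M"
    unfolding bounded_iff by blast
  have "norm (field t X) \<le> M" if "t \<in> {0..T}" "norm X \<le> R" for t X
    unfolding field_eq using that l[of t] sgn_vec_in_cbox[of "\<nu> X"]
    by (intro M image_eqI[of _ _ "(X, (\<chi> i. sgn (\<nu> X $ i)), w t)"]) (simp_all add: mem_Times_iff)
  then show "\<exists>M. \<forall>t\<in>{0..T}. \<forall>x. norm x \<le> R \<longrightarrow> norm (field t x) \<le> M" by blast
next
  fix t \<epsilon> :: real and X :: "('v, 'k, 'n) state" assume t: "0 \<le> t" and \<epsilon>: "0 < \<epsilon>"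
  let ?K = "cball X 1 \<times> cbox (\<chi> i. - 1) (\<chi> i. 1) \<times> cball (w t) 1"
  have "uniformly_continuous_on ?K (\<lambda>(X, \<sigma>, w'). sfield X \<sigma> w')"
    by (intro compact_uniformly_continuous continuous_on_subset[OF sfield_continuous] compact_Times compact_cball compact_cbox) auto
  then obtain \<delta>1 where \<delta>1: "\<delta>1 > 0" "\<And>a b. a \<in> ?K \<Longrightarrow> b \<in> ?K \<Longrightarrow> dist b a < \<delta>1 \<Longrightarrow>
      dist ((\<lambda>(X, \<sigma>, w'). sfield X \<sigma> w') b) ((\<lambda>(X, \<sigma>, w'). sfield X \<sigma> w') a) < \<epsilon>"
    unfolding uniformly_continuous_on_def using \<epsilon> by blast
  have "0 < min \<delta>1 1" using \<delta>1 by simp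
  then obtain \<delta>2 where \<delta>2: "\<delta>2 > 0" "\<And>s. 0 \<le> s \<Longrightarrow> dist s t < \<delta>2 \<Longrightarrow> dist (w s) (w t) < min \<delta>1 1"
    using w_continuous t unfolding continuous_on_iff by (metis atLeast_iff)
  have "norm (field s Y - field t Y) \<le> \<epsilon>" if "0 \<le> s" "\<bar>s - t\<bar> < min \<delta>2 1" "norm (Y - X) < min \<delta>2 1" for s Y
  proof -
    have ws: "dist (w s) (w t) < min \<delta>1 1" using that by (intro \<delta>2) (auto simp: dist_real_def)
    have "dist (sfield Y (\<chi> i. sgn (\<nu> Y $ i)) (w s)) (sfield Y (\<chi> i. sgn (\<nu> Y $ i)) (w t)) < \<epsilon>"
      using \<delta>1(2)[of "(Y, (\<chi> i. sgn (\<nu> Y $ i)), w t)" "(Y, (\<chi> i. sgn (\<nu> Y $ i)), w s)"] that ws sgn_vec_in_cbox[of "\<nu> Y"]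
      by (simp add: dist_Pair_Pair dist_commute[of "w t"] dist_commute[of X]) (simp add: dist_norm)
    then show ?thesis by (simp add: field_eq dist_norm)
  qed
  then show "\<exists>\<delta>>0. \<forall>s Y. 0 \<le> s \<and> \<bar>s - t\<bar> < \<delta> \<and> norm (Y - X) < \<delta> \<longrightarrow> norm (field s Y - field t Y) \<le> \<epsilon>"
    using \<delta>2(1) by (intro exI[of _ "min \<delta>2 1"]) auto
next
  fix t \<delta> :: real and Y :: "('v, 'k, 'n) state" and N :: "('v, 'k, 'n) state set" assume "0 < \<delta>" "negligible N"
  obtain c :: "('v, 'k, 'n) state" and b where cb: "\<And>X h. \<nu> (X + h *\<^sub>R c) = \<nu> X + h *\<^sub>R b" "\<And>i. 0 < b $ i"
    using direction_exists by blast
  have "continuous_on UNIV (\<lambda>(X, \<sigma>). sfield X \<sigma> (w t))"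
    using continuous_on_compose2[OF sfield_continuous, of UNIV "\<lambda>x. (fst x, snd x, w t)"]
    by (simp add: split_beta continuous_intros)
  from sgn_field_selection[where F = "\<lambda>X \<sigma>. sfield X \<sigma> (w t)", OF this sfield_affine \<nu>_continuous field_eq cb \<open>0 < \<delta>\<close> \<open>negligible N\<close>]
  show "field t Y \<in> closure (convex hull (field t ` (ball Y \<delta> - N)))" .
qed

lemma field_filippov_set:
  assumes "d \<in> filippov_set (field t) X"
  obtains \<sigma> where "\<And>i. \<bar>\<sigma> $ i\<bar> \<le> 1" "\<And>i. \<sigma> $ i * \<nu> X $ i = \<bar>\<nu> X $ i\<bar>" "d = sfield X \<sigma> (w t)"
proof -
  have "continuous_on UNIV (\<lambda>(X, \<sigma>). sfield X \<sigma> (w t))"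
    using continuous_on_compose2[OF sfield_continuous, of UNIV "\<lambda>x. (fst x, snd x, w t)"]
    by (simp add: split_beta continuous_intros)
  from filippov_set_sgn[where F = "\<lambda>X \<sigma>. sfield X \<sigma> (w t)", OF this sfield_affine \<nu>_continuous field_eq assms]
  show ?thesis using that by blast
qed

subsubsection \<open>Error coordinates\<close>

text \<open>The steady-state map of the internal model. It depends on the unknown \<mu> through D,
  so it may occur in the analysis only, not in the controller.\<close>

definition T :: "'n \<Rightarrow> real ^ 'k \<Rightarrow> real ^ 'k" where
  "T i = (SOME T. bounded_linear T \<and> (\<forall>x. T x \<in> coord_space (np i)) \<and>
     (\<forall>x. T (mat_act (S i) x) = mat_act (Phi_mat (P i)) (T x)) \<and> (\<forall>x. row_act (\<Psi> i) (T x) = row_act (D i \<mu>) x))"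

lemma T: "bounded_linear (T i)" "T i x \<in> coord_space (np i)"
  "T i (mat_act (S i) x) = mat_act (Phi_mat (P i)) (T i x)" "row_act (\<Psi> i) (T i x) = row_act (D i \<mu>) x"
proof -
  have "\<exists>T :: real ^ 'k \<Rightarrow> real ^ 'k. bounded_linear T \<and> (\<forall>x. T x \<in> coord_space (np i)) \<and>
     (\<forall>x. T (mat_act (S i) x) = mat_act (Phi_mat (P i)) (T x)) \<and> (\<forall>x. row_act (\<Psi> i) (T x) = row_act (D i \<mu>) x)"
    using internal_model[OF S no D P, of i \<mu>] by metis
  from someI_ex[OF this]
  show "bounded_linear (T i)" "T i x \<in> coord_space (np i)"
    "T i (mat_act (S i) x) = mat_act (Phi_mat (P i)) (T i x)" "row_act (\<Psi> i) (T i x) = row_act (D i \<mu>) x"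
    unfolding T_def by blast+
qed

definition zb :: "'n \<Rightarrow> ('v, 'k, 'n) state \<Rightarrow> real ^ 'k" where
  "zb i X = zS X $ i - zs i (vS X) \<mu>"

text \<open>Both \<eta> and G e are driven by G u, so subtracting G e removes the control, including
  its discontinuous part, from the equation of \<open>xb\<close>.\<close>

definition xb :: "'n \<Rightarrow> ('v, 'k, 'n) state \<Rightarrow> real ^ 'k" where
  "xb i X = coord_proj (np i) (\<eta>S X $ i) - T i (\<omega>S X $ i) - col_act (G i) (err X $ i)"

lemma coord_space_diff: "x \<in> coord_space m \<Longrightarrow> y \<in> coord_space m \<Longrightarrow> x - y \<in> coord_space m"
  and coord_space_add: "x \<in> coord_space m \<Longrightarrow> y \<in> coord_space m \<Longrightarrow> x + y \<in> coord_space m"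
  by (auto simp: coord_space_def)

lemma xb_coord: "xb i X \<in> coord_space (np i)"
  unfolding xb_def using G[of i]
  by (intro coord_space_diff coord_proj_in_coord_space T col_act_in_coord_space) auto

text \<open>The output of the internal model contains an exact copy of the disturbance; with the
  minus sign in the control law it cancels the disturbance in the equation of e.\<close>

lemma \<Psi>_\<eta>: "row_act (\<Psi> i) (\<eta>S X $ i) = row_act (\<Psi> i) (xb i X + col_act (G i) (err X $ i)) + row_act (D i \<mu>) (\<omega>S X $ i)"
proof -
  have "row_act (\<Psi> i) (\<eta>S X $ i) = row_act (\<Psi> i) (coord_proj (np i) (\<eta>S X $ i))"
    by (rule row_act_coord_proj[symmetric]) (use np in \<open>auto simp: Psi_mat_def\<close>)
  also have "coord_proj (np i) (\<eta>S X $ i) = (xb i X + col_act (G i) (err X $ i)) + T i (\<omega>S X $ i)"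
    by (simp add: xb_def)
  finally show ?thesis by (simp only: linear_add[OF bounded_linear.linear[OF bounded_linear_\<Psi>]] T(4))
qed

text \<open>The derivative of e_i without the sign term, after the cancellation of the disturbance;
  it involves neither \<theta> nor, apart from \<open>xb\<close>, the states \<omega> and
  \<eta>.\<close>

definition drift :: "'n \<Rightarrow> ('v, 'k, 'n) state \<Rightarrow> real ^ 'w \<Rightarrow> real" where
  "drift i X w' = h_term i (zb i X) (err X $ i) (vS X) w' \<mu> - row_act (\<Psi> i) (xb i X + col_act (G i) (err X $ i))
     - kS X $ i * \<rho> (\<nu> X $ i) * \<nu> X $ i"

context
  fixes X :: "real \<Rightarrow> ('v, 'k, 'n) state" and t \<sigma>
  assumes X: "(X has_vector_derivative sfield (X t) \<sigma> (w t)) (at t)"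
begin

lemma deriv_components:
  "((\<lambda>t. vS (X t)) has_vector_derivative p (vS (X t)) + q (vS (X t)) *v w t) (at t)"
  "((\<lambda>t. zS (X t) $ i) has_vector_derivative f i (coord_proj (nz i) (zS (X t) $ i)) (yS (X t) $ i) \<mu>) (at t)"
  "((\<lambda>t. yS (X t) $ i) has_vector_derivative g i (coord_proj (nz i) (zS (X t) $ i)) (yS (X t) $ i) \<mu>
      + control i (X t) (\<sigma> $ i) + row_act (D i \<mu>) (\<omega>S (X t) $ i)) (at t)"
  "((\<lambda>t. \<omega>S (X t) $ i) has_vector_derivative mat_act (S i) (\<omega>S (X t) $ i)) (at t)"
  "((\<lambda>t. \<eta>S (X t) $ i) has_vector_derivative mat_act (F i) (\<eta>S (X t) $ i) + col_act (G i) (control i (X t) (\<sigma> $ i))) (at t)"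
  "((\<lambda>t. kS (X t) $ i) has_vector_derivative - lam * kS (X t) $ i + \<rho> (\<nu> (X t) $ i) * (\<nu> (X t) $ i)\<^sup>2) (at t)"
  "((\<lambda>t. \<theta>S (X t) $ i) has_vector_derivative \<bar>\<nu> (X t) $ i\<bar>) (at t)"
proof -
  note c = bounded_linear_compose bounded_linear_fst bounded_linear_snd bounded_linear_vec_nth
  have b: "bounded_linear (\<lambda>X :: ('v, 'k, 'n) state. zS X $ i)" "bounded_linear (\<lambda>X :: ('v, 'k, 'n) state. yS X $ i)"
    "bounded_linear (\<lambda>X :: ('v, 'k, 'n) state. \<omega>S X $ i)" "bounded_linear (\<lambda>X :: ('v, 'k, 'n) state. \<eta>S X $ i)"
    "bounded_linear (\<lambda>X :: ('v, 'k, 'n) state. kS X $ i)" "bounded_linear (\<lambda>X :: ('v, 'k, 'n) state. \<theta>S X $ i)"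
    by (intro bounded_linear_compose[OF bounded_linear_vec_nth] bounded_linear_fst_comp bounded_linear_snd_comp bounded_linear_ident)+
  show "((\<lambda>t. vS (X t)) has_vector_derivative p (vS (X t)) + q (vS (X t)) *v w t) (at t)"
    using bounded_linear.has_vector_derivative[OF bounded_linear_fst X] by (simp add: sfield_def)
  show "((\<lambda>t. zS (X t) $ i) has_vector_derivative f i (coord_proj (nz i) (zS (X t) $ i)) (yS (X t) $ i) \<mu>) (at t)"
    using bounded_linear.has_vector_derivative[OF b(1) X] by (simp add: sfield_def)
  show "((\<lambda>t. yS (X t) $ i) has_vector_derivative g i (coord_proj (nz i) (zS (X t) $ i)) (yS (X t) $ i) \<mu>
      + control i (X t) (\<sigma> $ i) + row_act (D i \<mu>) (\<omega>S (X t) $ i)) (at t)"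
    using bounded_linear.has_vector_derivative[OF b(2) X] by (simp add: sfield_def)
  show "((\<lambda>t. \<omega>S (X t) $ i) has_vector_derivative mat_act (S i) (\<omega>S (X t) $ i)) (at t)"
    using bounded_linear.has_vector_derivative[OF b(3) X] by (simp add: sfield_def)
  show "((\<lambda>t. \<eta>S (X t) $ i) has_vector_derivative mat_act (F i) (\<eta>S (X t) $ i) + col_act (G i) (control i (X t) (\<sigma> $ i))) (at t)"
    using bounded_linear.has_vector_derivative[OF b(4) X] by (simp add: sfield_def)
  show "((\<lambda>t. kS (X t) $ i) has_vector_derivative - lam * kS (X t) $ i + \<rho> (\<nu> (X t) $ i) * (\<nu> (X t) $ i)\<^sup>2) (at t)"
    using bounded_linear.has_vector_derivative[OF b(5) X] by (simp add: sfield_def)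
  show "((\<lambda>t. \<theta>S (X t) $ i) has_vector_derivative \<bar>\<nu> (X t) $ i\<bar>) (at t)"
    using bounded_linear.has_vector_derivative[OF b(6) X] by (simp add: sfield_def)
qed

lemma has_vector_derivative_compose_v:
  assumes "(\<phi> has_derivative \<phi>') (at (vS (X t)))"
  shows "((\<lambda>t. \<phi> (vS (X t))) has_vector_derivative \<phi>' (p (vS (X t)) + q (vS (X t)) *v w t)) (at t)"
proof -
  have "((\<lambda>t. \<phi> (vS (X t))) has_derivative (\<lambda>h. \<phi>' (h *\<^sub>R (p (vS (X t)) + q (vS (X t)) *v w t)))) (at t)"
    by (rule has_derivative_compose[OF deriv_components(1)[unfolded has_vector_derivative_def] assms])
  then show ?thesis
    unfolding has_vector_derivative_def
    by (simp add: linear_cmul[OF has_derivative_linear[OF assms]])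
qed

lemma deriv_zb:
  assumes z: "zS (X t) $ i \<in> coord_space (nz i)"
  shows "((\<lambda>t. zb i (X t)) has_vector_derivative f_bar (f i) r q (zs i) (zb i (X t)) (err (X t) $ i) (vS (X t)) (w t) \<mu>) (at t)"
proof -
  let ?d = "frechet_derivative (\<lambda>v. zs i v \<mu>) (at (vS (X t)))"
  have d: "((\<lambda>v. zs i v \<mu>) has_derivative ?d) (at (vS (X t)))" by (rule smooth_partial_has_derivative[OF zs])
  have "?d (p (vS (X t)) + q (vS (X t)) *v w t) = f i (zs i (vS (X t)) \<mu>) (r (vS (X t)) \<mu>) \<mu> + ?d (q (vS (X t)) *v w t)"
    by (simp add: linear_add[OF has_derivative_linear[OF d]] regulator)
  then have "f_bar (f i) r q (zs i) (zb i (X t)) (err (X t) $ i) (vS (X t)) (w t) \<mu>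
      = f i (coord_proj (nz i) (zS (X t) $ i)) (yS (X t) $ i) \<mu> - ?d (p (vS (X t)) + q (vS (X t)) *v w t)"
    by (simp add: zb_def f_bar_def err_def coord_proj_eq_self[OF z])
  then show ?thesis
    unfolding zb_def[of i "X t" for t]
    using has_vector_derivative_diff[OF deriv_components(2)[of i] has_vector_derivative_compose_v[OF d]] by (simp add: zb_def)
qed

lemma deriv_err:
  assumes z: "zS (X t) $ i \<in> coord_space (nz i)"
  shows "((\<lambda>t. err (X t) $ i) has_vector_derivative drift i (X t) (w t) - \<theta>S (X t) $ i * \<sigma> $ i) (at t)"
    and "((\<lambda>t. xb i (X t)) has_vector_derivative mat_act (F i) (xb i (X t) + col_act (G i) (err (X t) $ i))
      - col_act (G i) (h_term i (zb i (X t)) (err (X t) $ i) (vS (X t)) (w t) \<mu>)) (at t)"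
proof -
  let ?h = "h_term i (zb i (X t)) (err (X t) $ i) (vS (X t)) (w t) \<mu>"
  let ?u = "control i (X t) (\<sigma> $ i)" and ?d = "row_act (D i \<mu>) (\<omega>S (X t) $ i)"
  have "((\<lambda>t. yS (X t) $ i - r (vS (X t)) \<mu>) has_vector_derivative g i (coord_proj (nz i) (zS (X t) $ i)) (yS (X t) $ i) \<mu> + ?u + ?d
      - frechet_derivative (\<lambda>v. r v \<mu>) (at (vS (X t))) (p (vS (X t)) + q (vS (X t)) *v w t)) (at t)"
    by (rule has_vector_derivative_diff[OF deriv_components(3)
        has_vector_derivative_compose_v[OF smooth_partial_has_derivative[OF r]]])
  moreover have "g i (coord_proj (nz i) (zS (X t) $ i)) (yS (X t) $ i) \<mu>
      - frechet_derivative (\<lambda>v. r v \<mu>) (at (vS (X t))) (p (vS (X t)) + q (vS (X t)) *v w t) = ?h"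
    by (simp add: h_term_def zb_def err_def)
  ultimately have e': "((\<lambda>t. err (X t) $ i) has_vector_derivative ?h + ?u + ?d) (at t)"
    by (simp add: err_def algebra_simps)
  moreover have "?h + ?u + ?d = drift i (X t) (w t) - \<theta>S (X t) $ i * \<sigma> $ i"
    by (simp add: control_def \<Psi>_\<eta> drift_def)
  ultimately show "((\<lambda>t. err (X t) $ i) has_vector_derivative drift i (X t) (w t) - \<theta>S (X t) $ i * \<sigma> $ i) (at t)" by simp
  have "((\<lambda>t. xb i (X t)) has_vector_derivative
      coord_proj (np i) (mat_act (F i) (\<eta>S (X t) $ i) + col_act (G i) ?u) - T i (mat_act (S i) (\<omega>S (X t) $ i))
      - col_act (G i) (?h + ?u + ?d)) (at t)"
    unfolding xb_def
    by (intro has_vector_derivative_diff bounded_linear.has_vector_derivative[OF bounded_linear_coord_proj]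
        bounded_linear.has_vector_derivative[OF T(1)] bounded_linear.has_vector_derivative[OF bounded_linear_col_act]
        deriv_components e')
  moreover have "coord_proj (np i) (mat_act (F i) (\<eta>S (X t) $ i) + col_act (G i) ?u) - T i (mat_act (S i) (\<omega>S (X t) $ i))
      - col_act (G i) (?h + ?u + ?d) = mat_act (F i) (xb i (X t) + col_act (G i) (err (X t) $ i)) - col_act (G i) ?h"
  proof -
    note lin = linear_add[OF bounded_linear.linear[OF bounded_linear_col_act]]
    have "coord_proj (np i) (mat_act (F i) (\<eta>S (X t) $ i) + col_act (G i) ?u) = mat_act (F i) (\<eta>S (X t) $ i) + col_act (G i) ?u"
      using F_carrier[of i] G[of i]
      by (intro coord_proj_eq_self coord_space_add mat_act_in_coord_space col_act_in_coord_space) auto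
    moreover have "mat_act (F i) (\<eta>S (X t) $ i) = mat_act (F i) (coord_proj (np i) (\<eta>S (X t) $ i))"
      using F_carrier[of i] np[of i] by (intro mat_act_coord_proj[symmetric]) auto
    moreover have "coord_proj (np i) (\<eta>S (X t) $ i) = (xb i (X t) + col_act (G i) (err (X t) $ i)) + T i (\<omega>S (X t) $ i)"
      by (simp add: xb_def)
    \<comment> \<open>From F = \<Phi> + G \<Psi>, the intertwining of S with \<Phi>, and \<Psi> T =
      D. The term G d cancels the disturbance contained in G e'.\<close>
    moreover have "mat_act (F i) (T i (\<omega>S (X t) $ i)) = T i (mat_act (S i) (\<omega>S (X t) $ i)) + col_act (G i) ?d"
      by (simp add: mat_act_F_mat[OF G np(1)] T)
    ultimately show ?thesis
      by (simp add: linear_add[OF bounded_linear.linear[OF bounded_linear_mat_act]] lin)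
  qed
  ultimately show "((\<lambda>t. xb i (X t)) has_vector_derivative mat_act (F i) (xb i (X t) + col_act (G i) (err (X t) $ i))
      - col_act (G i) ?h) (at t)" by simp
qed

end

end

lemma has_vector_derivative_cart:
  fixes x :: "real \<Rightarrow> real ^ 'n::finite"
  assumes "\<And>i. ((\<lambda>t. x t $ i) has_vector_derivative d $ i) (at t)"
  shows "(x has_vector_derivative d) (at t)"
  unfolding has_vector_derivative_def
proof (subst has_derivative_componentwise_within, rule ballI)
  fix b :: "real ^ 'n" assume "b \<in> Basis"
  then obtain i where "b = axis i 1" by (auto simp: Basis_vec_def)
  then show "((\<lambda>t. x t \<bullet> b) has_derivative (\<lambda>h. (h *\<^sub>R d) \<bullet> b)) (at t)"
    using assms[of i] by (simp add: inner_axis has_vector_derivative_def)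
qed

lemma norm_vec_le_sum: "norm (x :: 'a::real_normed_vector ^ 'n::finite) \<le> (\<Sum>i\<in>UNIV. norm (x $ i))"
  unfolding norm_vec_def by (rule L2_set_le_sum) simp

lemma le_one_plus_power2: "x \<le> 1 + x\<^sup>2" for x :: real
  using zero_le_power2[of "x - 1"] zero_le_power2[of x] unfolding power2_diff power_one mult_1_right by linarith

subsection \<open>Solutions of the closed loop\<close>

locale regulated_run = closed_loop_run p q r nz no f g S D A \<alpha>\<^sub>0 \<gamma>\<^sub>0 zs P G lam \<rho> \<mu> w
  for p :: "real ^ 'v::finite \<Rightarrow> real ^ 'v"
    and q :: "real ^ 'v \<Rightarrow> real ^ 'w::finite ^ 'v"
    and r :: "real ^ 'v \<Rightarrow> real ^ 'm::finite \<Rightarrow> real"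
    and nz no :: "'n::finite \<Rightarrow> nat"
    and f :: "'n \<Rightarrow> real ^ 'k::finite \<Rightarrow> real \<Rightarrow> real ^ 'm \<Rightarrow> real ^ 'k"
    and g :: "'n \<Rightarrow> real ^ 'k \<Rightarrow> real \<Rightarrow> real ^ 'm \<Rightarrow> real"
    and S :: "'n \<Rightarrow> real mat"
    and D :: "'n \<Rightarrow> real ^ 'm \<Rightarrow> real mat"
    and A :: "real ^ 'n option ^ 'n option"
    and \<alpha>\<^sub>0 \<gamma>\<^sub>0 :: "real \<Rightarrow> real"
    and zs :: "'n \<Rightarrow> real ^ 'v \<Rightarrow> real ^ 'm \<Rightarrow> real ^ 'k"
    and P :: "'n \<Rightarrow> real poly"
    and G :: "'n \<Rightarrow> real mat"
    and lam :: real
    and \<rho> :: "real \<Rightarrow> real" and \<mu> :: "real ^ 'm" and w :: "real \<Rightarrow> real ^ 'w" +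
  fixes X0 :: "('v, 'k, 'n) state"
  assumes gain: "gain_function \<rho>"
    and z0: "\<And>i. zS X0 $ i \<in> coord_space (nz i)" and \<eta>0: "\<And>i. \<eta>S X0 $ i \<in> coord_space (np i)"
    and \<theta>0: "\<And>i. \<theta>S X0 $ i = 0"
begin

text \<open>Restrictions of solutions are solutions, so bounds at the end point \<open>X b\<close>
  for all b and X are bounds at all times, uniform over all solutions; the prolongation argument
  needs this uniformity.\<close>

definition sol :: "real \<Rightarrow> (real \<Rightarrow> ('v, 'k, 'n) state) \<Rightarrow> bool" where
  "sol b X \<longleftrightarrow> 0 \<le> b \<and> filippov_solution field {0..b} X \<and> X 0 = X0"

lemma sol_subset: "sol b X \<Longrightarrow> 0 \<le> t \<Longrightarrow> t \<le> b \<Longrightarrow> sol t X"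
  unfolding sol_def using filippov_solution_subset[of field "{0..b}" X "{0..t}"] by auto

lemma solution_AE:
  assumes "sol b X"
  shows "AE t in lebesgue. t \<in> {0<..<b} \<longrightarrow> (\<exists>\<sigma>. (\<forall>i. \<bar>\<sigma> $ i\<bar> \<le> 1) \<and> (\<forall>i. \<sigma> $ i * \<nu> (X t) $ i = \<bar>\<nu> (X t) $ i\<bar>) \<and>
    (X has_vector_derivative sfield (X t) \<sigma> (w t)) (at t))"
proof -
  have "filippov_solution field {0..b} X" using assms by (simp add: sol_def)
  from filippov_solution_AE_at[OF this] show ?thesis
  proof eventually_elim
    case (elim t)
    show ?case
    proof
      assume "t \<in> {0<..<b}"
      then obtain d where d: "(X has_vector_derivative d) (at t)" "d \<in> filippov_set (field t) (X t)" using elim by auto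
      from field_filippov_set[OF d(2)] obtain \<sigma> where
        "\<And>i. \<bar>\<sigma> $ i\<bar> \<le> 1" "\<And>i. \<sigma> $ i * \<nu> (X t) $ i = \<bar>\<nu> (X t) $ i\<bar>" "d = sfield (X t) \<sigma> (w t)" by metis
      then show "\<exists>\<sigma>. (\<forall>i. \<bar>\<sigma> $ i\<bar> \<le> 1) \<and> (\<forall>i. \<sigma> $ i * \<nu> (X t) $ i = \<bar>\<nu> (X t) $ i\<bar>) \<and>
          (X has_vector_derivative sfield (X t) \<sigma> (w t)) (at t)" using d(1) by blast
    qed
  qed
qed

lemma solution_lipschitz:
  assumes "sol b X" "locally_lipschitz \<Phi>"
  obtains L where "L-lipschitz_on {0..b} (\<lambda>t. \<Phi> (X t))"
proof -
  have "filippov_solution field {0..b} X" using assms(1) by (simp add: sol_def)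
  from closed_solution_lipschitz_on[OF this] obtain M where "M-lipschitz_on {0..b} X" .
  from lipschitz_on_interval_compose[OF this assms(2)] show ?thesis using that .
qed

lemma solution_sublevel:
  fixes \<Phi> :: "('v, 'k, 'n) state \<Rightarrow> real"
  assumes X: "sol b X" and \<Phi>: "locally_lipschitz \<Phi>"
    and deriv: "\<And>t \<sigma>. 0 < t \<Longrightarrow> t < b \<Longrightarrow> (\<And>i. \<sigma> $ i * \<nu> (X t) $ i = \<bar>\<nu> (X t) $ i\<bar>) \<Longrightarrow>
      (X has_vector_derivative sfield (X t) \<sigma> (w t)) (at t) \<Longrightarrow>
      \<exists>d. ((\<lambda>t. \<Phi> (X t)) has_real_derivative d) (at t) \<and> (W < \<Phi> (X t) \<longrightarrow> d \<le> 0)"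
  shows "\<Phi> (X b) \<le> max (\<Phi> X0) W"
proof -
  obtain L where L: "L-lipschitz_on {0..b} (\<lambda>t. \<Phi> (X t))" using solution_lipschitz[OF X \<Phi>] .
  have "0 \<le> b" "X 0 = X0" using X by (simp_all add: sol_def)
  moreover have "AE t in lebesgue. t \<in> {0<..<b} \<longrightarrow> (\<exists>d. ((\<lambda>t. \<Phi> (X t)) has_real_derivative d) (at t) \<and> (W < \<Phi> (X t) \<longrightarrow> d \<le> 0))"
    using solution_AE[OF X]
  proof eventually_elim
    case (elim t)
    show ?case
    proof
      assume "t \<in> {0<..<b}"
      then show "\<exists>d. ((\<lambda>t. \<Phi> (X t)) has_real_derivative d) (at t) \<and> (W < \<Phi> (X t) \<longrightarrow> d \<le> 0)"
        using elim deriv[of t] by (metis greaterThanLessThan_iff)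
    qed
  qed
  ultimately show ?thesis using lipschitz_sublevel_invariant[OF L, of W] by simp
qed

lemma solution_increment_le:
  fixes \<Phi> :: "('v, 'k, 'n) state \<Rightarrow> real"
  assumes X: "sol b X" and \<Phi>: "locally_lipschitz \<Phi>" and a: "0 \<le> a" "a \<le> b"
    and deriv: "\<And>t \<sigma>. a < t \<Longrightarrow> t < b \<Longrightarrow> (\<And>i. \<bar>\<sigma> $ i\<bar> \<le> 1) \<Longrightarrow>
      (X has_vector_derivative sfield (X t) \<sigma> (w t)) (at t) \<Longrightarrow>
      \<exists>d. ((\<lambda>t. \<Phi> (X t)) has_real_derivative d) (at t) \<and> d \<le> M"
  shows "\<Phi> (X b) - \<Phi> (X a) \<le> M * (b - a)"
proof -
  obtain L where L: "L-lipschitz_on {0..b} (\<lambda>t. \<Phi> (X t))" using solution_lipschitz[OF X \<Phi>] .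
  have L: "L-lipschitz_on {a..b} (\<lambda>t. \<Phi> (X t))" using lipschitz_on_subset[OF L] a by simp
  show ?thesis
  proof (rule lipschitz_increment_le[OF L a(2)])
    show "AE t in lebesgue. t \<in> {a<..<b} \<longrightarrow> (\<exists>d. ((\<lambda>t. \<Phi> (X t)) has_real_derivative d) (at t) \<and> d \<le> M)"
      using solution_AE[OF X]
    proof eventually_elim
      case (elim t)
      show ?case
      proof
        assume t: "t \<in> {a<..<b}"
        then have "t \<in> {0<..<b}" using a by auto
        with elim obtain \<sigma> where "\<And>i. \<bar>\<sigma> $ i\<bar> \<le> 1" "(X has_vector_derivative sfield (X t) \<sigma> (w t)) (at t)" by blast
        with t show "\<exists>d. ((\<lambda>t. \<Phi> (X t)) has_real_derivative d) (at t) \<and> d \<le> M" by (intro deriv) auto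
      qed
    qed
  qed
qed

lemma solution_constant:
  fixes \<Phi> :: "('v, 'k, 'n) state \<Rightarrow> real"
  assumes X: "sol b X" and \<Phi>: "bounded_linear \<Phi>" and z: "\<And>Y \<sigma> w'. \<Phi> (sfield Y \<sigma> w') = 0"
  shows "\<Phi> (X b) = \<Phi> X0"
proof -
  have b: "0 \<le> b" "X 0 = X0" using X by (simp_all add: sol_def)
  have d: "((\<lambda>t. \<Phi> (X t)) has_real_derivative 0) (at t)" if "(X has_vector_derivative sfield (X t) \<sigma> (w t)) (at t)" for t \<sigma>
    using bounded_linear.has_vector_derivative[OF \<Phi> that] by (simp add: z has_real_derivative_iff_has_vector_derivative)
  have "\<Phi> (X b) - \<Phi> (X 0) \<le> 0 * (b - 0)"
    by (rule solution_increment_le[OF X locally_lipschitz_bounded_linear[OF \<Phi>]]) (use d b in auto)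
  moreover have "(- \<Phi> (X b)) - (- \<Phi> (X 0)) \<le> 0 * (b - 0)"
    by (rule solution_increment_le[OF X locally_lipschitz_bounded_linear[OF bounded_linear_minus[OF \<Phi>]]])
      (use DERIV_minus[OF d] b in auto)
  ultimately show ?thesis using b by simp
qed

lemma z_coord: assumes X: "sol b X" shows "zS (X b) $ i \<in> coord_space (nz i)"
  unfolding coord_space_def
proof (intro CollectI allI impI)
  fix l :: 'k assume l: "nz i \<le> to_nat_on UNIV l"
  have "zS (X b) $ i $ l = zS X0 $ i $ l"
  proof (rule solution_constant[OF X])
    show "bounded_linear (\<lambda>X :: ('v, 'k, 'n) state. zS X $ i $ l)"
      by (intro bounded_linear_compose[OF bounded_linear_vec_nth] bounded_linear_fst_comp bounded_linear_snd_comp bounded_linear_ident)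
    show "zS (sfield Y \<sigma> w') $ i $ l = 0" for Y \<sigma> w'
      using f_coord[OF coord_proj_in_coord_space] l by (auto simp: sfield_def coord_space_def)
  qed
  then show "zS (X b) $ i $ l = 0" using z0[of i] l by (simp add: coord_space_def)
qed

lemma \<eta>_coord: assumes X: "sol b X" shows "\<eta>S (X b) $ i \<in> coord_space (np i)"
  unfolding coord_space_def
proof (intro CollectI allI impI)
  fix l :: 'k assume l: "np i \<le> to_nat_on UNIV l"
  have "\<eta>S (X b) $ i $ l = \<eta>S X0 $ i $ l"
  proof (rule solution_constant[OF X])
    show "bounded_linear (\<lambda>X :: ('v, 'k, 'n) state. \<eta>S X $ i $ l)"
      by (intro bounded_linear_compose[OF bounded_linear_vec_nth] bounded_linear_fst_comp bounded_linear_snd_comp bounded_linear_ident)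
    fix Y \<sigma> and w' :: "real ^ 'w"
    have "mat_act (F i) (\<eta>S Y $ i) + col_act (G i) (control i Y (\<sigma> $ i)) \<in> coord_space (np i)"
      using F_carrier[of i] G[of i] by (intro coord_space_add mat_act_in_coord_space col_act_in_coord_space) auto
    then show "\<eta>S (sfield Y \<sigma> w') $ i $ l = 0" using l by (simp add: sfield_def coord_space_def)
  qed
  then show "\<eta>S (X b) $ i $ l = 0" using \<eta>0[of i] l by (simp add: coord_space_def)
qed

text \<open>The integral of |\<nu>_i| in the form in which Barbalat's argument uses it; the constant
  c = 0 gives monotonicity of \<theta>.\<close>

lemma \<theta>_increment:
  assumes X: "sol b X" and a: "0 \<le> a" "a \<le> b" and c: "\<And>t. t \<in> {a..b} \<Longrightarrow> c \<le> \<bar>\<nu> (X t) $ i\<bar>"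
  shows "c * (b - a) \<le> \<theta>S (X b) $ i - \<theta>S (X a) $ i"
proof -
  have "(- \<theta>S (X b) $ i) - (- \<theta>S (X a) $ i) \<le> (- c) * (b - a)"
  proof (rule solution_increment_le[OF X _ a])
    show "locally_lipschitz (\<lambda>X :: ('v, 'k, 'n) state. - \<theta>S X $ i)"
      by (intro locally_lipschitz_bounded_linear bounded_linear_minus bounded_linear_compose[OF bounded_linear_vec_nth]
          bounded_linear_snd_comp bounded_linear_ident)
    fix t \<sigma> assume "a < t" "t < b" and d: "(X has_vector_derivative sfield (X t) \<sigma> (w t)) (at t)"
    have "((\<lambda>t. - \<theta>S (X t) $ i) has_real_derivative - \<bar>\<nu> (X t) $ i\<bar>) (at t)"
      using has_vector_derivative_minus[OF deriv_components(7)[OF d, of i]]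
      by (simp add: has_real_derivative_iff_has_vector_derivative)
    then show "\<exists>d. ((\<lambda>t. - \<theta>S (X t) $ i) has_real_derivative d) (at t) \<and> d \<le> - c"
      using c[of t] \<open>a < t\<close> \<open>t < b\<close> by fastforce
  qed
  then show ?thesis by simp
qed

lemma \<theta>_nonneg: "sol b X \<Longrightarrow> 0 \<le> \<theta>S (X b) $ i"
  using \<theta>_increment[of b X 0 0 i] \<theta>0[of i] by (simp add: sol_def)

text \<open>The leader equation contains no sign term and its right side is continuous along the
  solution, so the almost everywhere equation holds everywhere and the stability assumption on the
  leader applies.\<close>

lemma leader_bounded: obtains R where "\<And>b X. sol b X \<Longrightarrow> norm (vS (X b)) \<le> R"
proof
  fix b X assume X: "sol b X"
  let ?R = "max (norm (vS X0)) (\<alpha>\<^sub>0 (norm (vS X0)) + \<gamma>\<^sub>0 (SUP s\<in>{0..}. infnorm (w s)))"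
  have X0: "0 \<le> b" "X 0 = X0" using X by (simp_all add: sol_def)
  show "norm (vS (X b)) \<le> ?R"
  proof (cases "b = 0")
    case False
    have vl: "locally_lipschitz (\<lambda>X :: ('v, 'k, 'n) state. vS X)"
      by (intro locally_lipschitz_bounded_linear bounded_linear_fst)
    obtain L where L: "L-lipschitz_on {0..b} (\<lambda>t. vS (X t))" using solution_lipschitz[OF X vl] .
    have v: "continuous_on {0..b} (\<lambda>t. vS (X t))" by (rule lipschitz_on_continuous_on[OF L])
    have cont: "continuous_on {0..b} (\<lambda>t. p (vS (X t)) + q (vS (X t)) *v w t)"
      by (intro continuous_on_add continuous_on_matrix_vector_mult continuous_on_compose2[OF smooth_continuous_on[OF p] v]
          continuous_on_compose2[OF smooth_continuous_on[OF q] v] continuous_on_subset[OF w_continuous]) auto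
    have "leader_solution p q w b (\<lambda>t. vS (X t))"
      unfolding leader_solution_def
    proof
      fix t assume t: "t \<in> {0..b}"
      have "AE t in lebesgue. t \<in> {0<..<b} \<longrightarrow> ((\<lambda>t. vS (X t)) has_vector_derivative p (vS (X t)) + q (vS (X t)) *v w t) (at t)"
        using solution_AE[OF X] by eventually_elim (use deriv_components(1) in blast)
      from lipschitz_AE_derivative_imp_derivative[OF L cont this t]
      show "((\<lambda>t. vS (X t)) has_vector_derivative p (vS (X t)) + q (vS (X t)) *v w t) (at t within {0..b})" .
    qed
    from leader_bound[OF w _ this] False X0 have "norm (vS (X b)) \<le> \<alpha>\<^sub>0 (norm (vS X0)) + \<gamma>\<^sub>0 (SUP s\<in>{0..}. infnorm (w s))"
      by simp
    then show ?thesis by simp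
  qed (simp add: X0)
qed

subsubsection \<open>The Lyapunov function\<close>

lemma zb_coord: "sol b X \<Longrightarrow> zb i (X b) \<in> coord_space (nz i)"
  unfolding zb_def by (intro coord_space_diff z_coord zs_coord)

lemma err_locally_lipschitz: "locally_lipschitz err"
proof -
  have b: "bounded_linear (\<lambda>X :: ('v, 'k, 'n) state. yS X)"
    by (intro bounded_linear_fst_comp bounded_linear_snd_comp bounded_linear_ident)
  have o: "bounded_linear (\<lambda>s :: real. (\<chi> i :: 'n. s))"
    using bounded_linear_scaleR_left[of "\<chi> i :: 'n. (1 :: real)"] by (simp add: Finite_Cartesian_Product.scaleR_vec_def)
  have "locally_lipschitz (\<lambda>X :: ('v, 'k, 'n) state. yS X - (\<chi> i :: 'n. r (vS X) \<mu>))"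
    by (intro locally_lipschitz_diff locally_lipschitz_bounded_linear[OF b]
        locally_lipschitz_compose[OF locally_lipschitz_bounded_linear[OF o]]
        locally_lipschitz_compose[OF smooth_partial_locally_lipschitz[OF r]] locally_lipschitz_bounded_linear[OF bounded_linear_fst])
  moreover have "err = (\<lambda>X. yS X - (\<chi> i :: 'n. r (vS X) \<mu>))"
    by (simp add: fun_eq_iff err_def Finite_Cartesian_Product.vec_eq_iff)
  ultimately show ?thesis by simp
qed

lemma zb_locally_lipschitz: "locally_lipschitz (zb i)"
proof -
  have b: "bounded_linear (\<lambda>X :: ('v, 'k, 'n) state. zS X $ i)"
    by (intro bounded_linear_compose[OF bounded_linear_vec_nth] bounded_linear_fst_comp bounded_linear_snd_comp bounded_linear_ident)
  show ?thesis unfolding zb_def[abs_def]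
    by (intro locally_lipschitz_diff locally_lipschitz_bounded_linear[OF b]
        locally_lipschitz_compose[OF smooth_partial_locally_lipschitz[OF zs]] locally_lipschitz_bounded_linear[OF bounded_linear_fst])
qed

lemma xb_locally_lipschitz: "locally_lipschitz (xb i)"
proof -
  have b: "bounded_linear (\<lambda>X :: ('v, 'k, 'n) state. \<eta>S X $ i)" "bounded_linear (\<lambda>X :: ('v, 'k, 'n) state. \<omega>S X $ i)"
    by (intro bounded_linear_compose[OF bounded_linear_vec_nth] bounded_linear_fst_comp bounded_linear_snd_comp bounded_linear_ident)+
  have "locally_lipschitz (\<lambda>X. err X $ i)"
    by (rule locally_lipschitz_compose[OF locally_lipschitz_bounded_linear[OF bounded_linear_vec_nth] err_locally_lipschitz])
  then show ?thesis unfolding xb_def[abs_def]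
    by (intro locally_lipschitz_diff
        locally_lipschitz_compose[OF locally_lipschitz_bounded_linear[OF bounded_linear_coord_proj] locally_lipschitz_bounded_linear[OF b(1)]]
        locally_lipschitz_compose[OF locally_lipschitz_bounded_linear[OF T(1)] locally_lipschitz_bounded_linear[OF b(2)]]
        locally_lipschitz_compose[OF locally_lipschitz_bounded_linear[OF bounded_linear_col_act]])
qed

lemma real_locally_lipschitz_mult: "locally_lipschitz u \<Longrightarrow> locally_lipschitz v \<Longrightarrow> locally_lipschitz (\<lambda>x. u x * v x :: real)"
  by (rule locally_lipschitz_bilinear[OF bounded_bilinear_mult])

definition energy :: "('v, 'k, 'n) state \<Rightarrow> real" where
  "energy X = (err X \<bullet> \<nu> X) / 2"

lemma energy_locally_lipschitz: "locally_lipschitz energy"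
proof -
  have "locally_lipschitz (\<lambda>X. err X \<bullet> \<nu> X)"
    by (intro locally_lipschitz_bilinear[OF bounded_bilinear_inner err_locally_lipschitz]
        locally_lipschitz_compose[OF locally_lipschitz_bounded_linear[OF bounded_linear_H] err_locally_lipschitz])
  from real_locally_lipschitz_mult[OF this locally_lipschitz_const[of "1 / 2"]] show ?thesis
    by (simp add: energy_def[abs_def])
qed

lemma energy_coercive: obtains c where "0 < c" "\<And>X. c * (norm (err X))\<^sup>2 \<le> energy X"
proof -
  obtain c where "0 < c" "\<And>x. c * (norm x)\<^sup>2 \<le> x \<bullet> H x"
    using follower_laplacian_coercive[OF A_nonneg A_reach A_sym] by metis
  then show ?thesis by (intro that[of "c / 2"]) (simp_all add: energy_def)
qed

text \<open>Self-adjointness of H merges the two product rule terms, so each derivative of e_i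
  appears with the weight \<nu>_i available to follower i.\<close>

lemma deriv_energy:
  assumes X: "(X has_vector_derivative sfield (X t) \<sigma> (w t)) (at t)" and z: "\<And>i. zS (X t) $ i \<in> coord_space (nz i)"
  shows "((\<lambda>t. energy (X t)) has_real_derivative
    (\<Sum>i\<in>UNIV. \<nu> (X t) $ i * (drift i (X t) (w t) - \<theta>S (X t) $ i * \<sigma> $ i))) (at t)"
proof -
  define d where "d = (\<chi> i. drift i (X t) (w t) - \<theta>S (X t) $ i * \<sigma> $ i)"
  have e: "((\<lambda>t. err (X t)) has_vector_derivative d) (at t)"
    by (rule has_vector_derivative_cart) (simp add: d_def deriv_err(1)[OF X z])
  have "((\<lambda>t. err (X t) \<bullet> \<nu> (X t)) has_vector_derivative err (X t) \<bullet> H d + d \<bullet> \<nu> (X t)) (at t)"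
    by (rule bounded_bilinear.has_vector_derivative[OF bounded_bilinear_inner e
          bounded_linear.has_vector_derivative[OF bounded_linear_H e]])
  moreover have "err (X t) \<bullet> H d = d \<bullet> \<nu> (X t)"
    using follower_laplacian_self_adjoint[OF A_nonneg A_reach A_sym, of "err (X t)" d] by (simp add: inner_commute)
  ultimately have "((\<lambda>t. err (X t) \<bullet> \<nu> (X t)) has_real_derivative 2 * (d \<bullet> \<nu> (X t))) (at t)"
    by (simp add: has_real_derivative_iff_has_vector_derivative)
  from DERIV_cdivide[OF this, of 2] show ?thesis
    by (simp add: energy_def inner_vec_def d_def mult.commute)
qed

lemma error_coordinates_bounded:
  obtains R where "\<And>b X. sol b X \<Longrightarrow> norm (vS (X b)) \<le> R" "\<And>b X i. sol b X \<Longrightarrow> norm (zb i (X b)) \<le> R"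
    "\<And>b X i. sol b X \<Longrightarrow> norm (xb i (X b)) \<le> R" "\<And>b X i. sol b X \<Longrightarrow> norm (kS (X b) $ i) \<le> R"
    "\<And>b X. sol b X \<Longrightarrow> norm (err (X b)) \<le> R"
proof -
  obtain Rv where Rv: "\<And>b X. sol b X \<Longrightarrow> norm (vS (X b)) \<le> Rv" using leader_bounded by blast
  obtain l where l: "\<And>t. 0 \<le> t \<Longrightarrow> norm (w t) \<le> l" using w_bounded by blast
  \<comment> \<open>The one ball that contains (v, w, \<mu>) along all solutions for the given input
    and initial state; \<rho> was chosen without knowing it.\<close>
  define N where "N = nat \<lceil>Rv + (l + norm \<mu>)\<rceil>"
  have N: "(vS (X t), w t, \<mu>) \<in> cball 0 (real N)" if "sol t X" for t X
  proof -
    have "norm (vS (X t), w t, \<mu>) \<le> norm (vS (X t)) + (norm (w t) + norm \<mu>)"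
      using norm_Pair_le[of "vS (X t)" "(w t, \<mu>)"] norm_Pair_le[of "w t" \<mu>] by linarith
    also have "\<dots> \<le> Rv + (l + norm \<mu>)" using Rv[OF that] l[of t] that by (simp add: sol_def)
    also have "\<dots> \<le> real N" unfolding N_def by (rule real_nat_ceiling_ge)
    finally show ?thesis by simp
  qed
  obtain U U' B C where data: "\<forall>i. \<exists>\<Theta>. lyapunov_data i (cball 0 (real N)) (U i) (U' i) (B i) \<Theta>"
    and decay: "\<forall>zb x (e :: real ^ 'n) (k :: real ^ 'n) (\<theta> :: real ^ 'n) (\<sigma> :: real ^ 'n) v w \<mu> j.
        (\<forall>i. zb i \<in> coord_space (nz i) \<and> x i \<in> coord_space (np i) \<and> 0 \<le> \<theta> $ i \<and> \<sigma> $ i * H e $ i = \<bar>H e $ i\<bar>) \<longrightarrow>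
        (v, w, \<mu>) \<in> cball 0 (real N) \<longrightarrow>
        (\<Sum>i\<in>UNIV. rate i (U' i) (B i) (zb i) (x i) (e $ i) (H e $ i) (k $ i) (\<rho> (H e $ i)) (\<theta> $ i) (\<sigma> $ i) v w \<mu>)
        \<le> C - (\<Sum>i\<in>UNIV. norm (zb i) + (norm (x i))\<^sup>2 / 2 + lam / 2 * (k $ i - 1)\<^sup>2) - \<bar>H e $ j\<bar>"
    using gain[unfolded gain_function_def, THEN spec[of _ N]] by (elim exE conjE) (rule that)
  have U: "(U i has_derivative U' i x) (at x)" "locally_lipschitz (U i)" "x \<in> coord_space (nz i) \<Longrightarrow> 0 \<le> U i x"
    "\<exists>R. \<forall>x\<in>coord_space (nz i). U i x \<le> c \<longrightarrow> norm x \<le> R"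
    and B: "bounded_bilinear (B i)" "B i x y = B i y x" "\<exists>c>0. \<forall>x\<in>coord_space (np i). c * (norm x)\<^sup>2 \<le> B i x x" for i x y c
    using data[rule_format, of i] unfolding lyapunov_data_def by blast+
  define \<Phi>i where "\<Phi>i i X = U i (zb i X) + B i (xb i X) (xb i X) + (kS X $ i - 1)\<^sup>2 / 2" for i X
  define \<Phi> where "\<Phi> X = (\<Sum>i\<in>UNIV. \<Phi>i i X) + energy X" for X
  have "locally_lipschitz (\<Phi>i i)" for i
  proof -
    have b: "bounded_linear (\<lambda>X :: ('v, 'k, 'n) state. kS X $ i)"
      by (intro bounded_linear_compose[OF bounded_linear_vec_nth] bounded_linear_fst_comp bounded_linear_snd_comp bounded_linear_ident)
    have "locally_lipschitz (\<lambda>X. U i (zb i X) + B i (xb i X) (xb i X) + (kS X $ i - 1) * ((kS X $ i - 1) * (1 / 2)))"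
      by (intro locally_lipschitz_add locally_lipschitz_compose[OF U(2)] locally_lipschitz_bilinear[OF B(1)] real_locally_lipschitz_mult
          locally_lipschitz_diff locally_lipschitz_const locally_lipschitz_bounded_linear[OF b] zb_locally_lipschitz xb_locally_lipschitz)
    then show ?thesis by (simp add: \<Phi>i_def[abs_def] power2_eq_square)
  qed
  then have \<Phi>: "locally_lipschitz \<Phi>"
    unfolding \<Phi>_def[abs_def] by (intro locally_lipschitz_add locally_lipschitz_sum energy_locally_lipschitz)
  obtain c :: nat where c: "1 \<le> c" "\<And>e s i. (\<And>j. \<bar>H e $ j\<bar> \<le> s) \<Longrightarrow> \<bar>e $ i\<bar> \<le> real c * s"
    using laplacian_inverse_bound by metis
  \<comment> \<open>W bounds \<Phi> on the set where the decay estimate leaves the sign of the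
    derivative open.\<close>
  obtain W where W: "\<And>X. (\<And>i. norm (zb i X) \<le> C) \<Longrightarrow> (\<And>i. (norm (xb i X))\<^sup>2 / 2 \<le> C) \<Longrightarrow> (\<And>i. lam / 2 * (kS X $ i - 1)\<^sup>2 \<le> C) \<Longrightarrow>
      (\<And>i. \<bar>\<nu> X $ i\<bar> \<le> C) \<Longrightarrow> \<Phi> X \<le> W"
  proof -
    have "\<forall>i. \<exists>M. \<forall>x. norm x \<le> C \<longrightarrow> norm (U i x) \<le> M"
    proof
      fix i
      obtain M where "\<And>x. norm x \<le> C \<Longrightarrow> norm (U i x) \<le> M"
        by (rule locally_lipschitz_bounded[OF U(2), where R = C]) blast
      then show "\<exists>M. \<forall>x. norm x \<le> C \<longrightarrow> norm (U i x) \<le> M" by blast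
    qed
    from choice[OF this] obtain M where M: "\<And>i x. norm x \<le> C \<Longrightarrow> norm (U i x) \<le> M i" by blast
    have "\<forall>i. \<exists>K. 0 \<le> K \<and> (\<forall>x. B i x x \<le> K * (norm x)\<^sup>2)"
    proof
      fix i
      obtain K where K: "0 \<le> K" "\<And>x y. norm (B i x y) \<le> norm x * norm y * K"
        using bounded_bilinear.nonneg_bounded[OF B(1)] by blast
      have "B i x x \<le> K * (norm x)\<^sup>2" for x
        using K(2)[of x x] by (simp add: power2_eq_square mult_ac)
      with K show "\<exists>K. 0 \<le> K \<and> (\<forall>x. B i x x \<le> K * (norm x)\<^sup>2)" by blast
    qed
    from choice[OF this] obtain K where K: "\<And>i. 0 \<le> K i" "\<And>i x. B i x x \<le> K i * (norm x)\<^sup>2" by blast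
    show ?thesis
    proof (rule that)
      fix X assume *: "\<And>i. norm (zb i X) \<le> C" "\<And>i. (norm (xb i X))\<^sup>2 / 2 \<le> C" "\<And>i. lam / 2 * (kS X $ i - 1)\<^sup>2 \<le> C"
        "\<And>i. \<bar>\<nu> X $ i\<bar> \<le> C"
      have C0: "0 \<le> C" using *(4)[of undefined] by linarith
      have "\<Phi>i i X \<le> M i + K i * (2 * C) + C / lam" for i
      proof -
        have "U i (zb i X) \<le> M i" using M[OF *(1)[of i], of i] by simp
        moreover have "B i (xb i X) (xb i X) \<le> K i * (2 * C)"
          using K(2)[of i "xb i X"] mult_left_mono[OF _ K(1), of "(norm (xb i X))\<^sup>2" "2 * C" i] *(2)[of i] by linarith
        moreover have "(kS X $ i - 1)\<^sup>2 / 2 \<le> C / lam" using *(3)[of i] lam by (simp add: field_simps)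
        ultimately show ?thesis unfolding \<Phi>i_def by linarith
      qed
      then have "(\<Sum>i\<in>UNIV. \<Phi>i i X) \<le> (\<Sum>i\<in>UNIV. M i + K i * (2 * C) + C / lam)" by (rule sum_mono)
      moreover have "err X \<bullet> \<nu> X \<le> (\<Sum>i\<in>(UNIV :: 'n set). (real c * C) * C)"
        unfolding inner_vec_def
      proof (rule sum_mono)
        fix i :: 'n
        have "err X $ i * \<nu> X $ i \<le> \<bar>err X $ i\<bar> * \<bar>\<nu> X $ i\<bar>" by (metis abs_ge_self abs_mult)
        also have "\<dots> \<le> (real c * C) * C" using c(2)[OF *(4), of i] *(4)[of i] C0 by (intro mult_mono) auto
        finally show "inner (err X $ i) (\<nu> X $ i) \<le> (real c * C) * C" by simp
      qed
      ultimately show "\<Phi> X \<le> (\<Sum>i\<in>UNIV. M i + K i * (2 * C) + C / lam) + (\<Sum>i\<in>(UNIV :: 'n set). (real c * C) * C) / 2"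
        unfolding \<Phi>_def energy_def by linarith
    qed
  qed
  have bound: "\<Phi> (X b) \<le> max (\<Phi> X0) W" if X: "sol b X" for b X
  proof (rule solution_sublevel[OF X \<Phi>])
    fix t \<sigma> assume t: "0 < t" "t < b" and \<sigma>: "\<And>i. \<sigma> $ i * \<nu> (X t) $ i = \<bar>\<nu> (X t) $ i\<bar>"
      and d: "(X has_vector_derivative sfield (X t) \<sigma> (w t)) (at t)"
    have Xt: "sol t X" using sol_subset[OF X, of t] t by simp
    let ?rate = "\<lambda>i. rate i (U' i) (B i) (zb i (X t)) (xb i (X t)) (err (X t) $ i) (\<nu> (X t) $ i) (kS (X t) $ i) (\<rho> (\<nu> (X t) $ i))
      (\<theta>S (X t) $ i) (\<sigma> $ i) (vS (X t)) (w t) \<mu>"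
    define Q where "Q = (\<Sum>i\<in>UNIV. norm (zb i (X t)) + (norm (xb i (X t)))\<^sup>2 / 2 + lam / 2 * (kS (X t) $ i - 1)\<^sup>2)"
    have le: "sum ?rate UNIV \<le> C - Q - \<bar>\<nu> (X t) $ j\<bar>" for j
      unfolding Q_def
      by (rule decay[rule_format, OF _ N[OF Xt]]) (use zb_coord[OF Xt] xb_coord \<theta>_nonneg[OF Xt] \<sigma> in blast)
    \<comment> \<open>The rate already includes the share of follower i in the derivative of the
      energy; it is taken out here and comes back when the energy is added.\<close>
    have di: "((\<lambda>t. \<Phi>i i (X t)) has_real_derivative ?rate i - \<nu> (X t) $ i * (drift i (X t) (w t) - \<theta>S (X t) $ i * \<sigma> $ i)) (at t)" for i
    proof -
      let ?zd = "f_bar (f i) r q (zs i) (zb i (X t)) (err (X t) $ i) (vS (X t)) (w t) \<mu>"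
      let ?xd = "mat_act (F i) (xb i (X t) + col_act (G i) (err (X t) $ i))
          - col_act (G i) (h_term i (zb i (X t)) (err (X t) $ i) (vS (X t)) (w t) \<mu>)"
      have "((\<lambda>t. U i (zb i (X t))) has_derivative (\<lambda>h. U' i (zb i (X t)) (h *\<^sub>R ?zd))) (at t)"
        by (rule has_derivative_compose[OF deriv_zb[OF d z_coord[OF Xt], unfolded has_vector_derivative_def] U(1)])
      then have 1: "((\<lambda>t. U i (zb i (X t))) has_real_derivative U' i (zb i (X t)) ?zd) (at t)"
        by (simp add: has_field_derivative_def linear_cmul[OF has_derivative_linear[OF U(1)]] mult.commute[of _ "U' i (zb i (X t)) ?zd"])
      have "((\<lambda>t. B i (xb i (X t)) (xb i (X t))) has_vector_derivative B i (xb i (X t)) ?xd + B i ?xd (xb i (X t))) (at t)"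
        using deriv_err(2)[OF d z_coord[OF Xt]] by (intro bounded_bilinear.has_vector_derivative[OF B(1)])
      then have 2: "((\<lambda>t. B i (xb i (X t)) (xb i (X t))) has_real_derivative 2 * B i (xb i (X t)) ?xd) (at t)"
        unfolding has_real_derivative_iff_has_vector_derivative B(2)[of i ?xd "xb i (X t)"] by simp
      have k: "((\<lambda>t. kS (X t) $ i) has_real_derivative - lam * kS (X t) $ i + \<rho> (\<nu> (X t) $ i) * (\<nu> (X t) $ i)\<^sup>2) (at t)"
        using deriv_components(6)[OF d] by (simp add: has_real_derivative_iff_has_vector_derivative)
      have "((\<lambda>t. (kS (X t) $ i - 1)\<^sup>2 / 2) has_real_derivative
          (kS (X t) $ i - 1) * (- lam * kS (X t) $ i + \<rho> (\<nu> (X t) $ i) * (\<nu> (X t) $ i)\<^sup>2)) (at t)"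
        by (rule derivative_eq_intros k refl | simp)+
      from DERIV_add[OF DERIV_add[OF 1 2] this] show ?thesis
        unfolding \<Phi>i_def[abs_def] by (rule DERIV_cong) (simp add: rate_def drift_def algebra_simps)
    qed
    have "((\<lambda>t. \<Phi> (X t)) has_real_derivative
        (\<Sum>i\<in>UNIV. ?rate i - \<nu> (X t) $ i * (drift i (X t) (w t) - \<theta>S (X t) $ i * \<sigma> $ i))
         + (\<Sum>i\<in>UNIV. \<nu> (X t) $ i * (drift i (X t) (w t) - \<theta>S (X t) $ i * \<sigma> $ i))) (at t)"
      unfolding \<Phi>_def[abs_def] by (intro DERIV_add DERIV_sum di deriv_energy[OF d] z_coord[OF Xt])
    then have "((\<lambda>t. \<Phi> (X t)) has_real_derivative sum ?rate UNIV) (at t)"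
      by (simp only: sum_subtractf diff_add_cancel)
    \<comment> \<open>If the sum of rates were positive, each nonnegative decay term would be at
      most C, which forces \<Phi> \<le> W.\<close>
    moreover have "sum ?rate UNIV \<le> 0" if "W < \<Phi> (X t)"
    proof (rule ccontr)
      assume "\<not> sum ?rate UNIV \<le> 0"
      then have CQ: "Q + \<bar>\<nu> (X t) $ j\<bar> \<le> C" for j using le[of j] by linarith
      have nn: "0 \<le> norm (zb i (X t))" "0 \<le> (norm (xb i (X t)))\<^sup>2 / 2" "0 \<le> lam / 2 * (kS (X t) $ i - 1)\<^sup>2" for i
        using lam by simp_all
      have Q: "norm (zb i (X t)) + (norm (xb i (X t)))\<^sup>2 / 2 + lam / 2 * (kS (X t) $ i - 1)\<^sup>2 \<le> Q" for i
        unfolding Q_def by (rule member_le_sum) (use nn in \<open>auto intro!: add_nonneg_nonneg\<close>)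
      have "\<Phi> (X t) \<le> W"
      proof (rule W)
        fix i
        show "norm (zb i (X t)) \<le> C" "(norm (xb i (X t)))\<^sup>2 / 2 \<le> C" "lam / 2 * (kS (X t) $ i - 1)\<^sup>2 \<le> C" "\<bar>\<nu> (X t) $ i\<bar> \<le> C"
          using Q[of i] CQ[of i] nn[of i] abs_ge_zero[of "\<nu> (X t) $ i"] by linarith+
      qed
      with that show False by simp
    qed
    ultimately show "\<exists>d. ((\<lambda>t. \<Phi> (X t)) has_real_derivative d) (at t) \<and> (W < \<Phi> (X t) \<longrightarrow> d \<le> 0)" by blast
  qed
  define W' where "W' = max (\<Phi> X0) W"
  obtain ce where ce: "0 < ce" "\<And>X. ce * (norm (err X))\<^sup>2 \<le> energy X" using energy_coercive by blast
  have "\<forall>i. \<exists>cB. 0 < cB \<and> (\<forall>x\<in>coord_space (np i). cB * (norm x)\<^sup>2 \<le> B i x x)" using B(3) by blast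
  from choice[OF this] obtain cB where cB: "\<And>i. 0 < cB i" "\<And>i x. x \<in> coord_space (np i) \<Longrightarrow> cB i * (norm x)\<^sup>2 \<le> B i x x" by blast
  have "\<forall>i. \<exists>R. \<forall>x\<in>coord_space (nz i). U i x \<le> W' \<longrightarrow> norm x \<le> R" using U(4) by blast
  from choice[OF this] obtain Rz where Rz: "\<And>i x. x \<in> coord_space (nz i) \<Longrightarrow> U i x \<le> W' \<Longrightarrow> norm x \<le> Rz i" by blast
  have parts: "U i (zb i (X b)) \<le> W'" "cB i * (norm (xb i (X b)))\<^sup>2 \<le> W'" "(kS (X b) $ i - 1)\<^sup>2 / 2 \<le> W'" "ce * (norm (err (X b)))\<^sup>2 \<le> W'"
    if X: "sol b X" for b X i
  proof -
    have nn: "0 \<le> U i (zb i (X b))" "0 \<le> cB i * (norm (xb i (X b)))\<^sup>2" "0 \<le> (kS (X b) $ i - 1)\<^sup>2 / 2" for i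
      using U(3)[OF zb_coord[OF X]] cB(1)[of i] by simp_all
    have "0 \<le> ce * (norm (err (X b)))\<^sup>2" using ce(1) by simp
    have xi: "cB i * (norm (xb i (X b)))\<^sup>2 \<le> B i (xb i (X b)) (xb i (X b))" for i by (rule cB(2)[OF xb_coord])
    have "0 \<le> \<Phi>i i (X b)" for i using nn[of i] xi[of i] unfolding \<Phi>i_def by linarith
    then have sums: "\<Phi>i i (X b) \<le> (\<Sum>i\<in>UNIV. \<Phi>i i (X b))" "0 \<le> (\<Sum>i\<in>UNIV. \<Phi>i i (X b))" by (auto intro: member_le_sum sum_nonneg)
    have "U i (zb i (X b)) + B i (xb i (X b)) (xb i (X b)) + (kS (X b) $ i - 1)\<^sup>2 / 2 \<le> (\<Sum>i\<in>UNIV. \<Phi>i i (X b))"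
      using sums(1) by (simp only: \<Phi>i_def)
    with sums(2) \<open>0 \<le> ce * (norm (err (X b)))\<^sup>2\<close> show "U i (zb i (X b)) \<le> W'" "cB i * (norm (xb i (X b)))\<^sup>2 \<le> W'" "(kS (X b) $ i - 1)\<^sup>2 / 2 \<le> W'" "ce * (norm (err (X b)))\<^sup>2 \<le> W'"
      using bound[OF X] ce(2)[of "X b"] nn[of i] xi[of i] unfolding \<Phi>_def[of "X b"] W'_def[symmetric] by linarith+
  qed
  have sq: "x \<le> 1 + a / s" if "s * x\<^sup>2 \<le> a" "0 < s" "0 \<le> x" for x s a :: real
  proof -
    have "x\<^sup>2 \<le> a / s" using that by (simp add: field_simps)
    then show ?thesis using le_one_plus_power2[of x] by linarith
  qed
  define R where "R = max Rv (max (Max (range Rz)) (max (Max (range (\<lambda>i. 1 + W' / cB i))) (max (2 + W' * 2) (1 + W' / ce))))"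
  show ?thesis
  proof
    fix b X i assume X: "sol b X"
    show "norm (vS (X b)) \<le> R" using Rv[OF X] by (simp add: R_def)
    have "norm (zb i (X b)) \<le> Rz i" by (rule Rz[OF zb_coord[OF X] parts(1)[OF X]])
    also have "\<dots> \<le> R" by (simp add: R_def le_max_iff_disj)
    finally show "norm (zb i (X b)) \<le> R" .
    have "norm (xb i (X b)) \<le> 1 + W' / cB i" by (rule sq[OF parts(2)[OF X] cB(1)]) simp
    also have "\<dots> \<le> Max (range (\<lambda>i. 1 + W' / cB i))" by (rule Max_ge) auto
    also have "\<dots> \<le> R" by (simp only: R_def le_max_iff_disj order_refl simp_thms)
    finally show "norm (xb i (X b)) \<le> R" .
    have "\<bar>kS (X b) $ i - 1\<bar> \<le> 1 + W' / (1 / 2)" by (rule sq) (use parts(3)[OF X, of i] in simp_all)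
    then have "norm (kS (X b) $ i) \<le> 2 + W' * 2" by auto
    also have "\<dots> \<le> R" by (simp add: R_def)
    finally show "norm (kS (X b) $ i) \<le> R" .
    have "norm (err (X b)) \<le> 1 + W' / ce" by (rule sq[OF parts(4)[OF X] ce(1)]) simp
    also have "\<dots> \<le> R" by (simp add: R_def)
    finally show "norm (err (X b)) \<le> R" .
  qed
qed

end

section \<open>Bounds for the drift, for \<theta> and for the whole state; convergence of the
  errors\<close>

lemma bounded_image_cart:
  fixes \<phi> :: "'a \<Rightarrow> 'b::real_normed_vector ^ 'n::finite"
  assumes "\<And>i. bounded ((\<lambda>y. \<phi> y $ i) ` Y)"
  shows "bounded (\<phi> ` Y)"
proof -
  have "\<forall>i. \<exists>R. \<forall>y\<in>Y. norm (\<phi> y $ i) \<le> R" using assms by (auto simp: bounded_iff)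
  from choice[OF this] obtain R where R: "\<And>i y. y \<in> Y \<Longrightarrow> norm (\<phi> y $ i) \<le> R i" by blast
  have "norm (\<phi> y) \<le> (\<Sum>i\<in>UNIV. R i)" if "y \<in> Y" for y
    using norm_vec_le_sum[of "\<phi> y"] sum_mono[of UNIV "\<lambda>i. norm (\<phi> y $ i)" R] R[OF that] by force
  then show ?thesis by (auto simp: bounded_iff)
qed

lemma locally_lipschitz_bounded_image:
  assumes "locally_lipschitz g" "bounded (\<phi> ` Y)"
  shows "bounded ((\<lambda>y. g (\<phi> y)) ` Y)"
proof -
  obtain R where R: "\<And>y. y \<in> Y \<Longrightarrow> norm (\<phi> y) \<le> R" using assms(2) by (auto simp: bounded_iff)
  obtain M where M: "\<And>x. norm x \<le> R \<Longrightarrow> norm (g x) \<le> M"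
    by (rule locally_lipschitz_bounded[OF assms(1), where R = R]) blast
  show ?thesis unfolding bounded_iff using R M by blast
qed

text \<open>Along a linear equation this logarithm has a bounded derivative, so exponential growth
  estimates follow from the plain increment estimate.\<close>

lemma locally_lipschitz_ln: "locally_lipschitz (\<lambda>x :: 'a::euclidean_space. ln (1 + x \<bullet> x))"
proof (rule locally_lipschitz_C1)
  have pos: "0 < 1 + x \<bullet> x" for x :: 'a by (simp add: add_pos_nonneg)
  have d: "((\<lambda>x. 1 + x \<bullet> x) has_derivative (\<lambda>h. 2 * (x \<bullet> h))) (at x)" for x :: 'a
    by (auto intro!: derivative_eq_intros simp: inner_commute)
  show "((\<lambda>x. ln (1 + x \<bullet> x)) has_derivative (\<lambda>h. 2 * (x \<bullet> h) * inverse (1 + x \<bullet> x))) (at x)" for x :: 'a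
    using has_derivative_ln[OF pos d] by simp
  show "continuous_on UNIV (\<lambda>(x :: 'a, h). 2 * (x \<bullet> h) * inverse (1 + x \<bullet> x))"
    unfolding split_beta using pos by (auto intro!: continuous_intros simp: less_imp_neq[symmetric])
qed

context regulated_run
begin

text \<open>The drift is a continuous function of error coordinates, k, v and w, all confined to
  balls. The bound M for it holds for all times and all solutions.\<close>

lemma drift_bounded:
  obtains M where "\<And>b X i. sol b X \<Longrightarrow> \<bar>drift i (X b) (w b)\<bar> \<le> M"
proof -
  obtain R where R: "\<And>b X. sol b X \<Longrightarrow> norm (vS (X b)) \<le> R" "\<And>b X i. sol b X \<Longrightarrow> norm (zb i (X b)) \<le> R"
    "\<And>b X i. sol b X \<Longrightarrow> norm (xb i (X b)) \<le> R" "\<And>b X i. sol b X \<Longrightarrow> norm (kS (X b) $ i) \<le> R"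
    "\<And>b X. sol b X \<Longrightarrow> norm (err (X b)) \<le> R"
    using error_coordinates_bounded by metis
  obtain l where l: "\<And>t. 0 \<le> t \<Longrightarrow> norm (w t) \<le> l" using w_bounded by blast
  define dd where "dd i x = h_term i (fst x) (fst (snd (snd x)) $ i) (fst (snd (snd (snd (snd x))))) (snd (snd (snd (snd (snd x))))) \<mu>
      - row_act (\<Psi> i) (fst (snd x) + col_act (G i) (fst (snd (snd x)) $ i))
      - fst (snd (snd (snd x))) * \<rho> (H (fst (snd (snd x))) $ i) * H (fst (snd (snd x))) $ i"
    for i and x :: "(real ^ 'k) \<times> (real ^ 'k) \<times> (real ^ 'n) \<times> real \<times> (real ^ 'v) \<times> (real ^ 'w)"
  have cont: "continuous_on UNIV (dd i)" for i
  proof -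
    let ?T = "UNIV :: ((real ^ 'k) \<times> (real ^ 'k) \<times> (real ^ 'n) \<times> real \<times> (real ^ 'v) \<times> (real ^ 'w)) set"
    have e: "continuous_on ?T (\<lambda>x. fst (snd (snd x)))" by (intro continuous_intros)
    have \<nu>: "continuous_on ?T (\<lambda>x. H (fst (snd (snd x))) $ i)"
      by (intro continuous_on_component bounded_linear.continuous_on[OF bounded_linear_H e])
    have h: "continuous_on ?T (\<lambda>x. (\<lambda>(zb, e, v, w, \<mu>). h_term i zb e v w \<mu>)
        (fst x, fst (snd (snd x)) $ i, fst (snd (snd (snd (snd x)))), snd (snd (snd (snd (snd x)))), \<mu>))"
      by (rule continuous_on_compose2[OF h_term_continuous]) (auto intro!: continuous_intros)
    have \<rho>\<nu>: "continuous_on ?T (\<lambda>x. \<rho> (H (fst (snd (snd x))) $ i))"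
      by (rule continuous_on_compose2[OF smooth_continuous_on[OF \<rho>] \<nu>]) auto
    have "continuous_on ?T (\<lambda>x. row_act (\<Psi> i) (fst (snd x) + col_act (G i) (fst (snd (snd x)) $ i)))"
      by (intro bounded_linear.continuous_on[OF bounded_linear_\<Psi>] continuous_on_add
          bounded_linear.continuous_on[OF bounded_linear_col_act] continuous_intros)
    with h \<nu> \<rho>\<nu> show ?thesis unfolding dd_def[abs_def] by (auto intro!: continuous_intros)
  qed
  have "\<forall>i. \<exists>M. \<forall>x\<in>cball 0 R \<times> cball 0 R \<times> cball 0 R \<times> cball 0 R \<times> cball 0 R \<times> cball 0 l. norm (dd i x) \<le> M"
  proof
    fix i
    have "compact (dd i ` (cball 0 R \<times> cball 0 R \<times> cball 0 R \<times> cball 0 R \<times> cball 0 R \<times> cball 0 l))"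
      by (intro compact_continuous_image continuous_on_subset[OF cont] compact_Times compact_cball) auto
    from compact_imp_bounded[OF this]
    show "\<exists>M. \<forall>x\<in>cball 0 R \<times> cball 0 R \<times> cball 0 R \<times> cball 0 R \<times> cball 0 R \<times> cball 0 l. norm (dd i x) \<le> M"
      unfolding bounded_iff by blast
  qed
  from choice[OF this] obtain M where
    M: "\<And>i x. x \<in> cball 0 R \<times> cball 0 R \<times> cball 0 R \<times> cball 0 R \<times> cball 0 R \<times> cball 0 l \<Longrightarrow> norm (dd i x) \<le> M i" by blast
  show ?thesis
  proof
    fix b X i assume X: "sol b X"
    have "norm (dd i (zb i (X b), xb i (X b), err (X b), kS (X b) $ i, vS (X b), w b)) \<le> M i"
      using R[OF X] l[of b] X by (intro M) (simp add: sol_def)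
    also have "\<dots> \<le> Max (range M)" by (rule Max_ge) auto
    finally show "\<bar>drift i (X b) (w b)\<bar> \<le> Max (range M)" by (simp add: dd_def drift_def)
  qed
qed

lemma \<theta>_bounded: obtains R where "\<And>b X i. sol b X \<Longrightarrow> \<bar>\<theta>S (X b) $ i\<bar> \<le> R"
proof -
  obtain M where M: "\<And>b X i. sol b X \<Longrightarrow> \<bar>drift i (X b) (w b)\<bar> \<le> M" using drift_bounded by blast
  define \<Phi> where "\<Phi> X = energy X + (\<Sum>i\<in>UNIV. (\<theta>S X $ i - M)\<^sup>2 / 2)" for X
  have b: "bounded_linear (\<lambda>X :: ('v, 'k, 'n) state. \<theta>S X $ i)" for i
    by (intro bounded_linear_compose[OF bounded_linear_vec_nth] bounded_linear_snd_comp bounded_linear_ident)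
  have "locally_lipschitz (\<lambda>X. energy X + (\<Sum>i\<in>UNIV. (\<theta>S X $ i - M) * ((\<theta>S X $ i - M) * (1 / 2))))"
    by (intro locally_lipschitz_add energy_locally_lipschitz locally_lipschitz_sum real_locally_lipschitz_mult
        locally_lipschitz_diff locally_lipschitz_const locally_lipschitz_bounded_linear[OF b])
  then have \<Phi>: "locally_lipschitz \<Phi>" by (simp add: \<Phi>_def[abs_def] power2_eq_square)
  have bound: "\<Phi> (X b) \<le> max (\<Phi> X0) (\<Phi> X0)" if X: "sol b X" for b X
  proof (rule solution_sublevel[OF X \<Phi>])
    fix t \<sigma> assume t: "0 < t" "t < b" and \<sigma>: "\<And>i. \<sigma> $ i * \<nu> (X t) $ i = \<bar>\<nu> (X t) $ i\<bar>"
      and d: "(X has_vector_derivative sfield (X t) \<sigma> (w t)) (at t)"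
    have Xt: "sol t X" using sol_subset[OF X, of t] t by simp
    have "((\<lambda>t. (\<theta>S (X t) $ i - M)\<^sup>2 / 2) has_real_derivative (\<theta>S (X t) $ i - M) * \<bar>\<nu> (X t) $ i\<bar>) (at t)" for i
    proof -
      have k: "((\<lambda>t. \<theta>S (X t) $ i) has_real_derivative \<bar>\<nu> (X t) $ i\<bar>) (at t)"
        using deriv_components(7)[OF d] by (simp add: has_real_derivative_iff_has_vector_derivative)
      show ?thesis by (rule derivative_eq_intros k refl | simp)+
    qed
    then have "((\<lambda>t. \<Phi> (X t)) has_real_derivative
        (\<Sum>i\<in>UNIV. \<nu> (X t) $ i * (drift i (X t) (w t) - \<theta>S (X t) $ i * \<sigma> $ i)) + (\<Sum>i\<in>UNIV. (\<theta>S (X t) $ i - M) * \<bar>\<nu> (X t) $ i\<bar>)) (at t)"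
      unfolding \<Phi>_def[abs_def] by (intro DERIV_add DERIV_sum deriv_energy[OF d] z_coord[OF Xt])
    \<comment> \<open>As \<sigma>_i \<nu>_i = |\<nu>_i|, the terms \<theta>_i |\<nu>_i| cancel, and
      \<nu>_i times the drift is at most M |\<nu>_i|. The true size of \<theta>_i relative to M does
      not matter.\<close>
    moreover have "(\<Sum>i\<in>UNIV. \<nu> (X t) $ i * (drift i (X t) (w t) - \<theta>S (X t) $ i * \<sigma> $ i)) + (\<Sum>i\<in>UNIV. (\<theta>S (X t) $ i - M) * \<bar>\<nu> (X t) $ i\<bar>) \<le> 0"
      unfolding sum.distrib[symmetric]
    proof (rule sum_nonpos)
      fix i
      have "\<nu> (X t) $ i * drift i (X t) (w t) \<le> \<bar>\<nu> (X t) $ i\<bar> * \<bar>drift i (X t) (w t)\<bar>" by (metis abs_ge_self abs_mult)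
      also have "\<dots> \<le> \<bar>\<nu> (X t) $ i\<bar> * M" by (rule mult_left_mono[OF M[OF Xt]]) simp
      finally have "\<nu> (X t) $ i * drift i (X t) (w t) \<le> \<bar>\<nu> (X t) $ i\<bar> * M" .
      moreover have "\<nu> (X t) $ i * (drift i (X t) (w t) - \<theta>S (X t) $ i * \<sigma> $ i)
          = \<nu> (X t) $ i * drift i (X t) (w t) - \<theta>S (X t) $ i * \<bar>\<nu> (X t) $ i\<bar>"
        unfolding \<sigma>[symmetric] by (simp add: algebra_simps)
      ultimately show "\<nu> (X t) $ i * (drift i (X t) (w t) - \<theta>S (X t) $ i * \<sigma> $ i) + (\<theta>S (X t) $ i - M) * \<bar>\<nu> (X t) $ i\<bar> \<le> 0"
        unfolding left_diff_distrib by (simp add: mult.commute)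
    qed
    ultimately show "\<exists>d. ((\<lambda>t. \<Phi> (X t)) has_real_derivative d) (at t) \<and> (\<Phi> X0 < \<Phi> (X t) \<longrightarrow> d \<le> 0)" by blast
  qed
  obtain ce where ce: "0 < ce" "\<And>X. ce * (norm (err X))\<^sup>2 \<le> energy X" using energy_coercive by blast
  show ?thesis
  proof
    fix b X i assume X: "sol b X"
    have "0 \<le> ce * (norm (err (X b)))\<^sup>2" using ce(1) by simp
    then have "0 \<le> energy (X b)" using ce(2)[of "X b"] by linarith
    moreover have "(\<theta>S (X b) $ i - M)\<^sup>2 / 2 \<le> (\<Sum>i\<in>UNIV. (\<theta>S (X b) $ i - M)\<^sup>2 / 2)" by (rule member_le_sum) auto
    ultimately have "(\<theta>S (X b) $ i - M)\<^sup>2 \<le> 2 * \<Phi> X0" using bound[OF X] unfolding \<Phi>_def[of "X b"] by linarith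
    moreover have "\<bar>\<theta>S (X b) $ i - M\<bar> \<le> 1 + (\<theta>S (X b) $ i - M)\<^sup>2" using le_one_plus_power2[of "\<bar>\<theta>S (X b) $ i - M\<bar>"] by simp
    ultimately show "\<bar>\<theta>S (X b) $ i\<bar> \<le> \<bar>M\<bar> + 1 + 2 * \<Phi> X0" by linarith
  qed
qed

text \<open>The disturbance state may grow exponentially, so the bound depends on \<tau>. This is
  enough for prolonging solutions, and the convergence argument never meets \<omega> outside
  \<open>xb\<close>.\<close>

lemma \<omega>_bounded: "\<exists>R. \<forall>b X. sol b X \<and> b \<le> \<tau> \<longrightarrow> norm (\<omega>S (X b) $ i) \<le> R"
proof -
  obtain K where K: "0 \<le> K" "\<And>x :: real ^ 'k. norm (mat_act (S i) x) \<le> norm x * K"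
    using bounded_linear.nonneg_bounded[OF bounded_linear_mat_act[of "S i"]] by blast
  define \<Phi> where "\<Phi> X = ln (1 + \<omega>S X $ i \<bullet> \<omega>S X $ i)" for X :: "('v, 'k, 'n) state"
  have b: "bounded_linear (\<lambda>X :: ('v, 'k, 'n) state. \<omega>S X $ i)"
    by (intro bounded_linear_compose[OF bounded_linear_vec_nth] bounded_linear_fst_comp bounded_linear_snd_comp bounded_linear_ident)
  have \<Phi>: "locally_lipschitz \<Phi>"
    unfolding \<Phi>_def[abs_def] by (rule locally_lipschitz_compose[OF locally_lipschitz_ln locally_lipschitz_bounded_linear[OF b]])
  have "norm (\<omega>S (X b) $ i) \<le> exp (\<Phi> X0 + 2 * K * \<tau>)" if X: "sol b X" and "b \<le> \<tau>" for b X
  proof -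
    have b: "0 \<le> b" "X 0 = X0" using X by (simp_all add: sol_def)
    have "\<Phi> (X b) - \<Phi> (X 0) \<le> (2 * K) * (b - 0)"
    proof (rule solution_increment_le[OF X \<Phi>])
      fix t \<sigma> assume d: "(X has_vector_derivative sfield (X t) \<sigma> (w t)) (at t)"
      define x where "x = \<omega>S (X t) $ i"
      have pos: "0 < 1 + x \<bullet> x" by (simp add: add_pos_nonneg)
      note w = deriv_components(4)[OF d, of i]
      have "((\<lambda>t. 1 + \<omega>S (X t) $ i \<bullet> \<omega>S (X t) $ i) has_real_derivative 2 * (x \<bullet> mat_act (S i) x)) (at t)"
        using has_vector_derivative_add[OF has_vector_derivative_const[of 1] bounded_bilinear.has_vector_derivative[OF bounded_bilinear_inner w w]]
        by (simp add: has_real_derivative_iff_has_vector_derivative x_def inner_commute)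
      then have "((\<lambda>t. \<Phi> (X t)) has_real_derivative 1 / (1 + x \<bullet> x) * (2 * (x \<bullet> mat_act (S i) x))) (at t)"
        unfolding \<Phi>_def x_def using pos[unfolded x_def] by (intro DERIV_ln_divide[THEN DERIV_chain2])
      moreover have "1 / (1 + x \<bullet> x) * (2 * (x \<bullet> mat_act (S i) x)) \<le> 2 * K"
      proof -
        have "x \<bullet> mat_act (S i) x \<le> norm x * norm (mat_act (S i) x)" by (rule norm_cauchy_schwarz)
        also have "\<dots> \<le> norm x * (norm x * K)" by (intro mult_left_mono K) simp
        also have "\<dots> = K * (x \<bullet> x)" by (simp add: dot_square_norm power2_eq_square)
        also have "\<dots> \<le> K * (1 + x \<bullet> x)" using K(1) by (intro mult_left_mono) auto
        finally show ?thesis using pos by (simp add: divide_le_eq)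
      qed
      ultimately show "\<exists>d. ((\<lambda>t. \<Phi> (X t)) has_real_derivative d) (at t) \<and> d \<le> 2 * K" by blast
    qed (use b in auto)
    also have "(2 * K) * (b - 0) \<le> 2 * K * \<tau>" using K(1) \<open>b \<le> \<tau>\<close> by (simp add: mult_left_mono)
    finally have "exp (\<Phi> (X b)) \<le> exp (\<Phi> X0 + 2 * K * \<tau>)" using b by simp
    moreover have "exp (\<Phi> (X b)) = 1 + (norm (\<omega>S (X b) $ i))\<^sup>2"
      unfolding \<Phi>_def by (simp add: dot_square_norm add_pos_nonneg)
    ultimately show ?thesis using le_one_plus_power2[of "norm (\<omega>S (X b) $ i)"] by linarith
  qed
  then show ?thesis by blast
qed

lemma bounded_values:
  assumes "\<And>b X. sol b X \<Longrightarrow> b \<le> \<tau> \<Longrightarrow> norm (\<phi> (X b)) \<le> c"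
  shows "bounded (\<phi> ` {X b | b X. sol b X \<and> b \<le> \<tau>})"
proof (rule boundedI)
  fix y assume "y \<in> \<phi> ` {X b | b X. sol b X \<and> b \<le> \<tau>}"
  then obtain b X where "y = \<phi> (X b)" "sol b X" "b \<le> \<tau>" by blast
  then show "norm y \<le> c" using assms by simp
qed

text \<open>The bounds are carried back to the original state: z from zb and v, y from e and v,
  \<eta> from \<open>xb\<close>, \<omega> and e.\<close>

lemma solution_bounded: "\<exists>R. \<forall>b X. sol b X \<and> b \<le> \<tau> \<longrightarrow> norm (X b) \<le> R"
proof -
  define Y where "Y = {X b | b X. sol b X \<and> b \<le> \<tau>}"
  obtain R where R: "\<And>b X. sol b X \<Longrightarrow> norm (vS (X b)) \<le> R" "\<And>b X i. sol b X \<Longrightarrow> norm (zb i (X b)) \<le> R"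
    "\<And>b X i. sol b X \<Longrightarrow> norm (xb i (X b)) \<le> R" "\<And>b X i. sol b X \<Longrightarrow> norm (kS (X b) $ i) \<le> R"
    "\<And>b X. sol b X \<Longrightarrow> norm (err (X b)) \<le> R"
    using error_coordinates_bounded by metis
  obtain R\<theta> where R\<theta>: "\<And>b X i. sol b X \<Longrightarrow> \<bar>\<theta>S (X b) $ i\<bar> \<le> R\<theta>" using \<theta>_bounded by blast
  note Y = bounded_values[where \<tau> = \<tau>, folded Y_def]
  have v: "bounded (vS ` Y)" and zb: "bounded (zb i ` Y)" and xb: "bounded (xb i ` Y)" and e: "bounded (err ` Y)" for i
    by (rule Y, rule R, assumption)+
  have \<omega>: "bounded ((\<lambda>X. \<omega>S X $ i) ` Y)" for i
  proof -
    obtain R\<omega> where "\<And>b X. sol b X \<Longrightarrow> b \<le> \<tau> \<Longrightarrow> norm (\<omega>S (X b) $ i) \<le> R\<omega>" using \<omega>_bounded[of \<tau> i] by blast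
    then show ?thesis by (rule Y)
  qed
  have k: "bounded (kS ` Y)"
    by (rule bounded_image_cart) (rule Y, rule R(4))
  have \<theta>: "bounded (\<theta>S ` Y)"
    by (rule bounded_image_cart) (rule Y, unfold real_norm_def, rule R\<theta>)
  have ei: "bounded ((\<lambda>X. err X $ i) ` Y)" for i
    by (rule locally_lipschitz_bounded_image[OF locally_lipschitz_bounded_linear[OF bounded_linear_vec_nth] e])
  have z: "bounded (zS ` Y)"
  proof (rule bounded_image_cart)
    fix i
    have "bounded ((\<lambda>X. zb i X + zs i (vS X) \<mu>) ` Y)"
      by (intro bounded_plus_comp zb locally_lipschitz_bounded_image[OF smooth_partial_locally_lipschitz[OF zs] v])
    then show "bounded ((\<lambda>X. zS X $ i) ` Y)" by (simp add: zb_def)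
  qed
  have y: "bounded (yS ` Y)"
  proof (rule bounded_image_cart)
    fix i
    have "bounded ((\<lambda>X. err X $ i + r (vS X) \<mu>) ` Y)"
      by (intro bounded_plus_comp ei locally_lipschitz_bounded_image[OF smooth_partial_locally_lipschitz[OF r] v])
    then show "bounded ((\<lambda>X. yS X $ i) ` Y)" by (simp add: err_def)
  qed
  have \<eta>: "bounded (\<eta>S ` Y)"
  proof (rule bounded_image_cart)
    fix i
    have "bounded ((\<lambda>X. xb i X + T i (\<omega>S X $ i) + col_act (G i) (err X $ i)) ` Y)"
      by (intro bounded_plus_comp xb locally_lipschitz_bounded_image[OF locally_lipschitz_bounded_linear[OF T(1)] \<omega>]
          locally_lipschitz_bounded_image[OF locally_lipschitz_bounded_linear[OF bounded_linear_col_act] ei])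
    moreover have "\<eta>S X $ i = xb i X + T i (\<omega>S X $ i) + col_act (G i) (err X $ i)" if "X \<in> Y" for X
    proof -
      have "coord_proj (np i) (\<eta>S X $ i) = \<eta>S X $ i"
        using that \<eta>_coord by (intro coord_proj_eq_self) (auto simp: Y_def)
      then show ?thesis by (simp add: xb_def)
    qed
    ultimately show "bounded ((\<lambda>X. \<eta>S X $ i) ` Y)" by (simp cong: image_cong)
  qed
  have "bounded (vS ` Y \<times> zS ` Y \<times> yS ` Y \<times> \<omega>S ` Y \<times> \<eta>S ` Y \<times> kS ` Y \<times> \<theta>S ` Y)"
    by (intro bounded_Times v z y \<eta> k \<theta> bounded_image_cart[OF \<omega>])
  moreover have "Y \<subseteq> vS ` Y \<times> zS ` Y \<times> yS ` Y \<times> \<omega>S ` Y \<times> \<eta>S ` Y \<times> kS ` Y \<times> \<theta>S ` Y"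
    unfolding mem_Times_iff subset_iff by (blast intro: rev_image_eqI)
  ultimately have "bounded Y" by (rule bounded_subset)
  then show ?thesis unfolding bounded_iff Y_def by blast
qed

sublocale apriori_bounded_field field X0
proof
  fix T
  obtain R where R: "\<And>b X. sol b X \<Longrightarrow> b \<le> T \<Longrightarrow> norm (X b) \<le> R" using solution_bounded[of T] by blast
  have "norm (x t) \<le> R" if "\<tau> \<le> T" "filippov_solution field {0..<\<tau>} x" "x 0 = X0" "t \<in> {0..<\<tau>}" for \<tau> x t
  proof (rule R)
    have "{0..t} \<subseteq> {0..<\<tau>}" using that by auto
    then show "sol t x" using that filippov_solution_subset[OF that(2)] by (simp add: sol_def)
  qed (use that in auto)
  then show "\<exists>R. \<forall>\<tau> x. 0 < \<tau> \<and> \<tau> \<le> T \<and> filippov_solution field {0..<\<tau>} x \<and> x 0 = X0 \<longrightarrow> (\<forall>t\<in>{0..<\<tau>}. norm (x t) \<le> R)"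
    by blast
qed

lemma err_tendsto_0:
  assumes X: "filippov_solution field {0..} X" "X 0 = X0"
  shows "((\<lambda>t. err (X t) $ i) \<longlongrightarrow> 0) at_top"
proof -
  have sol: "sol t X" if "0 \<le> t" for t
    using that X filippov_solution_subset[OF X(1), of "{0..t}"] by (auto simp: sol_def)
  obtain M where M: "\<And>b X i. sol b X \<Longrightarrow> \<bar>drift i (X b) (w b)\<bar> \<le> M" using drift_bounded by blast
  obtain R where R: "\<And>b X i. sol b X \<Longrightarrow> \<bar>\<theta>S (X b) $ i\<bar> \<le> R" using \<theta>_bounded by blast
  have MR: "0 \<le> M" "0 \<le> R" using M[OF sol[of 0], of undefined] R[OF sol[of 0], of undefined] by simp_all
  have ei: "locally_lipschitz (\<lambda>X. err X $ i)" for i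
    by (rule locally_lipschitz_compose[OF locally_lipschitz_bounded_linear[OF bounded_linear_vec_nth] err_locally_lipschitz])
  \<comment> \<open>The derivative of e_i is the drift minus \<theta>_i \<sigma>_i with |\<sigma>_i|
    \<le> 1. Although it is discontinuous, e_i is Lipschitz with one constant on the half-line, as
    Barbalat's argument requires.\<close>
  have inc: "\<bar>err (X t) $ i - err (X s) $ i\<bar> \<le> (M + R) * (t - s)" if st: "0 \<le> s" "s \<le> t" for s t i
  proof -
    have Xt: "sol t X" using sol st by simp
    have d: "((\<lambda>t. err (X t) $ i) has_real_derivative drift i (X u) (w u) - \<theta>S (X u) $ i * \<sigma> $ i) (at u)"
      and b: "\<bar>drift i (X u) (w u) - \<theta>S (X u) $ i * \<sigma> $ i\<bar> \<le> M + R"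
      if u: "s < u" and \<sigma>: "\<And>i. \<bar>\<sigma> $ i\<bar> \<le> 1" and d: "(X has_vector_derivative sfield (X u) \<sigma> (w u)) (at u)" for u \<sigma>
    proof -
      have Xu: "sol u X" using sol u st by simp
      show "((\<lambda>t. err (X t) $ i) has_real_derivative drift i (X u) (w u) - \<theta>S (X u) $ i * \<sigma> $ i) (at u)"
        using deriv_err(1)[OF d z_coord[OF Xu]] by (simp add: has_real_derivative_iff_has_vector_derivative)
      have "\<bar>\<theta>S (X u) $ i * \<sigma> $ i\<bar> \<le> R * 1"
        unfolding abs_mult by (rule mult_mono[OF R[OF Xu] \<sigma> MR(2)]) simp
      then show "\<bar>drift i (X u) (w u) - \<theta>S (X u) $ i * \<sigma> $ i\<bar> \<le> M + R" using M[OF Xu, of i] by linarith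
    qed
    have "err (X t) $ i - err (X s) $ i \<le> (M + R) * (t - s)"
    proof (rule solution_increment_le[OF Xt ei st])
      fix u \<sigma> assume *: "s < u" "\<And>i. \<bar>\<sigma> $ i\<bar> \<le> 1" "(X has_vector_derivative sfield (X u) \<sigma> (w u)) (at u)"
      show "\<exists>d. ((\<lambda>t. err (X t) $ i) has_real_derivative d) (at u) \<and> d \<le> M + R"
        using d[OF *] b[OF *] by (metis abs_le_D1)
    qed
    moreover have "(- err (X t) $ i) - (- err (X s) $ i) \<le> (M + R) * (t - s)"
    proof (rule solution_increment_le[OF Xt _ st])
      show "locally_lipschitz (\<lambda>X. - err X $ i)"
        by (rule locally_lipschitz_compose[OF locally_lipschitz_bounded_linear[OF bounded_linear_minus[OF bounded_linear_ident]] ei])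
      fix u \<sigma> assume *: "s < u" "\<And>i. \<bar>\<sigma> $ i\<bar> \<le> 1" "(X has_vector_derivative sfield (X u) \<sigma> (w u)) (at u)"
      show "\<exists>d. ((\<lambda>t. - err (X t) $ i) has_real_derivative d) (at u) \<and> d \<le> M + R"
        using DERIV_minus[OF d[OF *]] b[OF *] by (metis abs_le_D2)
    qed
    ultimately show ?thesis by linarith
  qed
  obtain K where K: "0 \<le> K" "\<And>x. norm (H x) \<le> norm x * K"
    using bounded_linear.nonneg_bounded[OF bounded_linear_H] by blast
  have \<nu>_lip: "(real CARD('n) * (M + R) * K)-lipschitz_on {0..} (\<lambda>t. \<nu> (X t) $ j)" for j
  proof (rule lipschitz_onI)
    have inc': "\<bar>\<nu> (X t) $ j - \<nu> (X s) $ j\<bar> \<le> (real CARD('n) * (M + R) * K) * (t - s)" if "0 \<le> s" "s \<le> t" for s t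
    proof -
      have "\<nu> (X t) $ j - \<nu> (X s) $ j = H (err (X t) - err (X s)) $ j"
        by (simp add: linear_diff[OF linear_follower_laplacian])
      then have "\<bar>\<nu> (X t) $ j - \<nu> (X s) $ j\<bar> \<le> norm (err (X t) - err (X s)) * K"
        using component_le_norm_cart[of "H (err (X t) - err (X s))" j] K(2)[of "err (X t) - err (X s)"] by linarith
      also have "\<dots> \<le> (\<Sum>i\<in>(UNIV :: 'n set). (M + R) * (t - s)) * K"
        using norm_le_l1_cart[of "err (X t) - err (X s)"] sum_mono[of UNIV "\<lambda>i. \<bar>(err (X t) - err (X s)) $ i\<bar>" "\<lambda>_. (M + R) * (t - s)"]
          inc[OF that] K(1) by (intro mult_right_mono) (auto intro: order_trans)
      finally show ?thesis by (simp add: mult_ac)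
    qed
    fix s t :: real assume "s \<in> {0..}" "t \<in> {0..}"
    then show "dist (\<nu> (X s) $ j) (\<nu> (X t) $ j) \<le> real CARD('n) * (M + R) * K * dist s t"
      using inc'[of s t] inc'[of t s] by (cases "s \<le> t") (simp_all add: dist_real_def abs_minus_commute)
  qed (use MR K in simp)
  have \<nu>: "((\<lambda>t. \<nu> (X t) $ j) \<longlongrightarrow> 0) at_top" for j
  proof (rule barbalat[OF \<nu>_lip, where \<theta> = "\<lambda>t. \<theta>S (X t) $ j" and B = R])
    show "c * (t - s) \<le> \<theta>S (X t) $ j - \<theta>S (X s) $ j"
      if "0 \<le> s" "s \<le> t" "\<And>r. r \<in> {s..t} \<Longrightarrow> c \<le> \<bar>\<nu> (X r) $ j\<bar>" for s t c
      using \<theta>_increment[OF sol that] that by simp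
    show "\<theta>S (X t) $ j \<le> R" if "0 \<le> t" for t using R[OF sol[OF that], of j] by linarith
  qed
  obtain c :: nat where c: "1 \<le> c" "\<And>e s i. (\<And>j. \<bar>H e $ j\<bar> \<le> s) \<Longrightarrow> \<bar>e $ i\<bar> \<le> real c * s"
    using laplacian_inverse_bound by metis
  have c': "\<bar>err (X t) $ i\<bar> \<le> real c * (\<Sum>j\<in>UNIV. \<bar>\<nu> (X t) $ j\<bar>)" for t
    by (rule c(2)) (rule member_le_sum; simp)
  have "((\<lambda>t. real c * (\<Sum>j\<in>UNIV. \<bar>\<nu> (X t) $ j\<bar>)) \<longlongrightarrow> real c * (\<Sum>j\<in>(UNIV :: 'n set). \<bar>0\<bar>)) at_top"
    by (intro tendsto_intros \<nu>)
  then show ?thesis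
    by (intro Lim_null_comparison[of "\<lambda>t. err (X t) $ i"]) (use c' in auto)
qed

end

theorem theorem1:
  fixes p :: "real ^ 'v \<Rightarrow> real ^ 'v"
    and q :: "real ^ 'v \<Rightarrow> real ^ 'w ^ 'v"
    and r :: "real ^ 'v \<Rightarrow> real ^ 'm \<Rightarrow> real"
    and nz no :: "'n::finite \<Rightarrow> nat"
    and f :: "'n \<Rightarrow> real ^ 'k \<Rightarrow> real \<Rightarrow> real ^ 'm \<Rightarrow> real ^ 'k"
    and g :: "'n \<Rightarrow> real ^ 'k \<Rightarrow> real \<Rightarrow> real ^ 'm \<Rightarrow> real"
    and S :: "'n \<Rightarrow> real mat"
    and D :: "'n \<Rightarrow> real ^ 'm \<Rightarrow> real mat"
    and A :: "real ^ 'n option ^ 'n option"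
    and \<alpha>\<^sub>0 \<gamma>\<^sub>0 :: "real \<Rightarrow> real"
    and zs :: "'n \<Rightarrow> real ^ 'v \<Rightarrow> real ^ 'm \<Rightarrow> real ^ 'k"
    and P :: "'n \<Rightarrow> real poly"
    and G :: "'n \<Rightarrow> real mat"
    and lam :: real
  \<comment> \<open>leader\<close>
  assumes "smooth p" "smooth q" "smooth (\<lambda>(v, \<mu>). r v \<mu>)"
    and "p 0 = 0" "\<And>\<mu>. r 0 \<mu> = 0"
  \<comment> \<open>followers\<close>
    and "\<And>i. nz i \<le> CARD('k)"
    and "\<And>i z y \<mu>. z \<in> coord_space (nz i) \<Longrightarrow> f i z y \<mu> \<in> coord_space (nz i)"
    and "\<And>i. smooth (\<lambda>(z, y, \<mu>). f i (coord_proj (nz i) z) y \<mu>)"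
    and "\<And>i. smooth (\<lambda>(z, y, \<mu>). g i (coord_proj (nz i) z) y \<mu>)"
    and "\<And>i \<mu>. f i 0 0 \<mu> = 0" "\<And>i \<mu>. g i 0 0 \<mu> = 0"
  \<comment> \<open>local disturbances\<close>
    and "\<And>i. 0 < no i" "\<And>i. no i \<le> CARD('k)"
    and "\<And>i. S i \<in> carrier_mat (no i) (no i)"
    and "\<And>i c. complex_eigenvalue (S i) c \<Longrightarrow> \<not> Re c < 0"
    and "\<And>i \<mu>. D i \<mu> \<in> carrier_mat 1 (no i)"
  \<comment> \<open>graph\<close>
    and "\<And>i. A $ i $ i = 0" "\<And>i j. 0 \<le> A $ i $ j"
    and "\<And>i. (None, Some i) \<in> (arcs A)\<^sup>*"
    and "\<And>i j. A $ Some i $ Some j = A $ Some j $ Some i"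
  \<comment> \<open>stability of the leader\<close>
    and "class_K \<alpha>\<^sub>0" "class_K \<gamma>\<^sub>0"
    and "\<And>w T v. admissible_input w \<Longrightarrow> 0 < T \<Longrightarrow> leader_solution p q w T v \<Longrightarrow>
           \<forall>t\<in>{0..T}. norm (v t) \<le> \<alpha>\<^sub>0 (norm (v 0)) + \<gamma>\<^sub>0 (SUP s\<in>{0..}. infnorm (w s))"
  \<comment> \<open>regulator equations\<close>
    and "\<And>i. smooth (\<lambda>(v, \<mu>). zs i v \<mu>)"
    and "\<And>i v \<mu>. zs i v \<mu> \<in> coord_space (nz i)" "\<And>i \<mu>. zs i 0 \<mu> = 0"
    and "\<And>i v \<mu>. frechet_derivative (\<lambda>v. zs i v \<mu>) (at v) (p v) = f i (zs i v \<mu>) (r v \<mu>) \<mu>"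
  \<comment> \<open>stability of the error dynamics of the z-subsystems\<close>
    and "\<And>i. \<exists>(\<gamma>\<^sub>1 :: real \<Rightarrow> real) (\<gamma>\<^sub>2 :: real ^ 'w \<Rightarrow> real) \<alpha>.
           smooth \<gamma>\<^sub>1 \<and> positive_definite \<gamma>\<^sub>1 \<and> smooth \<gamma>\<^sub>2 \<and> positive_definite \<gamma>\<^sub>2 \<and>
           class_K_inf \<alpha> \<and>
           Limsup (at_right 0) (\<lambda>s. ereal (the_inv_into {0..} \<alpha> (s\<^sup>2) / s)) < \<infinity> \<and>
           (\<forall>\<Sigma> :: ((real ^ 'v) \<times> (real ^ 'w) \<times> (real ^ 'm)) set. compact \<Sigma> \<longrightarrow>
             (\<exists>(V :: real ^ 'k \<Rightarrow> real) \<alpha>\<^sub>1 \<alpha>\<^sub>2 \<delta>\<^sub>1 \<delta>\<^sub>2.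
               smooth V \<and>
               smooth_on {0..} \<alpha>\<^sub>1 \<and> class_K_inf \<alpha>\<^sub>1 \<and> smooth_on {0..} \<alpha>\<^sub>2 \<and> class_K_inf \<alpha>\<^sub>2 \<and>
               (\<forall>zb\<in>coord_space (nz i). \<alpha>\<^sub>1 (norm zb) \<le> V zb \<and> V zb \<le> \<alpha>\<^sub>2 (norm zb)) \<and>
               0 < \<delta>\<^sub>1 \<and> 0 < \<delta>\<^sub>2 \<and>
               (\<forall>(v, w, \<mu>)\<in>\<Sigma>. \<forall>zb\<in>coord_space (nz i). \<forall>e.
                  frechet_derivative V (at zb) (f_bar (f i) r q (zs i) zb e v w \<mu>)
                    \<le> - \<alpha> (norm zb) + \<delta>\<^sub>1 * \<gamma>\<^sub>1 e + \<delta>\<^sub>2 * \<gamma>\<^sub>2 w)))"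
  \<comment> \<open>controller data\<close>
    and "0 < lam"
    and "\<And>i. minimal_polynomial (S i) (P i)"
    and "\<And>i. G i \<in> carrier_mat (degree (P i)) 1"
    and "\<And>i. hurwitz (F_mat (P i) (G i))"
  shows "\<exists>\<rho> :: 'n \<Rightarrow> real \<Rightarrow> real.
    (\<forall>i. smooth (\<rho> i) \<and> (\<forall>s. 0 < \<rho> i s)) \<and>
    (\<forall>\<mu> w v0 z0 y0 \<omega>0 \<eta>0.
       admissible_input w \<longrightarrow>
       (\<forall>i. z0 $ i \<in> coord_space (nz i) \<and> \<omega>0 $ i \<in> coord_space (no i) \<and>
            \<eta>0 $ i \<in> coord_space (degree (P i))) \<longrightarrow>
       (let X0 = (v0, z0, y0, \<omega>0, \<eta>0, 0, 0) :: ('v, 'k, 'n) state;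
            field = closed_loop p q r nz f g S D A
                      (\<lambda>i. Psi_mat (degree (P i))) (\<lambda>i. F_mat (P i) (G i)) G lam \<rho> \<mu> w
        in well_defined_from field X0 \<and>
           (\<forall>X. filippov_solution field {0..} X \<and> X 0 = X0 \<longrightarrow>
              (\<forall>i. ((\<lambda>t. tracking_error r \<mu> i (X t)) \<longlongrightarrow> 0) at_top))))"
proof -
  interpret leader_follower p q r nz no f g S D A \<alpha>\<^sub>0 \<gamma>\<^sub>0 zs P G lam
  proof (unfold_locales, goal_cases)
    \<comment> \<open>This goal is \<open>z_stable\<close>: the supply rates given before \<Sigma>
      are repeated as witnesses after it.\<close>
    case (18 i \<Sigma>)
    from assms(28)[of i] obtain \<gamma>\<^sub>1 :: "real \<Rightarrow> real" and \<gamma>\<^sub>2 :: "real ^ 'w \<Rightarrow> real" and \<alpha> where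
      1: "smooth \<gamma>\<^sub>1" "smooth \<gamma>\<^sub>2" "class_K_inf \<alpha>"
      and 2: "\<forall>\<Sigma> :: ((real ^ 'v) \<times> (real ^ 'w) \<times> (real ^ 'm)) set. compact \<Sigma> \<longrightarrow>
             (\<exists>(V :: real ^ 'k \<Rightarrow> real) \<alpha>\<^sub>1 \<alpha>\<^sub>2 \<delta>\<^sub>1 \<delta>\<^sub>2.
               smooth V \<and>
               smooth_on {0..} \<alpha>\<^sub>1 \<and> class_K_inf \<alpha>\<^sub>1 \<and> smooth_on {0..} \<alpha>\<^sub>2 \<and> class_K_inf \<alpha>\<^sub>2 \<and>
               (\<forall>zb\<in>coord_space (nz i). \<alpha>\<^sub>1 (norm zb) \<le> V zb \<and> V zb \<le> \<alpha>\<^sub>2 (norm zb)) \<and>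
               0 < \<delta>\<^sub>1 \<and> 0 < \<delta>\<^sub>2 \<and>
               (\<forall>(v, w, \<mu>)\<in>\<Sigma>. \<forall>zb\<in>coord_space (nz i). \<forall>e.
                  frechet_derivative V (at zb) (f_bar (f i) r q (zs i) zb e v w \<mu>)
                    \<le> - \<alpha> (norm zb) + \<delta>\<^sub>1 * \<gamma>\<^sub>1 e + \<delta>\<^sub>2 * \<gamma>\<^sub>2 w))"
      by (elim exE conjE) (rule that)
    from 2[rule_format, OF 18] obtain V :: "real ^ 'k \<Rightarrow> real" and \<alpha>\<^sub>1 \<alpha>\<^sub>2 \<delta>\<^sub>1 \<delta>\<^sub>2 where
      "smooth V" "class_K_inf \<alpha>\<^sub>1" "class_K_inf \<alpha>\<^sub>2"
      "\<forall>zb\<in>coord_space (nz i). \<alpha>\<^sub>1 (norm zb) \<le> V zb \<and> V zb \<le> \<alpha>\<^sub>2 (norm zb)"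
      "\<forall>(v, w, \<mu>)\<in>\<Sigma>. \<forall>zb\<in>coord_space (nz i). \<forall>e.
                  frechet_derivative V (at zb) (f_bar (f i) r q (zs i) zb e v w \<mu>)
                    \<le> - \<alpha> (norm zb) + \<delta>\<^sub>1 * \<gamma>\<^sub>1 e + \<delta>\<^sub>2 * \<gamma>\<^sub>2 w"
      by (elim exE conjE) (rule that)
    with 1 show ?case by (intro exI conjI)
  qed (fact assms)+
  obtain \<rho> :: "real \<Rightarrow> real" where \<rho>: "smooth \<rho>" "\<And>s. 0 < \<rho> s" and gain: "gain_function \<rho>"
    using gain_function_exists by blast
  show ?thesis
  proof (rule exI[of _ "\<lambda>_. \<rho>"], intro conjI allI impI \<rho>)
    fix \<mu> and w :: "real \<Rightarrow> real ^ 'w" and v0 and z0 :: "real ^ 'k ^ 'n" and y0 and \<omega>0 \<eta>0 :: "real ^ 'k ^ 'n"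
    assume w: "admissible_input w" and init: "\<forall>i. z0 $ i \<in> coord_space (nz i) \<and> \<omega>0 $ i \<in> coord_space (no i) \<and>
            \<eta>0 $ i \<in> coord_space (degree (P i))"
    \<comment> \<open>The parameter, the input and the initial state enter only now, after \<rho>
      has been fixed.\<close>
    interpret regulated_run p q r nz no f g S D A \<alpha>\<^sub>0 \<gamma>\<^sub>0 zs P G lam \<rho> \<mu> w "(v0, z0, y0, \<omega>0, \<eta>0, 0, 0)"
      by unfold_locales (use \<rho> w init gain in simp_all)
    have "tracking_error r \<mu> i X = err X $ i" for i X
      by (simp add: tracking_error_def err_def split_beta)
    then show "let X0 = (v0, z0, y0, \<omega>0, \<eta>0, 0, 0) :: ('v, 'k, 'n) state;
            field = closed_loop p q r nz f g S D A
                      (\<lambda>i. Psi_mat (degree (P i))) (\<lambda>i. F_mat (P i) (G i)) G lam (\<lambda>_. \<rho>) \<mu> w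
        in well_defined_from field X0 \<and>
           (\<forall>X. filippov_solution field {0..} X \<and> X 0 = X0 \<longrightarrow>
              (\<forall>i. ((\<lambda>t. tracking_error r \<mu> i (X t)) \<longlongrightarrow> 0) at_top))"
      using well_defined err_tendsto_0 by (simp add: Let_def field_def)
  qed
qed

end
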